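(* Let $n\ge1$, let $\beta_1=\dots=\beta_n=\beta>1$, and let $Q=(q_{j,j'})_{j,j'\le n}$ be a symmetric nonnegative definite matrix with $q_{j,j'}\in[-1,1]$ and $q_{j,j}=1$. Let $r_1,\dots,r_n$ be the eigenvalues of the matrix $\beta Q$. If $\min_j r_j\ge1$ then, for the pure 2-spin spherical model without external field, $$\lim_{\varepsilon\to0}\lim_{N\to\infty}F_N(Q_\varepsilon)=n\,\mathcal P(\beta).$$
   Context: $S_N$ is the sphere of radius $\sqrt N$ in $\mathbb R^N$ centered at $0$, and $\lambda_N$ is the uniform probability measure on $S_N$. The pure 2-spin Hamiltonian is $$H_N(\boldsymbol\sigma)=\frac{1}{\sqrt{2}\,N^{1/2}}\sum_{1\le i_1,i_2\le N}g_{i_1,i_2}\sigma_{i_1}\sigma_{i_2},$$ with $(g_{i_1,i_2})$ i.i.d. standard Gaussian. For $\boldsymbol\sigma^1,\dots,\boldsymbol\sigma^n\in S_N$ the overlaps are $R_{j,j'}=N^{-1}\sum_{i\le N}\sigma_i^j\sigma_i^{j'}$. For $\varepsilon>0$, $$Q_\varepsilon=\{(\boldsymbol\sigma^1,\dots,\boldsymbol\sigma^n)\in S_N^n: R_{j,j'}\in[q_{j,j'}-\varepsilon,q_{j,j'}+\varepsilon]\text{ for all }j,j'\le n\},$$ and (no external field, same $H_N$ for all copies) $$F_N(Q_\varepsilon)=\frac1N\mathbb E\log\int_{Q_\varepsilon}\exp\Bigl(\beta\sum_{j\le n}H_N(\boldsymbol\sigma^j)\Bigr)d\lambda_N^n .$$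 For $\beta>1$, $\mathcal P(\beta)=\frac12\bigl(2\beta-\frac32-\log\beta\bigr)$, which is the value of $\lim_{N\to\infty}\frac1N\mathbb E\log\int_{S_N}\exp(\beta H_N)\,d\lambda_N$. *)

theory Defs
  imports
    "HOL-Probability.Probability"
    "Jordan_Normal_Form.Char_Poly"
begin

text \<open>
  The dimension \<open>N\<close> goes to infinity, so it cannot be a type. A vector of \<open>N\<close> real coordinates is
  an extensional function on \<open>{..<N}\<close>; the coordinates are indexed from \<open>0\<close>.
\<close>

definition spin_sphere :: "nat \<Rightarrow> (nat \<Rightarrow> real) set" where
  "spin_sphere N = {\<sigma> \<in> {..<N} \<rightarrow>\<^sub>E UNIV. L2_set \<sigma> {..<N} = sqrt (real N)}"

definition unit_ball :: "nat \<Rightarrow> (nat \<Rightarrow> real) set" where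
  "unit_ball N = {x \<in> {..<N} \<rightarrow>\<^sub>E UNIV. L2_set x {..<N} \<le> 1}"

definition radial_projection :: "nat \<Rightarrow> (nat \<Rightarrow> real) \<Rightarrow> nat \<Rightarrow> real" where
  "radial_projection N x = (\<lambda>i\<in>{..<N}. sqrt (real N) * x i / L2_set x {..<N})"

text \<open>
  Normalised surface measure on the sphere, as the cone measure: a Borel subset of the sphere gets
  the fraction of the volume of the ball that lies in the cone over it. It is a measure on all of
  the ambient Euclidean space, concentrated on
  \<^term>\<open>spin_sphere N\<close>.
\<close>

definition sphere_uniform :: "nat \<Rightarrow> (nat \<Rightarrow> real) measure" where
  "sphere_uniform N =
     distr (uniform_measure (\<Pi>\<^sub>M i\<in>{..<N}. lborel) (unit_ball N)) (\<Pi>\<^sub>M i\<in>{..<N}. borel)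
       (radial_projection N)"

definition hamiltonian :: "nat \<Rightarrow> (nat \<Rightarrow> nat \<Rightarrow> real) \<Rightarrow> (nat \<Rightarrow> real) \<Rightarrow> real" where
  "hamiltonian N g \<sigma> =
     1 / (sqrt 2 * sqrt (real N)) * (\<Sum>i<N. \<Sum>k<N. g i k * \<sigma> i * \<sigma> k)"

definition overlap :: "nat \<Rightarrow> (nat \<Rightarrow> real) \<Rightarrow> (nat \<Rightarrow> real) \<Rightarrow> real" where
  "overlap N \<sigma> \<tau> = (\<Sum>i<N. \<sigma> i * \<tau> i) / real N"

definition overlap_constrained :: "nat \<Rightarrow> real mat \<Rightarrow> nat \<Rightarrow> real \<Rightarrow> (nat \<Rightarrow> nat \<Rightarrow> real) set" where
  "overlap_constrained n Q N \<epsilon> =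
     {\<sigma> \<in> {..<n} \<rightarrow>\<^sub>E spin_sphere N.
        \<forall>j<n. \<forall>j'<n. overlap N (\<sigma> j) (\<sigma> j') \<in> {Q $$ (j, j') - \<epsilon> .. Q $$ (j, j') + \<epsilon>}}"

text \<open>
  Where the inner integral vanishes, the convention \<open>ln 0 = 0\<close> replaces \<open>- \<infinity>\<close>. For
  \<^term>\<open>overlap_constrained n Q N \<epsilon>\<close> with \<open>Q\<close> nonnegative definite with unit diagonal and \<open>\<epsilon> > 0\<close>,
  this can only happen for \<open>N < max 2 n\<close>, and so does not affect the limit in \<open>N\<close>.
\<close>

definition free_energy ::
  "'w measure \<Rightarrow> (nat \<Rightarrow> nat \<Rightarrow> 'w \<Rightarrow> real) \<Rightarrow> real \<Rightarrow> nat \<Rightarrow> nat \<Rightarrow> (nat \<Rightarrow> nat \<Rightarrow> real) set \<Rightarrow> real" where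
  "free_energy M g \<beta> n N A =
     1 / real N *
     (LINT \<omega>|M. ln (LINT \<sigma>:A|(\<Pi>\<^sub>M j\<in>{..<n}. sphere_uniform N).
        exp (\<beta> * (\<Sum>j<n. hamiltonian N (\<lambda>i k. g i k \<omega>) (\<sigma> j)))))"

definition limit_free_energy :: "real \<Rightarrow> real" where
  "limit_free_energy \<beta> = 1 / 2 * (2 * \<beta> - 3 / 2 - ln \<beta>)"

definition nonneg_definite :: "nat \<Rightarrow> real mat \<Rightarrow> bool" where
  "nonneg_definite n A \<longleftrightarrow> (\<forall>v \<in> carrier_vec n. v \<bullet> (A *\<^sub>v v) \<ge> 0)"

end

theory Submission imports Defs begin

text \<open>
  For every \<open>\<epsilon> > 0\<close> the limit in \<open>N\<close> already equals \<open>n\<close> times the free energy of one replica.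

  Upper bound: dropping the constraint decouples the replicas, and Guerra's interpolation gives the replica-symmetric bound
  with overlap \<open>1 - 1 / \<beta>\<close> for each of them.

  Lower bound: all eigenvalues of \<open>\<beta> Q\<close> are at least 1, so \<open>Q - 1 / \<beta>\<close> is nonnegative definite and equals \<open>L L\<^sup>T\<close>. Let
  \<open>W\<close> be the symmetrised disorder, with spectrum filling \<open>[-1, 1]\<close>, so that the Hamiltonian is \<open>\<langle>\<sigma>, W \<sigma>\<rangle>\<close>. The loop
  equations for the moments of \<open>W\<close> provide \<open>n\<close> nearly orthonormal vectors at the upper edge of the spectrum; combined with
  the coefficients \<open>L\<close> they give vectors \<open>m\<^sub>j\<close> with Gram matrix \<open>N (Q - 1 / \<beta>)\<close> and energy \<open>N (1 - 1 / \<beta>)\<close>. Restrict the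
  integral to replicas \<open>m\<^sub>j + \<sigma>\<^sub>j / sqrt \<beta>\<close> with \<open>\<sigma>\<^sub>j\<close> on the sphere. Their energies are those of \<open>m\<^sub>j\<close> plus that of a
  model at inverse temperature just below 1, where the annealed free energy is exact and independent replicas are nearly
  orthogonal, so that the overlaps of the sum are those prescribed by \<open>Q\<close>. The entropy of the smaller spheres is \<open>- ln \<beta> / 2\<close>
  per replica, and the contributions add up to \<open>\<beta> - 1 + 1 / 4 - ln \<beta> / 2\<close>.
\<close>

section \<open>Gaussian integration by parts\<close>

text \<open>Both bounds meet at one number: the optimal overlap 1 - 1/\<beta> of the upper bound is
  also the squared length per site of the condensed part m of a replica, and
  \<open>Q - 1/\<beta>\<close> is a Gram matrix of such parts exactly when no eigenvalue of \<beta>Q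
  is below 1. Hence the constraint costs nothing at exponential scale. The obstacle in the lower
  bound is that the logarithm of the constrained integral has no deterministic lower bound, while
  the estimates on the disorder fail with probabilities that are merely small. Failure costs an
  amount of order N plus an unbounded term. Cauchy-Schwarz between the inverse temperatures \<beta>
  and - \<beta> turns the unbounded term into a partition function of known mean, and test functions
  of Chebyshev type pay for the rest, so first and second moments suffice. Eigenvectors of W are
  never formed: for a given precision, n by n corners of four consecutive powers of W are enough,
  and only fixed powers have to be controlled as N grows. The slack \<eta> in all radii also keeps
  the residual inverse temperature strictly below 1, where second moments still match squared first
  moments at exponential scale.\<close>

definition std_normal :: "real measure" where
  "std_normal = density lborel (\<lambda>x. ennreal (std_normal_density x))"

lemma prob_space_std_normal: "prob_space std_normal"
  unfolding std_normal_def by (rule prob_space_normal_density) simp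

lemma sets_std_normal [measurable_cong, simp]: "sets std_normal = sets borel"
  and space_std_normal [simp]: "space std_normal = UNIV"
  by (simp_all add: std_normal_def)

lemma integrable_std_normal_iff:
  fixes f :: "real \<Rightarrow> real"
  assumes "f \<in> borel_measurable borel"
  shows "integrable std_normal f \<longleftrightarrow> integrable lborel (\<lambda>x. std_normal_density x * f x)"
  using assms unfolding std_normal_def by (subst integrable_density) auto

lemma integral_std_normal:
  fixes f :: "real \<Rightarrow> real"
  assumes "f \<in> borel_measurable borel"
  shows "integral\<^sup>L std_normal f = (LINT x|lborel. std_normal_density x * f x)"
  using assms unfolding std_normal_def by (subst integral_density) auto

lemma integrable_std_normal_power [simp, intro]: "integrable std_normal (\<lambda>x. x ^ k)"
  by (simp add: integrable_std_normal_iff integrable_std_normal_moment)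

lemma std_normal_square: "(LINT x|std_normal. x\<^sup>2) = 1"
  using integral_std_normal_moment_even[of 1] by (simp add: integral_std_normal)

lemma has_real_derivative_std_normal_density:
  "(std_normal_density has_real_derivative - (x * std_normal_density x)) (at x)"
proof -
  have "((\<lambda>x. (1 / sqrt (2 * pi)) * exp (- x\<^sup>2 / 2)) has_real_derivative
      (1 / sqrt (2 * pi)) * (exp (- x\<^sup>2 / 2) * (- x))) (at x)"
    by (intro DERIV_cmult) (auto intro!: derivative_eq_intros)
  moreover have "std_normal_density = (\<lambda>x. (1 / sqrt (2 * pi)) * exp (- x\<^sup>2 / 2))"
    by (rule ext) (rule std_normal_density_def)
  ultimately show ?thesis
    by (simp add: mult_ac)
qed

text \<open>The boundary terms of the integration by parts. In the variable (1 + x^2) / 2 the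
  product becomes a power divided by an exponential; the filter \<open>F\<close> is left open to
  serve both ends of the line.\<close>

lemma polynomial_growth_gaussian_decay:
  fixes f :: "real \<Rightarrow> real"
  assumes bound: "\<And>x. \<bar>f x\<bar> \<le> C * (1 + x\<^sup>2) ^ m"
    and F: "filterlim (\<lambda>x::real. x\<^sup>2) at_top F"
  shows "((\<lambda>x. std_normal_density x * f x) \<longlongrightarrow> 0) F"
proof -
  have 1: "((\<lambda>y::real. y ^ m / exp y) \<longlongrightarrow> 0) at_top"
    by (rule tendsto_power_div_exp_0)
  have 2: "filterlim (\<lambda>x::real. (1 + x\<^sup>2) / 2) at_top F"
    using filterlim_tendsto_pos_mult_at_top[OF tendsto_const[of "1/2"] _
      filterlim_tendsto_add_at_top[OF tendsto_const[of 1] F]]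
    by (simp add: mult.commute)
  have 3: "((\<lambda>x. C * 2 ^ m * exp (1/2) / sqrt (2 * pi) *
      (((1 + x\<^sup>2) / 2) ^ m / exp ((1 + x\<^sup>2) / 2))) \<longlongrightarrow>
      C * 2 ^ m * exp (1/2) / sqrt (2 * pi) * 0) F"
    by (intro tendsto_mult tendsto_const filterlim_compose[OF 1 2])
  have eq: "C * 2 ^ m * exp (1/2) / sqrt (2 * pi) * (((1 + x\<^sup>2) / 2) ^ m / exp ((1 + x\<^sup>2) / 2))
      = std_normal_density x * (C * (1 + x\<^sup>2) ^ m)" for x :: real
  proof -
    have "exp ((1 + x\<^sup>2) / 2) = exp (1 / 2) * exp (x\<^sup>2 / 2)"
      by (simp add: exp_add[symmetric] add_divide_distrib)
    then show ?thesis
      by (simp add: std_normal_density_def power_divide exp_minus divide_simps)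
  qed
  show ?thesis
  proof (rule Lim_null_comparison)
    show "\<forall>\<^sub>F x in F. norm (std_normal_density x * f x) \<le> std_normal_density x * (C * (1 + x\<^sup>2) ^ m)"
      using bound by (auto simp: abs_mult intro!: always_eventually mult_left_mono)
    show "((\<lambda>x. std_normal_density x * (C * (1 + x\<^sup>2) ^ m)) \<longlongrightarrow> 0) F"
      using 3 by (simp only: eq mult_zero_right)
  qed
qed

lemma integrable_std_normal_growth:
  fixes f :: "real \<Rightarrow> real"
  assumes [measurable]: "f \<in> borel_measurable borel"
    and bound: "\<And>x. \<bar>f x\<bar> \<le> C * (1 + x\<^sup>2) ^ m"
  shows "integrable std_normal f"
proof (rule Bochner_Integration.integrable_bound)
  interpret prob_space std_normal by (rule prob_space_std_normal)
  show "integrable std_normal (\<lambda>x. C * (2 ^ m * (1 + x ^ (2 * m))))"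
    by (intro integrable_mult_right Bochner_Integration.integrable_add) auto
  have C: "0 \<le> C"
    using bound[of 0] by (simp add: abs_if split: if_splits)
  have "(1 + y) ^ m \<le> 2 ^ m * (1 + y ^ m)" if "0 \<le> y" for y :: real
  proof -
    have "(1 + y) ^ m \<le> (2 * max 1 y) ^ m"
      using that by (intro power_mono) auto
    also have "\<dots> = 2 ^ m * max 1 y ^ m"
      by (simp add: power_mult_distrib)
    also have "\<dots> \<le> 2 ^ m * (1 + y ^ m)"
      using that by (intro mult_left_mono) (auto simp: max_def)
    finally show ?thesis .
  qed
  then have "(1 + x\<^sup>2) ^ m \<le> 2 ^ m * (1 + x ^ (2 * m))" for x :: real
    by (metis power_mult zero_le_power2)
  then have "C * (1 + x\<^sup>2) ^ m \<le> C * (2 ^ m * (1 + x ^ (2 * m)))" for x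
    using C by (intro mult_left_mono)
  then have "norm (f x) \<le> norm (C * (2 ^ m * (1 + x ^ (2 * m))))" for x
    by (metis bound order_trans abs_ge_self real_norm_def)
  then show "AE x in std_normal. norm (f x) \<le> norm (C * (2 ^ m * (1 + x ^ (2 * m))))"
    by (rule AE_I2)
qed measurable

text \<open>The density p satisfies p' = - x p, so p f' - x p f is the derivative of p f, and its
  integral over the line is the difference of two vanishing boundary limits.\<close>

lemma stein_std_normal:
  fixes f f' :: "real \<Rightarrow> real"
  assumes deriv: "\<And>x. (f has_real_derivative f' x) (at x)"
    and cont: "continuous_on UNIV f'"
    and bound: "\<And>x. \<bar>f x\<bar> \<le> C * (1 + x\<^sup>2) ^ m"
    and bound': "\<And>x. \<bar>f' x\<bar> \<le> C' * (1 + x\<^sup>2) ^ m'"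
  shows "(LINT x|std_normal. x * f x) = (LINT x|std_normal. f' x)"
proof -
  let ?p = std_normal_density
  have contf: "continuous_on UNIV f"
    using deriv by (meson DERIV_continuous continuous_at_imp_continuous_on)
  have mf [measurable]: "f \<in> borel_measurable borel" and mf' [measurable]: "f' \<in> borel_measurable borel"
    using contf cont by (auto intro: borel_measurable_continuous_onI)
  have mxf: "(\<lambda>x. x * f x) \<in> borel_measurable borel"
    by measurable
  have "\<bar>x * f x\<bar> \<le> C * (1 + x\<^sup>2) ^ Suc m" for x
  proof -
    have "\<bar>x\<bar> \<le> 1 + x\<^sup>2"
      using zero_le_power2[of "\<bar>x\<bar> - 1"] by (simp add: power2_diff)
    then have "\<bar>x\<bar> * \<bar>f x\<bar> \<le> (1 + x\<^sup>2) * (C * (1 + x\<^sup>2) ^ m)"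
      using bound by (intro mult_mono) auto
    then show ?thesis by (simp add: abs_mult mult_ac)
  qed
  then have int: "integrable std_normal (\<lambda>x. x * f x)" "integrable std_normal f'"
    using bound' by (blast intro: integrable_std_normal_growth[OF mxf]
      integrable_std_normal_growth[OF mf'])+
  have i1: "integrable lborel (\<lambda>x. ?p x * (x * f x))" and i2: "integrable lborel (\<lambda>x. ?p x * f' x)"
    using int by (auto simp: integrable_std_normal_iff)
  let ?g = "\<lambda>x. ?p x * f' x - ?p x * (x * f x)"
  have D: "((\<lambda>x. ?p x * f x) has_real_derivative ?g x) (at x)" for x
    by (rule derivative_eq_intros deriv has_real_derivative_std_normal_density refl)+
       (simp add: algebra_simps)
  have contp: "continuous_on UNIV ?p"
    by (meson DERIV_continuous continuous_at_imp_continuous_on has_real_derivative_std_normal_density)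
  have contg: "isCont ?g x" for x
    using contp contf cont by (intro continuous_intros) (auto simp: continuous_on_eq_continuous_at)
  have lim: "((\<lambda>x. ?p x * f x) \<longlongrightarrow> 0) at_top" "((\<lambda>x. ?p x * f x) \<longlongrightarrow> 0) at_bot"
    by (rule polynomial_growth_gaussian_decay[OF bound], real_asymp)+
  have "(LBINT x=-\<infinity>..\<infinity>. ?g x) = 0 - 0"
    by (rule interval_integral_FTC_integrable[where F="\<lambda>x. ?p x * f x"])
       (use D contg lim i1 i2 in \<open>auto simp: ereal_tendsto_simps has_real_derivative_iff_has_vector_derivative[symmetric]
         set_integrable_def\<close>)
  then have "(LINT x|lborel. ?g x) = 0"
    by (simp add: interval_lebesgue_integral_def set_lebesgue_integral_def)
  then show ?thesis
    using i1 i2 by (simp add: integral_std_normal)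
qed

lemma integral_exp_std_normal:
  "integrable std_normal (\<lambda>x. exp (c * x))" "(LINT x|std_normal. exp (c * x)) = exp (c\<^sup>2 / 2)"
proof -
  have eq: "std_normal_density x * exp (c * x) = exp (c\<^sup>2 / 2) * normal_density c 1 x" for x
    by (simp add: normal_density_def exp_add[symmetric] power2_eq_square field_simps)
  show "integrable std_normal (\<lambda>x. exp (c * x))"
    by (subst integrable_std_normal_iff) (auto simp: eq)
  show "(LINT x|std_normal. exp (c * x)) = exp (c\<^sup>2 / 2)"
    by (subst integral_std_normal) (auto simp: eq)
qed

section \<open>Stein's lemma for products of standard Gaussians\<close>

definition gauss :: "'k set \<Rightarrow> ('k \<Rightarrow> real) measure" where
  "gauss K = (\<Pi>\<^sub>M k\<in>K. std_normal)"

lemma prob_space_gauss: "prob_space (gauss K)"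
  unfolding gauss_def by (intro prob_space_PiM prob_space_std_normal)

lemma sets_gauss [measurable_cong]: "sets (gauss K) = sets (\<Pi>\<^sub>M k\<in>K. borel)"
  unfolding gauss_def by (intro sets_PiM_cong) auto

lemma space_gauss: "space (gauss K) = K \<rightarrow>\<^sub>E UNIV"
  unfolding gauss_def by (simp add: space_PiM)

lemma product_sigma_finite_std_normal: "product_sigma_finite (\<lambda>_. std_normal)"
  by (intro product_sigma_finite.intro prob_space_imp_sigma_finite prob_space_std_normal)

lemma integral_gauss_coordinate:
  fixes f :: "real \<Rightarrow> real"
  assumes "k \<in> K" and [measurable]: "f \<in> borel_measurable borel"
  shows "integral\<^sup>L (gauss K) (\<lambda>g. f (g k)) = integral\<^sup>L std_normal f"
    and "integrable (gauss K) (\<lambda>g. f (g k)) \<longleftrightarrow> integrable std_normal f"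
proof -
  interpret product_prob_space "\<lambda>_. std_normal" K
    by (intro product_prob_spaceI prob_space_std_normal)
  have *: "distr (gauss K) std_normal (\<lambda>g. g k) = std_normal"
    unfolding gauss_def by (rule PiM_component) fact
  have m: "(\<lambda>g. g k) \<in> measurable (gauss K) std_normal"
    using assms(1) by measurable
  show "integral\<^sup>L (gauss K) (\<lambda>g. f (g k)) = integral\<^sup>L std_normal f"
    using integral_distr[OF m, of f] by (simp add: *)
  show "integrable (gauss K) (\<lambda>g. f (g k)) \<longleftrightarrow> integrable std_normal f"
    using integrable_distr_eq[OF m, of f] by (simp add: *)
qed

lemma integral_gauss_exp_linear:
  assumes "finite K"
  shows "integrable (gauss K) (\<lambda>g. exp (\<Sum>k\<in>K. c k * g k))"
    and "integral\<^sup>L (gauss K) (\<lambda>g. exp (\<Sum>k\<in>K. c k * g k)) = exp ((\<Sum>k\<in>K. (c k)\<^sup>2) / 2)"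
proof -
  interpret product_sigma_finite "\<lambda>_. std_normal" by (rule product_sigma_finite_std_normal)
  show "integrable (gauss K) (\<lambda>g. exp (\<Sum>k\<in>K. c k * g k))"
    unfolding gauss_def exp_sum[OF assms]
    by (rule product_integrable_prod) (auto simp: assms integral_exp_std_normal)
  show "integral\<^sup>L (gauss K) (\<lambda>g. exp (\<Sum>k\<in>K. c k * g k)) = exp ((\<Sum>k\<in>K. (c k)\<^sup>2) / 2)"
    unfolding gauss_def exp_sum[OF assms]
    by (subst product_integral_prod)
       (simp_all add: assms integral_exp_std_normal exp_sum[OF assms, symmetric] sum_divide_distrib)
qed

lemma stein_gauss:
  fixes F F' :: "('k \<Rightarrow> real) \<Rightarrow> real"
  assumes K: "finite K" "k \<in> K"
    and deriv: "\<And>g t. ((\<lambda>t. F (g(k := t))) has_real_derivative F' (g(k := t))) (at t)"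
    and cont: "\<And>g. continuous_on UNIV (\<lambda>t. F' (g(k := t)))"
    and bound: "\<And>g. \<exists>C m. \<forall>t. \<bar>F (g(k := t))\<bar> \<le> C * (1 + t\<^sup>2) ^ m"
    and bound': "\<And>g. \<exists>C m. \<forall>t. \<bar>F' (g(k := t))\<bar> \<le> C * (1 + t\<^sup>2) ^ m"
    and int: "integrable (gauss K) (\<lambda>g. g k * F g)" "integrable (gauss K) F'"
  shows "integral\<^sup>L (gauss K) (\<lambda>g. g k * F g) = integral\<^sup>L (gauss K) F'"
proof -
  interpret product_sigma_finite "\<lambda>_. std_normal" by (rule product_sigma_finite_std_normal)
  have K': "finite (K - {k})" "k \<notin> K - {k}"
    using K by auto
  have [simp]: "insert k K = K"
    using K by auto
  note ins = product_integral_insert[OF K'(1,2), simplified insert_Diff_single, simplified, folded gauss_def]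
  have "(LINT t|std_normal. t * F (g(k := t))) = (LINT t|std_normal. F' (g(k := t)))" for g
    using bound[of g] bound'[of g] by (auto intro!: stein_std_normal deriv cont)
  then show ?thesis
    using ins[OF int(1)] ins[OF int(2)] by simp
qed

section \<open>Gibbs measures with Gaussian disorder\<close>

text \<open>Dominated convergence for the difference quotients along an arbitrary null sequence,
  whose tail stays within radius \<open>r\<close>; the mean value theorem bounds the quotients by
  \<open>w\<close>.\<close>

lemma has_real_derivative_integral:
  fixes f f' :: "real \<Rightarrow> 's \<Rightarrow> real"
  assumes r: "0 < r"
    and int: "\<And>t. \<bar>t - t0\<bar> < r \<Longrightarrow> integrable M (f t)"
    and meas: "f' t0 \<in> borel_measurable M"
    and w: "integrable M w"
    and deriv: "AE s in M. \<forall>t. \<bar>t - t0\<bar> < r \<longrightarrow>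
      ((\<lambda>t. f t s) has_real_derivative f' t s) (at t) \<and> \<bar>f' t s\<bar> \<le> w s"
  shows "((\<lambda>t. integral\<^sup>L M (f t)) has_real_derivative integral\<^sup>L M (f' t0)) (at t0)"
proof -
  have "((\<lambda>h. (integral\<^sup>L M (f (t0 + h)) - integral\<^sup>L M (f t0)) / h) \<longlongrightarrow> integral\<^sup>L M (f' t0)) (at 0)"
    unfolding tendsto_at_iff_sequentially
  proof (intro allI impI, unfold comp_def)
    fix X :: "nat \<Rightarrow> real"
    assume X: "\<forall>i. X i \<in> UNIV - {0}" and X0: "X \<longlonglongrightarrow> 0"
    have "\<forall>\<^sub>F i in sequentially. \<bar>X i\<bar> < r"
      using tendstoD[OF X0 r] by (simp add: dist_real_def)
    then obtain n0 where n0: "\<And>i. \<bar>X (i + n0)\<bar> < r"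
      unfolding eventually_sequentially by (metis le_add2)
    define Y where "Y i = X (i + n0)" for i
    have Y: "Y i \<noteq> 0" "\<bar>Y i\<bar> < r" for i
      using X n0 by (auto simp: Y_def)
    have Y0: "Y \<longlonglongrightarrow> 0"
      using X0 unfolding Y_def by (rule LIMSEQ_ignore_initial_segment)
    have "(\<lambda>i. LINT s|M. (f (t0 + Y i) s - f t0 s) / Y i) \<longlonglongrightarrow> integral\<^sup>L M (f' t0)"
    proof (rule integral_dominated_convergence[OF meas _ w])
      show "(\<lambda>s. (f (t0 + Y i) s - f t0 s) / Y i) \<in> borel_measurable M" for i
        using int[of "t0 + Y i"] int[of t0] Y r by (intro borel_measurable_divide borel_measurable_diff) auto
      show "AE s in M. (\<lambda>i. (f (t0 + Y i) s - f t0 s) / Y i) \<longlonglongrightarrow> f' t0 s"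
        using deriv
      proof eventually_elim
        case (elim s)
        then have "((\<lambda>t. f t s) has_real_derivative f' t0 s) (at t0)"
          using r by auto
        then have "((\<lambda>h. (f (t0 + h) s - f t0 s) / h) \<longlongrightarrow> f' t0 s) (at 0)"
          by (simp add: DERIV_def)
        then show ?case
          using Y Y0 by (auto simp: tendsto_at_iff_sequentially comp_def)
      qed
      show "AE s in M. norm ((f (t0 + Y i) s - f t0 s) / Y i) \<le> w s" for i
        using deriv
      proof eventually_elim
        case (elim s)
        have *: "\<bar>f (t0 + h) s - f t0 s\<bar> \<le> w s * \<bar>h\<bar>" if h: "h \<noteq> 0" "\<bar>h\<bar> < r" for h
        proof -
          \<comment> \<open>The segment from t0 to t0 + h is parametrised by u in [0, 1], so that
            one application of the mean value theorem covers both signs of h.\<close>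
          have d: "((\<lambda>u. f (t0 + h * u) s) has_real_derivative f' (t0 + h * u) s * h) (at u)"
            if "0 \<le> u" "u \<le> 1" for u
          proof -
            have "\<bar>h * u\<bar> \<le> \<bar>h\<bar>" using that by (simp add: abs_mult mult_left_le)
            then have "((\<lambda>t. f t s) has_real_derivative f' (t0 + h * u) s) (at (t0 + h * u))"
              using elim h by auto
            then show ?thesis
              by (rule DERIV_chain2) (auto intro!: derivative_eq_intros)
          qed
          obtain z where z: "0 < z" "z < 1" "f (t0 + h * 1) s - f (t0 + h * 0) s = (1 - 0) * (f' (t0 + h * z) s * h)"
            using MVT2[of 0 1 "\<lambda>u. f (t0 + h * u) s" "\<lambda>u. f' (t0 + h * u) s * h"] d by auto
          have "\<bar>h * z\<bar> \<le> \<bar>h\<bar>" using z by (simp add: abs_mult mult_left_le)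
          then have "\<bar>f' (t0 + h * z) s\<bar> \<le> w s"
            using elim h by auto
          then show ?thesis
            using z(3) by (simp add: abs_mult mult_right_mono)
        qed
        show ?case
          using *[of "Y i"] Y[of i] by (simp add: abs_divide divide_le_eq)
      qed
    qed
    moreover have "(LINT s|M. (f (t0 + Y i) s - f t0 s) / Y i) =
        (integral\<^sup>L M (f (t0 + Y i)) - integral\<^sup>L M (f t0)) / Y i" for i
      using int[of "t0 + Y i"] int[of t0] Y r by simp
    ultimately have "(\<lambda>i. (integral\<^sup>L M (f (t0 + Y i)) - integral\<^sup>L M (f t0)) / Y i) \<longlonglongrightarrow> integral\<^sup>L M (f' t0)"
      by (simp only:)
    then show "(\<lambda>i. (integral\<^sup>L M (f (t0 + X i)) - integral\<^sup>L M (f t0)) / X i) \<longlonglongrightarrow> integral\<^sup>L M (f' t0)"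
      unfolding Y_def by (rule LIMSEQ_offset)
  qed
  then show ?thesis
    by (simp add: DERIV_def)
qed

text \<open>The exponent of the Gibbs weight is linear in the disorder, with coefficient functions
  \<open>a k\<close>. These are bounded only almost everywhere, because the reference measure will
  be \<open>sphere_uniform N\<close>, which is carried by the sphere but lives on the ambient
  space.\<close>

locale gibbs = prob_space mu for mu :: "'s measure" +
  fixes K :: "'k set" and a :: "'k \<Rightarrow> 's \<Rightarrow> real" and B :: real
  assumes finite_K [simp]: "finite K"
    and a_measurable [measurable]: "\<And>k. a k \<in> borel_measurable mu"
    and a_bound: "\<And>k. AE s in mu. \<bar>a k s\<bar> \<le> B"
begin

definition energy :: "('k \<Rightarrow> real) \<Rightarrow> 's \<Rightarrow> real" where
  "energy x s = (\<Sum>k\<in>K. x k * a k s)"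

definition Z :: "('k \<Rightarrow> real) \<Rightarrow> real" where
  "Z x = (LINT s|mu. exp (energy x s))"

definition avg :: "('k \<Rightarrow> real) \<Rightarrow> ('s \<Rightarrow> real) \<Rightarrow> real" where
  "avg x f = (LINT s|mu. f s * exp (energy x s)) / Z x"

lemma measurable_energy [measurable]: "energy x \<in> borel_measurable mu"
  unfolding energy_def by measurable

lemma B_nonneg: "0 \<le> B"
proof -
  have "AE s in mu. 0 \<le> B" using a_bound[of undefined] by eventually_elim auto
  then show ?thesis by (simp add: AE_const)
qed

lemma AE_a_bound: "AE s in mu. \<forall>k\<in>K. \<bar>a k s\<bar> \<le> B"
  using a_bound by (subst AE_finite_all) auto

lemma AE_energy_bound: "AE s in mu. \<bar>energy x s\<bar> \<le> (\<Sum>k\<in>K. \<bar>x k\<bar>) * B"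
  using AE_a_bound
proof eventually_elim
  case (elim s)
  have "\<bar>energy x s\<bar> \<le> (\<Sum>k\<in>K. \<bar>x k * a k s\<bar>)"
    unfolding energy_def by (rule sum_abs)
  also have "\<dots> \<le> (\<Sum>k\<in>K. \<bar>x k\<bar> * B)"
    using elim by (intro sum_mono) (auto simp: abs_mult intro!: mult_left_mono)
  finally show ?case by (simp add: sum_distrib_right)
qed

lemma integrable_exp_energy:
  assumes [measurable]: "f \<in> borel_measurable mu" and "AE s in mu. \<bar>f s\<bar> \<le> b"
  shows "integrable mu (\<lambda>s. f s * exp (energy x s))"
proof (rule integrable_const_bound)
  show "AE s in mu. norm (f s * exp (energy x s)) \<le> b * exp ((\<Sum>k\<in>K. \<bar>x k\<bar>) * B)"
    using assms(2) AE_energy_bound[of x]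
  proof eventually_elim
    case (elim s)
    then have "\<bar>f s\<bar> * exp (energy x s) \<le> b * exp ((\<Sum>k\<in>K. \<bar>x k\<bar>) * B)"
      by (intro mult_mono) auto
    then show ?case by (simp add: abs_mult)
  qed
qed measurable

lemma integrable_exp_energy1: "integrable mu (\<lambda>s. exp (energy x s))"
  using integrable_exp_energy[of "\<lambda>_. 1" 1 x] by simp

lemma Z_bounds:
  "exp (- (\<Sum>k\<in>K. \<bar>x k\<bar>) * B) \<le> Z x" "Z x \<le> exp ((\<Sum>k\<in>K. \<bar>x k\<bar>) * B)"
proof -
  have "(LINT s|mu. exp (- (\<Sum>k\<in>K. \<bar>x k\<bar>) * B)) \<le> Z x"
    unfolding Z_def
  proof (intro integral_mono_AE integrable_exp_energy1)
    show "AE s in mu. exp (- (\<Sum>k\<in>K. \<bar>x k\<bar>) * B) \<le> exp (energy x s)"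
      using AE_energy_bound[of x] by eventually_elim auto
  qed auto
  then show "exp (- (\<Sum>k\<in>K. \<bar>x k\<bar>) * B) \<le> Z x" by (simp add: prob_space)
  have "Z x \<le> (LINT s|mu. exp ((\<Sum>k\<in>K. \<bar>x k\<bar>) * B))"
    unfolding Z_def using AE_energy_bound[of x]
    by (intro integral_mono_AE integrable_exp_energy1) (auto elim!: eventually_mono)
  then show "Z x \<le> exp ((\<Sum>k\<in>K. \<bar>x k\<bar>) * B)" by (simp add: prob_space)
qed

lemma Z_pos: "0 < Z x"
  using Z_bounds(1)[of x] by (rule less_le_trans[OF exp_gt_zero])

lemma abs_ln_Z_le: "\<bar>ln (Z x)\<bar> \<le> (\<Sum>k\<in>K. \<bar>x k\<bar>) * B"
  using Z_bounds[of x] Z_pos[of x] ln_ge_iff[of "Z x" "- (\<Sum>k\<in>K. \<bar>x k\<bar>) * B"]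
    ln_le_cancel_iff[of "Z x" "exp ((\<Sum>k\<in>K. \<bar>x k\<bar>) * B)"]
  by (auto simp: abs_le_iff)

lemma avg_mono:
  assumes "f \<in> borel_measurable mu" "AE s in mu. \<bar>f s\<bar> \<le> b"
    and "h \<in> borel_measurable mu" "AE s in mu. \<bar>h s\<bar> \<le> b'" and "AE s in mu. f s \<le> h s"
  shows "avg x f \<le> avg x h"
  unfolding avg_def using assms Z_pos[of x]
  by (intro divide_right_mono integral_mono_AE integrable_exp_energy) (auto elim!: eventually_mono)

lemma avg_const [simp]: "avg x (\<lambda>_. c) = c"
  using Z_pos[of x] integrable_exp_energy1[of x] by (simp add: avg_def Z_def)

lemma avg_cmult: "avg x (\<lambda>s. c * f s) = c * avg x f"
  by (simp add: avg_def mult.assoc)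

lemma avg_add:
  assumes "f \<in> borel_measurable mu" "AE s in mu. \<bar>f s\<bar> \<le> b"
    and "h \<in> borel_measurable mu" "AE s in mu. \<bar>h s\<bar> \<le> b'"
  shows "avg x (\<lambda>s. f s + h s) = avg x f + avg x h"
  unfolding avg_def using integrable_exp_energy[OF assms(1,2), of x] integrable_exp_energy[OF assms(3,4), of x]
  by (simp add: distrib_right add_divide_distrib)

lemma avg_sum:
  assumes "finite I" "\<And>i. i \<in> I \<Longrightarrow> f i \<in> borel_measurable mu" "\<And>i. i \<in> I \<Longrightarrow> AE s in mu. \<bar>f i s\<bar> \<le> b i"
  shows "avg x (\<lambda>s. \<Sum>i\<in>I. f i s) = (\<Sum>i\<in>I. avg x (f i))"
  unfolding avg_def using integrable_exp_energy[OF assms(2,3)]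
  by (simp add: sum_distrib_right sum_divide_distrib)

lemma abs_avg_le:
  assumes [measurable]: "f \<in> borel_measurable mu" and b: "AE s in mu. \<bar>f s\<bar> \<le> b"
  shows "\<bar>avg x f\<bar> \<le> b"
proof -
  have "avg x f \<le> avg x (\<lambda>_. b)"
    by (rule avg_mono[OF assms, of _ "\<bar>b\<bar>"]) (use b in \<open>auto elim: eventually_mono\<close>)
  moreover have "avg x (\<lambda>_. - b) \<le> avg x f"
    by (rule avg_mono[OF _ _ assms, of _ "\<bar>b\<bar>"]) (use b in \<open>auto elim: eventually_mono\<close>)
  ultimately show ?thesis by simp
qed

lemma avg_cong: "AE s in mu. f s = h s \<Longrightarrow> f \<in> borel_measurable mu \<Longrightarrow> h \<in> borel_measurable mu \<Longrightarrow> avg x f = avg x h"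
  unfolding avg_def by (intro arg_cong2[where f="(/)"] integral_cong_AE refl) (auto elim!: eventually_mono)

lemma has_real_derivative_integral_energy:
  assumes [measurable]: "h \<in> borel_measurable mu" and hb: "AE s in mu. \<bar>h s\<bar> \<le> b"
    and x: "\<And>k t. k \<in> K \<Longrightarrow> ((\<lambda>t. x t k) has_real_derivative x' t k) (at t)"
    and D: "\<And>k t. k \<in> K \<Longrightarrow> \<bar>x' t k\<bar> \<le> D"
  shows "((\<lambda>t. LINT s|mu. h s * exp (energy (x t) s)) has_real_derivative
    (LINT s|mu. h s * energy (x' t0) s * exp (energy (x t0) s))) (at t0)"
proof (rule has_real_derivative_integral[where r=1 and f'="\<lambda>t s. h s * energy (x' t) s * exp (energy (x t) s)"])
  \<comment> \<open>Speed at most \<open>D\<close> keeps each coordinate within \<open>D\<close> of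
    its value at \<open>t0\<close> as long as |t - t0| < 1, so \<open>C * B\<close> bounds the
    energy on the whole window.\<close>
  define C where "C = (\<Sum>k\<in>K. \<bar>x t0 k\<bar> + D)"
  show "integrable mu (\<lambda>s. h s * exp (energy (x t) s))" for t
    by (rule integrable_exp_energy[OF _ hb]) simp
  show "integrable mu (\<lambda>s. b * (card K * D * B) * exp (C * B))" by simp
  show "AE s in mu. \<forall>t. \<bar>t - t0\<bar> < 1 \<longrightarrow>
      ((\<lambda>t. h s * exp (energy (x t) s)) has_real_derivative h s * energy (x' t) s * exp (energy (x t) s)) (at t) \<and>
      \<bar>h s * energy (x' t) s * exp (energy (x t) s)\<bar> \<le> b * (card K * D * B) * exp (C * B)"
    using AE_a_bound hb
  proof eventually_elim
    case (elim s)
    show ?case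
    proof (intro allI impI conjI)
      fix t assume t: "\<bar>t - t0\<bar> < 1"
      have "((\<lambda>t. energy (x t) s) has_real_derivative energy (x' t) s) (at t)"
        unfolding energy_def by (rule DERIV_sum) (auto intro: DERIV_cmult_right x)
      then show "((\<lambda>t. h s * exp (energy (x t) s)) has_real_derivative h s * energy (x' t) s * exp (energy (x t) s)) (at t)"
        by (auto intro!: derivative_eq_intros)
      have xb: "\<bar>x t k\<bar> \<le> \<bar>x t0 k\<bar> + D" if k: "k \<in> K" for k
      proof -
        have "norm (x t k - x t0 k) \<le> D * norm (t - t0)"
          by (rule field_differentiable_bound[of UNIV "\<lambda>t. x t k" "\<lambda>t. x' t k"]) (use x D k in \<open>auto intro: has_field_derivative_at_within\<close>)
        also have "\<dots> \<le> D * 1"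
          using t D[OF k, of t0] by (intro mult_left_mono) auto
        finally show ?thesis by simp
      qed
      have "\<bar>energy (x t) s\<bar> \<le> (\<Sum>k\<in>K. (\<bar>x t0 k\<bar> + D) * B)"
        unfolding energy_def using elim xb B_nonneg
        by (intro order_trans[OF sum_abs] sum_mono) (auto simp: abs_mult intro!: mult_mono intro: order_trans[OF abs_ge_zero])
      then have e: "energy (x t) s \<le> C * B" by (simp add: C_def sum_distrib_right)
      have "\<bar>energy (x' t) s\<bar> \<le> (\<Sum>k\<in>K. D * B)"
        unfolding energy_def using elim D B_nonneg
        by (intro order_trans[OF sum_abs] sum_mono) (auto simp: abs_mult intro!: mult_mono intro: order_trans[OF abs_ge_zero])
      then have e': "\<bar>energy (x' t) s\<bar> \<le> card K * D * B" by (simp add: mult_ac)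
      show "\<bar>h s * energy (x' t) s * exp (energy (x t) s)\<bar> \<le> b * (card K * D * B) * exp (C * B)"
        unfolding abs_mult using e e' elim(2)
        by (intro mult_mono) (auto intro!: mult_nonneg_nonneg intro: order_trans[OF abs_ge_zero])
    qed
  qed
qed auto

lemma avg_energy:
  assumes [measurable]: "h \<in> borel_measurable mu" and hb: "AE s in mu. \<bar>h s\<bar> \<le> b"
  shows "(LINT s|mu. h s * energy y s * exp (energy x s)) / Z x = (\<Sum>k\<in>K. y k * avg x (\<lambda>s. h s * a k s))"
proof -
  have bb: "AE s in mu. \<bar>h s * a k s\<bar> \<le> b * B" for k
    using hb a_bound[of k] by eventually_elim (auto simp: abs_mult intro!: mult_mono intro: order_trans[OF abs_ge_zero])
  have "(LINT s|mu. h s * energy y s * exp (energy x s)) / Z x = avg x (\<lambda>s. \<Sum>k\<in>K. y k * (h s * a k s))"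
    unfolding avg_def energy_def by (simp add: sum_distrib_left mult_ac)
  also have "\<dots> = (\<Sum>k\<in>K. avg x (\<lambda>s. y k * (h s * a k s)))"
  proof (rule avg_sum)
    show "AE s in mu. \<bar>y k * (h s * a k s)\<bar> \<le> \<bar>y k\<bar> * (b * B)" for k
      using bb[of k] by eventually_elim (subst abs_mult, auto intro!: mult_left_mono)
  qed auto
  finally show ?thesis by (simp add: avg_cmult)
qed

lemma has_real_derivative_Z:
  assumes "\<And>k t. k \<in> K \<Longrightarrow> ((\<lambda>t. x t k) has_real_derivative x' t k) (at t)"
    and "\<And>k t. k \<in> K \<Longrightarrow> \<bar>x' t k\<bar> \<le> D"
  shows "((\<lambda>t. Z (x t)) has_real_derivative Z (x t) * (\<Sum>k\<in>K. x' t k * avg (x t) (a k))) (at t)"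
proof -
  have "(LINT s|mu. 1 * energy (x' t) s * exp (energy (x t) s)) = Z (x t) * (\<Sum>k\<in>K. x' t k * avg (x t) (a k))"
    using avg_energy[of "\<lambda>_. 1" 1 "x' t" "x t"] Z_pos[of "x t"] by (simp add: field_simps)
  moreover have "((\<lambda>t. LINT s|mu. 1 * exp (energy (x t) s)) has_real_derivative
      (LINT s|mu. 1 * energy (x' t) s * exp (energy (x t) s))) (at t)"
    by (rule has_real_derivative_integral_energy[OF _ _ assms]) auto
  ultimately show ?thesis
    by (simp only: Z_def mult_1)
qed

lemma has_real_derivative_ln_Z:
  assumes "\<And>k t. k \<in> K \<Longrightarrow> ((\<lambda>t. x t k) has_real_derivative x' t k) (at t)"
    and "\<And>k t. k \<in> K \<Longrightarrow> \<bar>x' t k\<bar> \<le> D"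
  shows "((\<lambda>t. ln (Z (x t))) has_real_derivative (\<Sum>k\<in>K. x' t k * avg (x t) (a k))) (at t)"
proof -
  have "((\<lambda>t. ln (Z (x t))) has_real_derivative 1 / Z (x t) * (Z (x t) * (\<Sum>k\<in>K. x' t k * avg (x t) (a k)))) (at t)"
    by (rule DERIV_chain2[where f=ln and g="\<lambda>t. Z (x t)", OF DERIV_ln_divide[OF Z_pos[of "x t"]]], rule has_real_derivative_Z[OF assms])
  then show ?thesis using Z_pos[of "x t"] by simp
qed

lemma has_real_derivative_avg:
  assumes h: "h \<in> borel_measurable mu" "AE s in mu. \<bar>h s\<bar> \<le> b"
    and x: "\<And>k t. k \<in> K \<Longrightarrow> ((\<lambda>t. x t k) has_real_derivative x' t k) (at t)"
    and D: "\<And>k t. k \<in> K \<Longrightarrow> \<bar>x' t k\<bar> \<le> D"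
  shows "((\<lambda>t. avg (x t) h) has_real_derivative
    (\<Sum>k\<in>K. x' t k * (avg (x t) (\<lambda>s. h s * a k s) - avg (x t) h * avg (x t) (a k)))) (at t)"
proof -
  have "((\<lambda>t. avg (x t) h) has_real_derivative
     ((LINT s|mu. h s * energy (x' t) s * exp (energy (x t) s)) * Z (x t) -
      (LINT s|mu. h s * exp (energy (x t) s)) * (Z (x t) * (\<Sum>k\<in>K. x' t k * avg (x t) (a k)))) / (Z (x t) * Z (x t))) (at t)"
    unfolding avg_def[of _ h] using Z_pos[of "x t"]
    by (intro DERIV_divide has_real_derivative_integral_energy[OF h x D] has_real_derivative_Z[OF x D]) auto
  also have "((LINT s|mu. h s * energy (x' t) s * exp (energy (x t) s)) * Z (x t) -
      (LINT s|mu. h s * exp (energy (x t) s)) * (Z (x t) * (\<Sum>k\<in>K. x' t k * avg (x t) (a k)))) / (Z (x t) * Z (x t))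
    = (LINT s|mu. h s * energy (x' t) s * exp (energy (x t) s)) / Z (x t) - avg (x t) h * (\<Sum>k\<in>K. x' t k * avg (x t) (a k))"
    using Z_pos[of "x t"] unfolding avg_def[of _ h] by (simp add: field_simps)
  also have "\<dots> = (\<Sum>k\<in>K. x' t k * (avg (x t) (\<lambda>s. h s * a k s) - avg (x t) h * avg (x t) (a k)))"
    by (subst avg_energy[OF h]) (simp add: sum_distrib_left sum_subtractf algebra_simps)
  finally show ?thesis .
qed

definition var :: "('k \<Rightarrow> real) \<Rightarrow> 'k \<Rightarrow> real" where
  "var x k = avg x (\<lambda>s. (a k s)\<^sup>2) - (avg x (a k))\<^sup>2"

lemma a_square_bound: "AE s in mu. \<bar>(a k s)\<^sup>2\<bar> \<le> B\<^sup>2"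
  using a_bound[of k] B_nonneg by (auto elim!: eventually_mono simp: abs_le_square_iff[symmetric])

lemma abs_var_le: "\<bar>var x k\<bar> \<le> 2 * B\<^sup>2"
proof -
  have "\<bar>avg x (a k)\<bar> \<le> B" "\<bar>avg x (\<lambda>s. (a k s)\<^sup>2)\<bar> \<le> B\<^sup>2"
    by (intro abs_avg_le a_bound a_square_bound; simp)+
  moreover from this have "(avg x (a k))\<^sup>2 \<le> B\<^sup>2" "0 \<le> (avg x (a k))\<^sup>2"
    using B_nonneg abs_le_square_iff[of "avg x (a k)" B] by auto
  ultimately show ?thesis
    unfolding var_def by linarith
qed

lemma measurable_Z [measurable]:
  "(\<lambda>g. Z (\<lambda>k. c k * g k)) \<in> borel_measurable (gauss K)"
  unfolding Z_def energy_def by measurable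

lemma measurable_avg [measurable]:
  assumes [measurable]: "f \<in> borel_measurable mu"
  shows "(\<lambda>g. avg (\<lambda>k. c k * g k) f) \<in> borel_measurable (gauss K)"
  unfolding avg_def by (intro borel_measurable_divide measurable_Z) (unfold energy_def, measurable)

lemma integrable_var: "integrable (gauss K) (\<lambda>g. var (\<lambda>k. c k * g k) k)"
proof -
  interpret G: prob_space "gauss K" by (rule prob_space_gauss)
  have "(\<lambda>g. var (\<lambda>k. c k * g k) k) \<in> borel_measurable (gauss K)"
    unfolding var_def by measurable
  then show ?thesis
    by (rule G.integrable_const_bound[of _ "2 * B\<^sup>2", rotated]) (auto intro!: AE_I2 abs_var_le)
qed

lemma integrable_gauss_abs: "k \<in> K \<Longrightarrow> integrable (gauss K) (\<lambda>g. \<bar>g k\<bar>)"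
  using integrable_norm[OF integrable_std_normal_power[of 1]]
  by (intro iffD2[OF integral_gauss_coordinate(2)]) auto

lemma integrable_ln_Z: "integrable (gauss K) (\<lambda>g. ln (Z (\<lambda>k. c k * g k)))"
proof (rule Bochner_Integration.integrable_bound)
  show "integrable (gauss K) (\<lambda>g. (\<Sum>k\<in>K. \<bar>c k\<bar> * \<bar>g k\<bar>) * B)"
    by (intro integrable_mult_left Bochner_Integration.integrable_sum integrable_mult_right integrable_gauss_abs)
  show "AE g in gauss K. norm (ln (Z (\<lambda>k. c k * g k))) \<le> norm ((\<Sum>k\<in>K. \<bar>c k\<bar> * \<bar>g k\<bar>) * B)"
    using abs_ln_Z_le[of "\<lambda>k. c k * g k" for g] B_nonneg
    by (intro AE_I2) (auto simp: abs_mult sum_nonneg)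
qed measurable

text \<open>Stein's lemma turns the derivative of the expected log-partition function into Gibbs variances.\<close>

theorem has_real_derivative_expected_ln_Z:
  assumes c: "\<And>k t. k \<in> K \<Longrightarrow> ((\<lambda>t. c t k) has_real_derivative c' t k) (at t)"
    and D: "\<And>k t. k \<in> K \<Longrightarrow> \<bar>c' t k\<bar> \<le> D"
  shows "((\<lambda>t. LINT g|gauss K. ln (Z (\<lambda>k. c t k * g k))) has_real_derivative
    (\<Sum>k\<in>K. c t k * c' t k * (LINT g|gauss K. var (\<lambda>k. c t k * g k) k))) (at t)"
proof -
  have i1: "integrable (gauss K) (\<lambda>g. g k * avg (\<lambda>k. c t k * g k) (a k))" if "k \<in> K" for k
  proof (rule Bochner_Integration.integrable_bound)
    show "integrable (gauss K) (\<lambda>g. \<bar>g k\<bar> * B)"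
      by (intro integrable_mult_left integrable_gauss_abs that)
    show "AE g in gauss K. norm (g k * avg (\<lambda>k. c t k * g k) (a k)) \<le> norm (\<bar>g k\<bar> * B)"
      using abs_avg_le[OF _ a_bound] B_nonneg by (intro AE_I2) (auto simp: abs_mult intro!: mult_left_mono)
  qed (use that in measurable)
  have "((\<lambda>t. LINT g|gauss K. ln (Z (\<lambda>k. c t k * g k))) has_real_derivative
    (LINT g|gauss K. (\<Sum>k\<in>K. c' t k * g k * avg (\<lambda>k. c t k * g k) (a k)))) (at t)"
  proof (rule has_real_derivative_integral[where r=1 and
        f'="\<lambda>t g. \<Sum>k\<in>K. c' t k * g k * avg (\<lambda>k. c t k * g k) (a k)"])
    show "integrable (gauss K) (\<lambda>g. \<Sum>k\<in>K. D * \<bar>g k\<bar> * B)"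
      by (intro integrable_mult_left Bochner_Integration.integrable_sum integrable_mult_right integrable_gauss_abs)
    show "AE g in gauss K. \<forall>u. \<bar>u - t\<bar> < 1 \<longrightarrow>
      ((\<lambda>t. ln (Z (\<lambda>k. c t k * g k))) has_real_derivative (\<Sum>k\<in>K. c' u k * g k * avg (\<lambda>k. c u k * g k) (a k))) (at u)
       \<and> \<bar>(\<Sum>k\<in>K. c' u k * g k * avg (\<lambda>k. c u k * g k) (a k))\<bar> \<le> (\<Sum>k\<in>K. D * \<bar>g k\<bar> * B)"
    proof (intro AE_I2 allI impI conjI)
      fix g and u :: real
      show "((\<lambda>t. ln (Z (\<lambda>k. c t k * g k))) has_real_derivative (\<Sum>k\<in>K. c' u k * g k * avg (\<lambda>k. c u k * g k) (a k))) (at u)"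
      proof (rule has_real_derivative_ln_Z)
        show "((\<lambda>t. c t k * g k) has_real_derivative c' t k * g k) (at t)" if "k \<in> K" for k t
          by (rule DERIV_cmult_right) (rule c[OF that])
        show "\<bar>c' t k * g k\<bar> \<le> D * (\<Sum>k\<in>K. \<bar>g k\<bar>)" if "k \<in> K" for t k
          unfolding abs_mult using D[OF that, of t] that
          by (intro mult_mono member_le_sum) (auto intro: order_trans[OF abs_ge_zero])
      qed
      show "\<bar>(\<Sum>k\<in>K. c' u k * g k * avg (\<lambda>k. c u k * g k) (a k))\<bar> \<le> (\<Sum>k\<in>K. D * \<bar>g k\<bar> * B)"
        using D abs_avg_le[OF _ a_bound] B_nonneg
        by (intro order_trans[OF sum_abs] sum_mono)
           (auto simp: abs_mult intro!: mult_mono mult_nonneg_nonneg intro: order_trans[OF abs_ge_zero])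
    qed
    show "integrable (gauss K) (\<lambda>g. ln (Z (\<lambda>k. c t k * g k)))" for t
      by (rule integrable_ln_Z)
  qed (simp, measurable)
  also have "(LINT g|gauss K. (\<Sum>k\<in>K. c' t k * g k * avg (\<lambda>k. c t k * g k) (a k)))
    = (\<Sum>k\<in>K. c' t k * (LINT g|gauss K. g k * avg (\<lambda>k. c t k * g k) (a k)))"
    using i1 by (subst Bochner_Integration.integral_sum) (auto simp: mult.assoc)
  also have "\<dots> = (\<Sum>k\<in>K. c t k * c' t k * (LINT g|gauss K. var (\<lambda>k. c t k * g k) k))"
  proof (rule sum.cong[OF refl])
    fix k assume k: "k \<in> K"
    define x where "x g = (\<lambda>k. c t k * g k)" for g
    have upd: "((\<lambda>u. x (g(k := u)) j) has_real_derivative (if j = k then c t k else 0)) (at u)" for g j u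
      by (cases "j = k") (auto simp: x_def intro!: derivative_eq_intros)
    have *: "((\<lambda>u. avg (x (g(k := u))) h) has_real_derivative
         c t k * (avg (x (g(k := u))) (\<lambda>s. h s * a k s) - avg (x (g(k := u))) h * avg (x (g(k := u))) (a k))) (at u)"
      if "h \<in> borel_measurable mu" "AE s in mu. \<bar>h s\<bar> \<le> b" for g u h b
    proof -
      have "((\<lambda>u. avg (x (g(k := u))) h) has_real_derivative (\<Sum>j\<in>K. (if j = k then c t k else 0) *
         (avg (x (g(k := u))) (\<lambda>s. h s * a j s) - avg (x (g(k := u))) h * avg (x (g(k := u))) (a j)))) (at u)"
        by (rule has_real_derivative_avg[OF that upd, where D="\<bar>c t k\<bar>"]) auto
      then show ?thesis
        using k by (simp add: if_distrib[of "\<lambda>y. y * _"] sum.delta cong: if_cong)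
    qed
    have cont: "continuous_on UNIV (\<lambda>u. avg (x (g(k := u))) h)"
      if "h \<in> borel_measurable mu" "AE s in mu. \<bar>h s\<bar> \<le> b" for g h b
      using *[OF that] by (meson DERIV_continuous continuous_at_imp_continuous_on)
    have "integral\<^sup>L (gauss K) (\<lambda>g. g k * avg (x g) (a k)) = integral\<^sup>L (gauss K) (\<lambda>g. c t k * var (x g) k)"
    proof (rule stein_gauss)
      show "((\<lambda>u. avg (x (g(k := u))) (a k)) has_real_derivative c t k * var (x (g(k := u))) k) (at u)" for g u
        using *[OF _ a_bound, of k g u] by (simp add: var_def power2_eq_square)
      show "continuous_on UNIV (\<lambda>u. c t k * var (x (g(k := u))) k)" for g
        unfolding var_def by (intro continuous_intros cont[OF _ a_square_bound] cont[OF _ a_bound]) auto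
      show "\<exists>C m. \<forall>u. \<bar>avg (x (g(k := u))) (a k)\<bar> \<le> C * (1 + u\<^sup>2) ^ m" for g
        by (rule exI[of _ B], rule exI[of _ 0]) (auto intro!: abs_avg_le a_bound)
      show "\<exists>C m. \<forall>u. \<bar>c t k * var (x (g(k := u))) k\<bar> \<le> C * (1 + u\<^sup>2) ^ m" for g
        by (rule exI[of _ "\<bar>c t k\<bar> * (2 * B\<^sup>2)"], rule exI[of _ 0])
           (auto simp: abs_mult intro!: mult_left_mono abs_var_le)
      show "integrable (gauss K) (\<lambda>g. g k * avg (x g) (a k))"
        unfolding x_def by (rule i1[OF k])
      show "integrable (gauss K) (\<lambda>g. c t k * var (x g) k)"
        unfolding x_def by (intro integrable_mult_right integrable_var)
    qed (use k in auto)
    then show "c' t k * (LINT g|gauss K. g k * avg (\<lambda>k. c t k * g k) (a k)) =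
         c t k * c' t k * (LINT g|gauss K. var (\<lambda>k. c t k * g k) k)"
      by (simp add: x_def)
  qed
  finally show ?thesis .
qed

end

section \<open>Uniform measure on the sphere\<close>

definition ip :: "nat \<Rightarrow> (nat \<Rightarrow> real) \<Rightarrow> (nat \<Rightarrow> real) \<Rightarrow> real" where
  "ip N x y = (\<Sum>i<N. x i * y i)"

abbreviation leb :: "nat \<Rightarrow> (nat \<Rightarrow> real) measure" where
  "leb N \<equiv> \<Pi>\<^sub>M i\<in>{..<N}. lborel"

abbreviation bor :: "nat \<Rightarrow> (nat \<Rightarrow> real) measure" where
  "bor N \<equiv> \<Pi>\<^sub>M i\<in>{..<N}. borel"

lemma sets_leb: "sets (leb N) = sets (bor N)"
  by (intro sets_PiM_cong) auto

lemma measurable_ip [measurable]: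
  assumes [measurable]: "\<And>i. i < N \<Longrightarrow> (\<lambda>w. f w i) \<in> borel_measurable M" "\<And>i. i < N \<Longrightarrow> (\<lambda>w. h w i) \<in> borel_measurable M"
  shows "(\<lambda>w. ip N (f w) (h w)) \<in> borel_measurable M"
  unfolding ip_def by measurable

lemma ip_nonneg: "0 \<le> ip N x x"
  by (simp add: ip_def sum_nonneg)

lemma ip_commute: "ip N x y = ip N y x"
  by (simp add: ip_def mult.commute)

lemma ip_cong: "(\<And>i. i < N \<Longrightarrow> x i = x' i) \<Longrightarrow> (\<And>i. i < N \<Longrightarrow> y i = y' i) \<Longrightarrow> ip N x y = ip N x' y'"
  by (simp add: ip_def)

lemma ip_scale: "ip N (\<lambda>i. c * x i) (\<lambda>i. d * y i) = c * d * ip N x y"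
  by (simp add: ip_def sum_distrib_left mult_ac)

lemma ip_scale_left: "ip N (\<lambda>i. c * x i) y = c * ip N x y"
  and ip_scale_right: "ip N x (\<lambda>i. c * y i) = c * ip N x y"
  by (simp_all add: ip_def sum_distrib_left mult_ac)

lemma ip_add: "ip N (\<lambda>i. x i + y i) z = ip N x z + ip N y z"
  "ip N z (\<lambda>i. x i + y i) = ip N z x + ip N z y"
  by (simp_all add: ip_def sum.distrib algebra_simps)

lemma ip_restrict [simp]: "ip N (restrict x {..<N}) y = ip N x y" "ip N x (restrict y {..<N}) = ip N x y"
  by (auto simp: ip_def)

lemma ip_Cauchy_Schwarz: "(ip N x y)\<^sup>2 \<le> ip N x x * ip N y y"
  using Cauchy_Schwarz_ineq_sum[of x y "{..<N}"] by (simp add: ip_def power2_eq_square)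

lemma L2_set_ip: "L2_set x {..<N} = sqrt (ip N x x)"
  by (simp add: L2_set_def ip_def power2_eq_square)

section \<open>Scaling of Lebesgue measure, cones and shells\<close>

lemma nn_integral_PiM_affine:
  fixes c :: real and t :: "nat \<Rightarrow> real"
  assumes "finite I" "c \<noteq> 0" and "f \<in> borel_measurable (\<Pi>\<^sub>M i\<in>I. borel)"
  shows "(\<integral>\<^sup>+x. f x \<partial>(\<Pi>\<^sub>M i\<in>I. lborel)) = ennreal (\<bar>c\<bar> ^ card I) * (\<integral>\<^sup>+x. f (\<lambda>i\<in>I. t i + c * x i) \<partial>(\<Pi>\<^sub>M i\<in>I. lborel))"
  using assms(1,3)
proof (induction I arbitrary: f rule: finite_induct)
  case empty
  then show ?case by (simp add: PiM_empty nn_integral_count_space_finite)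
next
  case (insert j I)
  interpret product_sigma_finite "\<lambda>_::nat. lborel :: real measure" ..
  have bl: "sets (Pi\<^sub>M J (\<lambda>_::nat. lborel :: real measure)) = sets (\<Pi>\<^sub>M i\<in>J. borel)" for J
    by (intro sets_PiM_cong) auto
  have f[measurable]: "f \<in> borel_measurable (Pi\<^sub>M (insert j I) (\<lambda>_. lborel))"
    using insert.prems by (simp cong: measurable_cong_sets add: measurable_cong_sets[OF bl refl])
  note f' = insert.prems
  have [measurable]: "(\<lambda>(x, y). f (x(j := y))) \<in> borel_measurable ((\<Pi>\<^sub>M i\<in>I. borel) \<Otimes>\<^sub>M borel)"
    using f' by measurable
  have aff: "(\<lambda>(x, y). (\<lambda>i\<in>I. t i + c * x i)(j := t j + c * y)) \<in> measurable ((\<Pi>\<^sub>M i\<in>I. borel) \<Otimes>\<^sub>M borel) (\<Pi>\<^sub>M i\<in>insert j I. borel)"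
    using insert.hyps unfolding case_prod_beta by measurable
  have m1: "(\<lambda>x. \<integral>\<^sup>+y. f (x(j := t j + c * y)) \<partial>lborel) \<in> borel_measurable (\<Pi>\<^sub>M i\<in>I. borel)"
    by measurable
  have "integral\<^sup>N (Pi\<^sub>M (insert j I) (\<lambda>_. lborel)) f =
     (\<integral>\<^sup>+x. (\<integral>\<^sup>+y. f (x(j := y)) \<partial>lborel) \<partial>(\<Pi>\<^sub>M i\<in>I. lborel))"
    by (rule product_nn_integral_insert[OF insert.hyps f])
  also have "\<dots> = (\<integral>\<^sup>+x. \<bar>c\<bar> * (\<integral>\<^sup>+y. f (x(j := t j + c * y)) \<partial>lborel) \<partial>(\<Pi>\<^sub>M i\<in>I. lborel))"
  proof (rule nn_integral_cong)
    fix x assume x: "x \<in> space (\<Pi>\<^sub>M i\<in>I. lborel :: real measure)"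
    then have "(\<lambda>y. f (x(j := y))) \<in> borel_measurable borel"
      using measurable_compose[OF measurable_component_update[OF _ insert.hyps(2)] f']
      by (simp add: space_PiM)
    then show "(\<integral>\<^sup>+y. f (x(j := y)) \<partial>lborel) = \<bar>c\<bar> * (\<integral>\<^sup>+y. f (x(j := t j + c * y)) \<partial>lborel)"
      by (rule nn_integral_real_affine[OF _ assms(2)])
  qed
  also have "\<dots> = \<bar>c\<bar> * (\<integral>\<^sup>+x. (\<integral>\<^sup>+y. f (x(j := t j + c * y)) \<partial>lborel) \<partial>(\<Pi>\<^sub>M i\<in>I. lborel))"
    using m1 by (intro nn_integral_cmult) (simp add: measurable_cong_sets[OF bl refl])
  also have "\<dots> = \<bar>c\<bar> * (\<bar>c\<bar> ^ card I * (\<integral>\<^sup>+x. (\<integral>\<^sup>+y. f ((\<lambda>i\<in>I. t i + c * x i)(j := t j + c * y)) \<partial>lborel) \<partial>(\<Pi>\<^sub>M i\<in>I. lborel)))"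
    by (subst insert.IH[OF m1]) simp
  also have "(\<integral>\<^sup>+x. (\<integral>\<^sup>+y. f ((\<lambda>i\<in>I. t i + c * x i)(j := t j + c * y)) \<partial>lborel) \<partial>(\<Pi>\<^sub>M i\<in>I. lborel))
     = (\<integral>\<^sup>+x. (\<integral>\<^sup>+y. f (\<lambda>i\<in>insert j I. t i + c * (x(j := y)) i) \<partial>lborel) \<partial>(\<Pi>\<^sub>M i\<in>I. lborel))"
    using insert.hyps by (intro nn_integral_cong arg_cong[where f=f]) (auto simp: fun_eq_iff)
  also have "\<dots> = (\<integral>\<^sup>+x. f (\<lambda>i\<in>insert j I. t i + c * x i) \<partial>(\<Pi>\<^sub>M i\<in>insert j I. lborel))"
  proof (rule product_nn_integral_insert[OF insert.hyps, symmetric])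
    have "(\<lambda>x. \<lambda>i\<in>insert j I. t i + c * x i) \<in> measurable (\<Pi>\<^sub>M i\<in>insert j I. borel) (\<Pi>\<^sub>M i\<in>insert j I. borel)"
      by measurable
    from measurable_compose[OF this f']
    show "(\<lambda>x. f (\<lambda>i\<in>insert j I. t i + c * x i)) \<in> borel_measurable (\<Pi>\<^sub>M i\<in>insert j I. lborel)"
      by (simp add: measurable_cong_sets[OF bl refl])
  qed
  finally show ?case
    by (simp only: card_insert_disjoint[OF insert.hyps] power_Suc mult.assoc ennreal_mult[OF abs_ge_zero zero_le_power[OF abs_ge_zero]])
qed

text \<open>The two numbers bound the squared norm. Excluding the inner sphere makes a shell a
  difference of closed balls and keeps the origin out even for r = 0.\<close>

definition shell :: "nat \<Rightarrow> real \<Rightarrow> real \<Rightarrow> (nat \<Rightarrow> real) set" where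
  "shell N r s = {x \<in> space (bor N). r < ip N x x \<and> ip N x x \<le> s}"

lemma sets_shell [measurable]: "shell N r s \<in> sets (bor N)"
  unfolding shell_def by measurable

lemma measurable_radial_projection [measurable]: "radial_projection N \<in> measurable (bor N) (bor N)"
  unfolding radial_projection_def L2_set_ip by measurable

lemma sets_unit_ball [measurable]: "unit_ball N \<in> sets (bor N)"
proof -
  have "unit_ball N = {x \<in> space (bor N). sqrt (ip N x x) \<le> 1}"
    by (simp add: unit_ball_def L2_set_ip space_PiM)
  then show ?thesis by simp
qed

lemma radial_projection_scale:
  assumes "0 < c"
  shows "radial_projection N (\<lambda>i\<in>{..<N}. c * x i) = radial_projection N x"
  using assms by (auto simp: radial_projection_def L2_set_ip ip_scale real_sqrt_mult fun_eq_iff)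

text \<open>The ball lies between the cubes of half-side 1 / sqrt N and 1, which is enough to
  normalise the uniform measure on it.\<close>

lemma emeasure_unit_ball:
  assumes "0 < N"
  shows "emeasure (leb N) (unit_ball N) \<noteq> 0" "emeasure (leb N) (unit_ball N) \<noteq> \<infinity>"
proof -
  interpret product_sigma_finite "\<lambda>_::nat. lborel :: real measure" ..
  have em: "emeasure (leb N) (PiE {..<N} (\<lambda>_. {-r..r})) = ennreal ((2 * r) ^ N)" if "0 \<le> r" for r :: real
    using that by (subst emeasure_PiM) (auto simp: ennreal_power)
  have box: "PiE {..<N} (\<lambda>_. {-r..r}) \<in> sets (leb N)" for r :: real
    by (intro sets_PiM_I_finite) auto
  have "unit_ball N \<subseteq> PiE {..<N} (\<lambda>_. {-1..1})"
  proof
    fix x assume x: "x \<in> unit_ball N"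
    have "\<bar>x i\<bar> \<le> 1" if "i < N" for i
    proof -
      have "(x i)\<^sup>2 \<le> ip N x x"
        unfolding ip_def power2_eq_square using that by (intro member_le_sum[of i _ "\<lambda>i. x i * x i"]) auto
      also have "\<dots> \<le> 1" using x by (simp add: unit_ball_def L2_set_ip)
      finally show ?thesis by (simp add: abs_square_le_1)
    qed
    then show "x \<in> PiE {..<N} (\<lambda>_. {-1..1})"
      using x by (auto simp: unit_ball_def PiE_iff abs_le_iff minus_le_iff)
  qed
  then have "emeasure (leb N) (unit_ball N) \<le> ennreal ((2 * 1) ^ N)"
    using emeasure_mono[OF _ box[of 1]] em[of 1] by auto
  then show "emeasure (leb N) (unit_ball N) \<noteq> \<infinity>"
    by (auto simp: top_unique)
  define r where "r = 1 / sqrt (real N)"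
  have r: "0 < r" "r * r * real N = 1" using assms by (auto simp: r_def)
  have sub: "PiE {..<N} (\<lambda>_. {-r..r}) \<subseteq> unit_ball N"
  proof
    fix x assume x: "x \<in> PiE {..<N} (\<lambda>_. {-r..r})"
    have "x i * x i \<le> r * r" if "i < N" for i
    proof -
      have "\<bar>x i\<bar> \<le> r" using x that by (auto simp: PiE_iff abs_le_iff minus_le_iff)
      then have "\<bar>x i\<bar> * \<bar>x i\<bar> \<le> r * r" using r by (intro mult_mono) auto
      then show ?thesis by simp
    qed
    then have "ip N x x \<le> (\<Sum>i<N. r * r)"
      unfolding ip_def by (intro sum_mono) auto
    then show "x \<in> unit_ball N"
      using x r by (auto simp: unit_ball_def L2_set_ip PiE_iff mult_ac)
  qed
  have "ennreal ((2 * r) ^ N) \<le> emeasure (leb N) (unit_ball N)"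
    using emeasure_mono[OF sub, of "leb N"] sets_unit_ball[of N] em[of r] r by (simp add: sets_leb)
  then show "emeasure (leb N) (unit_ball N) \<noteq> 0"
    using r by auto
qed

lemma emeasure_leb_scale:
  assumes c: "0 < c" and A[measurable]: "A \<in> sets (bor N)"
  shows "emeasure (leb N) A = ennreal (c ^ N) * emeasure (leb N) {x \<in> space (bor N). (\<lambda>i\<in>{..<N}. c * x i) \<in> A}"
proof -
  have m: "(\<lambda>x. \<lambda>i\<in>{..<N}. c * x i) \<in> measurable (bor N) (bor N)" by measurable
  have s: "{x \<in> space (bor N). (\<lambda>i\<in>{..<N}. c * x i) \<in> A} \<in> sets (bor N)"
    using measurable_sets[OF m A] by (simp add: vimage_def Int_def conj_commute)
  have "emeasure (leb N) A = (\<integral>\<^sup>+x. indicator A x \<partial>leb N)"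
    using A by (simp add: sets_leb)
  also have "\<dots> = ennreal (c ^ N) * (\<integral>\<^sup>+x. indicator A (\<lambda>i\<in>{..<N}. 0 + c * x i) \<partial>leb N)"
    using nn_integral_PiM_affine[of "{..<N}" c "indicator A" "\<lambda>_. 0"] c by simp
  also have "(\<integral>\<^sup>+x. indicator A (\<lambda>i\<in>{..<N}. 0 + c * x i) \<partial>leb N) =
     (\<integral>\<^sup>+x. indicator {x \<in> space (bor N). (\<lambda>i\<in>{..<N}. c * x i) \<in> A} x \<partial>leb N)"
    by (intro nn_integral_cong) (auto simp: indicator_def space_PiM)
  also have "\<dots> = emeasure (leb N) {x \<in> space (bor N). (\<lambda>i\<in>{..<N}. c * x i) \<in> A}"
    using s by (intro nn_integral_indicator) (simp add: sets_leb)
  finally show ?thesis .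
qed

definition vol1 :: "nat \<Rightarrow> real" where
  "vol1 N = measure (leb N) (unit_ball N)"

lemma vol1: assumes "0 < N" shows "0 < vol1 N" "emeasure (leb N) (unit_ball N) = ennreal (vol1 N)"
  using emeasure_unit_ball[OF assms] unfolding vol1_def
  by (auto simp: emeasure_eq_ennreal_measure top.not_eq_extremum zero_less_measure_iff)

lemma emeasure_sphere_uniform:
  assumes N: "0 < N" and A[measurable]: "A \<in> sets (bor N)"
  shows "emeasure (leb N) {x \<in> unit_ball N. radial_projection N x \<in> A} = ennreal (vol1 N) * emeasure (sphere_uniform N) A"
proof -
  have [measurable_cong]: "sets (leb N) = sets (bor N)" by (rule sets_leb)
  have m: "radial_projection N \<in> measurable (uniform_measure (leb N) (unit_ball N)) (bor N)"
    by (simp add: measurable_cong_sets[OF sets_uniform_measure refl])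
  have s: "radial_projection N -` A \<inter> space (bor N) \<in> sets (leb N)"
    using measurable_sets[OF measurable_radial_projection A] by (simp add: sets_leb)
  have sp: "space (leb N) = space (bor N)" by (simp add: space_PiM)
  have "emeasure (sphere_uniform N) A = emeasure (uniform_measure (leb N) (unit_ball N)) (radial_projection N -` A \<inter> space (bor N))"
    unfolding sphere_uniform_def using emeasure_distr[OF m A] by (simp add: sp)
  also have "\<dots> = emeasure (leb N) (unit_ball N \<inter> (radial_projection N -` A \<inter> space (bor N))) / ennreal (vol1 N)"
    using s by (subst emeasure_uniform_measure) (auto simp: vol1[OF N] sets_leb)
  also have "unit_ball N \<inter> (radial_projection N -` A \<inter> space (bor N)) = {x \<in> unit_ball N. radial_projection N x \<in> A}"
    using sets.sets_into_space[OF sets_unit_ball[of N]] by auto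
  finally have "ennreal (vol1 N) * emeasure (sphere_uniform N) A =
      emeasure (leb N) {x \<in> unit_ball N. radial_projection N x \<in> A} * ennreal (vol1 N) / ennreal (vol1 N)"
    by (simp only: ennreal_times_divide mult.commute)
  then show ?thesis
    using vol1(1)[OF N] by (simp add: ennreal_mult_divide_eq)
qed

text \<open>Scaling by sqrt r carries the cone over \<open>A\<close> in the unit ball onto the cone
  in the ball of squared radius r, because the projection ignores scaling.\<close>

lemma emeasure_cone:
  assumes N: "0 < N" and r: "0 < r" and A[measurable]: "A \<in> sets (bor N)"
  shows "emeasure (leb N) {x \<in> space (bor N). ip N x x \<le> r \<and> radial_projection N x \<in> A}
    = ennreal (sqrt r ^ N * vol1 N) * emeasure (sphere_uniform N) A"
proof -
  let ?S = "{x \<in> space (bor N). ip N x x \<le> r \<and> radial_projection N x \<in> A}"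
  have "?S = {x \<in> space (bor N). ip N x x \<le> r} \<inter> (radial_projection N -` A \<inter> space (bor N))" by auto
  then have S: "?S \<in> sets (bor N)"
    using measurable_sets[OF measurable_radial_projection A] by auto
  have "{x \<in> space (bor N). (\<lambda>i\<in>{..<N}. sqrt r * x i) \<in> ?S} = {x \<in> unit_ball N. radial_projection N x \<in> A}"
    using r by (auto simp: radial_projection_scale ip_scale unit_ball_def L2_set_ip space_PiM)
  then show ?thesis
    using emeasure_leb_scale[OF _ S, of "sqrt r"] r vol1(1)[OF N] emeasure_sphere_uniform[OF N A]
    by (simp add: ennreal_mult mult.assoc)
qed

lemma prob_space_sphere_uniform:
  assumes "0 < N" shows "prob_space (sphere_uniform N)"
  unfolding sphere_uniform_def
  by (intro prob_space.prob_space_distr prob_space_uniform_measure emeasure_unit_ball assms)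
     (simp add: measurable_cong_sets[OF sets_uniform_measure refl] measurable_cong_sets[OF sets_leb refl])

lemma sets_sphere_uniform [measurable_cong, simp]: "sets (sphere_uniform N) = sets (bor N)"
  and space_sphere_uniform [simp]: "space (sphere_uniform N) = space (bor N)"
  by (simp_all add: sphere_uniform_def)

definition shell_vol :: "nat \<Rightarrow> real \<Rightarrow> real \<Rightarrow> real" where
  "shell_vol N r s = (sqrt s ^ N - sqrt r ^ N) * vol1 N"

lemma shell_vol_pos: "0 < N \<Longrightarrow> 0 \<le> r \<Longrightarrow> r < s \<Longrightarrow> 0 < shell_vol N r s"
  unfolding shell_vol_def using vol1(1)[of N]
  by (intro mult_pos_pos) (auto intro!: power_strict_mono)

lemma emeasure_shell_cone:
  assumes N: "0 < N" and r: "0 \<le> r" "r < s" and A[measurable]: "A \<in> sets (bor N)"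
  shows "emeasure (leb N) {x \<in> shell N r s. radial_projection N x \<in> A}
    = ennreal (shell_vol N r s) * emeasure (sphere_uniform N) A"
proof -
  interpret prob_space "sphere_uniform N" by (rule prob_space_sphere_uniform[OF N])
  define D where "D r = {x \<in> space (bor N). ip N x x \<le> r \<and> radial_projection N x \<in> A}" for r
  have "D r = {x \<in> space (bor N). ip N x x \<le> r} \<inter> (radial_projection N -` A \<inter> space (bor N))" for r
    by (auto simp: D_def)
  then have S: "D r \<in> sets (leb N)" for r
    using measurable_sets[OF measurable_radial_projection A] by (auto simp: sets_leb)
  have pos: "emeasure (leb N) (D r) = ennreal (sqrt r ^ N * vol1 N) * emeasure (sphere_uniform N) A" if "0 < r" for r
    unfolding D_def by (rule emeasure_cone[OF N that A])
  have D: "emeasure (leb N) (D r) = ennreal (sqrt r ^ N * vol1 N * measure (sphere_uniform N) A)" if "0 \<le> r" for r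
  \<comment> \<open>The scaling argument needs r > 0; at r = 0 the cone is at most the origin, a
    null set since N > 0.\<close>
  proof (cases "r = 0")
    case True
    interpret product_sigma_finite "\<lambda>_::nat. lborel :: real measure" ..
    have "D 0 \<subseteq> PiE {..<N} (\<lambda>_. {0})"
    proof
      fix x assume x: "x \<in> D 0"
      then have "ip N x x = 0" using ip_nonneg[of N x] by (auto simp: D_def)
      then have "\<forall>i<N. x i = 0" by (auto simp: ip_def sum_nonneg_eq_0_iff)
      then show "x \<in> PiE {..<N} (\<lambda>_. {0})" using x by (auto simp: D_def space_PiM PiE_iff extensional_def)
    qed
    then have "emeasure (leb N) (D 0) \<le> emeasure (leb N) (PiE {..<N} (\<lambda>_. {0}))"
      by (intro emeasure_mono sets_PiM_I_finite) auto
    also have "\<dots> = 0" using N by (subst emeasure_PiM) auto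
    finally show ?thesis using True N by (simp add: power_0_left)
  next
    case False
    then show ?thesis using that pos[of r] vol1(1)[OF N] by (simp add: emeasure_eq_measure ennreal_mult)
  qed
  have "{x \<in> shell N r s. radial_projection N x \<in> A} = D s - D r"
    using r by (auto simp: shell_def D_def)
  then have "emeasure (leb N) {x \<in> shell N r s. radial_projection N x \<in> A} = emeasure (leb N) (D s) - emeasure (leb N) (D r)"
  proof (simp only:, intro emeasure_Diff S)
    show "emeasure (leb N) (D r) \<noteq> \<infinity>" unfolding D[OF r(1)] by simp
    show "D r \<subseteq> D s" using r unfolding D_def by fastforce
  qed
  also have "\<dots> = ennreal (sqrt s ^ N * vol1 N * measure (sphere_uniform N) A - sqrt r ^ N * vol1 N * measure (sphere_uniform N) A)"
    using r vol1(1)[OF N] by (simp add: D ennreal_minus mult_nonneg_nonneg)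
  also have "\<dots> = ennreal (shell_vol N r s * measure (sphere_uniform N) A)"
    by (simp add: shell_vol_def algebra_simps)
  finally show ?thesis
    using shell_vol_pos[OF N r] by (simp add: emeasure_eq_measure ennreal_mult)
qed

lemma emeasure_shell:
  assumes N: "0 < N" and r: "0 \<le> r" "r < s"
  shows "emeasure (leb N) (shell N r s) = ennreal (shell_vol N r s)"
proof -
  interpret prob_space "sphere_uniform N" by (rule prob_space_sphere_uniform[OF N])
  have "{x \<in> shell N r s. radial_projection N x \<in> space (bor N)} = shell N r s"
    using measurable_space[OF measurable_radial_projection] by (auto simp: shell_def)
  then show ?thesis
    using emeasure_shell_cone[OF N r, of "space (bor N)"] emeasure_space_1 by simp
qed

definition shell_uniform :: "nat \<Rightarrow> real \<Rightarrow> real \<Rightarrow> (nat \<Rightarrow> real) measure" where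
  "shell_uniform N r s = uniform_measure (leb N) (shell N r s)"

lemma sets_shell_uniform [measurable_cong, simp]: "sets (shell_uniform N r s) = sets (bor N)"
  and space_shell_uniform [simp]: "space (shell_uniform N r s) = space (bor N)"
  by (simp_all add: shell_uniform_def sets_leb space_PiM)

lemma prob_space_shell_uniform:
  "0 < N \<Longrightarrow> 0 \<le> r \<Longrightarrow> r < s \<Longrightarrow> prob_space (shell_uniform N r s)"
  unfolding shell_uniform_def using shell_vol_pos[of N r s]
  by (intro prob_space_uniform_measure) (auto simp: emeasure_shell)

lemma nn_integral_shell_uniform:
  assumes N: "0 < N" and r: "0 \<le> r" "r < s" and [measurable]: "f \<in> borel_measurable (bor N)"
  shows "(\<integral>\<^sup>+x. f x \<partial>shell_uniform N r s) = (\<integral>\<^sup>+x. f x * indicator (shell N r s) x \<partial>leb N) / ennreal (shell_vol N r s)"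
proof -
  have [measurable_cong]: "sets (leb N) = sets (bor N)" by (rule sets_leb)
  show ?thesis
    unfolding shell_uniform_def using emeasure_shell[OF N r]
    by (subst nn_integral_uniform_measure) auto
qed

lemma AE_shell_uniform:
  assumes "0 < N" "0 \<le> r" "r < s"
  shows "AE x in shell_uniform N r s. x \<in> shell N r s"
  unfolding shell_uniform_def
  using assms shell_vol_pos[of N r s] sets_shell[of N r s]
  by (intro AE_uniform_measureI) (auto simp: sets_leb)

text \<open>Under Lebesgue measure direction and length are independent, so any shell can replace
  the ball in the definition of the cone measure. The freedom is used in two ways: a thin shell just
  outside radius sqrt N for the comparison with Gaussians and as the source of a shift, and a
  punctured ball as the target of a shift.\<close>

theorem sphere_uniform_shell:
  assumes N: "0 < N" and r: "0 \<le> r" "r < s"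
  shows "sphere_uniform N = distr (shell_uniform N r s) (bor N) (radial_projection N)"
proof (rule measure_eqI)
  fix A assume "A \<in> sets (sphere_uniform N)"
  then have A[measurable]: "A \<in> sets (bor N)" by simp
  have s: "radial_projection N -` A \<inter> space (bor N) \<in> sets (bor N)"
    using measurable_sets[OF measurable_radial_projection A] .
  have "emeasure (distr (shell_uniform N r s) (bor N) (radial_projection N)) A
      = emeasure (shell_uniform N r s) (radial_projection N -` A \<inter> space (bor N))"
    by (subst emeasure_distr) auto
  also have "\<dots> = emeasure (leb N) (shell N r s \<inter> (radial_projection N -` A \<inter> space (bor N))) / ennreal (shell_vol N r s)"
    unfolding shell_uniform_def using s by (subst emeasure_uniform_measure) (auto simp: sets_leb emeasure_shell[OF N r])
  also have "shell N r s \<inter> (radial_projection N -` A \<inter> space (bor N)) = {x \<in> shell N r s. radial_projection N x \<in> A}"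
    by (auto simp: shell_def)
  also have "emeasure (leb N) \<dots> / ennreal (shell_vol N r s) = emeasure (sphere_uniform N) A"
    using shell_vol_pos[OF N r] by (simp add: emeasure_shell_cone[OF N r] ennreal_times_divide ennreal_mult_divide_eq mult.commute)
  finally show "emeasure (sphere_uniform N) A = emeasure (distr (shell_uniform N r s) (bor N) (radial_projection N)) A" by simp
qed simp

lemma radial_projection_in_sphere:
  assumes "0 < N" "0 < ip N x x"
  shows "radial_projection N x \<in> spin_sphere N" "ip N (radial_projection N x) (radial_projection N x) = real N"
proof -
  have eq: "ip N (radial_projection N x) y = sqrt (real N / ip N x x) * ip N x y" for y
    unfolding radial_projection_def ip_restrict L2_set_ip
    by (simp add: ip_def sum_distrib_left sum_divide_distrib real_sqrt_divide mult_ac)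
  have "ip N (radial_projection N x) (radial_projection N x) = sqrt (real N / ip N x x) * (sqrt (real N / ip N x x) * ip N x x)"
    by (subst eq, subst ip_commute, subst eq) simp
  also have "\<dots> = real N" using assms by (simp add: mult.assoc[symmetric])
  finally show *: "ip N (radial_projection N x) (radial_projection N x) = real N" .
  show "radial_projection N x \<in> spin_sphere N"
    using * by (simp add: spin_sphere_def L2_set_ip PiE_iff) (simp add: radial_projection_def)
qed

lemma spin_sphere_eq: "spin_sphere N = {x \<in> space (bor N). ip N x x = real N}"
  by (auto simp: spin_sphere_def L2_set_ip space_PiM)

lemma sets_spin_sphere [measurable]: "spin_sphere N \<in> sets (bor N)"
  unfolding spin_sphere_eq by measurable

lemma AE_spin_sphere:
  assumes N: "0 < N" shows "AE \<sigma> in sphere_uniform N. \<sigma> \<in> spin_sphere N"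
proof -
  have "AE x in shell_uniform N 0 1. radial_projection N x \<in> spin_sphere N"
    using AE_shell_uniform[OF N, of 0 1, simplified]
    by eventually_elim (auto intro!: radial_projection_in_sphere[OF N] simp: shell_def)
  then show ?thesis
    by (subst sphere_uniform_shell[OF N, of 0 1]) (auto simp: AE_distr_iff)
qed

section \<open>Comparison of the sphere with Gaussian vectors\<close>

lemma nn_integral_std_normal:
  assumes [measurable]: "f \<in> borel_measurable borel"
  shows "(\<integral>\<^sup>+x. f x \<partial>std_normal) = (\<integral>\<^sup>+x. f x * ennreal (std_normal_density x) \<partial>lborel)"
  unfolding std_normal_def by (subst nn_integral_density) (auto simp: mult.commute)

lemma nn_integral_gauss_density:
  assumes "finite I" "f \<in> borel_measurable (\<Pi>\<^sub>M i\<in>I. borel)"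
  shows "(\<integral>\<^sup>+x. f x \<partial>gauss I) = (\<integral>\<^sup>+x. f x * ennreal (\<Prod>i\<in>I. std_normal_density (x i)) \<partial>(\<Pi>\<^sub>M i\<in>I. lborel))"
  using assms
proof (induction I arbitrary: f rule: finite_induct)
  case empty
  then show ?case by (simp add: gauss_def PiM_empty nn_integral_count_space_finite)
next
  case (insert j I)
  interpret L: product_sigma_finite "\<lambda>_. lborel :: real measure" ..
  interpret G: product_sigma_finite "\<lambda>_. std_normal" by (rule product_sigma_finite_std_normal)
  have bl: "sets (Pi\<^sub>M J (\<lambda>_. lborel :: real measure)) = sets (\<Pi>\<^sub>M i\<in>J. borel)" for J :: "'a set"
    by (intro sets_PiM_cong) auto
  have gl: "sets (Pi\<^sub>M J (\<lambda>_. std_normal)) = sets (\<Pi>\<^sub>M i\<in>J. borel)" for J :: "'a set"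
    by (intro sets_PiM_cong) auto
  note f = insert.prems
  have fs: "(\<lambda>y. f (x(j := y))) \<in> borel_measurable borel" if "x \<in> space (\<Pi>\<^sub>M i\<in>I. borel :: real measure)" for x
    using measurable_compose[OF measurable_component_update[OF that insert.hyps(2)] f] .
  have [measurable]: "(\<lambda>(x, y). f (x(j := y))) \<in> borel_measurable ((\<Pi>\<^sub>M i\<in>I. borel) \<Otimes>\<^sub>M borel)"
    using f by measurable
  have m1: "(\<lambda>x. \<integral>\<^sup>+y. f (x(j := y)) * ennreal (std_normal_density y) \<partial>lborel) \<in> borel_measurable (\<Pi>\<^sub>M i\<in>I. borel)"
    by measurable
  have "(\<integral>\<^sup>+x. f x \<partial>gauss (insert j I)) = (\<integral>\<^sup>+x. (\<integral>\<^sup>+y. f (x(j := y)) \<partial>std_normal) \<partial>gauss I)"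
    unfolding gauss_def by (rule G.product_nn_integral_insert[OF insert.hyps]) (use f in \<open>simp add: measurable_cong_sets[OF gl refl]\<close>)
  also have "\<dots> = (\<integral>\<^sup>+x. (\<integral>\<^sup>+y. f (x(j := y)) * ennreal (std_normal_density y) \<partial>lborel) \<partial>gauss I)"
    by (intro nn_integral_cong nn_integral_std_normal fs) (simp add: space_gauss space_PiM)
  also have "\<dots> = (\<integral>\<^sup>+x. (\<integral>\<^sup>+y. f (x(j := y)) * ennreal (std_normal_density y) \<partial>lborel) * ennreal (\<Prod>i\<in>I. std_normal_density (x i)) \<partial>(\<Pi>\<^sub>M i\<in>I. lborel))"
    by (rule insert.IH[OF m1])
  also have "\<dots> = (\<integral>\<^sup>+x. (\<integral>\<^sup>+y. f (x(j := y)) * ennreal (\<Prod>i\<in>insert j I. std_normal_density ((x(j := y)) i)) \<partial>lborel) \<partial>(\<Pi>\<^sub>M i\<in>I. lborel))"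
  proof (rule nn_integral_cong)
    fix x assume x: "x \<in> space (\<Pi>\<^sub>M i\<in>I. lborel :: real measure)"
    have "(\<Prod>i\<in>insert j I. std_normal_density ((x(j := y)) i)) = std_normal_density y * (\<Prod>i\<in>I. std_normal_density (x i))" for y
      using insert.hyps by (auto intro!: prod.cong)
    then show "(\<integral>\<^sup>+y. f (x(j := y)) * ennreal (std_normal_density y) \<partial>lborel) * ennreal (\<Prod>i\<in>I. std_normal_density (x i)) =
       (\<integral>\<^sup>+y. f (x(j := y)) * ennreal (\<Prod>i\<in>insert j I. std_normal_density ((x(j := y)) i)) \<partial>lborel)"
      using fs[of x] x by (subst nn_integral_multc[symmetric]) (auto simp: space_PiM ennreal_mult mult.assoc prod_nonneg)
  qed
  also have "\<dots> = (\<integral>\<^sup>+x. f x * ennreal (\<Prod>i\<in>insert j I. std_normal_density (x i)) \<partial>(\<Pi>\<^sub>M i\<in>insert j I. lborel))"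
  proof (rule L.product_nn_integral_insert[OF insert.hyps, symmetric])
    have "(\<lambda>x. f x * ennreal (\<Prod>i\<in>insert j I. std_normal_density (x i))) \<in> borel_measurable (\<Pi>\<^sub>M i\<in>insert j I. borel)"
      using f by measurable
    then show "(\<lambda>x. f x * ennreal (\<Prod>i\<in>insert j I. std_normal_density (x i))) \<in> borel_measurable (\<Pi>\<^sub>M i\<in>insert j I. lborel)"
      by (simp add: measurable_cong_sets[OF bl refl])
  qed
  finally show ?case .
qed

lemma prod_std_normal_density:
  "(\<Prod>i<N. std_normal_density (x i)) = (1 / sqrt (2 * pi)) ^ N * exp (- ip N x x / 2)"
  by (simp add: std_normal_density_def prod_dividef exp_sum[symmetric] ip_def power2_eq_square
      sum_negf sum_divide_distrib power_one_over divide_simps)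

lemma integral_gauss_product2:
  fixes f h :: "real \<Rightarrow> real"
  assumes "finite K" "i \<in> K" "k \<in> K" "i \<noteq> k"
    and "integrable std_normal f" "integrable std_normal h"
  shows "integrable (gauss K) (\<lambda>g. f (g i) * h (g k))"
    and "(LINT g|gauss K. f (g i) * h (g k)) = integral\<^sup>L std_normal f * integral\<^sup>L std_normal h"
proof -
  interpret G: product_sigma_finite "\<lambda>_. std_normal" by (rule product_sigma_finite_std_normal)
  interpret S: prob_space std_normal by (rule prob_space_std_normal)
  have [simp]: "S.prob UNIV = 1" using S.prob_space by simp
  define u where "u j = (if j = i then f else if j = k then h else (\<lambda>_. 1))" for j
  have *: "(\<Prod>j\<in>K. v (u j) j) = v f i * v h k * (\<Prod>j\<in>K - {i} - {k}. v (\<lambda>_. 1) j)" for v :: "(real \<Rightarrow> real) \<Rightarrow> 'a \<Rightarrow> real"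
  proof -
    have "(\<Prod>j\<in>K. v (u j) j) = v (u i) i * (v (u k) k * (\<Prod>j\<in>K - {i} - {k}. v (u j) j))"
      using assms by (subst prod.remove[of _ i], simp, simp, subst prod.remove[of _ k]) auto
    then show ?thesis
      using assms by (simp add: u_def mult.assoc)
  qed
  have eq: "(\<Prod>j\<in>K. u j (g j)) = f (g i) * h (g k)" for g :: "'a \<Rightarrow> real"
    using *[of "\<lambda>w j. w (g j)"] by simp
  have u: "integrable std_normal (u j)" for j
    using assms(5,6) by (auto simp: u_def)
  show "integrable (gauss K) (\<lambda>g. f (g i) * h (g k))"
    using G.product_integrable_prod[of K u] u assms(1) by (simp add: gauss_def eq)
  have "(LINT g|gauss K. f (g i) * h (g k)) = (\<Prod>j\<in>K. integral\<^sup>L std_normal (u j))"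
    using G.product_integral_prod[of K u] u assms(1) by (simp add: gauss_def eq)
  also have "\<dots> = integral\<^sup>L std_normal f * integral\<^sup>L std_normal h"
    using *[of "\<lambda>w j. integral\<^sup>L std_normal w"] by (simp add: S.prob_space)
  finally show "(LINT g|gauss K. f (g i) * h (g k)) = integral\<^sup>L std_normal f * integral\<^sup>L std_normal h" .
qed

lemma std_normal_fourth: "(LINT x|std_normal. x ^ 4) = 3"
  using integral_std_normal_moment_even[of 2] by (simp add: integral_std_normal fact_numeral)

lemma gauss_norm_variance:
  "integrable (gauss {..<N}) (\<lambda>g. (ip N g g - real N)\<^sup>2)"
  "(LINT g|gauss {..<N}. (ip N g g - real N)\<^sup>2) = 2 * real N"
proof -
  interpret S: prob_space std_normal by (rule prob_space_std_normal)
  have [simp]: "S.prob UNIV = 1" using S.prob_space by simp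
  let ?f = "\<lambda>x::real. x\<^sup>2 - 1"
  have f: "integrable std_normal ?f" "integral\<^sup>L std_normal ?f = 0"
    by (simp_all add: std_normal_square S.prob_space)
  have f2: "integrable std_normal (\<lambda>x. ?f x * ?f x)" "(LINT x|std_normal. ?f x * ?f x) = 2"
  proof -
    have eq: "?f x * ?f x = x ^ 4 - 2 * x\<^sup>2 + 1" for x
      by (simp add: power4_eq_xxxx power2_eq_square algebra_simps)
    show "integrable std_normal (\<lambda>x. ?f x * ?f x)" unfolding eq by simp
    show "(LINT x|std_normal. ?f x * ?f x) = 2" unfolding eq
      by (simp add: std_normal_fourth std_normal_square S.prob_space)
  qed
  have eq: "(ip N g g - real N)\<^sup>2 = (\<Sum>i<N. \<Sum>k<N. ?f (g i) * ?f (g k))" for g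
  proof -
    have "ip N g g - real N = (\<Sum>i<N. ?f (g i))"
      by (simp add: ip_def sum_subtractf power2_eq_square)
    then show ?thesis by (simp only: power2_eq_square[of "\<Sum>i<N. ?f (g i)"] sum_product)
  qed
  have int: "integrable (gauss {..<N}) (\<lambda>g. ?f (g i) * ?f (g k)) \<and>
     (LINT g|gauss {..<N}. ?f (g i) * ?f (g k)) = (if i = k then 2 else 0)" if "i < N" "k < N" for i k
  proof (cases "i = k")
    case True
    then show ?thesis
      using that f2 integral_gauss_coordinate[of i "{..<N}" "\<lambda>x. ?f x * ?f x"] by simp
  next
    case False
    then show ?thesis
      using that f integral_gauss_product2[of "{..<N}" i k ?f ?f] by simp
  qed
  show "integrable (gauss {..<N}) (\<lambda>g. (ip N g g - real N)\<^sup>2)"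
    unfolding eq using int by (intro Bochner_Integration.integrable_sum) auto
  have "(LINT g|gauss {..<N}. (ip N g g - real N)\<^sup>2) = (\<Sum>i<N. \<Sum>k<N. if i = k then 2 else 0)"
    unfolding eq using int by (subst Bochner_Integration.integral_sum, (auto intro!: Bochner_Integration.integrable_sum)[1],
      intro sum.cong refl, subst Bochner_Integration.integral_sum) auto
  then show "(LINT g|gauss {..<N}. (ip N g g - real N)\<^sup>2) = 2 * real N"
    by (simp add: sum.delta)
qed

text \<open>Chebyshev with variance 2 N: the probability of leaving the shell is at most 2 / (N
  d^2), which the threshold 4 / d^2 makes at most 1/2.\<close>

lemma gauss_shell_ge_half:
  assumes d: "0 < d" "d < 1" and N: "4 / d\<^sup>2 \<le> real N"
  shows "1 / 2 \<le> measure (gauss {..<N}) (shell N (real N * (1 - d)) (real N * (1 + d)))"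
proof -
  interpret G: prob_space "gauss {..<N}" by (rule prob_space_gauss)
  have N0: "0 < N" using N d by (cases "N = 0") (auto simp: field_simps)
  have [measurable]: "(\<lambda>g. ip N g g) \<in> borel_measurable (gauss {..<N})"
    by (rule measurable_ip) measurable
  let ?Bad = "{g \<in> space (gauss {..<N}). (real N * d)\<^sup>2 \<le> (ip N g g - real N)\<^sup>2}"
  have "G.prob ?Bad \<le> (LINT g|gauss {..<N}. (ip N g g - real N)\<^sup>2) / (real N * d)\<^sup>2"
    using gauss_norm_variance(1)[of N] d N0
    by (intro integral_Markov_inequality_measure[where A="{}"]) auto
  also have "\<dots> = 2 / (real N * d\<^sup>2)"
    using N0 unfolding gauss_norm_variance by (simp add: power2_eq_square)
  also have "\<dots> \<le> 1 / 2"
    using N N0 d by (simp add: field_simps)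
  finally have bad: "G.prob ?Bad \<le> 1 / 2" .
  have sub: "space (gauss {..<N}) - ?Bad \<subseteq> shell N (real N * (1 - d)) (real N * (1 + d))"
  proof
    fix g assume g: "g \<in> space (gauss {..<N}) - ?Bad"
    then have "\<bar>ip N g g - real N\<bar> < real N * d"
      using d N0 abs_le_square_iff[of "real N * d" "ip N g g - real N"] by (auto simp: not_le)
    then show "g \<in> shell N (real N * (1 - d)) (real N * (1 + d))"
      using g by (auto simp: shell_def space_gauss space_PiM algebra_simps abs_less_iff)
  qed
  have "1 / 2 \<le> G.prob (space (gauss {..<N}) - ?Bad)"
    using bad by (subst G.prob_compl) auto
  also have "\<dots> \<le> G.prob (shell N (real N * (1 - d)) (real N * (1 + d)))"
    using sub sets_shell by (intro G.finite_measure_mono) (auto simp: sets_gauss)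
  finally show ?thesis .
qed

lemma sets_gauss_bor: "sets (gauss {..<N}) = sets (bor N)"
  by (rule sets_gauss)

text \<open>The shell has Gaussian mass at least 1/2, and the Gaussian density on it is at most its
  value at the inner radius. This bounds the volume from below without a formula for the volume of
  the ball.\<close>

lemma shell_vol_lower:
  assumes d: "0 < d" "d < 1" and N: "4 / d\<^sup>2 \<le> real N"
  shows "sqrt (2 * pi) ^ N * exp (real N * (1 - d) / 2) / 2 \<le> shell_vol N (real N * (1 - d)) (real N * (1 + d))"
proof -
  interpret G: prob_space "gauss {..<N}" by (rule prob_space_gauss)
  have N0: "0 < N" using N d by (cases "N = 0") (auto simp: field_simps)
  let ?S = "shell N (real N * (1 - d)) (real N * (1 + d))"
  let ?c = "(1 / sqrt (2 * pi)) ^ N * exp (- (real N * (1 - d)) / 2)"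
  have r: "0 \<le> real N * (1 - d)" "real N * (1 - d) < real N * (1 + d)"
    using d N0 by auto
  have [measurable_cong]: "sets (leb N) = sets (bor N)" by (rule sets_leb)
  have "emeasure (gauss {..<N}) ?S = (\<integral>\<^sup>+x. indicator ?S x \<partial>gauss {..<N})"
    using sets_shell by (simp add: sets_gauss_bor)
  also have "\<dots> = (\<integral>\<^sup>+x. indicator ?S x * ennreal (\<Prod>i<N. std_normal_density (x i)) \<partial>leb N)"
    by (rule nn_integral_gauss_density) auto
  also have "\<dots> \<le> (\<integral>\<^sup>+x. ennreal ?c * indicator ?S x \<partial>leb N)"
  proof (rule nn_integral_mono)
    fix x
    show "indicator ?S x * ennreal (\<Prod>i<N. std_normal_density (x i)) \<le> ennreal ?c * indicator ?S x"
      unfolding prod_std_normal_density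
      by (auto simp: indicator_def shell_def intro!: ennreal_leI mult_left_mono)
  qed
  also have "\<dots> = ennreal ?c * ennreal (shell_vol N (real N * (1 - d)) (real N * (1 + d)))"
    using emeasure_shell[OF N0 r] by (subst nn_integral_cmult_indicator) auto
  finally have "G.prob ?S \<le> ?c * shell_vol N (real N * (1 - d)) (real N * (1 + d))"
    using shell_vol_pos[OF N0 r] by (simp add: G.emeasure_eq_measure ennreal_mult[symmetric])
  with gauss_shell_ge_half[OF d N] have "1 / 2 \<le> ?c * shell_vol N (real N * (1 - d)) (real N * (1 + d))"
    by simp
  then have "sqrt (2 * pi) ^ N * exp (real N * (1 - d) / 2) * (1 / 2) \<le>
     sqrt (2 * pi) ^ N * exp (real N * (1 - d) / 2) * (?c * shell_vol N (real N * (1 - d)) (real N * (1 + d)))"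
    by (intro mult_left_mono) auto
  also have "\<dots> = (sqrt (2 * pi) * (1 / sqrt (2 * pi))) ^ N * (exp (real N * (1 - d) / 2) * exp (- (real N * (1 - d)) / 2)) *
     shell_vol N (real N * (1 - d)) (real N * (1 + d))"
    unfolding power_mult_distrib by (simp only: mult_ac)
  also have "\<dots> = shell_vol N (real N * (1 - d)) (real N * (1 + d))"
    by (simp add: exp_add[symmetric])
  finally show ?thesis by simp
qed

lemma shell_vol_scale:
  assumes "0 < c" shows "shell_vol N (c * r) (c * s) = sqrt c ^ N * shell_vol N r s"
  by (simp add: shell_vol_def real_sqrt_mult power_mult_distrib algebra_simps)

text \<open>The Chebyshev threshold 4 / d^2 for d = e / (2 + e), the value with 1 + d = (1 - d) (1 +
  e).\<close>

definition shell_threshold :: "real \<Rightarrow> real" where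
  "shell_threshold e = 4 / (e / (2 + e))\<^sup>2"

text \<open>Dilating the squared radii by 1 / (1 - d) moves the inner radius to sqrt N and can only
  enlarge the volume. An inner radius of sqrt N ensures that projecting the shell to the sphere
  shortens every vector.\<close>

lemma shell_vol_lower':
  assumes e: "0 < e" and N: "shell_threshold e \<le> real N"
  shows "sqrt (2 * pi) ^ N * exp (real N * (1 - e) / 2) / 2 \<le> shell_vol N (real N) (real N * (1 + e))"
proof -
  define d where "d = e / (2 + e)"
  have d: "0 < d" "d < 1" "d \<le> e" "(1 + d) = (1 - d) * (1 + e)"
    using e by (auto simp: d_def field_simps)
  have c: "1 \<le> sqrt (1 / (1 - d))" using d by simp
  have "sqrt (2 * pi) ^ N * exp (real N * (1 - e) / 2) / 2 \<le> sqrt (2 * pi) ^ N * exp (real N * (1 - d) / 2) / 2"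
    using d by (intro divide_right_mono mult_left_mono) (auto intro!: mult_left_mono)
  also have "\<dots> \<le> shell_vol N (real N * (1 - d)) (real N * (1 + d))"
    by (rule shell_vol_lower) (use d N in \<open>auto simp: shell_threshold_def d_def\<close>)
  also have "\<dots> = 1 * shell_vol N (real N * (1 - d)) (real N * (1 + d))" by simp
  also have "\<dots> \<le> sqrt (1 / (1 - d)) ^ N * shell_vol N (real N * (1 - d)) (real N * (1 + d))"
  proof (rule mult_right_mono)
    show "1 \<le> sqrt (1 / (1 - d)) ^ N" using c by (rule one_le_power)
    have "0 \<le> sqrt (2 * pi) ^ N * exp (real N * (1 - d) / 2) / 2" by simp
    also note \<open>\<dots> \<le> shell_vol N (real N * (1 - d)) (real N * (1 + d))\<close>
    finally show "0 \<le> shell_vol N (real N * (1 - d)) (real N * (1 + d))" .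
  qed
  also have "\<dots> = shell_vol N (1 / (1 - d) * (real N * (1 - d))) (1 / (1 - d) * (real N * (1 + d)))"
    using d by (subst shell_vol_scale) auto
  also have "\<dots> = shell_vol N (real N) (real N * (1 + e))"
    using d by (auto intro!: arg_cong2[where f="shell_vol N"] simp: d(4))
  finally show ?thesis .
qed

text \<open>On the thin shell the weight exp(- b |x|^2 / 2) is at least exp(- b N (1 + e) / 2), and
  the shell has volume at least (2 pi)^(N/2) exp(N (1 - e) / 2) / 2. Up to \<open>e\<close> the
  price per site is therefore (b - 1 - ln b) / 2, which vanishes at b = 1; the parameter b is left
  free to be optimised.\<close>

lemma nn_integral_sphere_le_gauss:
  assumes e: "0 < e" and N: "shell_threshold e \<le> real N" and b: "0 < b"
    and h[measurable]: "h \<in> borel_measurable (bor N)"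
    and le: "\<And>x. x \<in> shell N (real N) (real N * (1 + e)) \<Longrightarrow> h (radial_projection N x) \<le> h x"
  shows "(\<integral>\<^sup>+\<sigma>. h \<sigma> \<partial>sphere_uniform N) \<le>
    ennreal (2 * exp (real N * (b * (1 + e) - (1 - e)) / 2) * (1 / sqrt b) ^ N) *
    (\<integral>\<^sup>+x. h (\<lambda>i\<in>{..<N}. 1 / sqrt b * x i) \<partial>gauss {..<N})"
proof -
  have "0 < shell_threshold e" using e by (simp add: shell_threshold_def)
  then have N0: "0 < N" using N by (cases "N = 0") auto
  let ?S = "shell N (real N) (real N * (1 + e))" and ?v = "shell_vol N (real N) (real N * (1 + e))"
  have r: "0 \<le> real N" "real N < real N * (1 + e)" using e N0 by auto
  have [measurable_cong]: "sets (leb N) = sets (bor N)" by (rule sets_leb)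
  have v: "0 < ?v" by (rule shell_vol_pos[OF N0 r])
  let ?A = "(\<integral>\<^sup>+x. h x * ennreal (exp (- (b * ip N x x) / 2)) \<partial>leb N)"
  let ?G = "(\<integral>\<^sup>+x. h (\<lambda>i\<in>{..<N}. 1 / sqrt b * x i) \<partial>gauss {..<N})"
  have mip[measurable]: "(\<lambda>x. ip N x x) \<in> borel_measurable (bor N)"
    by (rule measurable_ip) measurable
  have ms: "(\<lambda>x. \<lambda>i\<in>{..<N}. 1 / sqrt b * x i) \<in> measurable (bor N) (bor N)"
    by measurable
  have mh[measurable]: "(\<lambda>x. h (\<lambda>i\<in>{..<N}. 1 / sqrt b * x i)) \<in> borel_measurable (bor N)"
    by (rule measurable_compose[OF ms h])
  have A1: "?A = ennreal ((1 / sqrt b) ^ N) * (\<integral>\<^sup>+x. h (\<lambda>i\<in>{..<N}. 1 / sqrt b * x i) * ennreal (exp (- ip N x x / 2)) \<partial>leb N)"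
  proof -
    have "b * ip N (\<lambda>i\<in>{..<N}. 1 / sqrt b * x i) (\<lambda>i\<in>{..<N}. 1 / sqrt b * x i) = ip N x x" for x
      using b by (simp only: ip_restrict ip_scale) simp
    then show ?thesis
      using b by (subst nn_integral_PiM_affine[of "{..<N}" "1 / sqrt b" _ "\<lambda>_. 0"]) auto
  qed
  have A2: "(\<integral>\<^sup>+x. h (\<lambda>i\<in>{..<N}. 1 / sqrt b * x i) * ennreal (exp (- ip N x x / 2)) \<partial>leb N)
     = (\<integral>\<^sup>+x. ennreal (sqrt (2 * pi) ^ N) * (h (\<lambda>i\<in>{..<N}. 1 / sqrt b * x i) * ennreal (\<Prod>i<N. std_normal_density (x i))) \<partial>leb N)"
  proof (rule nn_integral_cong)
    fix x
    have "exp (- ip N x x / 2) = sqrt (2 * pi) ^ N * (\<Prod>i<N. std_normal_density (x i))"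
      unfolding prod_std_normal_density by (simp add: power_mult_distrib[symmetric] mult.assoc[symmetric] del: power_mult_distrib)
    then show "h (\<lambda>i\<in>{..<N}. 1 / sqrt b * x i) * ennreal (exp (- ip N x x / 2)) =
       ennreal (sqrt (2 * pi) ^ N) * (h (\<lambda>i\<in>{..<N}. 1 / sqrt b * x i) * ennreal (\<Prod>i<N. std_normal_density (x i)))"
      by (simp only: ennreal_mult[OF zero_le_power[OF real_sqrt_ge_zero] prod_nonneg] pi_ge_zero mult_nonneg_nonneg zero_le_numeral
          normal_density_nonneg mult_ac)
  qed
  also have "\<dots> = ennreal (sqrt (2 * pi) ^ N) * ?G"
  proof (subst nn_integral_cmult)
    show "(\<lambda>x. h (\<lambda>i\<in>{..<N}. 1 / sqrt b * x i) * ennreal (\<Prod>i<N. std_normal_density (x i))) \<in> borel_measurable (leb N)"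
      by measurable
    show "ennreal (sqrt (2 * pi) ^ N) * (\<integral>\<^sup>+x. h (\<lambda>i\<in>{..<N}. 1 / sqrt b * x i) * ennreal (\<Prod>i<N. std_normal_density (x i)) \<partial>leb N) = ennreal (sqrt (2 * pi) ^ N) * ?G"
      by (subst nn_integral_gauss_density[OF _ mh]) auto
  qed
  finally have A3: "(\<integral>\<^sup>+x. h (\<lambda>i\<in>{..<N}. 1 / sqrt b * x i) * ennreal (exp (- ip N x x / 2)) \<partial>leb N) = ennreal (sqrt (2 * pi) ^ N) * ?G" .
  have "(\<integral>\<^sup>+x. h (radial_projection N x) * indicator ?S x \<partial>leb N) \<le>
      (\<integral>\<^sup>+x. ennreal (exp (b * (real N * (1 + e)) / 2)) * (h x * ennreal (exp (- (b * ip N x x) / 2))) \<partial>leb N)"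
  proof (rule nn_integral_mono)
    fix x
    show "h (radial_projection N x) * indicator ?S x \<le> ennreal (exp (b * (real N * (1 + e)) / 2)) * (h x * ennreal (exp (- (b * ip N x x) / 2)))"
    proof (cases "x \<in> ?S")
      case True
      have "1 \<le> exp (b * (real N * (1 + e)) / 2) * exp (- (b * ip N x x) / 2)"
        using True b by (simp add: exp_add[symmetric] shell_def divide_right_mono mult_left_mono)
      then have "1 \<le> ennreal (exp (b * (real N * (1 + e)) / 2)) * ennreal (exp (- (b * ip N x x) / 2))"
        by (simp add: ennreal_mult[symmetric])
      then have "h x * 1 \<le> h x * (ennreal (exp (b * (real N * (1 + e)) / 2)) * ennreal (exp (- (b * ip N x x) / 2)))"
        by (rule mult_left_mono) simp
      then show ?thesis using le[OF True] True by (simp add: mult_ac)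
    qed simp
  qed
  also have "\<dots> = ennreal (exp (b * (real N * (1 + e)) / 2)) * ?A"
    by (rule nn_integral_cmult) measurable
  finally have m: "(\<integral>\<^sup>+x. h (radial_projection N x) * indicator ?S x \<partial>leb N) \<le> ennreal (exp (b * (real N * (1 + e)) / 2)) * ?A" .
  have "(\<integral>\<^sup>+\<sigma>. h \<sigma> \<partial>sphere_uniform N) = (\<integral>\<^sup>+x. h (radial_projection N x) \<partial>shell_uniform N (real N) (real N * (1 + e)))"
    by (subst sphere_uniform_shell[OF N0 r], subst nn_integral_distr) auto
  also have "\<dots> = (\<integral>\<^sup>+x. h (radial_projection N x) * indicator ?S x \<partial>leb N) / ennreal ?v"
    by (rule nn_integral_shell_uniform[OF N0 r]) measurable
  also have "\<dots> \<le> ennreal (exp (b * (real N * (1 + e)) / 2)) * ?A / ennreal ?v"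
    by (rule divide_right_mono_ennreal[OF m])
  finally have "(\<integral>\<^sup>+\<sigma>. h \<sigma> \<partial>sphere_uniform N) \<le> ennreal (exp (b * (real N * (1 + e)) / 2)) * ?A / ennreal ?v" .
  then have 1: "(\<integral>\<^sup>+\<sigma>. h \<sigma> \<partial>sphere_uniform N) \<le>
     ennreal (exp (b * (real N * (1 + e)) / 2)) * (ennreal ((1 / sqrt b) ^ N) * (ennreal (sqrt (2 * pi) ^ N) * ?G)) / ennreal ?v"
    by (simp only: A1 A3)
  let ?a = "exp (b * (real N * (1 + e)) / 2) * (1 / sqrt b) ^ N * sqrt (2 * pi) ^ N"
  have "ennreal (exp (b * (real N * (1 + e)) / 2)) * (ennreal ((1 / sqrt b) ^ N) * (ennreal (sqrt (2 * pi) ^ N) * ?G)) / ennreal ?v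
     = ennreal (?a / ?v) * ?G"
  proof -
    have "ennreal (exp (b * (real N * (1 + e)) / 2)) * (ennreal ((1 / sqrt b) ^ N) * (ennreal (sqrt (2 * pi) ^ N) * ?G)) = ennreal ?a * ?G"
      using b by (simp add: ennreal_mult mult.assoc)
    then show ?thesis
      using v b by (simp add: divide_ennreal[symmetric] ennreal_times_divide ennreal_divide_times del: divide_ennreal)
  qed
  also have "\<dots> \<le> ennreal (2 * exp (real N * (b * (1 + e) - (1 - e)) / 2) * (1 / sqrt b) ^ N) * ?G"
  proof (rule mult_right_mono[OF ennreal_leI])
    have low: "sqrt (2 * pi) ^ N * exp (real N * (1 - e) / 2) / 2 \<le> ?v"
      by (rule shell_vol_lower'[OF e N])
    have "?a / ?v \<le> ?a / (sqrt (2 * pi) ^ N * exp (real N * (1 - e) / 2) / 2)"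
      using low v b by (intro divide_left_mono) auto
    also have "\<dots> = 2 * (exp (b * (real N * (1 + e)) / 2) / exp (real N * (1 - e) / 2)) * (1 / sqrt b) ^ N"
      by (simp add: field_simps)
    also have "exp (b * (real N * (1 + e)) / 2) / exp (real N * (1 - e) / 2) = exp (real N * (b * (1 + e) - (1 - e)) / 2)"
      by (simp add: exp_diff[symmetric] algebra_simps diff_divide_distrib add_divide_distrib)
    finally show "?a / ?v \<le> 2 * exp (real N * (b * (1 + e) - (1 - e)) / 2) * (1 / sqrt b) ^ N" .
  qed simp
  finally show ?thesis using 1 by (rule order_trans[rotated])
qed

lemma nn_integral_exp_std_normal: "(\<integral>\<^sup>+x. ennreal (exp (c * x)) \<partial>std_normal) = ennreal (exp (c\<^sup>2 / 2))"
  using nn_integral_eq_integral[OF integral_exp_std_normal(1)[of c]] by (simp add: integral_exp_std_normal)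

lemma nn_integral_exp_square_std_normal:
  assumes k: "k < 1"
  shows "(\<integral>\<^sup>+x. ennreal (exp (k * x\<^sup>2 / 2)) \<partial>std_normal) = ennreal (1 / sqrt (1 - k))"
proof -
  let ?s = "1 / sqrt (1 - k)"
  have s: "0 < ?s" "?s\<^sup>2 = 1 / (1 - k)" using k by (auto simp: power_divide)
  interpret prob_space "density lborel (\<lambda>x. ennreal (normal_density 0 ?s x))"
    by (rule prob_space_normal_density[OF s(1)])
  have "exp (k * x\<^sup>2 / 2) * std_normal_density x = ?s * normal_density 0 ?s x" for x
  proof -
    have "sqrt (2 * pi * ?s\<^sup>2) = sqrt (2 * pi) * ?s" using s(1) by (simp add: real_sqrt_mult)
    moreover have "exp (k * x\<^sup>2 / 2) * exp (- x\<^sup>2 / 2) = exp (- (x\<^sup>2) / (2 * ?s\<^sup>2))"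
      using k by (simp add: s(2) exp_add[symmetric] algebra_simps diff_divide_distrib)
    ultimately show ?thesis
      using s(1) by (simp add: normal_density_def mult_ac)
  qed
  then have "ennreal (exp (k * x\<^sup>2 / 2)) * ennreal (std_normal_density x) = ennreal ?s * ennreal (normal_density 0 ?s x)" for x
    using s(1) by (metis ennreal_mult' exp_ge_zero less_imp_le)
  then have "(\<integral>\<^sup>+x. ennreal (exp (k * x\<^sup>2 / 2)) \<partial>std_normal) = (\<integral>\<^sup>+x. ennreal ?s * ennreal (normal_density 0 ?s x) \<partial>lborel)"
    by (subst nn_integral_std_normal) auto
  also have "\<dots> = ennreal ?s * (\<integral>\<^sup>+x. ennreal (normal_density 0 ?s x) \<partial>lborel)"
    by (rule nn_integral_cmult) auto
  also have "(\<integral>\<^sup>+x. ennreal (normal_density 0 ?s x) \<partial>lborel) = 1"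
    using emeasure_space_1 by (simp add: emeasure_density)
  finally show ?thesis by simp
qed

lemma nn_integral_gauss_exp_ip:
  "(\<integral>\<^sup>+x. ennreal (exp (c * ip N v x)) \<partial>gauss {..<N}) = ennreal (exp (c\<^sup>2 * ip N v v / 2))"
proof -
  have eq: "c * ip N v x = (\<Sum>i<N. (c * v i) * x i)" for x
    by (simp add: ip_def sum_distrib_left mult.assoc)
  have "(\<Sum>i<N. (c * v i)\<^sup>2) = c\<^sup>2 * ip N v v"
    by (simp add: ip_def sum_distrib_left power2_eq_square mult_ac)
  then show ?thesis
    unfolding eq using integral_gauss_exp_linear[of "{..<N}" "\<lambda>i. c * v i"]
    by (subst nn_integral_eq_integral) auto
qed

lemma abs_ip_radial_projection_le:
  assumes "0 < N" "real N \<le> ip N x x"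
  shows "\<bar>ip N v (radial_projection N x)\<bar> \<le> \<bar>ip N v x\<bar>"
proof -
  have "ip N v (radial_projection N x) = sqrt (real N / ip N x x) * ip N v x"
    unfolding radial_projection_def ip_restrict L2_set_ip
    by (simp add: ip_def sum_distrib_left sum_divide_distrib real_sqrt_divide mult_ac)
  moreover have "sqrt (real N / ip N x x) \<le> 1" "0 \<le> sqrt (real N / ip N x x)"
    using assms by auto
  ultimately show ?thesis by (simp add: abs_mult mult_left_le_one_le)
qed

text \<open>Projection shortens \<open>ip N v x\<close> only in absolute value, so exp is first
  enlarged to 2 cosh, which is even and increasing in the modulus. The Gaussian integral is then
  explicit.\<close>

lemma sphere_exp_linear_le:
  assumes e: "0 < e" and N: "shell_threshold e \<le> real N" and b: "0 < b"
  shows "(\<integral>\<^sup>+\<sigma>. ennreal (exp (ip N v \<sigma>)) \<partial>sphere_uniform N) \<le>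
    ennreal (4 * exp (real N * (b * (1 + e) - (1 - e)) / 2) * (1 / sqrt b) ^ N * exp (ip N v v / (2 * b)))"
proof -
  have "0 < shell_threshold e" using e by (simp add: shell_threshold_def)
  then have N0: "0 < N" using N by (cases "N = 0") auto
  have ex: "exp x + exp (- x) = 2 * cosh x" for x :: real by (simp add: cosh_def)
  define h where "h \<sigma> = ennreal (2 * cosh (ip N v \<sigma>))" for \<sigma>
  have mv: "(\<lambda>x. ip N v x) \<in> borel_measurable (bor N)"
    by (rule measurable_ip) measurable
  have h: "h \<in> borel_measurable (bor N)"
    unfolding h_def cosh_def using mv by measurable
  have "(\<integral>\<^sup>+\<sigma>. ennreal (exp (ip N v \<sigma>)) \<partial>sphere_uniform N) \<le> (\<integral>\<^sup>+\<sigma>. h \<sigma> \<partial>sphere_uniform N)"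
    unfolding h_def ex[symmetric] by (intro nn_integral_mono ennreal_leI) simp
  also have "\<dots> \<le> ennreal (2 * exp (real N * (b * (1 + e) - (1 - e)) / 2) * (1 / sqrt b) ^ N) *
    (\<integral>\<^sup>+x. h (\<lambda>i\<in>{..<N}. 1 / sqrt b * x i) \<partial>gauss {..<N})"
  proof (rule nn_integral_sphere_le_gauss[OF e N b h])
    fix x assume "x \<in> shell N (real N) (real N * (1 + e))"
    then have "\<bar>ip N v (radial_projection N x)\<bar> \<le> \<bar>ip N v x\<bar>"
      by (intro abs_ip_radial_projection_le[OF N0]) (auto simp: shell_def)
    then have "cosh \<bar>ip N v (radial_projection N x)\<bar> \<le> cosh \<bar>ip N v x\<bar>"
      by (subst cosh_real_nonneg_le_iff) auto
    then show "h (radial_projection N x) \<le> h x"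
      by (auto simp: h_def intro!: ennreal_leI)
  qed
  also have "(\<integral>\<^sup>+x. h (\<lambda>i\<in>{..<N}. 1 / sqrt b * x i) \<partial>gauss {..<N}) =
     (\<integral>\<^sup>+x. ennreal (exp (1 / sqrt b * ip N v x)) + ennreal (exp (- (1 / sqrt b) * ip N v x)) \<partial>gauss {..<N})"
    unfolding h_def ex[symmetric] ip_restrict ip_scale_right by simp
  also have "\<dots> = ennreal (exp (ip N v v / (2 * b))) + ennreal (exp (ip N v v / (2 * b)))"
  proof (subst nn_integral_add)
    have [measurable]: "(\<lambda>x. ip N v x) \<in> borel_measurable (gauss {..<N})"
      by (rule measurable_ip) measurable
    show "(\<lambda>x. ennreal (exp (1 / sqrt b * ip N v x))) \<in> borel_measurable (gauss {..<N})" by measurable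
    show "(\<lambda>x. ennreal (exp (- (1 / sqrt b) * ip N v x))) \<in> borel_measurable (gauss {..<N})" by measurable
    show "(\<integral>\<^sup>+x. ennreal (exp (1 / sqrt b * ip N v x)) \<partial>gauss {..<N}) + (\<integral>\<^sup>+x. ennreal (exp (- (1 / sqrt b) * ip N v x)) \<partial>gauss {..<N})
      = ennreal (exp (ip N v v / (2 * b))) + ennreal (exp (ip N v v / (2 * b)))"
      unfolding nn_integral_gauss_exp_ip using b by (simp add: power_divide mult.commute[of b])
  qed
  also have "\<dots> = ennreal (2 * exp (ip N v v / (2 * b)))"
    by (simp add: ennreal_plus[symmetric] del: ennreal_plus)
  finally show ?thesis
    using b by (simp add: ennreal_mult[symmetric] mult_ac)
qed

text \<open>The Gaussian square is linearised by an auxiliary Gaussian variable (Hubbard--Stratonovich).\<close>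

lemma sphere_exp_square_le:
  assumes e: "0 < e" and N: "shell_threshold e \<le> real N" and k: "0 \<le> k" "k < 1" and v: "ip N v v = real N"
  shows "(\<integral>\<^sup>+\<sigma>. ennreal (exp (k * (ip N v \<sigma>)\<^sup>2 / (2 * real N))) \<partial>sphere_uniform N) \<le>
    ennreal (2 * exp (real N * e) / sqrt (1 - k))"
proof -
  have "0 < shell_threshold e" using e by (simp add: shell_threshold_def)
  then have N0: "0 < N" using N by (cases "N = 0") auto
  interpret S: prob_space std_normal by (rule prob_space_std_normal)
  interpret G: prob_space "gauss {..<N}" by (rule prob_space_gauss)
  interpret P: pair_sigma_finite "gauss {..<N}" std_normal ..
  define h where "h \<sigma> = ennreal (exp (k * (ip N v \<sigma>)\<^sup>2 / (2 * real N)))" for \<sigma>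
  define c where "c = sqrt (k / real N)"
  have c: "c\<^sup>2 = k / real N" using k by (simp add: c_def)
  have mv: "(\<lambda>x. ip N v x) \<in> borel_measurable (bor N)"
    by (rule measurable_ip) measurable
  have h: "h \<in> borel_measurable (bor N)"
    unfolding h_def using mv by measurable
  have [measurable]: "(\<lambda>x. ip N v x) \<in> borel_measurable (gauss {..<N})"
    by (rule measurable_ip) measurable
  have "(\<integral>\<^sup>+\<sigma>. h \<sigma> \<partial>sphere_uniform N) \<le> ennreal (2 * exp (real N * (1 * (1 + e) - (1 - e)) / 2) * (1 / sqrt 1) ^ N) *
    (\<integral>\<^sup>+x. h (\<lambda>i\<in>{..<N}. 1 / sqrt 1 * x i) \<partial>gauss {..<N})"
  proof (rule nn_integral_sphere_le_gauss[OF e N _ h])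
    fix x assume "x \<in> shell N (real N) (real N * (1 + e))"
    then have "\<bar>ip N v (radial_projection N x)\<bar> \<le> \<bar>ip N v x\<bar>"
      by (intro abs_ip_radial_projection_le[OF N0]) (auto simp: shell_def)
    then have "(ip N v (radial_projection N x))\<^sup>2 \<le> (ip N v x)\<^sup>2" by (simp add: abs_le_square_iff)
    then show "h (radial_projection N x) \<le> h x"
      using k by (auto simp: h_def intro!: ennreal_leI divide_right_mono mult_left_mono)
  qed simp
  also have "(\<integral>\<^sup>+x. h (\<lambda>i\<in>{..<N}. 1 / sqrt 1 * x i) \<partial>gauss {..<N}) = (\<integral>\<^sup>+x. h x \<partial>gauss {..<N})"
    by (simp add: h_def)
  also have "\<dots> = (\<integral>\<^sup>+x. (\<integral>\<^sup>+y. ennreal (exp (c * ip N v x * y)) \<partial>std_normal) \<partial>gauss {..<N})"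
    unfolding nn_integral_exp_std_normal h_def power_mult_distrib c by (simp add: mult_ac)
  also have "\<dots> = (\<integral>\<^sup>+y. (\<integral>\<^sup>+x. ennreal (exp (c * ip N v x * y)) \<partial>gauss {..<N}) \<partial>std_normal)"
    by (rule P.Fubini'[symmetric]) measurable
  \<comment> \<open>Since |v|^2 = N cancels the 1/N in c^2, the integral over x leaves exp(k y^2 /
    2), which is integrable against the Gaussian exactly for k < 1. This is where the critical
    temperature comes from.\<close>
  also have "\<dots> = (\<integral>\<^sup>+y. ennreal (exp (k * y\<^sup>2 / 2)) \<partial>std_normal)"
  proof (rule nn_integral_cong)
    fix y
    have eq: "c * ip N v x * y = (c * y) * ip N v x" for x by simp
    show "(\<integral>\<^sup>+x. ennreal (exp (c * ip N v x * y)) \<partial>gauss {..<N}) = ennreal (exp (k * y\<^sup>2 / 2))"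
      unfolding eq nn_integral_gauss_exp_ip power_mult_distrib c v using N0 by simp
  qed
  also have "\<dots> = ennreal (1 / sqrt (1 - k))"
    by (rule nn_integral_exp_square_std_normal[OF k(2)])
  finally have "(\<integral>\<^sup>+\<sigma>. h \<sigma> \<partial>sphere_uniform N) \<le> ennreal (2 * exp (real N * (1 * (1 + e) - (1 - e)) / 2) * (1 / sqrt 1) ^ N) * ennreal (1 / sqrt (1 - k))" .
  also have "real N * (1 * (1 + e) - (1 - e)) / 2 = real N * e" by (simp add: algebra_simps)
  finally show ?thesis
    using k unfolding h_def by (simp add: ennreal_mult[symmetric])
qed

section \<open>Replica-symmetric upper bound\<close>

text \<open>
  The coordinate \<open>(i, k)\<close> with \<open>k < N\<close> carries the coupling \<open>g\<^sub>i\<^sub>k\<close>; the coordinate \<open>(i, N)\<close> carries an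
  auxiliary external field at site \<open>i\<close>.
\<close>

definition coupling :: "nat \<Rightarrow> nat \<times> nat \<Rightarrow> (nat \<Rightarrow> real) \<Rightarrow> real" where
  "coupling N p \<sigma> = (if fst p < N then
     (if snd p < N then \<sigma> (fst p) * \<sigma> (snd p) / sqrt (2 * real N) else \<sigma> (fst p)) else 0)"

definition weight :: "nat \<Rightarrow> real \<Rightarrow> real \<Rightarrow> nat \<times> nat \<Rightarrow> real" where
  "weight N b h p = (if snd p < N then b else h)"

abbreviation sites :: "nat \<Rightarrow> (nat \<times> nat) set" where
  "sites N \<equiv> {..<N} \<times> {..<Suc N}"

lemma sum_sites: "(\<Sum>p\<in>sites N. f p) = (\<Sum>i<N. \<Sum>k<N. f (i, k)) + (\<Sum>i<N. f (i, N))"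
proof -
  have "(\<Sum>p\<in>sites N. f p) = (\<Sum>i<N. \<Sum>k<Suc N. f (i, k))"
    by (subst sum.cartesian_product) (rule sum.cong, auto)
  also have "\<dots> = (\<Sum>i<N. \<Sum>k<N. f (i, k)) + (\<Sum>i<N. f (i, N))"
    by (simp add: sum.distrib)
  finally show ?thesis .
qed

lemma abs_le_sqrt_of_sphere:
  assumes "\<sigma> \<in> spin_sphere N" "i < N"
  shows "\<bar>\<sigma> i\<bar> \<le> sqrt (real N)"
proof -
  have "(\<sigma> i)\<^sup>2 \<le> ip N \<sigma> \<sigma>"
    unfolding ip_def power2_eq_square using assms by (intro member_le_sum[of i _ "\<lambda>i. \<sigma> i * \<sigma> i"]) auto
  then show ?thesis
    using assms(1) real_sqrt_le_mono[of "(\<sigma> i)\<^sup>2" "real N"] by (simp add: spin_sphere_eq)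
qed

locale spin =
  fixes N :: nat assumes N_pos: "0 < N"
begin

lemma coupling_measurable: "coupling N p \<in> borel_measurable (sphere_uniform N)"
proof (cases "fst p < N")
  case True
  then have [measurable]: "(\<lambda>\<sigma>. \<sigma> (fst p)) \<in> borel_measurable (bor N)"
    by (intro measurable_component_singleton) simp
  show ?thesis
  proof (cases "snd p < N")
    case True': True
    then have [measurable]: "(\<lambda>\<sigma>. \<sigma> (snd p)) \<in> borel_measurable (bor N)"
      by (intro measurable_component_singleton) simp
    show ?thesis using True True' unfolding coupling_def by simp measurable
  next
    case False
    then show ?thesis using True unfolding coupling_def by simp measurable
  qed
next
  case False
  then have "coupling N p = (\<lambda>_. 0)" by (auto simp: coupling_def)
  then show ?thesis by simp
qed

lemma coupling_bound: "AE \<sigma> in sphere_uniform N. \<bar>coupling N p \<sigma>\<bar> \<le> real N"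
  using AE_spin_sphere[OF N_pos]
proof eventually_elim
  case (elim \<sigma>)
  have N1: "1 \<le> real N" using N_pos by simp
  have s: "sqrt (real N) \<le> real N"
    using N1 real_sqrt_le_mono[of "real N" "real N * real N"] by simp
  have b: "\<bar>\<sigma> i\<bar> \<le> sqrt (real N)" if "i < N" for i
    by (rule abs_le_sqrt_of_sphere[OF elim that])
  have "\<bar>\<sigma> i * \<sigma> k / sqrt (2 * real N)\<bar> \<le> real N" if "i < N" "k < N" for i k
  proof -
    have "\<bar>\<sigma> i * \<sigma> k\<bar> \<le> sqrt (real N) * sqrt (real N)"
      unfolding abs_mult using b that by (intro mult_mono) auto
    moreover have "1 \<le> sqrt (2 * real N)" using N1 by simp
    ultimately have "\<bar>\<sigma> i * \<sigma> k\<bar> / sqrt (2 * real N) \<le> real N / 1"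
      by (intro frac_le) auto
    then show ?thesis by (simp add: abs_divide)
  qed
  then show ?case using b[of "fst p"] s by (auto simp: coupling_def intro: order_trans)
qed

end

sublocale spin \<subseteq> gibbs "sphere_uniform N" "sites N" "coupling N" "real N"
  by (intro gibbs.intro gibbs_axioms.intro prob_space_sphere_uniform N_pos coupling_measurable coupling_bound) auto

definition disorder :: "real \<Rightarrow> real \<Rightarrow> nat \<Rightarrow> (nat \<times> nat \<Rightarrow> real) \<Rightarrow> nat \<times> nat \<Rightarrow> real" where
  "disorder b h N g = (\<lambda>p. weight N b h p * g p)"

definition ham :: "nat \<Rightarrow> (nat \<times> nat \<Rightarrow> real) \<Rightarrow> (nat \<Rightarrow> real) \<Rightarrow> real" where
  "ham N g = hamiltonian N (\<lambda>i k. g (i, k))"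

context spin
begin

lemma energy_field:
  "energy (disorder b h N g) \<sigma> = b * ham N g \<sigma> + h * (\<Sum>i<N. g (i, N) * \<sigma> i)"
  unfolding energy_def sum_sites disorder_def ham_def hamiltonian_def
  by (simp add: weight_def coupling_def sum_distrib_left real_sqrt_mult mult_ac)

text \<open>The Gibbs average of the overlap R of two independent replicas in the same disorder;
  independence turns it into a sum of squares of one-replica averages. In the same way
  \<open>r2\<close> is the average of R^2.\<close>

definition r1 :: "(nat \<times> nat \<Rightarrow> real) \<Rightarrow> real" where
  "r1 x = (\<Sum>i<N. (avg x (\<lambda>\<sigma>. \<sigma> i))\<^sup>2) / real N"

definition r2 :: "(nat \<times> nat \<Rightarrow> real) \<Rightarrow> real" where
  "r2 x = (\<Sum>i<N. \<Sum>k<N. (avg x (\<lambda>\<sigma>. \<sigma> i * \<sigma> k))\<^sup>2) / (real N)\<^sup>2"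

lemma measurable_spin [measurable]: "i < N \<Longrightarrow> (\<lambda>\<sigma>. \<sigma> i) \<in> borel_measurable (sphere_uniform N)"
  by measurable

lemma spin_bound:
  assumes "i < N" shows "AE \<sigma> in sphere_uniform N. \<bar>\<sigma> i\<bar> \<le> sqrt (real N)"
  using AE_spin_sphere[OF N_pos] by eventually_elim (rule abs_le_sqrt_of_sphere[OF _ assms])

lemma spin2_bound:
  assumes "i < N" "k < N" shows "AE \<sigma> in sphere_uniform N. \<bar>\<sigma> i * \<sigma> k\<bar> \<le> real N"
  using spin_bound[OF assms(1)] spin_bound[OF assms(2)]
proof eventually_elim
  case (elim \<sigma>)
  then have "\<bar>\<sigma> i\<bar> * \<bar>\<sigma> k\<bar> \<le> sqrt (real N) * sqrt (real N)" by (intro mult_mono) auto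
  then show ?case by (simp add: abs_mult)
qed

text \<open>On the sphere the squares of the products of two spins add up to the constant N^2, so of
  all second moments only the squared averages remain, that is \<open>r2\<close>.\<close>

lemma sum_var_pairs: "(\<Sum>i<N. \<Sum>k<N. var x (i, k)) = real N / 2 * (1 - r2 x)"
proof -
  have c: "coupling N (i, k) = (\<lambda>\<sigma>. (1 / sqrt (2 * real N)) * (\<sigma> i * \<sigma> k))" if "i < N" "k < N" for i k
    using that by (auto simp: coupling_def)
  have sq: "(1 / sqrt (2 * real N))\<^sup>2 = 1 / (2 * real N)" by (simp add: power_divide)
  have v: "var x (i, k) = (1 / (2 * real N)) * (avg x (\<lambda>\<sigma>. (\<sigma> i * \<sigma> k)\<^sup>2) - (avg x (\<lambda>\<sigma>. \<sigma> i * \<sigma> k))\<^sup>2)"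
    if "i < N" "k < N" for i k
    unfolding var_def c[OF that] avg_cmult power_mult_distrib[of "1 / sqrt (2 * real N)"] sq
    by (simp add: avg_cmult algebra_simps)
  have b: "AE \<sigma> in sphere_uniform N. \<bar>(\<sigma> i * \<sigma> k)\<^sup>2\<bar> \<le> (real N)\<^sup>2" if "i < N" "k < N" for i k
    using spin2_bound[OF that] by eventually_elim (simp add: abs_le_square_iff[symmetric])
  have "(\<Sum>i<N. \<Sum>k<N. avg x (\<lambda>\<sigma>. (\<sigma> i * \<sigma> k)\<^sup>2)) = avg x (\<lambda>\<sigma>. \<Sum>p\<in>{..<N}\<times>{..<N}. (\<sigma> (fst p) * \<sigma> (snd p))\<^sup>2)"
    by (subst avg_sum[where b="\<lambda>_. (real N)\<^sup>2"]) (auto intro!: b[unfolded abs_power2] simp: sum.cartesian_product case_prod_beta)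
  also have "\<dots> = avg x (\<lambda>_. (real N)\<^sup>2)"
  proof (rule avg_cong)
    show "AE \<sigma> in sphere_uniform N. (\<Sum>p\<in>{..<N}\<times>{..<N}. (\<sigma> (fst p) * \<sigma> (snd p))\<^sup>2) = (real N)\<^sup>2"
      using AE_spin_sphere[OF N_pos]
    proof eventually_elim
      case (elim \<sigma>)
      have "(\<Sum>p\<in>{..<N}\<times>{..<N}. (\<sigma> (fst p) * \<sigma> (snd p))\<^sup>2) = ip N \<sigma> \<sigma> * ip N \<sigma> \<sigma>"
        by (simp add: ip_def sum_product sum.cartesian_product case_prod_beta power2_eq_square mult_ac)
      then show ?case using elim by (simp add: spin_sphere_eq power2_eq_square)
    qed
  qed (auto intro!: borel_measurable_sum borel_measurable_power borel_measurable_times measurable_spin)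
  finally have s: "(\<Sum>i<N. \<Sum>k<N. avg x (\<lambda>\<sigma>. (\<sigma> i * \<sigma> k)\<^sup>2)) = (real N)\<^sup>2" by simp
  have "(\<Sum>i<N. \<Sum>k<N. var x (i, k)) = (1 / (2 * real N)) * ((\<Sum>i<N. \<Sum>k<N. avg x (\<lambda>\<sigma>. (\<sigma> i * \<sigma> k)\<^sup>2)) - (real N)\<^sup>2 * r2 x)"
    using N_pos by (simp add: v sum_divide_distrib[symmetric] sum_subtractf r2_def)
  also have "\<dots> = real N / 2 * (1 - r2 x)"
    unfolding s using N_pos by (simp add: field_simps power2_eq_square)
  finally show ?thesis .
qed

lemma sum_var_sites: "(\<Sum>i<N. var x (i, N)) = real N * (1 - r1 x)"
proof -
  have c: "coupling N (i, N) = (\<lambda>\<sigma>. \<sigma> i)" if "i < N" for i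
    using that by (auto simp: coupling_def)
  have v: "var x (i, N) = avg x (\<lambda>\<sigma>. (\<sigma> i)\<^sup>2) - (avg x (\<lambda>\<sigma>. \<sigma> i))\<^sup>2" if "i < N" for i
    unfolding var_def c[OF that] ..
  have b: "AE \<sigma> in sphere_uniform N. \<bar>(\<sigma> i)\<^sup>2\<bar> \<le> real N" if "i < N" for i
    using spin2_bound[OF that that] by eventually_elim (simp add: power2_eq_square)
  have "(\<Sum>i<N. avg x (\<lambda>\<sigma>. (\<sigma> i)\<^sup>2)) = avg x (\<lambda>\<sigma>. \<Sum>i<N. (\<sigma> i)\<^sup>2)"
    by (subst avg_sum[where b="\<lambda>_. real N"]) (auto intro!: b[unfolded abs_power2])
  also have "\<dots> = avg x (\<lambda>_. real N)"
  proof (rule avg_cong)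
    show "AE \<sigma> in sphere_uniform N. (\<Sum>i<N. (\<sigma> i)\<^sup>2) = real N"
      using AE_spin_sphere[OF N_pos] by eventually_elim (simp add: spin_sphere_eq ip_def power2_eq_square)
  qed auto
  finally show ?thesis
    using N_pos by (simp add: v sum_subtractf r1_def field_simps)
qed

text \<open>Cauchy-Schwarz in the Hilbert-Schmidt norm for the matrices v v^T and the Gibbs average
  of \<sigma> \<sigma>^T, whose norms are |v|^2 and N sqrt r2. So a small \<open>r2\<close> makes a
  Gibbs sample nearly orthogonal to every fixed vector.\<close>

lemma avg_square_ip_le:
  shows "avg x (\<lambda>\<sigma>. (ip N v \<sigma>)\<^sup>2) \<le> ip N v v * real N * sqrt (r2 x)"
proof -
  have "avg x (\<lambda>\<sigma>. (ip N v \<sigma>)\<^sup>2) = avg x (\<lambda>\<sigma>. \<Sum>p\<in>{..<N}\<times>{..<N}. (v (fst p) * v (snd p)) * (\<sigma> (fst p) * \<sigma> (snd p)))"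
    by (simp add: ip_def power2_eq_square sum_product sum.cartesian_product case_prod_beta mult_ac)
  also have "\<dots> = (\<Sum>p\<in>{..<N}\<times>{..<N}. (v (fst p) * v (snd p)) * avg x (\<lambda>\<sigma>. \<sigma> (fst p) * \<sigma> (snd p)))"
  proof (subst avg_sum[where b="\<lambda>p. \<bar>v (fst p) * v (snd p)\<bar> * real N"])
    show "AE \<sigma> in sphere_uniform N. \<bar>v (fst p) * v (snd p) * (\<sigma> (fst p) * \<sigma> (snd p))\<bar> \<le> \<bar>v (fst p) * v (snd p)\<bar> * real N"
      if "p \<in> {..<N}\<times>{..<N}" for p
      using that spin2_bound[of "fst p" "snd p"]
      by (auto elim!: eventually_mono simp: abs_mult[of "v (fst p) * v (snd p)"] intro!: mult_left_mono)
  qed (auto simp: avg_cmult)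
  also have "\<dots> \<le> sqrt ((\<Sum>p\<in>{..<N}\<times>{..<N}. (v (fst p) * v (snd p))\<^sup>2) * (\<Sum>p\<in>{..<N}\<times>{..<N}. (avg x (\<lambda>\<sigma>. \<sigma> (fst p) * \<sigma> (snd p)))\<^sup>2))"
    by (rule real_le_rsqrt[OF Cauchy_Schwarz_ineq_sum])
  also have "(\<Sum>p\<in>{..<N}\<times>{..<N}. (v (fst p) * v (snd p))\<^sup>2) = (ip N v v)\<^sup>2"
    by (simp add: ip_def power2_eq_square sum_product sum.cartesian_product case_prod_beta mult_ac)
  also have "(\<Sum>p\<in>{..<N}\<times>{..<N}. (avg x (\<lambda>\<sigma>. \<sigma> (fst p) * \<sigma> (snd p)))\<^sup>2) = (real N)\<^sup>2 * r2 x"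
    using N_pos by (simp add: r2_def sum.cartesian_product case_prod_beta)
  finally show ?thesis
    using ip_nonneg[of N v] by (simp add: real_sqrt_mult)
qed

lemma r2_nonneg: "0 \<le> r2 x" by (simp add: r2_def sum_nonneg)

lemma r1_nonneg: "0 \<le> r1 x" by (simp add: r1_def sum_nonneg)

lemma ip_bound: "AE \<sigma> in sphere_uniform N. \<bar>ip N v \<sigma>\<bar> \<le> sqrt (ip N v v * real N)"
  using AE_spin_sphere[OF N_pos]
proof eventually_elim
  case (elim \<sigma>)
  then show ?case
    using real_sqrt_le_mono[OF ip_Cauchy_Schwarz[of N v \<sigma>]] by (simp add: spin_sphere_eq)
qed

lemma measurable_ip_spin [measurable]: "(\<lambda>\<sigma>. ip N v \<sigma>) \<in> borel_measurable (sphere_uniform N)"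
  by (rule measurable_ip) measurable

text \<open>Jensen's inequality for the overlap of two replicas. To stay with averages over one
  replica, it is applied to \<open>ip N v \<sigma>\<close> with v the vector of mean spins: (N r1)^2
  is at most the average of the square, hence at most N r1 * N sqrt r2, and one factor r1
  cancels.\<close>

lemma r1_square_le_r2: "(r1 x)\<^sup>2 \<le> r2 x"
proof -
  define v where "v i = avg x (\<lambda>\<sigma>. \<sigma> i)" for i
  define m where "m = avg x (\<lambda>\<sigma>. ip N v \<sigma>)"
  have vv: "ip N v v = real N * r1 x"
    using N_pos by (simp add: ip_def r1_def v_def power2_eq_square)
  have "m = (\<Sum>i<N. v i * v i)"
    unfolding m_def ip_def
  proof (subst avg_sum[where b="\<lambda>i. \<bar>v i\<bar> * sqrt (real N)"])
    show "AE \<sigma> in sphere_uniform N. \<bar>v i * \<sigma> i\<bar> \<le> \<bar>v i\<bar> * sqrt (real N)" if "i \<in> {..<N}" for i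
      using that spin_bound[of i] by (auto elim!: eventually_mono simp: abs_mult intro!: mult_left_mono)
  qed (auto simp: avg_cmult v_def)
  then have m: "m = real N * r1 x" using vv by (simp add: ip_def)
  have "0 \<le> avg x (\<lambda>\<sigma>. (ip N v \<sigma> - m)\<^sup>2)"
    unfolding avg_def using Z_pos[of x] by (intro divide_nonneg_pos integral_nonneg) auto
  also have "avg x (\<lambda>\<sigma>. (ip N v \<sigma> - m)\<^sup>2) = avg x (\<lambda>\<sigma>. (ip N v \<sigma>)\<^sup>2 + ((- 2 * m) * ip N v \<sigma> + m\<^sup>2))"
    by (simp add: power2_diff algebra_simps)
  also have "\<dots> = avg x (\<lambda>\<sigma>. (ip N v \<sigma>)\<^sup>2) + (avg x (\<lambda>\<sigma>. (- 2 * m) * ip N v \<sigma>) + avg x (\<lambda>_. m\<^sup>2))"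
  proof -
    have b1: "AE \<sigma> in sphere_uniform N. \<bar>(ip N v \<sigma>)\<^sup>2\<bar> \<le> (sqrt (ip N v v * real N))\<^sup>2"
      using ip_bound[of v] by eventually_elim (subst abs_power2, rule iffD2[OF power2_le_iff_abs_le], auto simp: ip_nonneg)
    have b2: "AE \<sigma> in sphere_uniform N. \<bar>(- 2 * m) * ip N v \<sigma>\<bar> \<le> \<bar>- 2 * m\<bar> * sqrt (ip N v v * real N)"
      using ip_bound[of v] by eventually_elim (subst abs_mult, rule mult_left_mono, auto)
    have b3: "AE \<sigma> in sphere_uniform N. \<bar>(- 2 * m) * ip N v \<sigma> + m\<^sup>2\<bar> \<le> \<bar>- 2 * m\<bar> * sqrt (ip N v v * real N) + m\<^sup>2"
      using b2 by eventually_elim (rule order_trans[OF abs_triangle_ineq], simp)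
    show ?thesis
      by (subst avg_add[OF _ b1 _ b3], simp, simp, subst avg_add[OF _ b2 _, of _ "m\<^sup>2"]) auto
  qed
  finally have "m\<^sup>2 \<le> avg x (\<lambda>\<sigma>. (ip N v \<sigma>)\<^sup>2)"
    by (simp add: avg_cmult[of x "- 2 * m", simplified] m_def[symmetric] power2_eq_square)
  also have "\<dots> \<le> ip N v v * real N * sqrt (r2 x)" by (rule avg_square_ip_le)
  finally have *: "(real N)\<^sup>2 * (r1 x)\<^sup>2 \<le> (real N)\<^sup>2 * (r1 x * sqrt (r2 x))"
    by (simp add: m vv power2_eq_square mult_ac)
  then have "r1 x * r1 x \<le> r1 x * sqrt (r2 x)"
    using N_pos by (simp add: power2_eq_square)
  then have "r1 x \<le> sqrt (r2 x)"
    using r1_nonneg[of x] r2_nonneg[of x] by (cases "r1 x = 0") auto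
  then show ?thesis
    using real_sqrt_le_iff r1_nonneg[of x] r2_nonneg[of x] power_mono[of "r1 x" "sqrt (r2 x)" 2] by simp
qed

definition phi :: "real \<Rightarrow> real \<Rightarrow> real" where
  "phi b h = (LINT g|gauss (sites N). ln (Z (disorder b h N g)))"

lemma integrable_r2: "integrable (gauss (sites N)) (\<lambda>g. r2 (disorder b h N g))"
  and integrable_r1: "integrable (gauss (sites N)) (\<lambda>g. r1 (disorder b h N g))"
proof -
  interpret G: prob_space "gauss (sites N)" by (rule prob_space_gauss)
  have b2: "\<bar>(avg x (\<lambda>\<sigma>. \<sigma> i * \<sigma> k))\<^sup>2\<bar> \<le> (real N)\<^sup>2" if "i < N" "k < N" for i k x
    using abs_avg_le[OF _ spin2_bound[OF that], of x] that by (simp add: abs_le_square_iff[symmetric])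
  have b1: "\<bar>(avg x (\<lambda>\<sigma>. \<sigma> i))\<^sup>2\<bar> \<le> (sqrt (real N))\<^sup>2" if "i < N" for i x
    using abs_avg_le[OF _ spin_bound[OF that], of x] that by (subst abs_power2, subst abs_le_square_iff[symmetric]) auto
  show "integrable (gauss (sites N)) (\<lambda>g. r2 (disorder b h N g))"
    unfolding r2_def disorder_def
    by (intro integrable_divide Bochner_Integration.integrable_sum G.integrable_const_bound[of _ "(real N)\<^sup>2"] AE_I2)
       (auto intro!: b2[unfolded abs_power2])
  show "integrable (gauss (sites N)) (\<lambda>g. r1 (disorder b h N g))"
    unfolding r1_def disorder_def
    by (intro integrable_divide Bochner_Integration.integrable_sum G.integrable_const_bound[of _ "(sqrt (real N))\<^sup>2"] AE_I2)
       (use b1 in auto)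
qed

definition R1 :: "real \<Rightarrow> real \<Rightarrow> real" where
  "R1 b h = (LINT g|gauss (sites N). r1 (disorder b h N g))"

definition R2 :: "real \<Rightarrow> real \<Rightarrow> real" where
  "R2 b h = (LINT g|gauss (sites N). r2 (disorder b h N g))"

text \<open>Stein's lemma gives a sum of Gibbs variances for each of the two kinds of disorder, and
  the spherical constraint reduces both sums to overlaps.\<close>

theorem has_real_derivative_phi:
  assumes b: "\<And>t. (b has_real_derivative b' t) (at t)" and h: "\<And>t. (h has_real_derivative h' t) (at t)"
    and D: "\<And>t. \<bar>b' t\<bar> \<le> D" "\<And>t. \<bar>h' t\<bar> \<le> D"
  shows "((\<lambda>t. phi (b t) (h t)) has_real_derivative
    real N * (b t * b' t * (1 - R2 (b t) (h t)) / 2 + h t * h' t * (1 - R1 (b t) (h t)))) (at t)"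
proof -
  interpret G: prob_space "gauss (sites N)" by (rule prob_space_gauss)
  let ?x = "\<lambda>g. disorder (b t) (h t) N g"
  have "((\<lambda>t. LINT g|gauss (sites N). ln (Z (\<lambda>p. weight N (b t) (h t) p * g p))) has_real_derivative
    (\<Sum>p\<in>sites N. weight N (b t) (h t) p * weight N (b' t) (h' t) p * (LINT g|gauss (sites N). var (\<lambda>p. weight N (b t) (h t) p * g p) p))) (at t)"
  proof (rule has_real_derivative_expected_ln_Z[where c="\<lambda>t p. weight N (b t) (h t) p" and D=D])
    show "((\<lambda>t. weight N (b t) (h t) p) has_real_derivative weight N (b' t) (h' t) p) (at t)" for p t
      using b h by (simp add: weight_def)
    show "\<bar>weight N (b' t) (h' t) p\<bar> \<le> D" for p t
      using D by (simp add: weight_def)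
  qed
  then have d: "((\<lambda>t. phi (b t) (h t)) has_real_derivative (\<Sum>p\<in>sites N. weight N (b t) (h t) p * weight N (b' t) (h' t) p * (LINT g|gauss (sites N). var (?x g) p))) (at t)"
    by (simp only: phi_def disorder_def)
  have iv: "integrable (gauss (sites N)) (\<lambda>g. var (?x g) p)" for p
    unfolding disorder_def by (rule integrable_var)
  have e1: "(\<Sum>p\<in>sites N. weight N (b t) (h t) p * weight N (b' t) (h' t) p * (LINT g|gauss (sites N). var (?x g) p))
    = b t * b' t * (\<Sum>i<N. \<Sum>k<N. LINT g|gauss (sites N). var (?x g) (i, k)) + h t * h' t * (\<Sum>i<N. LINT g|gauss (sites N). var (?x g) (i, N))"
    unfolding sum_sites by (simp add: weight_def sum_distrib_left)
  have e2: "(\<Sum>i<N. \<Sum>k<N. LINT g|gauss (sites N). var (?x g) (i, k)) = (LINT g|gauss (sites N). real N / 2 * (1 - r2 (?x g)))"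
    unfolding sum_var_pairs[symmetric] using iv
    by (subst Bochner_Integration.integral_sum, (auto intro!: Bochner_Integration.integrable_sum)[1],
      intro sum.cong refl, subst Bochner_Integration.integral_sum) auto
  have e3: "(\<Sum>i<N. LINT g|gauss (sites N). var (?x g) (i, N)) = (LINT g|gauss (sites N). real N * (1 - r1 (?x g)))"
    unfolding sum_var_sites[symmetric] using iv by (subst Bochner_Integration.integral_sum) auto
  have e4: "(LINT g|gauss (sites N). real N / 2 * (1 - r2 (?x g))) = real N / 2 * (1 - R2 (b t) (h t))"
    using integrable_r2 by (simp add: R2_def G.prob_space)
  have e5: "(LINT g|gauss (sites N). real N * (1 - r1 (?x g))) = real N * (1 - R1 (b t) (h t))"
    using integrable_r1 by (simp add: R1_def G.prob_space)
  have "b t * b' t * (real N / 2 * (1 - R2 (b t) (h t))) + h t * h' t * (real N * (1 - R1 (b t) (h t))) =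
     real N * (b t * b' t * (1 - R2 (b t) (h t)) / 2 + h t * h' t * (1 - R1 (b t) (h t)))"
    by (simp add: field_simps)
  with d show ?thesis
    by (simp only: e1 e2 e3 e4 e5)
qed

text \<open>
  Guerra's interpolation, run along a circle so that both square roots become smooth: the derivative is the asserted
  constant minus a nonnegative multiple of \<open>R2 - 2 q R1 + q\<^sup>2\<close>, which is nonnegative because \<open>r1\<^sup>2 \<le> r2\<close>.
\<close>

lemma guerra_bound:
  assumes \<beta>: "0 \<le> \<beta>" and q: "0 \<le> q"
  shows "phi \<beta> 0 \<le> phi 0 (\<beta> * sqrt q) + real N * \<beta>\<^sup>2 * (1 - q)\<^sup>2 / 4"
proof -
  interpret G: prob_space "gauss (sites N)" by (rule prob_space_gauss)
  define f where "f t = phi (\<beta> * sin t) (\<beta> * sqrt q * cos t) - real N * \<beta>\<^sup>2 * (1 - q)\<^sup>2 / 4 * (sin t)\<^sup>2" for t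
  define f' where "f' t = real N * ((\<beta> * sin t) * (\<beta> * cos t) * (1 - R2 (\<beta> * sin t) (\<beta> * sqrt q * cos t)) / 2 +
       (\<beta> * sqrt q * cos t) * (- (\<beta> * sqrt q * sin t)) * (1 - R1 (\<beta> * sin t) (\<beta> * sqrt q * cos t)))
     - real N * \<beta>\<^sup>2 * (1 - q)\<^sup>2 / 4 * (2 * sin t * cos t)" for t
  have d: "(f has_real_derivative f' t) (at t)" for t
    unfolding f_def f'_def
  proof (rule DERIV_diff)
    show "((\<lambda>t. phi (\<beta> * sin t) (\<beta> * sqrt q * cos t)) has_real_derivative
       real N * ((\<beta> * sin t) * (\<beta> * cos t) * (1 - R2 (\<beta> * sin t) (\<beta> * sqrt q * cos t)) / 2 +
       (\<beta> * sqrt q * cos t) * (- (\<beta> * sqrt q * sin t)) * (1 - R1 (\<beta> * sin t) (\<beta> * sqrt q * cos t)))) (at t)"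
    proof (rule has_real_derivative_phi[where D="\<beta> + \<beta> * sqrt q"])
      show "((\<lambda>t. \<beta> * sin t) has_real_derivative \<beta> * cos t) (at t)" for t
        by (auto intro!: derivative_eq_intros)
      show "((\<lambda>t. \<beta> * sqrt q * cos t) has_real_derivative - (\<beta> * sqrt q * sin t)) (at t)" for t
        by (auto intro!: derivative_eq_intros)
      have "\<bar>\<beta> * cos t\<bar> \<le> \<beta>" for t
        using \<beta> by (simp add: abs_mult mult_left_le)
      then show "\<bar>\<beta> * cos t\<bar> \<le> \<beta> + \<beta> * sqrt q" for t
        using \<beta> q by (meson add_increasing2 mult_nonneg_nonneg order_trans real_sqrt_ge_zero order_refl)
      have "\<bar>- (\<beta> * sqrt q * sin t)\<bar> \<le> \<beta> * sqrt q" for t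
        using \<beta> q by (simp add: abs_mult mult_left_le)
      then show "\<bar>- (\<beta> * sqrt q * sin t)\<bar> \<le> \<beta> + \<beta> * sqrt q" for t
        using \<beta> by (smt (verit))
    qed
    show "((\<lambda>t. real N * \<beta>\<^sup>2 * (1 - q)\<^sup>2 / 4 * (sin t)\<^sup>2) has_real_derivative real N * \<beta>\<^sup>2 * (1 - q)\<^sup>2 / 4 * (2 * sin t * cos t)) (at t)"
      by (auto intro!: derivative_eq_intros)
  qed
  have neg: "f' t \<le> 0" if t: "0 \<le> t" "t \<le> pi / 2" for t
  proof -
    let ?x = "disorder (\<beta> * sin t) (\<beta> * sqrt q * cos t) N"
    have f': "f' t = real N * \<beta>\<^sup>2 * (sin t * cos t) * ((1 - R2 (\<beta> * sin t) (\<beta> * sqrt q * cos t)) / 2 - q * (1 - R1 (\<beta> * sin t) (\<beta> * sqrt q * cos t)) - (1 - q)\<^sup>2 / 2)"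
    proof -
      have ss: "sqrt q * (sqrt q * x) = q * x" for x
        using q by (simp add: mult.assoc[symmetric])
      show ?thesis
        by (simp add: f'_def ss field_simps power2_eq_square)
    qed
    have "(1 - R2 (\<beta> * sin t) (\<beta> * sqrt q * cos t)) / 2 - q * (1 - R1 (\<beta> * sin t) (\<beta> * sqrt q * cos t)) - (1 - q)\<^sup>2 / 2
      = (LINT g|gauss (sites N). (1 - r2 (?x g)) / 2 - q * (1 - r1 (?x g)) - (1 - q)\<^sup>2 / 2)"
      using integrable_r1 integrable_r2 by (simp add: R1_def R2_def G.prob_space)
    also have "\<dots> \<le> 0"
    proof -
      have "(1 - r2 (?x g)) / 2 - q * (1 - r1 (?x g)) - (1 - q)\<^sup>2 / 2 \<le> 0" for g
      proof -
        have "(1 - b) / 2 - q * (1 - a) - (1 - q)\<^sup>2 / 2 = - ((b - a\<^sup>2) / 2) - (a - q)\<^sup>2 / 2" for a b :: real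
          by (simp add: power2_eq_square field_simps)
        then show ?thesis
          using r1_square_le_r2[of "?x g"] zero_le_power2[of "r1 (?x g) - q"] by (smt (verit) divide_nonneg_pos)
      qed
      then have "0 \<le> (LINT g|gauss (sites N). - ((1 - r2 (?x g)) / 2 - q * (1 - r1 (?x g)) - (1 - q)\<^sup>2 / 2))"
        by (intro Bochner_Integration.integral_nonneg) (simp only: neg_0_le_iff_le)
      then show ?thesis by (simp only: integral_minus neg_0_le_iff_le)
    qed
    finally have "(1 - R2 (\<beta> * sin t) (\<beta> * sqrt q * cos t)) / 2 - q * (1 - R1 (\<beta> * sin t) (\<beta> * sqrt q * cos t)) - (1 - q)\<^sup>2 / 2 \<le> 0" .
    then show ?thesis
      unfolding f' using t sin_ge_zero[of t] cos_ge_zero[of t] by (intro mult_nonneg_nonpos) auto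
  qed
  have "f (pi / 2) \<le> f 0"
    by (rule DERIV_nonpos_imp_nonincreasing) (use d neg in auto)
  then show ?thesis by (simp add: f_def)
qed

end

section \<open>High-temperature phase\<close>

lemma ennreal_integral_le_nn_integral:
  assumes "integrable M f"
  shows "ennreal (integral\<^sup>L M f) \<le> (\<integral>\<^sup>+x. ennreal (f x) \<partial>M)"
proof -
  have i: "integrable M (\<lambda>x. max 0 (f x))" using assms by auto
  have "integral\<^sup>L M f \<le> (LINT x|M. max 0 (f x))"
    using assms i by (intro integral_mono) auto
  then have "ennreal (integral\<^sup>L M f) \<le> ennreal (LINT x|M. max 0 (f x))" by (rule ennreal_leI)
  also have "\<dots> = (\<integral>\<^sup>+x. ennreal (max 0 (f x)) \<partial>M)"
    using i by (subst nn_integral_eq_integral) auto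
  also have "\<dots> = (\<integral>\<^sup>+x. ennreal (f x) \<partial>M)"
    by (intro nn_integral_cong) (auto simp: max_def ennreal_neg)
  finally show ?thesis .
qed

text \<open>Jensen's inequality through the tangent of ln at c. The moment bound is taken in
  \<open>ennreal\<close>, so that integrability of Y comes with it.\<close>

lemma (in prob_space) expectation_ln_le:
  assumes [measurable]: "Y \<in> borel_measurable M" and pos: "\<And>x. x \<in> space M \<Longrightarrow> 0 < Y x"
    and int: "integrable M (\<lambda>x. ln (Y x))" and c: "0 < c" and le: "(\<integral>\<^sup>+x. ennreal (Y x) \<partial>M) \<le> ennreal c"
  shows "expectation (\<lambda>x. ln (Y x)) \<le> ln c"
proof -
  have "(\<integral>\<^sup>+x. ennreal (norm (Y x)) \<partial>M) = (\<integral>\<^sup>+x. ennreal (Y x) \<partial>M)"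
    using pos by (intro nn_integral_cong) (simp add: less_imp_le)
  then have Y: "integrable M Y"
    using le by (intro integrableI_bounded) (auto simp: less_top[symmetric] top_unique)
  have "ennreal (expectation Y) \<le> ennreal c"
    using ennreal_integral_le_nn_integral[OF Y] le by (rule order_trans)
  then have Yc: "expectation Y \<le> c" using c by (simp add: ennreal_le_iff)
  have "expectation (\<lambda>x. ln (Y x)) \<le> expectation (\<lambda>x. ln c + (Y x / c - 1))"
  proof (rule integral_mono[OF int])
    show "integrable M (\<lambda>x. ln c + (Y x / c - 1))" using Y by simp
    fix x assume "x \<in> space M"
    then have "ln (Y x / c) \<le> Y x / c - 1" using pos c by (intro ln_le_minus_one) auto
    then show "ln (Y x) \<le> ln c + (Y x / c - 1)"
      using pos[OF \<open>x \<in> space M\<close>] c by (simp add: ln_div)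
  qed
  also have "\<dots> = ln c + (expectation Y / c - 1)" using Y by (simp add: prob_space)
  also have "\<dots> \<le> ln c" using Yc c by simp
  finally show ?thesis .
qed

context spin
begin

lemma integrable_ln_Z_disorder: "integrable (gauss (sites N)) (\<lambda>g. ln (Z (disorder b h N g)))"
  unfolding disorder_def by (rule integrable_ln_Z)

lemma measurable_Z_disorder [measurable]: "(\<lambda>g. Z (disorder b h N g)) \<in> borel_measurable (gauss (sites N))"
  unfolding disorder_def by measurable

lemma measurable_r2_disorder [measurable]: "(\<lambda>g. r2 (disorder b h N g)) \<in> borel_measurable (gauss (sites N))"
  using integrable_r2 by (rule borel_measurable_integrable)

text \<open>For a fixed field, ln Z is at most a constant plus h^2 / (2 b) times the sum of the
  squared field variables, whose mean is N.\<close>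

lemma phi_field_le:
  assumes e: "0 < e" and N: "shell_threshold e \<le> real N" and b: "0 < b"
  shows "phi 0 h \<le> ln 4 + real N * ((b * (1 + e) - (1 - e)) / 2 - ln b / 2 + h\<^sup>2 / (2 * b))"
proof -
  interpret G: prob_space "gauss (sites N)" by (rule prob_space_gauss)
  let ?C = "4 * exp (real N * (b * (1 + e) - (1 - e)) / 2) * (1 / sqrt b) ^ N"
  have Zle: "ln (Z (disorder 0 h N g)) \<le> ln ?C + (\<Sum>i<N. (g (i, N))\<^sup>2) * (h\<^sup>2 / (2 * b))" for g
  proof -
    define v where "v i = h * g (i, N)" for i
    have "ip N v v = (\<Sum>i<N. (g (i, N))\<^sup>2) * h\<^sup>2"
      by (simp add: ip_def v_def power2_eq_square sum_distrib_left mult_ac)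
    then have vv: "ip N v v / (2 * b) = (\<Sum>i<N. (g (i, N))\<^sup>2) * (h\<^sup>2 / (2 * b))" by simp
    have en: "energy (disorder 0 h N g) \<sigma> = ip N v \<sigma>" for \<sigma>
      unfolding energy_field by (simp add: v_def ip_def sum_distrib_left mult.assoc)
    have "ennreal (Z (disorder 0 h N g)) = (\<integral>\<^sup>+\<sigma>. ennreal (exp (ip N v \<sigma>)) \<partial>sphere_uniform N)"
      unfolding Z_def using integrable_exp_energy1[of "disorder 0 h N g"]
      by (subst nn_integral_eq_integral[symmetric]) (auto simp: en)
    also have "\<dots> \<le> ennreal (?C * exp (ip N v v / (2 * b)))"
      by (rule sphere_exp_linear_le[OF e N b])
    finally have "Z (disorder 0 h N g) \<le> ?C * exp (ip N v v / (2 * b))"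
      using b by (subst (asm) ennreal_le_iff) auto
    then have "ln (Z (disorder 0 h N g)) \<le> ln (?C * exp (ip N v v / (2 * b)))"
      using Z_pos b by (subst ln_le_cancel_iff) auto
    also have "\<dots> = ln ?C + ip N v v / (2 * b)"
      using b by (simp add: ln_mult)
    finally show ?thesis by (simp only: vv)
  qed
  have sq: "integrable (gauss (sites N)) (\<lambda>g. (g (i, N))\<^sup>2)" "(LINT g|gauss (sites N). (g (i, N))\<^sup>2) = 1" if "i < N" for i
    using that integral_gauss_coordinate[of "(i, N)" "sites N" "\<lambda>x. x\<^sup>2"] by (auto simp: std_normal_square)
  have isq: "integrable (gauss (sites N)) (\<lambda>g. \<Sum>i<N. (g (i, N))\<^sup>2)"
    using sq by (intro Bochner_Integration.integrable_sum) auto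
  have "phi 0 h \<le> (LINT g|gauss (sites N). ln ?C + (\<Sum>i<N. (g (i, N))\<^sup>2) * (h\<^sup>2 / (2 * b)))"
    unfolding phi_def
    by (rule integral_mono) (use Zle integrable_ln_Z_disorder isq in auto)
  also have "\<dots> = ln ?C + (LINT g|gauss (sites N). (\<Sum>i<N. (g (i, N))\<^sup>2)) * (h\<^sup>2 / (2 * b))"
    using isq by (simp add: G.prob_space)
  also have "(LINT g|gauss (sites N). (\<Sum>i<N. (g (i, N))\<^sup>2)) = real N"
    using sq by (subst Bochner_Integration.integral_sum) auto
  also have "ln ?C = ln 4 + real N * ((b * (1 + e) - (1 - e)) / 2) + real N * (- (ln b / 2))"
    using b by (simp add: ln_mult ln_realpow ln_div ln_sqrt)
  finally show ?thesis by (simp add: algebra_simps)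
qed

theorem phi_upper:
  assumes e: "0 < e" and N: "shell_threshold e \<le> real N" and \<beta>: "1 < \<beta>"
  shows "phi \<beta> 0 \<le> ln 4 + real N * (limit_free_energy \<beta> + e * (1 + \<beta>) / 2)"
proof -
  \<comment> \<open>This q and b = \<beta> form the stationary point of the bound: stationarity in b
    reads b^2 - b = \<beta>^2 q, stationarity in q reads 1 - q = 1 / b.\<close>
  define q where "q = 1 - 1 / \<beta>"
  have q: "0 \<le> q" "\<beta>\<^sup>2 * (1 - q)\<^sup>2 = 1" "(\<beta> * sqrt q)\<^sup>2 = \<beta> * (\<beta> - 1)"
    using \<beta> by (auto simp: q_def power_divide power_mult_distrib) (simp add: power2_eq_square field_simps)
  have "phi \<beta> 0 \<le> phi 0 (\<beta> * sqrt q) + real N * \<beta>\<^sup>2 * (1 - q)\<^sup>2 / 4"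
    by (rule guerra_bound) (use \<beta> q in auto)
  also have "\<dots> \<le> ln 4 + real N * ((\<beta> * (1 + e) - (1 - e)) / 2 - ln \<beta> / 2 + (\<beta> * sqrt q)\<^sup>2 / (2 * \<beta>)) + real N * (\<beta>\<^sup>2 * (1 - q)\<^sup>2) / 4"
    using phi_field_le[OF e N, of \<beta> "\<beta> * sqrt q"] \<beta> by (simp add: mult.assoc)
  also have "\<dots> = ln 4 + real N * (limit_free_energy \<beta> + e * (1 + \<beta>) / 2)"
    using \<beta> unfolding q limit_free_energy_def by (simp add: field_simps)
  finally show ?thesis .
qed

lemma ham_measurable [measurable]: "(\<lambda>\<sigma>. ham N g \<sigma>) \<in> borel_measurable (sphere_uniform N)"
  unfolding ham_def hamiltonian_def by measurable

text \<open>Jensen's inequality for the product of two Gibbs measures, with exponent X = lam (ip N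
  \<sigma> \<tau>)^2 / (2 N) of mean m. It is proved through the tangent exp X >= exp m (1 + X - m):
  X is a sum of products of a function of \<sigma> and a function of \<tau>, so both integrals of
  the tangent are explicit.\<close>

lemma Z_square_le:
  assumes lam: "0 \<le> lam"
  shows "ennreal ((Z (disorder b 0 N g))\<^sup>2 * exp (lam * real N / 2 * r2 (disorder b 0 N g))) \<le>
    (\<integral>\<^sup>+\<sigma>. (\<integral>\<^sup>+\<tau>. ennreal (exp (b * ham N g \<sigma> + b * ham N g \<tau> + lam * (ip N \<sigma> \<tau>)\<^sup>2 / (2 * real N)))
      \<partial>sphere_uniform N) \<partial>sphere_uniform N)"
proof -
  let ?x = "disorder b 0 N g" and ?L = "sphere_uniform N"
  let ?P = "{..<N} \<times> {..<N}"
  define m where "m = lam * real N / 2 * r2 ?x"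
  define W where "W \<sigma> = exp (b * ham N g \<sigma>)" for \<sigma>
  have W: "exp (energy ?x \<sigma>) = W \<sigma>" for \<sigma> by (simp add: W_def energy_field)
  have mW [measurable]: "W \<in> borel_measurable ?L" unfolding W_def by measurable
  have Wpos: "0 < W \<sigma>" for \<sigma> by (simp add: W_def)
  define s where "s p \<sigma> = \<sigma> (fst p) * \<sigma> (snd p)" for p :: "nat \<times> nat" and \<sigma> :: "nat \<Rightarrow> real"
  have ms: "s p \<in> borel_measurable ?L" if "p \<in> ?P" for p
    unfolding s_def using that by (intro borel_measurable_times measurable_spin) auto
  have iW: "integrable ?L W" and isW: "integrable ?L (\<lambda>\<sigma>. s p \<sigma> * W \<sigma>)" if "p \<in> ?P" for p
    using integrable_exp_energy1[of ?x] integrable_exp_energy[OF ms[OF that], of "real N" ?x] spin2_bound[of "fst p" "snd p"] that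
    by (auto simp: W s_def)
  have iW: "integrable ?L W" using integrable_exp_energy1[of ?x] by (simp add: W)
  define A where "A p = (LINT \<sigma>|?L. s p \<sigma> * W \<sigma>)" for p
  have ZW: "integral\<^sup>L ?L W = Z ?x" by (simp add: Z_def W)
  have Apos: "0 < Z ?x" by (rule Z_pos)
  have sumA: "(\<Sum>p\<in>?P. (A p)\<^sup>2) = (Z ?x)\<^sup>2 * ((real N)\<^sup>2 * r2 ?x)"
  proof -
    have "A p = Z ?x * avg ?x (\<lambda>\<sigma>. \<sigma> (fst p) * \<sigma> (snd p))" for p
      using Apos by (simp add: A_def avg_def W s_def)
    moreover have "(real N)\<^sup>2 * r2 ?x = (\<Sum>p\<in>?P. (avg ?x (\<lambda>\<sigma>. \<sigma> (fst p) * \<sigma> (snd p)))\<^sup>2)"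
      using N_pos by (simp add: r2_def sum.cartesian_product case_prod_beta)
    ultimately show ?thesis
      by (simp add: power_mult_distrib sum_distrib_left[symmetric])
  qed
  have ip2: "(ip N \<sigma> \<tau>)\<^sup>2 = (\<Sum>p\<in>?P. s p \<sigma> * s p \<tau>)" for \<sigma> \<tau>
    by (simp add: ip_def power2_eq_square sum_product sum.cartesian_product case_prod_beta s_def mult_ac)
  define X where "X \<sigma> \<tau> = lam * (ip N \<sigma> \<tau>)\<^sup>2 / (2 * real N)" for \<sigma> \<tau>
  have X: "X \<sigma> \<tau> = (\<Sum>p\<in>?P. (lam / (2 * real N) * s p \<sigma>) * s p \<tau>)" for \<sigma> \<tau>
    unfolding X_def ip2 by (simp add: sum_distrib_left sum_divide_distrib mult_ac)
  define f where "f \<sigma> \<tau> = W \<sigma> * exp m * ((1 - m) * W \<tau> + (\<Sum>p\<in>?P. (lam / (2 * real N) * s p \<sigma>) * (s p \<tau> * W \<tau>)))" for \<sigma> \<tau>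
  define J where "J \<sigma> = exp m * ((1 - m) * Z ?x * W \<sigma> + (\<Sum>p\<in>?P. (lam / (2 * real N) * A p) * (s p \<sigma> * W \<sigma>)))" for \<sigma>
  have f_le: "f \<sigma> \<tau> \<le> exp (b * ham N g \<sigma> + b * ham N g \<tau> + X \<sigma> \<tau>)" for \<sigma> \<tau>
  proof -
    have "1 + (X \<sigma> \<tau> - m) \<le> exp (X \<sigma> \<tau> - m)" by (rule exp_ge_add_one_self)
    then have "exp m * (1 + (X \<sigma> \<tau> - m)) \<le> exp m * exp (X \<sigma> \<tau> - m)" by (rule mult_left_mono) simp
    then have "W \<sigma> * W \<tau> * (exp m * (1 + (X \<sigma> \<tau> - m))) \<le> W \<sigma> * W \<tau> * exp (X \<sigma> \<tau>)"
      using Wpos by (intro mult_left_mono) (auto simp: exp_add[symmetric] less_imp_le)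
    moreover have "f \<sigma> \<tau> = W \<sigma> * W \<tau> * (exp m * (1 + (X \<sigma> \<tau> - m)))"
      by (simp add: f_def X sum_distrib_left sum_distrib_right algebra_simps)
    ultimately show ?thesis by (simp add: W_def exp_add)
  qed
  have intgf: "integrable ?L (f \<sigma>)" for \<sigma>
    unfolding f_def using iW isW
    by (intro integrable_mult_right Bochner_Integration.integrable_add Bochner_Integration.integrable_sum) auto
  have intf: "integral\<^sup>L ?L (f \<sigma>) = J \<sigma>" for \<sigma>
  proof -
    have "integral\<^sup>L ?L (f \<sigma>) = W \<sigma> * exp m * ((1 - m) * Z ?x + (\<Sum>p\<in>?P. (lam / (2 * real N) * s p \<sigma>) * A p))"
      unfolding f_def A_def ZW[symmetric] using iW isW
      by (simp add: Bochner_Integration.integral_add Bochner_Integration.integral_sum)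
    then show ?thesis by (simp add: J_def sum_distrib_left algebra_simps)
  qed
  have iJ: "integrable ?L J"
    unfolding J_def using iW isW
    by (intro integrable_mult_right Bochner_Integration.integrable_add Bochner_Integration.integrable_sum) auto
  have "integral\<^sup>L ?L J = exp m * ((1 - m) * Z ?x * Z ?x + (\<Sum>p\<in>?P. (lam / (2 * real N) * A p) * A p))"
    unfolding J_def A_def[symmetric] ZW[symmetric] using iW isW
    by (simp add: A_def Bochner_Integration.integral_add Bochner_Integration.integral_sum)
  also have "(\<Sum>p\<in>?P. (lam / (2 * real N) * A p) * A p) = lam / (2 * real N) * (\<Sum>p\<in>?P. (A p)\<^sup>2)"
    by (simp add: sum_distrib_left power2_eq_square mult.assoc)
  also have "\<dots> = m * (Z ?x)\<^sup>2"
    unfolding sumA m_def using N_pos by (simp add: field_simps power2_eq_square)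
  finally have J: "integral\<^sup>L ?L J = (Z ?x)\<^sup>2 * exp m" by (simp add: power2_eq_square algebra_simps)
  have "ennreal ((Z ?x)\<^sup>2 * exp m) \<le> (\<integral>\<^sup>+\<sigma>. ennreal (J \<sigma>) \<partial>?L)"
    unfolding J[symmetric] by (rule ennreal_integral_le_nn_integral[OF iJ])
  also have "\<dots> \<le> (\<integral>\<^sup>+\<sigma>. (\<integral>\<^sup>+\<tau>. ennreal (exp (b * ham N g \<sigma> + b * ham N g \<tau> + X \<sigma> \<tau>)) \<partial>?L) \<partial>?L)"
  proof (rule nn_integral_mono)
    fix \<sigma>
    have "ennreal (J \<sigma>) \<le> (\<integral>\<^sup>+\<tau>. ennreal (f \<sigma> \<tau>) \<partial>?L)"
      unfolding intf[symmetric] by (rule ennreal_integral_le_nn_integral[OF intgf])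
    also have "\<dots> \<le> (\<integral>\<^sup>+\<tau>. ennreal (exp (b * ham N g \<sigma> + b * ham N g \<tau> + X \<sigma> \<tau>)) \<partial>?L)"
      by (intro nn_integral_mono ennreal_leI f_le)
    finally show "ennreal (J \<sigma>) \<le> (\<integral>\<^sup>+\<tau>. ennreal (exp (b * ham N g \<sigma> + b * ham N g \<tau> + X \<sigma> \<tau>)) \<partial>?L)" .
  qed
  finally show ?thesis by (simp only: m_def X_def)
qed

lemma measurable_ham:
  assumes "\<And>p. p \<in> sites N \<Longrightarrow> (\<lambda>w. u w p) \<in> borel_measurable M" "\<And>i. i < N \<Longrightarrow> (\<lambda>w. v w i) \<in> borel_measurable M"
  shows "(\<lambda>w. ham N (u w) (v w)) \<in> borel_measurable M"
  unfolding ham_def hamiltonian_def using assms by (intro borel_measurable_times borel_measurable_sum) auto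

text \<open>The Hamiltonian is a centred Gaussian process with covariance (ip N \<sigma> \<tau>)^2 /
  (2 N), so its values at two points of the sphere have a sum of variance N + (ip N \<sigma>
  \<tau>)^2 / N.\<close>

lemma nn_integral_gauss_ham:
  assumes \<sigma>: "\<sigma> \<in> spin_sphere N" and \<tau>: "\<tau> \<in> spin_sphere N"
  shows "(\<integral>\<^sup>+g. ennreal (exp (b * ham N g \<sigma> + b * ham N g \<tau>)) \<partial>gauss (sites N)) =
    ennreal (exp (real N * b\<^sup>2 / 2 + b\<^sup>2 * (ip N \<sigma> \<tau>)\<^sup>2 / (2 * real N)))"
proof -
  define c where "c p = (if snd p < N then b * (coupling N p \<sigma> + coupling N p \<tau>) else 0)" for p
  have eq: "b * ham N g \<sigma> + b * ham N g \<tau> = (\<Sum>p\<in>sites N. c p * g p)" for g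
    unfolding sum_sites ham_def hamiltonian_def c_def coupling_def
    by (simp add: sum_distrib_left sum.distrib[symmetric] real_sqrt_mult field_simps)
  have nz: "real N \<noteq> 0" using N_pos by simp
  have n: "ip N \<sigma> \<sigma> = real N" "ip N \<tau> \<tau> = real N" using assms by (auto simp: spin_sphere_eq)
  have "(\<Sum>p\<in>sites N. (c p)\<^sup>2) = (\<Sum>i<N. \<Sum>k<N. b\<^sup>2 / (2 * real N) * (\<sigma> i * \<sigma> k + \<tau> i * \<tau> k)\<^sup>2)"
    unfolding sum_sites c_def coupling_def
    by (simp add: add_divide_distrib[symmetric] power_mult_distrib power_divide)
  also have "\<dots> = b\<^sup>2 / (2 * real N) * (\<Sum>i<N. \<Sum>k<N. (\<sigma> i * \<sigma> k + \<tau> i * \<tau> k)\<^sup>2)"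
    by (simp only: sum_distrib_left)
  also have "(\<Sum>i<N. \<Sum>k<N. (\<sigma> i * \<sigma> k + \<tau> i * \<tau> k)\<^sup>2) = (ip N \<sigma> \<sigma>)\<^sup>2 + (ip N \<tau> \<tau>)\<^sup>2 + 2 * (ip N \<sigma> \<tau>)\<^sup>2"
    by (simp add: ip_def power2_eq_square sum_product sum.distrib[symmetric] sum_distrib_left algebra_simps)
  also have "b\<^sup>2 / (2 * real N) * ((ip N \<sigma> \<sigma>)\<^sup>2 + (ip N \<tau> \<tau>)\<^sup>2 + 2 * (ip N \<sigma> \<tau>)\<^sup>2) = 2 * (real N * b\<^sup>2 / 2 + b\<^sup>2 * (ip N \<sigma> \<tau>)\<^sup>2 / (2 * real N))"
    unfolding n using nz by (simp add: field_simps power2_eq_square)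
  finally have sc: "(\<Sum>p\<in>sites N. (c p)\<^sup>2) / 2 = real N * b\<^sup>2 / 2 + b\<^sup>2 * (ip N \<sigma> \<tau>)\<^sup>2 / (2 * real N)" by simp
  show ?thesis
    unfolding eq using integral_gauss_exp_linear[of "sites N" c]
    by (subst nn_integral_eq_integral) (auto simp: sc)
qed

text \<open>Averaging over the disorder first, the coupling lam of the replicas just adds to b^2 in
  front of (ip N \<sigma> \<tau>)^2 / (2 N), and as long as b^2 + lam < 1 the sphere integral of the
  exponential stays below a constant times exp (N e). This is the second moment method, with room
  for a tilt by \<open>r2\<close>.\<close>

lemma annealed_bound:
  assumes e: "0 < e" and N: "shell_threshold e \<le> real N" and lam: "0 \<le> lam" and k: "b\<^sup>2 + lam < 1"
  shows "(\<integral>\<^sup>+g. ennreal ((Z (disorder b 0 N g))\<^sup>2 * exp (lam * real N / 2 * r2 (disorder b 0 N g))) \<partial>gauss (sites N)) \<le>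
    ennreal (exp (real N * b\<^sup>2 / 2) * (2 * exp (real N * e) / sqrt (1 - (b\<^sup>2 + lam))))"
proof -
  let ?L = "sphere_uniform N" and ?G = "gauss (sites N)"
  interpret G: prob_space ?G by (rule prob_space_gauss)
  interpret GL: pair_sigma_finite ?G ?L ..
  let ?F = "\<lambda>g \<sigma> \<tau>. ennreal (exp (b * ham N g \<sigma> + b * ham N g \<tau> + lam * (ip N \<sigma> \<tau>)\<^sup>2 / (2 * real N)))"
  have c: "(\<lambda>g. g p) \<in> borel_measurable ?G" if "p \<in> sites N" for p
    using measurable_component_singleton[OF that, of "\<lambda>_. borel"] by (simp add: measurable_cong_sets[OF sets_gauss refl])
  note comps = measurable_compose[OF measurable_compose[OF measurable_fst measurable_fst] c]
         measurable_compose[OF measurable_compose[OF measurable_fst measurable_snd] measurable_spin]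
         measurable_compose[OF measurable_snd measurable_spin] measurable_compose[OF measurable_fst c]
  have [measurable]:
    "(\<lambda>w. ham N (fst (fst w)) (snd (fst w))) \<in> borel_measurable ((?G \<Otimes>\<^sub>M ?L) \<Otimes>\<^sub>M ?L)"
    "(\<lambda>w. ham N (fst (fst w)) (snd w)) \<in> borel_measurable ((?G \<Otimes>\<^sub>M ?L) \<Otimes>\<^sub>M ?L)"
    "(\<lambda>w. ip N (snd (fst w)) (snd w)) \<in> borel_measurable ((?G \<Otimes>\<^sub>M ?L) \<Otimes>\<^sub>M ?L)"
    by (intro measurable_ham measurable_ip comps; assumption)+
  have m3: "(\<lambda>(w, \<tau>). ?F (fst w) (snd w) \<tau>) \<in> borel_measurable ((?G \<Otimes>\<^sub>M ?L) \<Otimes>\<^sub>M ?L)"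
    unfolding case_prod_beta by measurable
  have m2: "(\<lambda>(g, \<sigma>). \<integral>\<^sup>+\<tau>. ?F g \<sigma> \<tau> \<partial>?L) \<in> borel_measurable (?G \<Otimes>\<^sub>M ?L)"
    using borel_measurable_nn_integral[OF m3] by (simp add: case_prod_beta')
  have m1: "(\<lambda>(g, \<tau>). ?F g \<sigma> \<tau>) \<in> borel_measurable (?G \<Otimes>\<^sub>M ?L)" for \<sigma>
  proof -
    have [measurable]:
      "(\<lambda>w. ham N (fst w) \<sigma>) \<in> borel_measurable (?G \<Otimes>\<^sub>M ?L)"
      "(\<lambda>w. ham N (fst w) (snd w)) \<in> borel_measurable (?G \<Otimes>\<^sub>M ?L)"
      "(\<lambda>w. ip N \<sigma> (snd w)) \<in> borel_measurable (?G \<Otimes>\<^sub>M ?L)"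
      by (intro measurable_ham measurable_ip comps borel_measurable_const; assumption)+
    show ?thesis unfolding case_prod_beta by measurable
  qed
  have "(\<integral>\<^sup>+g. ennreal ((Z (disorder b 0 N g))\<^sup>2 * exp (lam * real N / 2 * r2 (disorder b 0 N g))) \<partial>?G) \<le>
     (\<integral>\<^sup>+g. (\<integral>\<^sup>+\<sigma>. (\<integral>\<^sup>+\<tau>. ?F g \<sigma> \<tau> \<partial>?L) \<partial>?L) \<partial>?G)"
    by (intro nn_integral_mono Z_square_le lam)
  also have "\<dots> = (\<integral>\<^sup>+\<sigma>. (\<integral>\<^sup>+g. (\<integral>\<^sup>+\<tau>. ?F g \<sigma> \<tau> \<partial>?L) \<partial>?G) \<partial>?L)"
    by (rule GL.Fubini'[symmetric]) (rule m2)
  also have "\<dots> = (\<integral>\<^sup>+\<sigma>. (\<integral>\<^sup>+\<tau>. (\<integral>\<^sup>+g. ?F g \<sigma> \<tau> \<partial>?G) \<partial>?L) \<partial>?L)"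
    by (intro nn_integral_cong GL.Fubini'[symmetric] m1)
  also have "\<dots> \<le> (\<integral>\<^sup>+\<sigma>. ennreal (exp (real N * b\<^sup>2 / 2) * (2 * exp (real N * e) / sqrt (1 - (b\<^sup>2 + lam)))) \<partial>?L)"
  proof (rule nn_integral_mono_AE)
    show "AE \<sigma> in ?L. (\<integral>\<^sup>+\<tau>. (\<integral>\<^sup>+g. ?F g \<sigma> \<tau> \<partial>?G) \<partial>?L) \<le> ennreal (exp (real N * b\<^sup>2 / 2) * (2 * exp (real N * e) / sqrt (1 - (b\<^sup>2 + lam))))"
      using AE_spin_sphere[OF N_pos]
    proof eventually_elim
      case (elim \<sigma>)
      have "(\<integral>\<^sup>+\<tau>. (\<integral>\<^sup>+g. ?F g \<sigma> \<tau> \<partial>?G) \<partial>?L) =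
         (\<integral>\<^sup>+\<tau>. ennreal (exp (real N * b\<^sup>2 / 2)) * ennreal (exp ((b\<^sup>2 + lam) * (ip N \<sigma> \<tau>)\<^sup>2 / (2 * real N))) \<partial>?L)"
      proof (rule nn_integral_cong_AE)
        show "AE \<tau> in ?L. (\<integral>\<^sup>+g. ?F g \<sigma> \<tau> \<partial>?G) = ennreal (exp (real N * b\<^sup>2 / 2)) * ennreal (exp ((b\<^sup>2 + lam) * (ip N \<sigma> \<tau>)\<^sup>2 / (2 * real N)))"
          using AE_spin_sphere[OF N_pos]
        proof eventually_elim
          case (elim \<tau>)
          have [measurable]: "(\<lambda>g. ham N g \<rho>) \<in> borel_measurable ?G" for \<rho>
            by (intro measurable_ham c borel_measurable_const; assumption)
          have mm: "(\<lambda>g. ennreal (exp (b * ham N g \<sigma> + b * ham N g \<tau>))) \<in> borel_measurable ?G"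
            by measurable
          have "(\<integral>\<^sup>+g. ?F g \<sigma> \<tau> \<partial>?G) = (\<integral>\<^sup>+g. ennreal (exp (b * ham N g \<sigma> + b * ham N g \<tau>)) * ennreal (exp (lam * (ip N \<sigma> \<tau>)\<^sup>2 / (2 * real N))) \<partial>?G)"
            by (intro nn_integral_cong) (simp add: exp_add ennreal_mult)
          also have "\<dots> = ennreal (exp (real N * b\<^sup>2 / 2 + b\<^sup>2 * (ip N \<sigma> \<tau>)\<^sup>2 / (2 * real N))) * ennreal (exp (lam * (ip N \<sigma> \<tau>)\<^sup>2 / (2 * real N)))"
            by (subst nn_integral_multc[OF mm]) (simp only: nn_integral_gauss_ham[OF \<open>\<sigma> \<in> spin_sphere N\<close> elim])
          also have "\<dots> = ennreal (exp (real N * b\<^sup>2 / 2)) * ennreal (exp ((b\<^sup>2 + lam) * (ip N \<sigma> \<tau>)\<^sup>2 / (2 * real N)))"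
            by (simp add: ennreal_mult[symmetric] exp_add[symmetric] add_divide_distrib algebra_simps)
          finally show ?case .
        qed
      qed
      also have "\<dots> = ennreal (exp (real N * b\<^sup>2 / 2)) * (\<integral>\<^sup>+\<tau>. ennreal (exp ((b\<^sup>2 + lam) * (ip N \<sigma> \<tau>)\<^sup>2 / (2 * real N))) \<partial>?L)"
        by (rule nn_integral_cmult) measurable
      also have "\<dots> \<le> ennreal (exp (real N * b\<^sup>2 / 2)) * ennreal (2 * exp (real N * e) / sqrt (1 - (b\<^sup>2 + lam)))"
        using elim k lam by (intro mult_left_mono sphere_exp_square_le[OF e N]) (auto simp: spin_sphere_eq)
      also have "\<dots> = ennreal (exp (real N * b\<^sup>2 / 2) * (2 * exp (real N * e) / sqrt (1 - (b\<^sup>2 + lam))))"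
        using k by (intro ennreal_mult[symmetric]) auto
      finally show ?case .
    qed
  qed
  also have "\<dots> = ennreal (exp (real N * b\<^sup>2 / 2) * (2 * exp (real N * e) / sqrt (1 - (b\<^sup>2 + lam))))"
    using emeasure_space_1 by simp
  finally show ?thesis .
qed

lemma phi_R2_bound:
  assumes e: "0 < e" and N: "shell_threshold e \<le> real N" and lam: "0 \<le> lam" and k: "b\<^sup>2 + lam < 1"
  shows "2 * phi b 0 + lam * real N / 2 * R2 b 0 \<le> real N * b\<^sup>2 / 2 + (ln 2 + real N * e - ln (1 - (b\<^sup>2 + lam)) / 2)"
proof -
  let ?x = "\<lambda>g. disorder b 0 N g" and ?G = "gauss (sites N)"
  interpret G: prob_space ?G by (rule prob_space_gauss)
  have ln: "ln ((Z (?x g))\<^sup>2 * exp (lam * real N / 2 * r2 (?x g))) = 2 * ln (Z (?x g)) + lam * real N / 2 * r2 (?x g)" for g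
    using Z_pos[of "?x g"] by (simp add: ln_mult ln_realpow)
  have int: "integrable ?G (\<lambda>g. 2 * ln (Z (?x g)) + lam * real N / 2 * r2 (?x g))"
    by (intro Bochner_Integration.integrable_add integrable_mult_right integrable_r2 integrable_ln_Z_disorder)
  have "2 * phi b 0 + lam * real N / 2 * R2 b 0 = (LINT g|?G. 2 * ln (Z (?x g)) + lam * real N / 2 * r2 (?x g))"
    unfolding phi_def R2_def using integrable_r2 integrable_ln_Z_disorder by simp
  also have "\<dots> = (LINT g|?G. ln ((Z (?x g))\<^sup>2 * exp (lam * real N / 2 * r2 (?x g))))"
    by (simp only: ln)
  also have "\<dots> \<le> ln (exp (real N * b\<^sup>2 / 2) * (2 * exp (real N * e) / sqrt (1 - (b\<^sup>2 + lam))))"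
  proof (rule G.expectation_ln_le[OF _ _ _ _ annealed_bound[OF e N lam k]])
    show "integrable ?G (\<lambda>g. ln ((Z (?x g))\<^sup>2 * exp (lam * real N / 2 * r2 (?x g))))"
      unfolding ln by (rule int)
    show "0 < (Z (?x g))\<^sup>2 * exp (lam * real N / 2 * r2 (?x g))" for g
      using Z_pos[of "?x g"] by simp
  qed (use k in auto)
  also have "\<dots> = real N * b\<^sup>2 / 2 + (ln 2 + real N * e - ln (1 - (b\<^sup>2 + lam)) / 2)"
    using k by (simp add: ln_mult ln_div ln_sqrt)
  finally show ?thesis .
qed

lemma phi_0_0: "phi 0 0 = 0"
proof -
  have "Z (disorder 0 0 N g) = 1" for g
    unfolding Z_def using prob_space by (simp add: energy_field)
  then show ?thesis by (simp add: phi_def)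
qed

lemma R2_nonneg: "0 \<le> R2 b h"
  unfolding R2_def by (intro Bochner_Integration.integral_nonneg r2_nonneg)

text \<open>
  Below the critical temperature \<open>b = 1\<close> the coupling \<open>lam\<close> of two replicas is absorbed by the annealed bound, and
  Gronwall's inequality propagates the resulting control of the overlap (Guerra--Toninelli).
\<close>

theorem high_temperature:
  assumes e: "0 < e" and N: "shell_threshold e \<le> real N" and b: "0 \<le> b" "b < 1"
  defines "lam \<equiv> (1 - b\<^sup>2) / 2"
  defines "D \<equiv> ln 2 + real N * e - ln lam / 2"
  shows "real N * b\<^sup>2 / 4 - phi b 0 \<le> D / 2 * exp (2 * b / lam)"
    and "lam * real N / 2 * R2 b 0 \<le> D * (exp (2 * b / lam) + 1)"
proof -
  have b2: "b\<^sup>2 < 1" using b by (simp add: power_less_one_iff)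
  then have lam: "0 < lam" by (simp add: lam_def)
  \<comment> \<open>The deficit of the quenched free energy below its annealed value. Its derivative
    N t R2 / 2 is controlled by the deficit itself through \<open>bound\<close>, which closes the
    Gronwall loop.\<close>
  define \<Psi> where "\<Psi> t = real N * t\<^sup>2 / 4 - phi t 0" for t
  have bound: "lam * real N / 2 * R2 t 0 \<le> 2 * \<Psi> t + D" if t: "0 \<le> t" "t \<le> b" for t
  proof -
    have t2: "t\<^sup>2 \<le> b\<^sup>2" using t by (intro power_mono) auto
    \<comment> \<open>\<open>lam\<close> is half of the gap 1 - b^2; the other half remains as a
      lower bound for 1 - (t^2 + lam), uniformly in t <= b.\<close>
    then have k: "t\<^sup>2 + lam \<le> 1 - lam" by (simp add: lam_def field_simps)
    have "2 * phi t 0 + lam * real N / 2 * R2 t 0 \<le> real N * t\<^sup>2 / 2 + (ln 2 + real N * e - ln (1 - (t\<^sup>2 + lam)) / 2)"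
      using lam k by (intro phi_R2_bound e N) auto
    moreover have "ln lam \<le> ln (1 - (t\<^sup>2 + lam))"
      using lam k by simp
    ultimately show ?thesis by (simp add: \<Psi>_def D_def)
  qed
  have nonneg: "0 \<le> 2 * \<Psi> t + D" if t: "0 \<le> t" "t \<le> b" for t
  proof -
    have "0 \<le> lam * real N / 2 * R2 t 0" using lam R2_nonneg[of t 0] by simp
    then show ?thesis using bound[OF t] by linarith
  qed
  have d\<Psi>: "(\<Psi> has_real_derivative real N * t / 2 * R2 t 0) (at t)" for t
  proof -
    have "((\<lambda>t. phi t 0) has_real_derivative real N * (t * 1 * (1 - R2 t 0) / 2 + 0 * 0 * (1 - R1 t 0))) (at t)"
      by (rule has_real_derivative_phi[where b="\<lambda>t. t" and h="\<lambda>_. 0" and D=1]) auto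
    then have "(\<Psi> has_real_derivative real N * (2 * t) / 4 - real N * (t * 1 * (1 - R2 t 0) / 2 + 0 * 0 * (1 - R1 t 0))) (at t)"
      unfolding \<Psi>_def by (intro DERIV_diff) (auto intro!: derivative_eq_intros)
    then show ?thesis by (simp add: field_simps)
  qed
  define f where "f t = exp (- (2 / lam) * t) * (\<Psi> t + D / 2)" for t
  define f' where "f' t = exp (- (2 / lam) * t) * (real N * t / 2 * R2 t 0 - (2 / lam) * (\<Psi> t + D / 2))" for t
  have "f b \<le> f 0"
  proof (rule DERIV_nonpos_imp_nonincreasing[OF b(1)])
    fix t assume t: "0 \<le> t" "t \<le> b"
    have d: "(f has_real_derivative f' t) (at t)"
    proof -
      have "((\<lambda>t. exp (- (2 / lam) * t)) has_real_derivative exp (- (2 / lam) * t) * (- (2 / lam))) (at t)"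
        using lam by (auto intro!: derivative_eq_intros)
      moreover have "((\<lambda>t. \<Psi> t + D / 2) has_real_derivative real N * t / 2 * R2 t 0) (at t)"
        using DERIV_add[OF d\<Psi> DERIV_const[of "D / 2"]] by simp
      ultimately have "(f has_real_derivative exp (- (2 / lam) * t) * (- (2 / lam)) * (\<Psi> t + D / 2) +
          real N * t / 2 * R2 t 0 * exp (- (2 / lam) * t)) (at t)"
        unfolding f_def by (rule DERIV_mult)
      moreover have "exp (- (2 / lam) * t) * (- (2 / lam)) * (\<Psi> t + D / 2) + real N * t / 2 * R2 t 0 * exp (- (2 / lam) * t) = f' t"
        unfolding f'_def by (simp only: algebra_simps)
      ultimately show ?thesis by simp
    qed
    have "lam * (real N * t / 2 * R2 t 0) = t * (lam * real N / 2 * R2 t 0)" by simp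
    also have "\<dots> \<le> 1 * (2 * \<Psi> t + D)"
      using bound[OF t] nonneg[OF t] t b R2_nonneg[of t 0] lam by (intro mult_mono) auto
    finally have "real N * t / 2 * R2 t 0 \<le> (2 * \<Psi> t + D) / lam"
      using lam by (simp add: field_simps)
    then have "f' t \<le> 0"
      unfolding f'_def by (intro mult_nonneg_nonpos) (simp_all add: add_divide_distrib algebra_simps)
    then show "\<exists>y. (f has_real_derivative y) (at t) \<and> y \<le> 0" using d by blast
  qed
  then have "exp (- (2 * b / lam)) * (\<Psi> b + D / 2) \<le> D / 2"
    by (simp add: f_def \<Psi>_def phi_0_0)
  then have "exp (2 * b / lam) * (exp (- (2 * b / lam)) * (\<Psi> b + D / 2)) \<le> exp (2 * b / lam) * (D / 2)"
    by (rule mult_left_mono) simp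
  then have *: "\<Psi> b + D / 2 \<le> D / 2 * exp (2 * b / lam)"
    by (simp only: mult.assoc[symmetric] exp_minus_inverse mult_1 mult.commute[of "D / 2"])
  have D0: "0 \<le> D"
    using nonneg[of 0] b by (simp add: \<Psi>_def phi_0_0)
  with * show "real N * b\<^sup>2 / 4 - phi b 0 \<le> D / 2 * exp (2 * b / lam)"
    by (simp add: \<Psi>_def)
  show "lam * real N / 2 * R2 b 0 \<le> D * (exp (2 * b / lam) + 1)"
    using bound[of b] b * D0 by (simp add: algebra_simps)
qed

end

section \<open>Moments of the disorder matrix\<close>

text \<open>Polynomials in the Gaussian coordinates. They have all moments and grow polynomially in
  each coordinate, which settles the side conditions of Stein's lemma for the whole class.\<close>

inductive polyfun :: "'k set \<Rightarrow> (('k \<Rightarrow> real) \<Rightarrow> real) \<Rightarrow> bool" for K where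
  const: "polyfun K (\<lambda>_. c)"
| coord: "k \<in> K \<Longrightarrow> polyfun K (\<lambda>g. g k)"
| add: "polyfun K f \<Longrightarrow> polyfun K h \<Longrightarrow> polyfun K (\<lambda>g. f g + h g)"
| mult: "polyfun K f \<Longrightarrow> polyfun K h \<Longrightarrow> polyfun K (\<lambda>g. f g * h g)"

lemma polyfun_sum: "(\<And>i. i \<in> I \<Longrightarrow> polyfun K (f i)) \<Longrightarrow> polyfun K (\<lambda>g. \<Sum>i\<in>I. f i g)"
  by (induction I rule: infinite_finite_induct) (auto intro: polyfun.intros)

lemma polyfun_sum_list: "(\<And>x. x \<in> set xs \<Longrightarrow> polyfun K (f x)) \<Longrightarrow> polyfun K (\<lambda>g. \<Sum>x\<leftarrow>xs. f x g)"
  by (induction xs) (auto intro: polyfun.intros)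

text \<open>All powers p are treated at once, because the product case needs the moments of order 2
  p of its factors.\<close>

lemma polyfun_moments:
  assumes "polyfun K f"
  shows "f \<in> borel_measurable (gauss K) \<and> (\<forall>p::nat. integrable (gauss K) (\<lambda>g. \<bar>f g\<bar> ^ p))"
  using assms
proof induction
  case (const c)
  interpret prob_space "gauss K" by (rule prob_space_gauss)
  show ?case by simp
next
  case (coord k)
  have "integrable std_normal (\<lambda>x. \<bar>x\<bar> ^ p)" for p
    using integrable_norm[OF integrable_std_normal_power[of p]] by (simp add: power_abs)
  then have "integrable (gauss K) (\<lambda>g. \<bar>g k\<bar> ^ p)" for p
    using integral_gauss_coordinate(2)[OF coord, of "\<lambda>x. \<bar>x\<bar> ^ p"] by simp
  moreover have "(\<lambda>g. g k) \<in> borel_measurable (gauss K)"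
    using measurable_component_singleton[OF coord, of "\<lambda>_. borel"] by (simp add: measurable_cong_sets[OF sets_gauss refl])
  ultimately show ?case by auto
next
  case (add f h)
  then have [measurable]: "f \<in> borel_measurable (gauss K)" "h \<in> borel_measurable (gauss K)" by auto
  have "integrable (gauss K) (\<lambda>g. \<bar>f g + h g\<bar> ^ p)" for p
  proof (rule Bochner_Integration.integrable_bound)
    show "integrable (gauss K) (\<lambda>g. 2 ^ p * (\<bar>f g\<bar> ^ p + \<bar>h g\<bar> ^ p))"
      using add.IH by (intro integrable_mult_right Bochner_Integration.integrable_add) auto
    have "\<bar>a + b\<bar> ^ p \<le> 2 ^ p * (\<bar>a\<bar> ^ p + \<bar>b\<bar> ^ p)" for a b :: real
    proof -
      have "\<bar>a + b\<bar> ^ p \<le> (2 * max \<bar>a\<bar> \<bar>b\<bar>) ^ p" by (intro power_mono) auto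
      also have "\<dots> = 2 ^ p * max \<bar>a\<bar> \<bar>b\<bar> ^ p" by (simp add: power_mult_distrib)
      also have "\<dots> \<le> 2 ^ p * (\<bar>a\<bar> ^ p + \<bar>b\<bar> ^ p)" by (intro mult_left_mono) (auto simp: max_def)
      finally show ?thesis .
    qed
    then show "AE g in gauss K. norm (\<bar>f g + h g\<bar> ^ p) \<le> norm (2 ^ p * (\<bar>f g\<bar> ^ p + \<bar>h g\<bar> ^ p))"
      by (intro AE_I2) simp
  qed measurable
  then show ?case by auto
next
  case (mult f h)
  then have [measurable]: "f \<in> borel_measurable (gauss K)" "h \<in> borel_measurable (gauss K)" by auto
  have "integrable (gauss K) (\<lambda>g. \<bar>f g * h g\<bar> ^ p)" for p
  proof (rule Bochner_Integration.integrable_bound)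
    show "integrable (gauss K) (\<lambda>g. \<bar>f g\<bar> ^ (2 * p) + \<bar>h g\<bar> ^ (2 * p))"
      using mult.IH by (intro Bochner_Integration.integrable_add) auto
    have "\<bar>a * b\<bar> ^ p \<le> \<bar>a\<bar> ^ (2 * p) + \<bar>b\<bar> ^ (2 * p)" for a b :: real
    proof -
      have "0 \<le> (\<bar>a\<bar> ^ p - \<bar>b\<bar> ^ p)\<^sup>2" "0 \<le> \<bar>a\<bar> ^ p * \<bar>b\<bar> ^ p" by simp_all
      moreover have "(\<bar>a\<bar> ^ p - \<bar>b\<bar> ^ p)\<^sup>2 = \<bar>a\<bar> ^ (2 * p) + \<bar>b\<bar> ^ (2 * p) - 2 * (\<bar>a\<bar> ^ p * \<bar>b\<bar> ^ p)"
        by (simp add: power2_diff power_mult[symmetric] mult.commute[of p])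
      ultimately show ?thesis unfolding abs_mult power_mult_distrib by linarith
    qed
    then show "AE g in gauss K. norm (\<bar>f g * h g\<bar> ^ p) \<le> norm (\<bar>f g\<bar> ^ (2 * p) + \<bar>h g\<bar> ^ (2 * p))"
      by (intro AE_I2) simp
  qed measurable
  then show ?case by auto
qed

lemma polyfun_integrable: assumes "polyfun K f" shows "integrable (gauss K) f"
proof -
  have "integrable (gauss K) (\<lambda>g. \<bar>f g\<bar> ^ 1)" "f \<in> borel_measurable (gauss K)"
    using polyfun_moments[OF assms] by blast+
  then have "integrable (gauss K) (\<lambda>g. norm (f g))" by (simp only: power_one_right real_norm_def)
  then show ?thesis using \<open>f \<in> borel_measurable (gauss K)\<close> by (rule integrable_norm_cancel)
qed

lemma polyfun_growth:
  assumes "polyfun K f"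
  shows "(\<exists>C m. 0 \<le> C \<and> (\<forall>t. \<bar>f (g(k := t))\<bar> \<le> C * (1 + t\<^sup>2) ^ m)) \<and> continuous_on UNIV (\<lambda>t. f (g(k := t)))"
  using assms
proof induction
  case (const c)
  show ?case by (intro conjI exI[of _ "\<bar>c\<bar>"] exI[of _ "0::nat"]) auto
next
  case (coord j)
  show ?case
  proof (cases "j = k")
    case True
    have "\<bar>t\<bar> \<le> 1 * (1 + t\<^sup>2) ^ 1" for t :: real
      using zero_le_power2[of "\<bar>t\<bar> - 1"] by (simp add: power2_diff)
    moreover have "continuous_on UNIV (\<lambda>t. (g(k := t)) j)" using True by simp
    ultimately show ?thesis using True
      by (intro conjI exI[of _ "1::real"] exI[of _ "1::nat"]) auto
  next
    case False
    then show ?thesis by (intro conjI exI[of _ "\<bar>g j\<bar>"] exI[of _ "0::nat"]) auto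
  qed
next
  case (add f h)
  obtain C m where 1: "0 \<le> C" "\<And>t. \<bar>f (g(k := t))\<bar> \<le> C * (1 + t\<^sup>2) ^ m"
    using add.IH(1) by blast
  obtain C' m' where 2: "0 \<le> C'" "\<And>t. \<bar>h (g(k := t))\<bar> \<le> C' * (1 + t\<^sup>2) ^ m'"
    using add.IH(2) by blast
  note * = 1(1) 2(1) 1(2) 2(2)
  have "\<bar>f (g(k := t)) + h (g(k := t))\<bar> \<le> (C + C') * (1 + t\<^sup>2) ^ (m + m')" for t
  proof -
    have "(1 + t\<^sup>2) ^ m \<le> (1 + t\<^sup>2) ^ (m + m')" "(1 + t\<^sup>2) ^ m' \<le> (1 + t\<^sup>2) ^ (m + m')"
      by (intro power_increasing; simp)+
    then have "C * (1 + t\<^sup>2) ^ m + C' * (1 + t\<^sup>2) ^ m' \<le> C * (1 + t\<^sup>2) ^ (m + m') + C' * (1 + t\<^sup>2) ^ (m + m')"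
      using *(1,2) by (intro add_mono mult_left_mono)
    with *(3,4)[of t] show ?thesis unfolding distrib_right by linarith
  qed
  moreover have "continuous_on UNIV (\<lambda>t. f (g(k := t)) + h (g(k := t)))"
    using add.IH by (intro continuous_on_add) blast+
  ultimately show ?case using add_nonneg_nonneg[OF *(1,2)] by blast
next
  case (mult f h)
  obtain C m where 1: "0 \<le> C" "\<And>t. \<bar>f (g(k := t))\<bar> \<le> C * (1 + t\<^sup>2) ^ m"
    using mult.IH(1) by blast
  obtain C' m' where 2: "0 \<le> C'" "\<And>t. \<bar>h (g(k := t))\<bar> \<le> C' * (1 + t\<^sup>2) ^ m'"
    using mult.IH(2) by blast
  note * = 1(1) 2(1) 1(2) 2(2)
  have "\<bar>f (g(k := t)) * h (g(k := t))\<bar> \<le> (C * C') * (1 + t\<^sup>2) ^ (m + m')" for t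
  proof -
    have "\<bar>f (g(k := t))\<bar> * \<bar>h (g(k := t))\<bar> \<le> (C * (1 + t\<^sup>2) ^ m) * (C' * (1 + t\<^sup>2) ^ m')"
      using * by (intro mult_mono) auto
    then show ?thesis by (simp add: abs_mult power_add mult_ac)
  qed
  moreover have "continuous_on UNIV (\<lambda>t. f (g(k := t)) * h (g(k := t)))"
    using mult.IH by (intro continuous_on_mult) blast+
  ultimately show ?case using mult_nonneg_nonneg[OF *(1,2)] by blast
qed

lemma stein_polyfun:
  assumes K: "finite K" "k \<in> K" and F: "polyfun K F" "polyfun K F'"
    and deriv: "\<And>g t. ((\<lambda>t. F (g(k := t))) has_real_derivative F' (g(k := t))) (at t)"
  shows "(LINT g|gauss K. g k * F g) = (LINT g|gauss K. F' g)"
  using polyfun_growth[OF F(1)] polyfun_growth[OF F(2)]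
  by (intro stein_gauss[OF K deriv] polyfun_integrable F polyfun.intros K) blast+

text \<open>Off-diagonal entries have variance 1 / (4 N), the normalisation for which the semicircle
  fills [-1, 1]. The Hamiltonian is the quadratic form of this matrix.\<close>

definition goe :: "nat \<Rightarrow> (nat \<times> nat \<Rightarrow> real) \<Rightarrow> nat \<Rightarrow> nat \<Rightarrow> real" where
  "goe N g i j = (g (i, j) + g (j, i)) / (2 * sqrt (2 * real N))"

fun goe_pow :: "nat \<Rightarrow> (nat \<times> nat \<Rightarrow> real) \<Rightarrow> nat \<Rightarrow> nat \<Rightarrow> nat \<Rightarrow> real" where
  "goe_pow N g 0 i j = (if i = j then 1 else 0)"
| "goe_pow N g (Suc k) i j = (\<Sum>a<N. goe N g i a * goe_pow N g k a j)"

lemma goe_commute: "goe N g i j = goe N g j i"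
  by (simp add: goe_def add.commute)

lemma goe_pow_add:
  "j < N \<Longrightarrow> i < N \<Longrightarrow> (\<Sum>a<N. goe_pow N g k i a * goe_pow N g l a j) = goe_pow N g (k + l) i j"
proof (induction k arbitrary: i)
  case 0
  then show ?case by (simp add: if_distrib[of "\<lambda>x. x * _"] sum.delta' cong: if_cong)
next
  case (Suc k)
  have "(\<Sum>a<N. goe_pow N g (Suc k) i a * goe_pow N g l a j) = (\<Sum>a<N. \<Sum>b<N. goe N g i b * (goe_pow N g k b a * goe_pow N g l a j))"
    by (simp add: sum_distrib_right mult.assoc)
  also have "\<dots> = (\<Sum>b<N. goe N g i b * (\<Sum>a<N. goe_pow N g k b a * goe_pow N g l a j))"
    by (subst sum.swap) (simp add: sum_distrib_left)
  finally show ?case using Suc by simp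
qed

lemma goe_pow_1: "j < N \<Longrightarrow> goe_pow N g (Suc 0) i j = goe N g i j"
  by (simp add: if_distrib[of "\<lambda>x. _ * x"] sum.delta cong: if_cong)

lemma goe_pow_commute: "i < N \<Longrightarrow> j < N \<Longrightarrow> goe_pow N g k i j = goe_pow N g k j i"
proof (induction k arbitrary: i j)
  case (Suc k)
  have "goe_pow N g (Suc k) i j = (\<Sum>a<N. goe_pow N g k j a * goe_pow N g (Suc 0) a i)"
    using Suc by (simp add: goe_pow_1 goe_commute[of N g i] mult.commute del: goe_pow.simps(2)) (simp add: goe_commute[of N g i] mult.commute)
  also have "\<dots> = goe_pow N g (Suc k) j i"
    using goe_pow_add[of i N j g k "Suc 0"] Suc by simp
  finally show ?case .
qed simp

text \<open>The product rule for the entry (i, j) of W^k under a change of g (u, v): the sum runs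
  over the place of the differentiated factor, and its two terms come from the entries (u, v) and
  (v, u) of W. The common factor 1 / (2 sqrt (2 N)) is left out.\<close>

definition goe_deriv :: "nat \<Rightarrow> (nat \<times> nat \<Rightarrow> real) \<Rightarrow> nat \<Rightarrow> nat \<Rightarrow> nat \<Rightarrow> nat \<Rightarrow> nat \<Rightarrow> real" where
  "goe_deriv N g k i j u v = (\<Sum>r<k. goe_pow N g r i u * goe_pow N g (k - 1 - r) v j + goe_pow N g r i v * goe_pow N g (k - 1 - r) u j)"

lemma goe_deriv_Suc:
  "goe_deriv N g (Suc k) i j u v = (if i = u then goe_pow N g k v j else 0) + (if i = v then goe_pow N g k u j else 0)
     + (\<Sum>a<N. goe N g i a * goe_deriv N g k a j u v)"
proof -
  have "(\<Sum>a<N. goe N g i a * goe_deriv N g k a j u v) =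
    (\<Sum>r<k. goe_pow N g (Suc r) i u * goe_pow N g (k - 1 - r) v j + goe_pow N g (Suc r) i v * goe_pow N g (k - 1 - r) u j)"
    unfolding goe_deriv_def sum_distrib_left
    by (subst sum.swap) (simp add: sum.distrib distrib_left sum_distrib_right mult.assoc)
  moreover have "goe_deriv N g (Suc k) i j u v = (goe_pow N g 0 i u * goe_pow N g k v j + goe_pow N g 0 i v * goe_pow N g k u j) +
    (\<Sum>r<k. goe_pow N g (Suc r) i u * goe_pow N g (k - 1 - r) v j + goe_pow N g (Suc r) i v * goe_pow N g (k - 1 - r) u j)"
    unfolding goe_deriv_def by (subst sum.lessThan_Suc_shift) (simp del: goe_pow.simps)
  moreover have "goe_pow N g 0 i a * x = (if i = a then x else 0)" for a x by simp
  ultimately show ?thesis by (simp only:)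
qed

lemma goe_deriv_commute: "goe_deriv N g k i j u v = goe_deriv N g k i j v u"
  by (simp add: goe_deriv_def add.commute)

lemma has_derivative_goe_pow:
  assumes uv: "u < N" "v < N"
  shows "((\<lambda>t. goe_pow N (g((u, v) := t)) k i j) has_real_derivative
    goe_deriv N (g((u, v) := t)) k i j u v / (2 * sqrt (2 * real N))) (at t)"
proof (induction k arbitrary: i)
  case 0
  show ?case by (simp add: goe_deriv_def)
next
  case (Suc k)
  let ?s = "2 * sqrt (2 * real N)" and ?g = "g((u, v) := t)"
  have d: "((\<lambda>t. goe N (g((u, v) := t)) i a) has_real_derivative
     ((if i = u \<and> a = v then 1 else 0) + (if a = u \<and> i = v then 1 else 0)) / ?s) (at t)" for a
    unfolding goe_def by (intro DERIV_cdivide DERIV_add) (auto intro!: derivative_eq_intros)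
  have "((\<lambda>t. goe_pow N (g((u, v) := t)) (Suc k) i j) has_real_derivative
    (\<Sum>a<N. ((if i = u \<and> a = v then 1 else 0) + (if a = u \<and> i = v then 1 else 0)) / ?s * goe_pow N ?g k a j
       + goe_deriv N ?g k a j u v / ?s * goe N ?g i a)) (at t)"
    unfolding goe_pow.simps by (intro DERIV_sum DERIV_mult d Suc)
  also have "(\<Sum>a<N. ((if i = u \<and> a = v then 1 else 0) + (if a = u \<and> i = v then 1 else 0)) / ?s * goe_pow N ?g k a j
       + goe_deriv N ?g k a j u v / ?s * goe N ?g i a) =
     ((\<Sum>a<N. (if a = v then (if i = u then goe_pow N ?g k v j else 0) else 0)) +
      (\<Sum>a<N. (if a = u then (if i = v then goe_pow N ?g k u j else 0) else 0)) + (\<Sum>a<N. goe N ?g i a * goe_deriv N ?g k a j u v)) / ?s"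
    unfolding sum.distrib[symmetric] sum_divide_distrib by (intro sum.cong refl) (auto simp: field_simps)
  also have "\<dots> = goe_deriv N ?g (Suc k) i j u v / ?s"
    unfolding goe_deriv_Suc using uv by (simp add: sum.delta)
  finally show ?case .
qed

text \<open>A letter (k, i, j) stands for the entry (i, j) of W^k, a word for the product of its
  letters. Products are unavoidable: differentiating one entry of a power gives products of two such
  entries.\<close>

type_synonym word = "(nat \<times> nat \<times> nat) list"

fun wmono :: "nat \<Rightarrow> (nat \<times> nat \<Rightarrow> real) \<Rightarrow> word \<Rightarrow> real" where
  "wmono N g [] = 1"
| "wmono N g ((k, i, j) # xs) = goe_pow N g k i j * wmono N g xs"

text \<open>All words that arise when one factor \<open>W\<^sub>u\<^sub>v\<close> is contracted with a letter of the given word.\<close>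

fun contract :: "nat \<Rightarrow> nat \<Rightarrow> word \<Rightarrow> word list" where
  "contract u v [] = []"
| "contract u v ((k, i, j) # xs) =
     map (\<lambda>r. (r, i, u) # (k - 1 - r, v, j) # xs) [0..<k] @ map (\<lambda>r. (r, i, v) # (k - 1 - r, u, j) # xs) [0..<k] @
     map ((#) (k, i, j)) (contract u v xs)"

definition dwmono :: "nat \<Rightarrow> (nat \<times> nat \<Rightarrow> real) \<Rightarrow> nat \<Rightarrow> nat \<Rightarrow> word \<Rightarrow> real" where
  "dwmono N g u v xs = (\<Sum>ys\<leftarrow>contract u v xs. wmono N g ys)"

lemma dwmono_Cons: "dwmono N g u v ((k, i, j) # xs) = goe_deriv N g k i j u v * wmono N g xs + goe_pow N g k i j * dwmono N g u v xs"
  by (simp add: dwmono_def goe_deriv_def sum.distrib sum_distrib_right comp_def interv_sum_list_conv_sum_set_nat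
      atLeast0LessThan sum_list_const_mult distrib_right mult.assoc)

lemma dwmono_commute: "dwmono N g u v xs = dwmono N g v u xs"
proof (induction xs)
  case (Cons x xs)
  obtain k i j where "x = (k, i, j)" by (cases x) auto
  then show ?case by (simp add: dwmono_Cons Cons goe_deriv_commute[of N g k i j u v])
qed (simp add: dwmono_def)

lemma has_derivative_wmono:
  assumes uv: "u < N" "v < N"
  shows "((\<lambda>t. wmono N (g((u, v) := t)) xs) has_real_derivative dwmono N (g((u, v) := t)) u v xs / (2 * sqrt (2 * real N))) (at t)"
proof (induction xs)
  case Nil
  show ?case by (simp add: dwmono_def)
next
  case (Cons x xs)
  obtain k i j where x: "x = (k, i, j)" by (cases x) auto
  show ?case
    unfolding x wmono.simps
  proof (rule DERIV_cong[OF DERIV_mult[OF has_derivative_goe_pow[OF uv] Cons]])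
    have "A / c * M + D / c * P = (A * M + P * D) / c" for A M D P c :: real
      by (simp add: add_divide_distrib mult.commute)
    then show "goe_deriv N (g((u, v) := t)) k i j u v / (2 * sqrt (2 * real N)) * wmono N (g((u, v) := t)) xs +
      dwmono N (g((u, v) := t)) u v xs / (2 * sqrt (2 * real N)) * goe_pow N (g((u, v) := t)) k i j =
      dwmono N (g((u, v) := t)) u v ((k, i, j) # xs) / (2 * sqrt (2 * real N))"
      unfolding dwmono_Cons .
  qed
qed

definition indices_less :: "nat \<Rightarrow> word \<Rightarrow> bool" where
  "indices_less N xs \<longleftrightarrow> (\<forall>(k, i, j)\<in>set xs. i < N \<and> j < N)"

definition deg :: "word \<Rightarrow> nat" where
  "deg xs = (\<Sum>(k, i, j)\<leftarrow>xs. k)"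

lemma polyfun_goe: "i < N \<Longrightarrow> j < N \<Longrightarrow> polyfun (sites N) (\<lambda>g. goe N g i j)"
  unfolding goe_def divide_inverse by (intro polyfun.intros) auto

lemma polyfun_goe_pow: "i < N \<Longrightarrow> j < N \<Longrightarrow> polyfun (sites N) (\<lambda>g. goe_pow N g k i j)"
proof (induction k arbitrary: i)
  case 0
  show ?case by (simp add: polyfun.const)
next
  case (Suc k)
  show ?case unfolding goe_pow.simps
    by (intro polyfun_sum polyfun.mult polyfun_goe Suc) (use Suc in auto)
qed

lemma polyfun_wmono: "indices_less N xs \<Longrightarrow> polyfun (sites N) (\<lambda>g. wmono N g xs)"
proof (induction xs)
  case Nil
  show ?case by (simp add: polyfun.const)
next
  case (Cons x xs)
  obtain k i j where "x = (k, i, j)" by (cases x) auto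
  with Cons show ?case by (auto simp: indices_less_def intro!: polyfun.mult polyfun_goe_pow)
qed

text \<open>The number of contractions depends on the degree alone and not on N, which keeps the
  constants of the loop equations uniform in N.\<close>

lemma contract_props:
  assumes "u < N" "v < N" "indices_less N xs"
  shows "\<forall>ys\<in>set (contract u v xs). indices_less N ys \<and> Suc (deg ys) = deg xs" "length (contract u v xs) = 2 * deg xs"
  using assms
proof (induction xs)
  case (Cons x xs)
  obtain k i j where x: "x = (k, i, j)" by (cases x) auto
  { case 1
    with Cons show ?case by (fastforce simp: x indices_less_def deg_def)
  next
    case 2
    with Cons show ?case by (auto simp: x indices_less_def deg_def)
  }
qed (auto simp: deg_def)

lemma polyfun_dwmono: "u < N \<Longrightarrow> v < N \<Longrightarrow> indices_less N xs \<Longrightarrow> polyfun (sites N) (\<lambda>g. dwmono N g u v xs)"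
  unfolding dwmono_def by (intro polyfun_sum_list polyfun_wmono) (use contract_props in blast)

text \<open>The couplings g (u, v) and g (v, u) contribute the same derivative, and 2 / (2 sqrt (2
  N))^2 = 1 / (4 N).\<close>

lemma stein_wmono:
  assumes uv: "u < N" "v < N" and xs: "indices_less N xs"
  shows "(LINT g|gauss (sites N). goe N g u v * wmono N g xs) = (LINT g|gauss (sites N). dwmono N g u v xs) / (4 * real N)"
proof -
  let ?s = "2 * sqrt (2 * real N)"
  have N: "0 < real N" using uv by simp
  have 1: "(LINT g|gauss (sites N). g (u, v) * wmono N g xs) = (LINT g|gauss (sites N). dwmono N g u v xs / ?s)" if "u < N" "v < N" for u v
  proof (rule stein_polyfun)
    show "polyfun (sites N) (\<lambda>g. dwmono N g u v xs / ?s)"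
      unfolding divide_inverse by (intro polyfun.mult polyfun_dwmono polyfun.const xs that)
    show "((\<lambda>t. wmono N (g((u, v) := t)) xs) has_real_derivative dwmono N (g((u, v) := t)) u v xs / ?s) (at t)" for g t
      by (rule has_derivative_wmono[OF that])
  qed (use that polyfun_wmono[OF xs] in auto)
  have int: "integrable (gauss (sites N)) (\<lambda>g. g (u, v) * wmono N g xs)" if "u < N" "v < N" for u v
    using that by (intro polyfun_integrable polyfun.mult polyfun.coord polyfun_wmono xs) auto
  have "(LINT g|gauss (sites N). goe N g u v * wmono N g xs) =
     (LINT g|gauss (sites N). (g (u, v) * wmono N g xs + g (v, u) * wmono N g xs) / ?s)"
    by (simp add: goe_def distrib_right)
  also have "\<dots> = ((LINT g|gauss (sites N). dwmono N g u v xs / ?s) + (LINT g|gauss (sites N). dwmono N g v u xs / ?s)) / ?s"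
    using int uv by (simp only: integral_divide_zero Bochner_Integration.integral_add 1)
  also have "\<dots> = (LINT g|gauss (sites N). dwmono N g u v xs) / (4 * real N)"
    unfolding dwmono_commute[of _ _ v u] integral_divide_zero using N by (simp add: field_simps)
  finally show ?thesis .
qed

text \<open>The number \<open>4\<^sup>k cat k\<close> is the \<open>k\<close>-th Catalan number; \<open>semi\<close> lists the moments of the semicircle law on \<open>[-1, 1]\<close>.\<close>

fun cat :: "nat \<Rightarrow> real" where
  "cat 0 = 1"
| "cat (Suc k) = (1 / 4) * (\<Sum>l\<le>k. cat l * cat (k - l))"

declare cat.simps(2) [simp del]

definition semi :: "nat \<Rightarrow> real" where
  "semi k = (if even k then cat (k div 2) else 0)"

section \<open>Bounds and recursion for the semicircle moments\<close>

lemma cat_nonneg: "0 \<le> cat k"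
proof (induction k rule: less_induct)
  case (less k)
  then show ?case by (cases k) (auto simp: cat.simps intro!: sum_nonneg mult_nonneg_nonneg)
qed

text \<open>A partial sum s is followed by one of size at most 1 + s^2 / 4, and 2 is a fixed point
  of this map.\<close>

lemma sum_cat_le: "(\<Sum>k\<le>n. cat k) \<le> 2"
proof (induction n)
  case (Suc n)
  have "(\<Sum>k\<le>Suc n. cat k) = 1 + (\<Sum>k\<le>n. cat (Suc k))"
    by (subst sum.atMost_Suc_shift) simp
  also have "(\<Sum>k\<le>n. cat (Suc k)) = 1 / 4 * (\<Sum>k\<le>n. \<Sum>l\<le>k. cat l * cat (k - l))"
    by (simp add: cat.simps sum_distrib_left)
  also have "(\<Sum>k\<le>n. \<Sum>l\<le>k. cat l * cat (k - l)) = (\<Sum>(l, m)\<in>{(l, m). l + m \<le> n}. cat l * cat m)"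
    by (rule sum.triangle_reindex_eq[symmetric])
  also have "\<dots> \<le> (\<Sum>(l, m)\<in>{..n} \<times> {..n}. cat l * cat m)"
    by (rule sum_mono2) (auto intro!: mult_nonneg_nonneg cat_nonneg)
  also have "\<dots> = (\<Sum>k\<le>n. cat k) * (\<Sum>k\<le>n. cat k)"
    by (simp add: sum_product sum.cartesian_product)
  also have "\<dots> \<le> 2 * 2"
    using Suc by (intro mult_mono) (auto intro!: sum_nonneg cat_nonneg)
  finally show ?case by simp
qed simp

lemma cat_le_1: "cat k \<le> 1"
proof (cases k)
  case (Suc m)
  have "cat 0 + cat (Suc m) \<le> (\<Sum>k\<le>Suc m. cat k)"
    by (subst sum.atMost_Suc) (auto intro!: add_right_mono member_le_sum cat_nonneg simp del: cat.simps)
  then show ?thesis using sum_cat_le[of "Suc m"] Suc by simp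
qed simp

lemma semi_bounds: "0 \<le> semi k" "semi k \<le> 1"
  by (auto simp: semi_def cat_nonneg cat_le_1)

text \<open>The Catalan recursion in a form without parity: for even k the indices r and k - 1 - r
  have different parity, so each product vanishes; for odd k only even r contribute.\<close>

lemma semi_Suc: "semi (Suc k) = (1 / 4) * (\<Sum>r<k. semi r * semi (k - 1 - r))"
proof (cases "even k")
  case True
  have "semi r * semi (k - 1 - r) = 0" if "r < k" for r
    using True that by (auto simp: semi_def)
  then have "(\<Sum>r<k. semi r * semi (k - 1 - r)) = 0" by (intro sum.neutral) auto
  then show ?thesis using True by (simp add: semi_def[of "Suc k"])
next
  case False
  then obtain m where k: "k = Suc (2 * m)" by (metis oddE Suc_eq_plus1)
  have split: "(\<Sum>r<Suc (2 * m). f r) = (\<Sum>l\<le>m. f (2 * l)) + (\<Sum>l<m. f (Suc (2 * l)))" for f :: "nat \<Rightarrow> real"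
    by (induction m) (simp_all add: algebra_simps)
  have "(\<Sum>r<k. semi r * semi (k - 1 - r)) = (\<Sum>l\<le>m. cat l * cat (m - l))"
  proof -
    have "semi (2 * l) * semi (2 * m - 2 * l) = cat l * cat (m - l)" for l
      by (simp add: semi_def diff_mult_distrib2[symmetric])
    moreover have "semi (Suc (2 * l)) = 0" for l by (simp add: semi_def)
    ultimately show ?thesis unfolding k split by simp
  qed
  then show ?thesis by (simp add: k semi_def cat.simps)
qed

text \<open>The limit of the expectation of a word. The entries of W^k approach those of
  \<open>semi k\<close> times the identity matrix and become deterministic, so the limit is
  multiplicative over the letters.\<close>

fun wlim :: "word \<Rightarrow> real" where
  "wlim [] = 1"
| "wlim ((k, i, j) # xs) = (if i = j then semi k else 0) * wlim xs"

lemma wlim_bounds: "0 \<le> wlim xs \<and> wlim xs \<le> 1"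
proof (induction xs)
  case (Cons x xs)
  obtain k i j where "x = (k, i, j)" by (cases x) auto
  with Cons show ?case using semi_bounds[of k] by (auto simp: mult_le_one)
qed simp

text \<open>Brings any letter to the front, where the integration by parts acts.\<close>

lemma wmono_permute: "xs = ys @ x # zs \<Longrightarrow> wmono N g xs = wmono N g (x # ys @ zs)"
  "xs = ys @ x # zs \<Longrightarrow> wlim xs = wlim (x # ys @ zs)"
proof -
  have "wmono N g (ys @ x # zs) = wmono N g (x # ys @ zs)"
    by (cases x) (induction ys, auto simp: mult_ac)
  moreover have "wlim (ys @ x # zs) = wlim (x # ys @ zs)"
    by (cases x) (induction ys, auto simp: mult_ac)
  ultimately show "xs = ys @ x # zs \<Longrightarrow> wmono N g xs = wmono N g (x # ys @ zs)"
    "xs = ys @ x # zs \<Longrightarrow> wlim xs = wlim (x # ys @ zs)" by auto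
qed

text \<open>Among the contractions of the entry (i, a) of W, only those that create a letter (r, a,
  a) survive for all N values of a; divided by 4 N they reproduce the recursion of
  \<open>semi\<close>. Each of the others contains a letter whose limit vanishes unless a = i or
  unless a = j, so together they contribute at most k + 2 deg ys to the sum over a.\<close>

lemma contract_limit:
  assumes i: "i < N" and j: "j < N" and N: "0 < N" and ys: "indices_less N ys"
  shows "\<bar>(\<Sum>a<N. \<Sum>zs\<leftarrow>contract i a ((k, a, j) # ys). wlim zs) / (4 * real N) - wlim ((Suc k, i, j) # ys)\<bar>
    \<le> real (k + 2 * deg ys) / (4 * real N)"
proof -
  define A where "A a = (\<Sum>r<k. wlim ((r, a, i) # (k - 1 - r, a, j) # ys))" for a
  define B where "B = (\<Sum>r<k. semi r * semi (k - 1 - r)) * (if i = j then 1 else 0) * wlim ys"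
  define C where "C a = (\<Sum>zs\<leftarrow>contract i a ys. wlim ((k, a, j) # zs))" for a
  have split: "(\<Sum>zs\<leftarrow>contract i a ((k, a, j) # ys). wlim zs) = A a + B + C a" for a
    by (simp add: A_def B_def C_def comp_def interv_sum_list_conv_sum_set_nat atLeast0LessThan sum_distrib_right mult.assoc)
  have A: "0 \<le> A a \<and> A a \<le> (if a = i then real k else 0)" for a
  proof (cases "a = i")
    case True
    have "A a \<le> (\<Sum>r<k. 1)"
      unfolding A_def using wlim_bounds by (intro sum_mono) blast
    moreover have "0 \<le> A a"
      unfolding A_def using wlim_bounds by (intro sum_nonneg) blast
    ultimately show ?thesis using True by simp
  qed (simp add: A_def)
  have C: "0 \<le> C a \<and> C a \<le> (if a = j then real (2 * deg ys) else 0)" if a: "a < N" for a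
  proof (cases "a = j")
    case True
    have "C a \<le> (\<Sum>zs\<leftarrow>contract i a ys. 1)"
      unfolding C_def using wlim_bounds by (intro sum_list_mono) blast
    also have "\<dots> = real (2 * deg ys)"
      using contract_props(2)[OF i a ys] by (simp add: sum_list_triv)
    finally have "C a \<le> real (2 * deg ys)" .
    moreover have "0 \<le> C a"
      unfolding C_def using wlim_bounds by (intro sum_list_nonneg) (auto simp del: wlim.simps)
    ultimately show ?thesis using True by simp
  next
    case False
    then have "C a = (\<Sum>zs\<leftarrow>contract i a ys. 0)"
      unfolding C_def by (intro arg_cong[where f=sum_list] map_cong) auto
    then show ?thesis using False by simp
  qed
  have "wlim ((Suc k, i, j) # ys) = B / 4"
    by (simp add: B_def semi_Suc)
  then have "(\<Sum>a<N. \<Sum>zs\<leftarrow>contract i a ((k, a, j) # ys). wlim zs) / (4 * real N) - wlim ((Suc k, i, j) # ys)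
     = ((\<Sum>a<N. A a) + (\<Sum>a<N. C a)) / (4 * real N)"
    unfolding split sum.distrib using N by (simp add: add_divide_distrib)
  moreover have "0 \<le> (\<Sum>a<N. A a)" "(\<Sum>a<N. A a) \<le> real k"
  proof -
    show "0 \<le> (\<Sum>a<N. A a)" using A by (intro sum_nonneg) auto
    have "(\<Sum>a<N. A a) \<le> (\<Sum>a<N. (if a = i then real k else 0))" using A by (intro sum_mono) auto
    then show "(\<Sum>a<N. A a) \<le> real k" using i by (simp add: sum.delta)
  qed
  moreover have "0 \<le> (\<Sum>a<N. C a)" "(\<Sum>a<N. C a) \<le> real (2 * deg ys)"
  proof -
    show "0 \<le> (\<Sum>a<N. C a)" using C by (intro sum_nonneg) auto
    have "(\<Sum>a<N. C a) \<le> (\<Sum>a<N. (if a = j then real (2 * deg ys) else 0))" using C by (intro sum_mono) auto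
    then show "(\<Sum>a<N. C a) \<le> real (2 * deg ys)" using j by (simp add: sum.delta)
  qed
  ultimately show ?thesis using N by (auto intro!: divide_right_mono)
qed

lemma abs_sum_list_le:
  "(\<And>x. x \<in> set xs \<Longrightarrow> \<bar>f x - h x\<bar> \<le> (c::real)) \<Longrightarrow> \<bar>(\<Sum>x\<leftarrow>xs. f x) - (\<Sum>x\<leftarrow>xs. h x)\<bar> \<le> real (length xs) * c"
proof (induction xs)
  case (Cons x xs)
  then have "\<bar>f x - h x\<bar> \<le> c" "\<bar>(\<Sum>x\<leftarrow>xs. f x) - (\<Sum>x\<leftarrow>xs. h x)\<bar> \<le> real (length xs) * c" by auto
  then show ?case by (simp add: distrib_right abs_le_iff)
qed simp

text \<open>The loop equations: integration by parts expresses a moment through moments whose degree is smaller by two.\<close>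

theorem wmono_expectation:
  "\<exists>C\<ge>0. \<forall>N>0. \<forall>xs. deg xs = d \<longrightarrow> indices_less N xs \<longrightarrow>
     \<bar>(LINT g|gauss (sites N). wmono N g xs) - wlim xs\<bar> \<le> C / real N"
proof (induction d rule: less_induct)
  case (less d)
  show ?case
  proof (cases "d = 0")
    case True
    have "wmono N g xs = wlim xs" if "deg xs = 0" for N g xs
      using that
    proof (induction xs)
      case (Cons x xs)
      obtain k i j where "x = (k, i, j)" by (cases x) auto
      with Cons show ?case by (simp add: deg_def semi_def)
    qed simp
    moreover have "measure (gauss (sites N)) (space (gauss (sites N))) = 1" for N
      by (rule prob_space.prob_space[OF prob_space_gauss])
    ultimately show ?thesis using True by (intro exI[of _ 0]) simp
  next
    case d: False
    \<comment> \<open>The induction hypothesis for d - 2. If d = 1, no word satisfies the premise on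
      the degree, and C = 0 will do.\<close>
    obtain C where C: "0 \<le> C" "\<And>N xs. 0 < N \<Longrightarrow> Suc (Suc (deg xs)) = d \<Longrightarrow> indices_less N xs \<Longrightarrow>
       \<bar>(LINT g|gauss (sites N). wmono N g xs) - wlim xs\<bar> \<le> C / real N"
    proof (cases "2 \<le> d")
      case True
      with less[of "d - 2"] show ?thesis by (auto intro!: that)
    next
      case False
      show ?thesis by (rule that[of 0]) (use False in auto)
    qed
    have "\<bar>(LINT g|gauss (sites N). wmono N g xs) - wlim xs\<bar> \<le> (real (2 * d) * C + real (2 * d)) / 4 / real N"
      if N: "0 < N" and xs: "deg xs = d" "indices_less N xs" for N xs
    proof -
      have "\<exists>x\<in>set xs. fst x \<noteq> 0"
      proof (rule ccontr)
        assume "\<not> ?thesis"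
        then have "deg xs = 0" unfolding deg_def by (induction xs) auto
        then show False using xs d by simp
      qed
      then obtain x ps qs where "xs = ps @ x # qs" "fst x \<noteq> 0" by (meson split_list)
      moreover then obtain k i j where "x = (Suc k, i, j)" by (metis prod_cases3 fst_conv not0_implies_Suc)
      ultimately obtain k i j where x: "xs = ps @ (Suc k, i, j) # qs" by auto
      define ys where "ys = ps @ qs"
      have ij: "i < N" "j < N" and ys: "indices_less N ys" and dg: "Suc (k + deg ys) = d"
        using xs by (auto simp: x ys_def indices_less_def deg_def)
      have idx: "indices_less N ((k, a, j) # ys)" if "a < N" for a
        using ys ij that by (auto simp: indices_less_def)
      let ?c = "\<lambda>a. contract i a ((k, a, j) # ys)"
      have cp: "indices_less N zs" "Suc (Suc (deg zs)) = d" if "a < N" "zs \<in> set (?c a)" for a zs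
        using contract_props(1)[OF ij(1) that(1) idx[OF that(1)]] that(2) dg by (auto simp: deg_def)
      have len: "length (?c a) = 2 * (d - 1)" if "a < N" for a
        using contract_props(2)[OF ij(1) that idx[OF that]] dg by (auto simp: deg_def)
      \<comment> \<open>One factor W is split off a letter of positive degree: the entry (i, j) of
        W^(k+1) is the sum over a of the entries (i, a) of W and (a, j) of W^k. The split factor is
        then integrated by parts.\<close>
      have "(LINT g|gauss (sites N). wmono N g xs) = (LINT g|gauss (sites N). (\<Sum>a<N. goe N g i a * wmono N g ((k, a, j) # ys)))"
        unfolding wmono_permute(1)[OF x] ys_def[symmetric] by (simp add: sum_distrib_right mult.assoc)
      also have "\<dots> = (\<Sum>a<N. LINT g|gauss (sites N). goe N g i a * wmono N g ((k, a, j) # ys))"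
        by (rule Bochner_Integration.integral_sum)
           (auto intro!: polyfun_integrable polyfun.mult[OF polyfun_goe polyfun_wmono] idx ij simp del: wmono.simps)
      also have "\<dots> = (\<Sum>a<N. (LINT g|gauss (sites N). dwmono N g i a ((k, a, j) # ys)) / (4 * real N))"
        using ij idx by (intro sum.cong refl stein_wmono) auto
      also have "\<dots> = (\<Sum>a<N. \<Sum>zs\<leftarrow>?c a. LINT g|gauss (sites N). wmono N g zs) / (4 * real N)"
      proof -
        have "(LINT g|gauss (sites N). dwmono N g i a ((k, a, j) # ys)) = (\<Sum>zs\<leftarrow>?c a. LINT g|gauss (sites N). wmono N g zs)" if "a < N" for a
        proof -
          have "(LINT g|gauss (sites N). (\<Sum>zs\<leftarrow>L. wmono N g zs)) = (\<Sum>zs\<leftarrow>L. LINT g|gauss (sites N). wmono N g zs)"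
            if "\<forall>zs\<in>set L. indices_less N zs" for L
            using that
          proof (induction L)
            case (Cons z L)
            then show ?case
              by (simp, subst Bochner_Integration.integral_add)
                 (auto intro!: polyfun_integrable polyfun_wmono polyfun_sum_list)
          qed simp
          then show ?thesis unfolding dwmono_def using cp(1)[OF that] by blast
        qed
        then show ?thesis by (simp add: sum_divide_distrib)
      qed
      finally have E: "(LINT g|gauss (sites N). wmono N g xs) = (\<Sum>a<N. \<Sum>zs\<leftarrow>?c a. LINT g|gauss (sites N). wmono N g zs) / (4 * real N)" .
      have 1: "\<bar>(\<Sum>a<N. \<Sum>zs\<leftarrow>?c a. LINT g|gauss (sites N). wmono N g zs) - (\<Sum>a<N. \<Sum>zs\<leftarrow>?c a. wlim zs)\<bar> \<le> (\<Sum>a<N. real (2 * d) * (C / real N))"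
        unfolding sum_subtractf[symmetric]
      proof (rule order_trans[OF sum_abs], rule sum_mono)
        fix a assume a: "a \<in> {..<N}"
        have "\<bar>(\<Sum>zs\<leftarrow>?c a. LINT g|gauss (sites N). wmono N g zs) - (\<Sum>zs\<leftarrow>?c a. wlim zs)\<bar> \<le> real (length (?c a)) * (C / real N)"
          using a cp C(2) N by (intro abs_sum_list_le) auto
        also have "\<dots> \<le> real (2 * d) * (C / real N)"
          using a C(1) by (subst len) (auto intro!: mult_right_mono divide_right_mono)
        finally show "\<bar>(\<Sum>zs\<leftarrow>?c a. LINT g|gauss (sites N). wmono N g zs) - (\<Sum>zs\<leftarrow>?c a. wlim zs)\<bar> \<le> real (2 * d) * (C / real N)" .
      qed
      have "\<bar>(LINT g|gauss (sites N). wmono N g xs) - wlim xs\<bar> \<le>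
         \<bar>(LINT g|gauss (sites N). wmono N g xs) - (\<Sum>a<N. \<Sum>zs\<leftarrow>?c a. wlim zs) / (4 * real N)\<bar> +
         \<bar>(\<Sum>a<N. \<Sum>zs\<leftarrow>?c a. wlim zs) / (4 * real N) - wlim xs\<bar>" by simp
      also have "\<dots> \<le> real (2 * d) * C / (4 * real N) + real (2 * d) / (4 * real N)"
      proof (rule add_mono)
        have "\<bar>(LINT g|gauss (sites N). wmono N g xs) - (\<Sum>a<N. \<Sum>zs\<leftarrow>?c a. wlim zs) / (4 * real N)\<bar> =
            \<bar>(\<Sum>a<N. \<Sum>zs\<leftarrow>?c a. LINT g|gauss (sites N). wmono N g zs) - (\<Sum>a<N. \<Sum>zs\<leftarrow>?c a. wlim zs)\<bar> / (4 * real N)"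
          unfolding E using N by (simp add: diff_divide_distrib[symmetric] abs_divide)
        also have "\<dots> \<le> (\<Sum>a<N. real (2 * d) * (C / real N)) / (4 * real N)"
          using 1 by (rule divide_right_mono) simp
        also have "\<dots> = real (2 * d) * C / (4 * real N)" using N by simp
        finally show "\<bar>(LINT g|gauss (sites N). wmono N g xs) - (\<Sum>a<N. \<Sum>zs\<leftarrow>?c a. wlim zs) / (4 * real N)\<bar> \<le> real (2 * d) * C / (4 * real N)" .
        have "\<bar>(\<Sum>a<N. \<Sum>zs\<leftarrow>?c a. wlim zs) / (4 * real N) - wlim xs\<bar> \<le> real (k + 2 * deg ys) / (4 * real N)"
          unfolding wmono_permute(2)[OF x] ys_def[symmetric] by (rule contract_limit[OF ij N ys])
        also have "\<dots> \<le> real (2 * d) / (4 * real N)"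
          using dg by (intro divide_right_mono) auto
        finally show "\<bar>(\<Sum>a<N. \<Sum>zs\<leftarrow>?c a. wlim zs) / (4 * real N) - wlim xs\<bar> \<le> real (2 * d) / (4 * real N)" .
      qed
      also have "\<dots> = (real (2 * d) * C + real (2 * d)) / 4 / real N" by (simp add: add_divide_distrib)
      finally show ?thesis .
    qed
    then show ?thesis using C(1) by (intro exI[of _ "(real (2 * d) * C + real (2 * d)) / 4"]) auto
  qed
qed

text \<open>The word consisting of (k, i, j) twice has the limit l^2, where l is the limit of the
  single letter, so the terms of the expanded square cancel up to O(1 / N), uniformly in i and
  j.\<close>

theorem goe_pow_second_moment:
  "\<exists>C\<ge>0. \<forall>N>0. \<forall>i<N. \<forall>j<N.
     integrable (gauss (sites N)) (\<lambda>g. (goe_pow N g k i j - (if i = j then semi k else 0))\<^sup>2) \<and>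
     (LINT g|gauss (sites N). (goe_pow N g k i j - (if i = j then semi k else 0))\<^sup>2) \<le> C / real N"
proof -
  obtain C1 where C1: "0 \<le> C1" "\<And>N xs. 0 < N \<Longrightarrow> deg xs = k \<Longrightarrow> indices_less N xs \<Longrightarrow>
       \<bar>(LINT g|gauss (sites N). wmono N g xs) - wlim xs\<bar> \<le> C1 / real N"
    using wmono_expectation[of k] by auto
  obtain C2 where C2: "0 \<le> C2" "\<And>N xs. 0 < N \<Longrightarrow> deg xs = 2 * k \<Longrightarrow> indices_less N xs \<Longrightarrow>
       \<bar>(LINT g|gauss (sites N). wmono N g xs) - wlim xs\<bar> \<le> C2 / real N"
    using wmono_expectation[of "2 * k"] by auto
  have "integrable (gauss (sites N)) (\<lambda>g. (goe_pow N g k i j - l)\<^sup>2) \<and>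
     (LINT g|gauss (sites N). (goe_pow N g k i j - l)\<^sup>2) \<le> (C2 + 2 * C1) / real N"
    if N: "0 < N" and ij: "i < N" "j < N" and l: "l = (if i = j then semi k else 0)" for N i j l
  proof
    interpret prob_space "gauss (sites N)" by (rule prob_space_gauss)
    let ?w = "\<lambda>g. goe_pow N g k i j"
    have i1: "integrable (gauss (sites N)) ?w" and i2: "integrable (gauss (sites N)) (\<lambda>g. ?w g * ?w g)"
      using ij by (auto intro!: polyfun_integrable polyfun.mult polyfun_goe_pow)
    have eq: "(?w g - l)\<^sup>2 = ?w g * ?w g - 2 * l * ?w g + l * l" for g
      by (simp add: power2_eq_square algebra_simps)
    show "integrable (gauss (sites N)) (\<lambda>g. (?w g - l)\<^sup>2)"
      unfolding eq using i1 i2 by simp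
    have e1: "\<bar>expectation ?w - l\<bar> \<le> C1 / real N"
      using C1(2)[OF N, of "[(k, i, j)]"] ij l by (simp add: deg_def indices_less_def)
    have e2: "\<bar>expectation (\<lambda>g. ?w g * ?w g) - l * l\<bar> \<le> C2 / real N"
      using C2(2)[OF N, of "[(k, i, j), (k, i, j)]"] ij l by (simp add: deg_def indices_less_def)
    have lb: "0 \<le> l" "l \<le> 1" using l semi_bounds[of k] by auto
    have "expectation (\<lambda>g. (?w g - l)\<^sup>2) = (expectation (\<lambda>g. ?w g * ?w g) - l * l) - 2 * (l * (expectation ?w - l))"
      unfolding eq using i1 i2 prob_space by (simp add: algebra_simps)
    also have "\<dots> \<le> C2 / real N + 2 * (1 * (C1 / real N))"
    proof -
      have "\<bar>l * (expectation ?w - l)\<bar> \<le> 1 * (C1 / real N)"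
        unfolding abs_mult using e1 lb by (intro mult_mono) auto
      then show ?thesis using e2 by (simp add: abs_le_iff)
    qed
    finally show "expectation (\<lambda>g. (?w g - l)\<^sup>2) \<le> (C2 + 2 * C1) / real N"
      by (simp add: add_divide_distrib)
  qed
  then show ?thesis using C1(1) C2(1) by (intro exI[of _ "C2 + 2 * C1"]) auto
qed

text \<open>
  If all ratios stayed below \<open>\<rho> < 1\<close>, the generating function \<open>A(y)\<close> would converge beyond \<open>y = 1\<close>; but
  \<open>A = 1 + (y/4) A\<^sup>2\<close> has no real solution there.
\<close>

lemma cat_ratio:
  assumes d: "0 < d" "d < 1"
  shows "\<exists>m. (1 - d) * cat m \<le> cat (Suc m)"
proof (rule ccontr)
  assume "\<not> ?thesis"
  then have less: "cat (Suc m) < (1 - d) * cat m" for m by (simp add: not_le)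
  define \<rho> where "\<rho> = 1 - d"
  have \<rho>: "0 < \<rho>" "\<rho> < 1" using d by (auto simp: \<rho>_def)
  have pow: "cat m \<le> \<rho> ^ m" for m
  proof (induction m)
    case (Suc m)
    have "cat (Suc m) \<le> \<rho> * cat m" using less[of m] by (simp add: \<rho>_def)
    also have "\<dots> \<le> \<rho> * \<rho> ^ m" using Suc \<rho> by (intro mult_left_mono) auto
    finally show ?case by simp
  qed simp
  \<comment> \<open>A point strictly between 1 and 1 / \<rho>: the series still converges there by
    \<open>pow\<close>, although it lies beyond the singularity of the quadratic equation.\<close>
  define y where "y = 2 / (1 + \<rho>)"
  have y: "1 < y" "y * \<rho> < 1" using \<rho> by (auto simp: y_def field_simps)
  define A where "A = (\<Sum>k. cat k * y ^ k)"
  have sm: "summable (\<lambda>k. norm (cat k * y ^ k))"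
  proof (rule summable_comparison_test')
    show "summable (\<lambda>k. (y * \<rho>) ^ k)" using y \<rho> by (intro summable_geometric) auto
    show "norm (norm (cat k * y ^ k)) \<le> (y * \<rho>) ^ k" for k
      using pow[of k] y cat_nonneg[of k] by (simp add: power_mult_distrib mult.commute mult_left_mono abs_mult)
  qed
  have "A * A = (\<Sum>k. \<Sum>i\<le>k. (cat i * y ^ i) * (cat (k - i) * y ^ (k - i)))"
    unfolding A_def by (rule Cauchy_product[OF sm sm])
  also have "\<dots> = (\<Sum>k. 4 / y * (cat (Suc k) * y ^ Suc k))"
  proof (rule suminf_cong)
    fix k
    have "(\<Sum>i\<le>k. (cat i * y ^ i) * (cat (k - i) * y ^ (k - i))) = (\<Sum>i\<le>k. cat i * cat (k - i)) * y ^ k"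
      unfolding sum_distrib_right by (intro sum.cong refl) (simp add: power_add[symmetric] mult_ac)
    then show "(\<Sum>i\<le>k. (cat i * y ^ i) * (cat (k - i) * y ^ (k - i))) = 4 / y * (cat (Suc k) * y ^ Suc k)"
      using y by (simp add: cat.simps)
  qed
  also have "\<dots> = 4 / y * (\<Sum>k. cat (Suc k) * y ^ Suc k)"
    using summable_norm_cancel[OF sm] by (intro suminf_mult) (subst summable_Suc_iff)
  also have "(\<Sum>k. cat (Suc k) * y ^ Suc k) = A - 1"
    unfolding A_def using suminf_split_head[OF summable_norm_cancel[OF sm]] by simp
  finally have h: "y * (A * A) = 4 * (A - 1)" using y by (simp add: field_simps)
  have "(y * A - 2)\<^sup>2 = y * (y * (A * A)) - 4 * (y * A) + 4"
    by (simp add: power2_eq_square algebra_simps)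
  also have "\<dots> = 4 - 4 * y"
    unfolding h by (simp add: algebra_simps)
  finally have "(y * A - 2)\<^sup>2 = 4 - 4 * y" .
  then show False using y zero_le_power2[of "y * A - 2"] by simp
qed

lemma cat_pos: "0 < cat m"
proof (induction m)
  case (Suc m)
  have "cat 0 * cat (m - 0) \<le> (\<Sum>l\<le>m. cat l * cat (m - l))"
    by (rule member_le_sum) (auto intro!: mult_nonneg_nonneg cat_nonneg)
  then show ?case using Suc by (simp add: cat.simps)
qed simp

section \<open>Shifted replicas\<close>

text \<open>
  The random vector \<open>m + c y\<close> is used with the sign of \<open>y\<close> chosen so that the cross term of the Hamiltonian, which is
  \<open>ip N w y\<close> up to a factor, is nonnegative. The price is a factor 2 in the change of variables.
\<close>

definition flip :: "nat \<Rightarrow> (nat \<Rightarrow> real) \<Rightarrow> (nat \<Rightarrow> real) \<Rightarrow> real" where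
  "flip N w y = (if 0 \<le> ip N w y then 1 else - 1)"

definition shifted :: "nat \<Rightarrow> real \<Rightarrow> (nat \<Rightarrow> real) \<Rightarrow> (nat \<Rightarrow> real) \<Rightarrow> (nat \<Rightarrow> real) \<Rightarrow> nat \<Rightarrow> real" where
  "shifted N c m w y = (\<lambda>i\<in>{..<N}. m i + c * (flip N w y * y i))"

lemma measurable_flip [measurable]: "flip N w \<in> borel_measurable (bor N)"
proof -
  have [measurable]: "(\<lambda>y. ip N w y) \<in> borel_measurable (bor N)" by (rule measurable_ip) measurable
  show ?thesis unfolding flip_def by measurable
qed

lemma measurable_shifted [measurable]: "shifted N c m w \<in> measurable (bor N) (bor N)"
  unfolding shifted_def by measurable

text \<open>The sign depends on y, so this is not an injective substitution. Its integrand is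
  dominated by the sum of the integrands at y and at - y, and reflection preserves Lebesgue measure;
  hence the factor 2.\<close>

lemma nn_integral_leb_flip_le:
  assumes F[measurable]: "F \<in> borel_measurable (bor N)" and S[measurable]: "S \<in> sets (bor N)"
    and sym: "\<And>y. y \<in> S \<Longrightarrow> (\<lambda>i\<in>{..<N}. - y i) \<in> S"
  shows "(\<integral>\<^sup>+y. F (\<lambda>i\<in>{..<N}. flip N w y * y i) * indicator S y \<partial>leb N) \<le> 2 * (\<integral>\<^sup>+y. F y \<partial>leb N)"
proof -
  have [measurable_cong]: "sets (leb N) = sets (bor N)" by (rule sets_leb)
  have neg[measurable]: "(\<lambda>y. \<lambda>i\<in>{..<N}. - y i :: real) \<in> measurable (bor N) (bor N)" by measurable
  have Fm: "(\<lambda>y. F (\<lambda>i\<in>{..<N}. - y i)) \<in> borel_measurable (bor N)"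
    by (rule measurable_compose[OF neg F])
  have "(\<integral>\<^sup>+y. F (\<lambda>i\<in>{..<N}. flip N w y * y i) * indicator S y \<partial>leb N) \<le> (\<integral>\<^sup>+y. F y + F (\<lambda>i\<in>{..<N}. - y i) \<partial>leb N)"
  proof (rule nn_integral_mono)
    fix y assume y: "y \<in> space (leb N)"
    have "(\<lambda>i\<in>{..<N}. y i) = y" using y by (auto simp: space_PiM PiE_iff extensional_restrict)
    then show "F (\<lambda>i\<in>{..<N}. flip N w y * y i) * indicator S y \<le> F y + F (\<lambda>i\<in>{..<N}. - y i)"
      by (auto simp: flip_def indicator_def)
  qed
  also have "\<dots> = (\<integral>\<^sup>+y. F y \<partial>leb N) + (\<integral>\<^sup>+y. F (\<lambda>i\<in>{..<N}. - y i) \<partial>leb N)"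
    using Fm by (intro nn_integral_add) measurable
  also have "(\<integral>\<^sup>+y. F (\<lambda>i\<in>{..<N}. - y i) \<partial>leb N) = (\<integral>\<^sup>+y. F y \<partial>leb N)"
    using nn_integral_PiM_affine[of "{..<N}" "-1" F "\<lambda>_. 0"] by simp
  finally show ?thesis by (simp only: mult_2)
qed

text \<open>The sphere is opened up to the punctured ball of squared radius R, where x = m + c y is
  an affine substitution with Jacobian c^N; the indicator keeps the y whose image stays in that
  ball. The ratio of volumes together with c^N is the entropy price of one replica.\<close>

lemma sphere_shift_le:
  assumes N: "0 < N" and c: "0 < c" and R: "0 < R" and S: "0 \<le> r" "r < s"
    and f[measurable]: "f \<in> borel_measurable (bor N)"
  shows "ennreal (shell_vol N r s / shell_vol N 0 R * c ^ N / 2) *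
     (\<integral>\<^sup>+y. f (radial_projection N (shifted N c m w y)) * indicator {y \<in> space (bor N). shifted N c m w y \<in> shell N 0 R} y \<partial>shell_uniform N r s)
     \<le> (\<integral>\<^sup>+\<sigma>. f \<sigma> \<partial>sphere_uniform N)"
proof -
  have [measurable_cong]: "sets (leb N) = sets (bor N)" by (rule sets_leb)
  let ?V = "shell_vol N 0 R" and ?v = "shell_vol N r s"
  have V: "0 < ?V" and v: "0 < ?v" using shell_vol_pos[OF N] R S by auto
  define h where "h x = f (radial_projection N x) * indicator (shell N 0 R) x" for x
  have h[measurable]: "h \<in> borel_measurable (bor N)" unfolding h_def by measurable
  define F where "F y = h (\<lambda>i\<in>{..<N}. m i + c * y i)" for y
  have am: "(\<lambda>y. \<lambda>i\<in>{..<N}. m i + c * y i) \<in> measurable (bor N) (bor N)" by measurable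
  have F[measurable]: "F \<in> borel_measurable (bor N)"
    unfolding F_def by (rule measurable_compose[OF am h])
  have Fs: "F (\<lambda>i\<in>{..<N}. flip N w y * y i) = h (shifted N c m w y)" for y
    unfolding F_def shifted_def by (rule arg_cong[where f=h]) auto
  have "(\<integral>\<^sup>+\<sigma>. f \<sigma> \<partial>sphere_uniform N) = (\<integral>\<^sup>+x. f (radial_projection N x) \<partial>shell_uniform N 0 R)"
    by (subst sphere_uniform_shell[OF N _ R]) (auto simp: nn_integral_distr)
  also have "\<dots> = (\<integral>\<^sup>+x. h x \<partial>leb N) / ennreal ?V"
    unfolding h_def using R by (intro nn_integral_shell_uniform[OF N]) auto
  also have "(\<integral>\<^sup>+x. h x \<partial>leb N) = ennreal (c ^ N) * (\<integral>\<^sup>+y. F y \<partial>leb N)"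
    unfolding F_def using c nn_integral_PiM_affine[of "{..<N}" c h m] by simp
  finally have eq: "(\<integral>\<^sup>+\<sigma>. f \<sigma> \<partial>sphere_uniform N) = ennreal (c ^ N) * (\<integral>\<^sup>+y. F y \<partial>leb N) / ennreal ?V" .
  let ?I = "\<integral>\<^sup>+y. f (radial_projection N (shifted N c m w y)) * indicator {y \<in> space (bor N). shifted N c m w y \<in> shell N 0 R} y \<partial>shell_uniform N r s"
  have "?I = (\<integral>\<^sup>+y. h (shifted N c m w y) \<partial>shell_uniform N r s)"
    by (intro nn_integral_cong) (auto simp: h_def indicator_def)
  also have "\<dots> = (\<integral>\<^sup>+y. h (shifted N c m w y) * indicator (shell N r s) y \<partial>leb N) / ennreal ?v"
    using measurable_compose[OF measurable_shifted h] by (intro nn_integral_shell_uniform[OF N S])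
  also have "\<dots> \<le> 2 * (\<integral>\<^sup>+y. F y \<partial>leb N) / ennreal ?v"
    unfolding Fs[symmetric]
  proof (rule divide_right_mono_ennreal, rule nn_integral_leb_flip_le[OF F sets_shell])
    show "(\<lambda>i\<in>{..<N}. - y i) \<in> shell N r s" if "y \<in> shell N r s" for y
      using that ip_scale[of N "-1" y "-1" y] by (auto simp: shell_def space_PiM)
  qed
  finally have "ennreal (?v / ?V * c ^ N / 2) * ?I \<le> ennreal (?v / ?V * c ^ N / 2) * (2 * (\<integral>\<^sup>+y. F y \<partial>leb N) / ennreal ?v)"
    by (rule mult_left_mono) simp
  also have "\<dots> = ennreal (c ^ N) * (\<integral>\<^sup>+y. F y \<partial>leb N) / ennreal ?V"
  proof -
    have "2 * A / ennreal ?v = ennreal (2 / ?v) * A" for A :: ennreal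
    proof -
      have "ennreal (2 / ?v) = ennreal 2 / ennreal ?v"
        using v by (simp only: divide_ennreal)
      then show ?thesis
        by (simp add: ennreal_times_divide ennreal_divide_times)
    qed
    moreover have "B * A / ennreal ?V = ennreal (1 / ?V) * (B * A)" for A B :: ennreal
    proof -
      have "ennreal (1 / ?V) = ennreal 1 / ennreal ?V" using V by (simp only: divide_ennreal)
      then show ?thesis by (simp add: ennreal_times_divide ennreal_divide_times)
    qed
    moreover have "ennreal (?v / ?V * c ^ N / 2) * (ennreal (2 / ?v) * A) = ennreal (1 / ?V) * (ennreal (c ^ N) * A)" for A
      using v V c by (simp add: mult.assoc[symmetric] ennreal_mult[symmetric])
    ultimately show ?thesis by simp
  qed
  finally show ?thesis by (simp only: eq)
qed

text \<open>Tensorisation: the one-replica inequality is applied to one coordinate after another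
  with the others frozen. The price \<kappa> is paid once per replica, while \<Phi> may couple the
  replicas.\<close>

lemma nn_integral_PiM_le:
  assumes "finite J" and k: "0 \<le> (\<kappa>::real)"
    and L: "prob_space L" and U: "prob_space U"
    and T: "\<And>j. T j \<in> measurable U L" and D: "\<And>j. D j \<in> sets U"
    and le: "\<And>j f. j \<in> J \<Longrightarrow> f \<in> borel_measurable L \<Longrightarrow>
      ennreal \<kappa> * (\<integral>\<^sup>+y. f (T j y) * indicator (D j) y \<partial>U) \<le> (\<integral>\<^sup>+\<sigma>. f \<sigma> \<partial>L)"
    and "\<Phi> \<in> borel_measurable (\<Pi>\<^sub>M j\<in>J. L)"
  shows "ennreal (\<kappa> ^ card J) * (\<integral>\<^sup>+y. \<Phi> (\<lambda>j\<in>J. T j (y j)) * (\<Prod>j\<in>J. indicator (D j) (y j)) \<partial>(\<Pi>\<^sub>M j\<in>J. U)) \<le> (\<integral>\<^sup>+\<sigma>. \<Phi> \<sigma> \<partial>(\<Pi>\<^sub>M j\<in>J. L))"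
  using assms(1,7,8)
proof (induction J arbitrary: \<Phi> rule: finite_induct)
  case empty
  then show ?case by (simp add: PiM_empty nn_integral_count_space_finite)
next
  case (insert j J)
  interpret PL: product_sigma_finite "\<lambda>_. L"
    by (intro product_sigma_finite.intro prob_space_imp_sigma_finite L)
  interpret PU: product_sigma_finite "\<lambda>_. U"
    by (intro product_sigma_finite.intro prob_space_imp_sigma_finite U)
  interpret L: prob_space L by fact
  interpret U: prob_space U by fact
  note T[measurable] D[measurable]
  note [measurable] = insert.prems(2)
  have up: "(\<lambda>(x, y). x(j := y)) \<in> measurable ((\<Pi>\<^sub>M i\<in>J. L) \<Otimes>\<^sub>M L) (\<Pi>\<^sub>M i\<in>insert j J. L)" by measurable
  have [measurable]: "(\<lambda>(x, y). \<Phi> (x(j := y))) \<in> borel_measurable ((\<Pi>\<^sub>M i\<in>J. L) \<Otimes>\<^sub>M L)"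
    using measurable_compose[OF up insert.prems(2)] by (simp add: case_prod_beta')
  have m2: "(\<lambda>x. \<integral>\<^sup>+y. \<Phi> (x(j := T j y)) * indicator (D j) y \<partial>U) \<in> borel_measurable (\<Pi>\<^sub>M i\<in>J. L)"
    by measurable
  have rm: "(\<lambda>y. \<lambda>i\<in>insert j J. T i (y i)) \<in> measurable (\<Pi>\<^sub>M i\<in>insert j J. U) (\<Pi>\<^sub>M i\<in>insert j J. L)" by measurable
  have m3: "(\<lambda>y. \<Phi> (\<lambda>i\<in>insert j J. T i (y i)) * (\<Prod>i\<in>insert j J. indicator (D i) (y i))) \<in> borel_measurable (\<Pi>\<^sub>M i\<in>insert j J. U)"
    using measurable_compose[OF rm insert.prems(2)] by measurable
  have "ennreal (\<kappa> ^ card (insert j J)) * (\<integral>\<^sup>+y. \<Phi> (\<lambda>i\<in>insert j J. T i (y i)) * (\<Prod>i\<in>insert j J. indicator (D i) (y i)) \<partial>(\<Pi>\<^sub>M i\<in>insert j J. U))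
    = ennreal \<kappa> * (ennreal (\<kappa> ^ card J) * (\<integral>\<^sup>+y. (\<integral>\<^sup>+z. \<Phi> (\<lambda>i\<in>insert j J. T i ((y(j := z)) i)) * (\<Prod>i\<in>insert j J. indicator (D i) ((y(j := z)) i)) \<partial>U) \<partial>(\<Pi>\<^sub>M i\<in>J. U)))"
    using insert.hyps k by (subst PU.product_nn_integral_insert[OF insert.hyps m3]) (simp add: ennreal_mult mult.assoc)
  also have "(\<integral>\<^sup>+y. (\<integral>\<^sup>+z. \<Phi> (\<lambda>i\<in>insert j J. T i ((y(j := z)) i)) * (\<Prod>i\<in>insert j J. indicator (D i) ((y(j := z)) i)) \<partial>U) \<partial>(\<Pi>\<^sub>M i\<in>J. U))
    = (\<integral>\<^sup>+y. (\<integral>\<^sup>+z. \<Phi> ((\<lambda>i\<in>J. T i (y i))(j := T j z)) * indicator (D j) z \<partial>U) * (\<Prod>i\<in>J. indicator (D i) (y i)) \<partial>(\<Pi>\<^sub>M i\<in>J. U))"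
  proof (rule nn_integral_cong)
    fix y assume y: "y \<in> space (\<Pi>\<^sub>M i\<in>J. U)"
    have e1: "(\<lambda>i\<in>insert j J. T i ((y(j := z)) i)) = (\<lambda>i\<in>J. T i (y i))(j := T j z)" for z
      using insert.hyps by (auto simp: fun_eq_iff)
    have e2: "(\<Prod>i\<in>insert j J. indicator (D i) ((y(j := z)) i)) = indicator (D j) z * (\<Prod>i\<in>J. indicator (D i) (y i) :: ennreal)" for z
      using insert.hyps by (auto intro!: arg_cong2[where f="(*)"] prod.cong)
    have ys: "(\<lambda>i\<in>J. T i (y i)) \<in> space (\<Pi>\<^sub>M i\<in>J. L)"
      using y measurable_space[OF T] by (auto simp: space_PiM PiE_iff)
    have "(\<lambda>z. \<Phi> ((\<lambda>i\<in>J. T i (y i))(j := T j z))) \<in> borel_measurable U"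
      by (rule measurable_compose[OF T measurable_compose[OF measurable_component_update[OF ys insert.hyps(2)] insert.prems(2)]])
    then show "(\<integral>\<^sup>+z. \<Phi> (\<lambda>i\<in>insert j J. T i ((y(j := z)) i)) * (\<Prod>i\<in>insert j J. indicator (D i) ((y(j := z)) i)) \<partial>U)
      = (\<integral>\<^sup>+z. \<Phi> ((\<lambda>i\<in>J. T i (y i))(j := T j z)) * indicator (D j) z \<partial>U) * (\<Prod>i\<in>J. indicator (D i) (y i))"
      unfolding e1 e2 by (subst nn_integral_multc[symmetric]) (auto simp: mult.assoc)
  qed
  also have "ennreal \<kappa> * (ennreal (\<kappa> ^ card J) * \<dots>) \<le> ennreal \<kappa> * (\<integral>\<^sup>+\<sigma>. (\<integral>\<^sup>+z. \<Phi> (\<sigma>(j := T j z)) * indicator (D j) z \<partial>U) \<partial>(\<Pi>\<^sub>M i\<in>J. L))"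
    by (intro mult_left_mono insert.IH[OF _ m2] insert.prems(1)) auto
  also have "\<dots> = (\<integral>\<^sup>+\<sigma>. ennreal \<kappa> * (\<integral>\<^sup>+z. \<Phi> (\<sigma>(j := T j z)) * indicator (D j) z \<partial>U) \<partial>(\<Pi>\<^sub>M i\<in>J. L))"
    by (rule nn_integral_cmult[symmetric]) (rule m2)
  also have "\<dots> \<le> (\<integral>\<^sup>+\<sigma>. (\<integral>\<^sup>+z. \<Phi> (\<sigma>(j := z)) \<partial>L) \<partial>(\<Pi>\<^sub>M i\<in>J. L))"
  proof (rule nn_integral_mono)
    fix \<sigma> assume s: "\<sigma> \<in> space (\<Pi>\<^sub>M i\<in>J. L)"
    have "(\<lambda>z. \<Phi> (\<sigma>(j := z))) \<in> borel_measurable L"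
      by (rule measurable_compose[OF measurable_component_update[OF s insert.hyps(2)] insert.prems(2)])
    then show "ennreal \<kappa> * (\<integral>\<^sup>+z. \<Phi> (\<sigma>(j := T j z)) * indicator (D j) z \<partial>U) \<le> (\<integral>\<^sup>+z. \<Phi> (\<sigma>(j := z)) \<partial>L)"
      by (intro insert.prems(1)) auto
  qed
  also have "\<dots> = (\<integral>\<^sup>+\<sigma>. \<Phi> \<sigma> \<partial>(\<Pi>\<^sub>M i\<in>insert j J. L))"
    by (rule PL.product_nn_integral_insert[OF insert.hyps, symmetric]) measurable
  finally show ?case .
qed

lemma PiM_sphere_uniform_distr:
  assumes "0 < N" "0 \<le> r" "r < s" "finite J"
  shows "(\<Pi>\<^sub>M j\<in>J. sphere_uniform N) = distr (\<Pi>\<^sub>M j\<in>J. shell_uniform N r s) (\<Pi>\<^sub>M j\<in>J. sphere_uniform N) (\<lambda>y. \<lambda>j\<in>J. radial_projection N (y j))"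
proof -
  have "distr (\<Pi>\<^sub>M j\<in>J. shell_uniform N r s) (\<Pi>\<^sub>M j\<in>J. sphere_uniform N) (compose J (radial_projection N)) =
    (\<Pi>\<^sub>M j\<in>J. distr (shell_uniform N r s) (sphere_uniform N) (radial_projection N))"
    using assms by (intro distr_PiM_finite_prob_space' prob_space_shell_uniform prob_space_sphere_uniform) auto
  also have "distr (shell_uniform N r s) (sphere_uniform N) (radial_projection N) = sphere_uniform N"
    using sphere_uniform_shell[OF assms(1-3)] by (metis distr_cong sets_sphere_uniform)
  finally have "distr (\<Pi>\<^sub>M j\<in>J. shell_uniform N r s) (\<Pi>\<^sub>M j\<in>J. sphere_uniform N) (compose J (radial_projection N)) = (\<Pi>\<^sub>M j\<in>J. sphere_uniform N)" .
  moreover have "compose J (radial_projection N) = (\<lambda>y. \<lambda>j\<in>J. radial_projection N (y j))"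
    by (rule ext) (simp only: compose_def)
  ultimately show ?thesis by (simp only:)
qed

section \<open>Independent replicas under the product Gibbs measure\<close>

context spin
begin

abbreviation lam :: "nat \<Rightarrow> (nat \<Rightarrow> nat \<Rightarrow> real) measure" where
  "lam n \<equiv> \<Pi>\<^sub>M j\<in>{..<n}. sphere_uniform N"

lemma prob_space_lam: "prob_space (lam n)"
  by (intro prob_space_PiM prob_space_sphere_uniform N_pos)

lemma product_sigma_finite_sphere: "product_sigma_finite (\<lambda>_::nat. sphere_uniform N)"
  by (intro product_sigma_finite.intro prob_space_imp_sigma_finite prob_space_sphere_uniform N_pos)

lemma AE_lam_sphere: "AE \<sigma> in lam n. \<forall>j<n. \<sigma> j \<in> spin_sphere N"
proof -
  have "AE \<sigma> in lam n. \<forall>j\<in>{..<n}. \<sigma> j \<in> spin_sphere N"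
    by (subst AE_finite_all) (auto intro!: AE_PiM_component prob_space_sphere_uniform N_pos AE_spin_sphere)
  then show ?thesis by eventually_elim auto
qed

definition gw :: "nat \<Rightarrow> (nat \<times> nat \<Rightarrow> real) \<Rightarrow> real \<Rightarrow> (nat \<Rightarrow> nat \<Rightarrow> real) \<Rightarrow> real" where
  "gw n g b \<sigma> = exp (b * (\<Sum>j<n. ham N g (\<sigma> j)))"

lemma gw_prod: "gw n g b \<sigma> = (\<Prod>j<n. exp (energy (disorder b 0 N g) (\<sigma> j)))"
  by (simp add: gw_def exp_sum[symmetric] energy_field sum_distrib_left)

lemma gibbs_product:
  assumes f: "\<And>j. j < n \<Longrightarrow> f j \<in> borel_measurable (sphere_uniform N)"
    and b: "\<And>j. j < n \<Longrightarrow> AE \<sigma> in sphere_uniform N. \<bar>f j \<sigma>\<bar> \<le> C j"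
  shows "integrable (lam n) (\<lambda>\<sigma>. (\<Prod>j<n. f j (\<sigma> j)) * gw n g b \<sigma>)"
    and "(LINT \<sigma>|lam n. (\<Prod>j<n. f j (\<sigma> j)) * gw n g b \<sigma>) = (\<Prod>j<n. Z (disorder b 0 N g) * avg (disorder b 0 N g) (f j))"
proof -
  interpret P: product_sigma_finite "\<lambda>_::nat. sphere_uniform N" by (rule product_sigma_finite_sphere)
  have eq: "(\<Prod>j<n. f j (\<sigma> j)) * gw n g b \<sigma> = (\<Prod>j<n. f j (\<sigma> j) * exp (energy (disorder b 0 N g) (\<sigma> j)))" for \<sigma>
    by (simp add: gw_prod prod.distrib)
  have i: "integrable (sphere_uniform N) (\<lambda>\<sigma>. f j \<sigma> * exp (energy (disorder b 0 N g) \<sigma>))" if "j < n" for j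
    by (rule integrable_exp_energy[OF f[OF that] b[OF that]])
  show "integrable (lam n) (\<lambda>\<sigma>. (\<Prod>j<n. f j (\<sigma> j)) * gw n g b \<sigma>)"
    unfolding eq by (rule P.product_integrable_prod) (auto intro: i)
  have "(LINT \<sigma>|lam n. (\<Prod>j<n. f j (\<sigma> j)) * gw n g b \<sigma>) = (\<Prod>j<n. LINT \<sigma>|sphere_uniform N. f j \<sigma> * exp (energy (disorder b 0 N g) \<sigma>))"
    unfolding eq by (rule P.product_integral_prod) (auto intro: i)
  also have "\<dots> = (\<Prod>j<n. Z (disorder b 0 N g) * avg (disorder b 0 N g) (f j))"
    using Z_pos by (intro prod.cong refl) (simp add: avg_def less_imp_neq[symmetric])
  finally show "(LINT \<sigma>|lam n. (\<Prod>j<n. f j (\<sigma> j)) * gw n g b \<sigma>) = (\<Prod>j<n. Z (disorder b 0 N g) * avg (disorder b 0 N g) (f j))" .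
qed

lemma gibbs_product_one: "integrable (lam n) (gw n g b)" "(LINT \<sigma>|lam n. gw n g b \<sigma>) = Z (disorder b 0 N g) ^ n"
  using gibbs_product[of n "\<lambda>_ _. 1" "\<lambda>_. 1" g b] by simp_all

lemma gibbs_product_single:
  assumes j: "j < n" and f: "f \<in> borel_measurable (sphere_uniform N)" "AE \<sigma> in sphere_uniform N. \<bar>f \<sigma>\<bar> \<le> C"
  shows "integrable (lam n) (\<lambda>\<sigma>. f (\<sigma> j) * gw n g b \<sigma>)"
    and "(LINT \<sigma>|lam n. f (\<sigma> j) * gw n g b \<sigma>) = Z (disorder b 0 N g) ^ n * avg (disorder b 0 N g) f"
proof -
  let ?f = "\<lambda>l. if l = j then f else (\<lambda>_. 1)"
  have "?f l \<in> borel_measurable (sphere_uniform N)" "AE \<sigma> in sphere_uniform N. \<bar>?f l \<sigma>\<bar> \<le> max \<bar>C\<bar> 1" for l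
    using f by (auto elim!: eventually_mono)
  note gp = gibbs_product[of n ?f "\<lambda>_. max \<bar>C\<bar> 1" g b, OF this]
  have eq: "(\<Prod>l<n. ?f l (\<sigma> l)) = f (\<sigma> j)" for \<sigma>
  proof -
    have "(\<Prod>l<n. ?f l (\<sigma> l)) = (\<Prod>l<n. if l = j then f (\<sigma> j) else 1)" by (intro prod.cong) auto
    then show ?thesis using j by (simp add: prod.delta)
  qed
  show "integrable (lam n) (\<lambda>\<sigma>. f (\<sigma> j) * gw n g b \<sigma>)" using gp(1) unfolding eq .
  have "(\<Prod>l<n. avg x (?f l)) = avg x f" for x
  proof -
    have "(\<Prod>l<n. avg x (?f l)) = (\<Prod>l<n. if l = j then avg x f else 1)" by (intro prod.cong) auto
    then show ?thesis using j by (simp add: prod.delta)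
  qed
  then show "(LINT \<sigma>|lam n. f (\<sigma> j) * gw n g b \<sigma>) = Z (disorder b 0 N g) ^ n * avg (disorder b 0 N g) f"
    using gp(2) unfolding eq by (simp add: prod.distrib)
qed

lemma gibbs_product_pair:
  assumes j: "j < n" "j' < n" "j \<noteq> j'" and f: "f \<in> borel_measurable (sphere_uniform N)" "AE \<sigma> in sphere_uniform N. \<bar>f \<sigma>\<bar> \<le> C"
  shows "integrable (lam n) (\<lambda>\<sigma>. f (\<sigma> j) * f (\<sigma> j') * gw n g b \<sigma>)"
    and "(LINT \<sigma>|lam n. f (\<sigma> j) * f (\<sigma> j') * gw n g b \<sigma>) = Z (disorder b 0 N g) ^ n * (avg (disorder b 0 N g) f)\<^sup>2"
proof -
  let ?f = "\<lambda>l. if l \<in> {j, j'} then f else (\<lambda>_. 1)"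
  have "?f l \<in> borel_measurable (sphere_uniform N)" "AE \<sigma> in sphere_uniform N. \<bar>?f l \<sigma>\<bar> \<le> max \<bar>C\<bar> 1" for l
    using f by (auto elim!: eventually_mono)
  note gp = gibbs_product[of n ?f "\<lambda>_. max \<bar>C\<bar> 1" g b, OF this]
  have delta: "(\<Prod>l<n. if l \<in> {j, j'} then u l else 1) = u j * u j'" for u :: "nat \<Rightarrow> real"
  proof -
    have "(\<Prod>l<n. if l \<in> {j, j'} then u l else 1) = (\<Prod>l\<in>{j, j'}. u l)"
      using j by (intro prod.mono_neutral_cong_right) auto
    then show ?thesis using j by simp
  qed
  have eq: "(\<Prod>l<n. ?f l (\<sigma> l)) = f (\<sigma> j) * f (\<sigma> j')" for \<sigma>
    unfolding delta[of "\<lambda>l. f (\<sigma> l)", symmetric] by (intro prod.cong) auto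
  show "integrable (lam n) (\<lambda>\<sigma>. f (\<sigma> j) * f (\<sigma> j') * gw n g b \<sigma>)" using gp(1) unfolding eq .
  have "(\<Prod>l<n. avg x (?f l)) = (avg x f)\<^sup>2" for x
  proof -
    have "(\<Prod>l<n. avg x (?f l)) = (\<Prod>l<n. if l \<in> {j, j'} then avg x f else 1)" by (intro prod.cong) auto
    then show ?thesis unfolding delta by (simp add: power2_eq_square)
  qed
  then show "(LINT \<sigma>|lam n. f (\<sigma> j) * f (\<sigma> j') * gw n g b \<sigma>) = Z (disorder b 0 N g) ^ n * (avg (disorder b 0 N g) f)\<^sup>2"
    using gp(2) unfolding eq by (simp add: prod.distrib)
qed

lemma gibbs_overlap:
  assumes j: "j < n" "j' < n" "j \<noteq> j'"
  shows "integrable (lam n) (\<lambda>\<sigma>. (ip N (\<sigma> j) (\<sigma> j'))\<^sup>2 * gw n g b \<sigma>)"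
    and "(LINT \<sigma>|lam n. (ip N (\<sigma> j) (\<sigma> j'))\<^sup>2 * gw n g b \<sigma>) = Z (disorder b 0 N g) ^ n * ((real N)\<^sup>2 * r2 (disorder b 0 N g))"
proof -
  have eq: "(ip N (\<sigma> j) (\<sigma> j'))\<^sup>2 * gw n g b \<sigma> = (\<Sum>p\<in>{..<N}\<times>{..<N}. (\<sigma> j (fst p) * \<sigma> j (snd p)) * (\<sigma> j' (fst p) * \<sigma> j' (snd p)) * gw n g b \<sigma>)" for \<sigma>
  proof -
    have "(ip N (\<sigma> j) (\<sigma> j'))\<^sup>2 = (\<Sum>p\<in>{..<N}\<times>{..<N}. (\<sigma> j (fst p) * \<sigma> j (snd p)) * (\<sigma> j' (fst p) * \<sigma> j' (snd p)))"
      by (simp add: ip_def power2_eq_square sum_product sum.cartesian_product case_prod_beta mult_ac)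
    then show ?thesis by (simp only: sum_distrib_right)
  qed
  have p: "integrable (lam n) (\<lambda>\<sigma>. (\<sigma> j (fst p) * \<sigma> j (snd p)) * (\<sigma> j' (fst p) * \<sigma> j' (snd p)) * gw n g b \<sigma>) \<and>
     (LINT \<sigma>|lam n. (\<sigma> j (fst p) * \<sigma> j (snd p)) * (\<sigma> j' (fst p) * \<sigma> j' (snd p)) * gw n g b \<sigma>) =
     Z (disorder b 0 N g) ^ n * (avg (disorder b 0 N g) (\<lambda>\<sigma>. \<sigma> (fst p) * \<sigma> (snd p)))\<^sup>2" if "p \<in> {..<N}\<times>{..<N}" for p
  proof -
    have f: "fst p < N" "snd p < N" using that by auto
    then have m: "(\<lambda>\<sigma>. \<sigma> (fst p) * \<sigma> (snd p)) \<in> borel_measurable (sphere_uniform N)" by measurable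
    show ?thesis
      using gibbs_product_pair[OF j m spin2_bound[OF f], of g b] by auto
  qed
  show "integrable (lam n) (\<lambda>\<sigma>. (ip N (\<sigma> j) (\<sigma> j'))\<^sup>2 * gw n g b \<sigma>)"
    unfolding eq using p by (intro Bochner_Integration.integrable_sum) auto
  have "(LINT \<sigma>|lam n. (ip N (\<sigma> j) (\<sigma> j'))\<^sup>2 * gw n g b \<sigma>) =
     (\<Sum>p\<in>{..<N}\<times>{..<N}. Z (disorder b 0 N g) ^ n * (avg (disorder b 0 N g) (\<lambda>\<sigma>. \<sigma> (fst p) * \<sigma> (snd p)))\<^sup>2)"
    unfolding eq using p by (subst Bochner_Integration.integral_sum) auto
  also have "\<dots> = Z (disorder b 0 N g) ^ n * ((real N)\<^sup>2 * r2 (disorder b 0 N g))"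
  proof -
    have "(real N)\<^sup>2 * r2 (disorder b 0 N g) = (\<Sum>p\<in>{..<N}\<times>{..<N}. (avg (disorder b 0 N g) (\<lambda>\<sigma>. \<sigma> (fst p) * \<sigma> (snd p)))\<^sup>2)"
      using N_pos by (simp add: r2_def sum.cartesian_product case_prod_beta)
    then show ?thesis by (simp add: sum_distrib_left[symmetric])
  qed
  finally show "(LINT \<sigma>|lam n. (ip N (\<sigma> j) (\<sigma> j'))\<^sup>2 * gw n g b \<sigma>) = Z (disorder b 0 N g) ^ n * ((real N)\<^sup>2 * r2 (disorder b 0 N g))" .
qed

lemma gibbs_field:
  assumes j: "j < n"
  shows "integrable (lam n) (\<lambda>\<sigma>. (ip N v (\<sigma> j))\<^sup>2 * gw n g b \<sigma>)"
    and "(LINT \<sigma>|lam n. (ip N v (\<sigma> j))\<^sup>2 * gw n g b \<sigma>) \<le> Z (disorder b 0 N g) ^ n * (ip N v v * real N * sqrt (r2 (disorder b 0 N g)))"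
proof -
  have b: "AE \<sigma> in sphere_uniform N. \<bar>(ip N v \<sigma>)\<^sup>2\<bar> \<le> (sqrt (ip N v v * real N))\<^sup>2"
    using ip_bound[of v] by eventually_elim (subst abs_power2, rule iffD2[OF power2_le_iff_abs_le], auto simp: ip_nonneg)
  have m: "(\<lambda>\<sigma>. (ip N v \<sigma>)\<^sup>2) \<in> borel_measurable (sphere_uniform N)" by measurable
  note gp = gibbs_product_single[OF j m b]
  show "integrable (lam n) (\<lambda>\<sigma>. (ip N v (\<sigma> j))\<^sup>2 * gw n g b \<sigma>)" by (rule gp(1))
  show "(LINT \<sigma>|lam n. (ip N v (\<sigma> j))\<^sup>2 * gw n g b \<sigma>) \<le> Z (disorder b 0 N g) ^ n * (ip N v v * real N * sqrt (r2 (disorder b 0 N g)))"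
    unfolding gp(2) using Z_pos by (intro mult_left_mono avg_square_ip_le) (simp add: less_imp_le)
qed

text \<open>Where the energy is negative the Gibbs weight is at most 1, so the Gibbs mass of this
  set is at most its volume divided by Z.\<close>

lemma gibbs_negative:
  assumes j: "j < n" and b: "0 \<le> b" and z: "measure (sphere_uniform N) {\<sigma> \<in> space (sphere_uniform N). ham N g \<sigma> < 0} \<le> \<zeta> * Z (disorder b 0 N g)"
  shows "integrable (lam n) (\<lambda>\<sigma>. indicator {\<sigma>. ham N g \<sigma> < 0} (\<sigma> j) * gw n g b \<sigma>)"
    and "(LINT \<sigma>|lam n. indicator {\<sigma>. ham N g \<sigma> < 0} (\<sigma> j) * gw n g b \<sigma>) \<le> Z (disorder b 0 N g) ^ n * \<zeta>"
proof -
  let ?x = "disorder b 0 N g"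
  have m: "(\<lambda>\<sigma>. indicator {\<sigma>. ham N g \<sigma> < 0} \<sigma> :: real) \<in> borel_measurable (sphere_uniform N)"
    unfolding indicator_def by measurable
  have bd: "AE \<sigma> in sphere_uniform N. \<bar>indicator {\<sigma>. ham N g \<sigma> < 0} \<sigma> :: real\<bar> \<le> 1" by simp
  note gp = gibbs_product_single[OF j m bd]
  show "integrable (lam n) (\<lambda>\<sigma>. indicator {\<sigma>. ham N g \<sigma> < 0} (\<sigma> j) * gw n g b \<sigma>)" by (rule gp(1))
  have "(LINT \<sigma>|sphere_uniform N. indicator {\<sigma>. ham N g \<sigma> < 0} \<sigma> * exp (energy ?x \<sigma>)) \<le>
     (LINT \<sigma>|sphere_uniform N. indicator {\<sigma> \<in> space (sphere_uniform N). ham N g \<sigma> < 0} \<sigma>)"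
  proof (rule integral_mono[OF integrable_exp_energy[OF m bd]])
    show "integrable (sphere_uniform N) (indicator {\<sigma> \<in> space (sphere_uniform N). ham N g \<sigma> < 0} :: _ \<Rightarrow> real)"
      by (intro integrable_const_bound[of _ 1]) (auto simp: indicator_def)
    show "indicator {\<sigma>. ham N g \<sigma> < 0} \<sigma> * exp (energy ?x \<sigma>) \<le> indicator {\<sigma> \<in> space (sphere_uniform N). ham N g \<sigma> < 0} \<sigma>"
      if "\<sigma> \<in> space (sphere_uniform N)" for \<sigma>
      using that b by (auto simp: indicator_def energy_field mult_nonneg_nonpos)
  qed
  also have "\<dots> = measure (sphere_uniform N) {\<sigma> \<in> space (sphere_uniform N). ham N g \<sigma> < 0}"
    by (simp add: Int_absorb1 subset_eq)
  finally have "avg ?x (indicator {\<sigma>. ham N g \<sigma> < 0}) \<le> \<zeta>"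
    unfolding avg_def using z Z_pos[of ?x] by (simp add: divide_le_eq)
  then show "(LINT \<sigma>|lam n. indicator {\<sigma>. ham N g \<sigma> < 0} (\<sigma> j) * gw n g b \<sigma>) \<le> Z ?x ^ n * \<zeta>"
    unfolding gp(2) using Z_pos[of ?x] by (intro mult_left_mono) auto
qed

text \<open>What a sample at the residual temperature must satisfy for the shifted replicas to have
  the prescribed overlaps. Nonnegative energies make it possible to replace inexact scale factors by
  their lower bounds.\<close>

definition good :: "nat \<Rightarrow> (nat \<times> nat \<Rightarrow> real) \<Rightarrow> (nat \<Rightarrow> nat \<Rightarrow> real) \<Rightarrow> real \<Rightarrow> (nat \<Rightarrow> nat \<Rightarrow> real) \<Rightarrow> bool" where
  "good n g m \<eta> \<sigma> \<longleftrightarrow> (\<forall>j<n. \<sigma> j \<in> spin_sphere N \<and> 0 \<le> ham N g (\<sigma> j)) \<and>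
     (\<forall>j<n. \<forall>j'<n. j \<noteq> j' \<longrightarrow> \<bar>ip N (\<sigma> j) (\<sigma> j')\<bar> \<le> \<eta> * real N) \<and>
     (\<forall>j<n. \<forall>j'<n. \<bar>ip N (m j) (\<sigma> j')\<bar> \<le> \<eta> * real N)"

lemma measurable_component2: "j < n \<Longrightarrow> i < N \<Longrightarrow> (\<lambda>\<sigma>. \<sigma> j i) \<in> borel_measurable (lam n)"
  using measurable_compose[OF measurable_component_singleton[of j "{..<n}" "\<lambda>_. sphere_uniform N"] measurable_spin] by simp

lemma measurable_ham_lam [measurable]: "j < n \<Longrightarrow> (\<lambda>\<sigma>. ham N g (\<sigma> j)) \<in> borel_measurable (lam n)"
  by (intro measurable_ham measurable_component2 borel_measurable_const)

lemma measurable_ip_lam [measurable]: "j < n \<Longrightarrow> j' < n \<Longrightarrow> (\<lambda>\<sigma>. ip N (\<sigma> j) (\<sigma> j')) \<in> borel_measurable (lam n)"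
  by (intro measurable_ip measurable_component2)

lemma measurable_ip_lam' [measurable]: "j < n \<Longrightarrow> (\<lambda>\<sigma>. ip N v (\<sigma> j)) \<in> borel_measurable (lam n)"
  by (intro measurable_ip measurable_component2 borel_measurable_const)

lemma measurable_sphere_lam [measurable]: "j < n \<Longrightarrow> Measurable.pred (lam n) (\<lambda>\<sigma>. \<sigma> j \<in> spin_sphere N)"
  using measurable_compose[OF measurable_component_singleton[of j "{..<n}" "\<lambda>_. sphere_uniform N"], of "\<lambda>\<sigma>. \<sigma> \<in> spin_sphere N" "count_space UNIV"]
    sets_spin_sphere[of N] by (simp add: pred_def spin_sphere_eq)

lemma measurable_gw [measurable]: "gw n g b \<in> borel_measurable (lam n)"
  using gibbs_product_one(1) by (rule borel_measurable_integrable)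

lemma measurable_good [measurable]: "Measurable.pred (lam n) (good n g m \<eta>)"
proof -
  have "Measurable.pred (lam n) (\<lambda>\<sigma>. (\<forall>j\<in>{..<n}. \<sigma> j \<in> spin_sphere N \<and> 0 \<le> ham N g (\<sigma> j)) \<and>
     (\<forall>j\<in>{..<n}. \<forall>j'\<in>{..<n}. j \<noteq> j' \<longrightarrow> \<bar>ip N (\<sigma> j) (\<sigma> j')\<bar> \<le> \<eta> * real N) \<and>
     (\<forall>j\<in>{..<n}. \<forall>j'\<in>{..<n}. \<bar>ip N (m j) (\<sigma> j')\<bar> \<le> \<eta> * real N))"
  proof -
    have "Measurable.pred (lam n) (\<lambda>\<sigma>. 0 \<le> ham N g (\<sigma> j))" if "j \<in> {..<n}" for j
    proof -
      have [measurable]: "(\<lambda>\<sigma>. ham N g (\<sigma> j)) \<in> borel_measurable (lam n)" using that by (intro measurable_ham_lam) simp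
      show ?thesis by measurable
    qed
    moreover have "Measurable.pred (lam n) (\<lambda>\<sigma>. \<bar>ip N (\<sigma> j) (\<sigma> j')\<bar> \<le> \<eta> * real N)" if "j \<in> {..<n}" "j' \<in> {..<n}" for j j'
    proof -
      have [measurable]: "(\<lambda>\<sigma>. ip N (\<sigma> j) (\<sigma> j')) \<in> borel_measurable (lam n)" using that by (intro measurable_ip_lam) simp_all
      show ?thesis by measurable
    qed
    moreover have "Measurable.pred (lam n) (\<lambda>\<sigma>. \<bar>ip N v (\<sigma> j)\<bar> \<le> \<eta> * real N)" if "j \<in> {..<n}" for v j
    proof -
      have [measurable]: "(\<lambda>\<sigma>. ip N v (\<sigma> j)) \<in> borel_measurable (lam n)" using that by (intro measurable_ip_lam') simp
      show ?thesis by measurable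
    qed
    moreover have "Measurable.pred (lam n) (\<lambda>\<sigma>. \<sigma> j \<in> spin_sphere N)" if "j \<in> {..<n}" for j
      using that by (intro measurable_sphere_lam) simp
    ultimately show ?thesis
      by (intro pred_intros_logic pred_intros_finite finite_lessThan) auto
  qed
  then show ?thesis unfolding good_def[abs_def] by (simp add: Ball_def)
qed

text \<open>A union bound inside the Gibbs measure. Pointwise, the weight restricted to
  \<open>good\<close> is at least the full weight minus the terms \<open>A\<close>, \<open>B\<close>
  and \<open>D\<close> for the three ways to fail, the last two weighted as in Chebyshev's
  inequality; their averages are controlled by \<zeta>, \<open>r2\<close> and the square root of
  \<open>r2\<close>.\<close>

lemma good_mass:
  assumes b: "0 \<le> b" and \<eta>: "0 < \<eta>"
    and m: "\<And>j. j < n \<Longrightarrow> ip N (m j) (m j) \<le> 2 * real N"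
    and z: "measure (sphere_uniform N) {\<sigma> \<in> space (sphere_uniform N). ham N g \<sigma> < 0} \<le> \<zeta> * Z (disorder b 0 N g)"
    and small: "real n * \<zeta> + (real n)\<^sup>2 * r2 (disorder b 0 N g) / \<eta>\<^sup>2 + 2 * (real n)\<^sup>2 * sqrt (r2 (disorder b 0 N g)) / \<eta>\<^sup>2 \<le> 1 / 2"
  shows "Z (disorder b 0 N g) ^ n / 2 \<le> (LINT \<sigma>|lam n. (if good n g m \<eta> \<sigma> then gw n g b \<sigma> else 0))"
proof -
  let ?x = "disorder b 0 N g" and ?c = "1 / (\<eta> * real N)\<^sup>2" and ?Zn = "Z (disorder b 0 N g) ^ n"
  have Zn: "0 \<le> ?Zn" using Z_pos[of ?x] by (simp add: less_imp_le)
  have c: "0 < ?c" using \<eta> N_pos by simp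
  define A where "A j \<sigma> = indicator {\<sigma>. ham N g \<sigma> < 0} (\<sigma> j) * gw n g b \<sigma>" for j \<sigma>
  define B where "B p \<sigma> = (if fst p = snd p then 0 else (ip N (\<sigma> (fst p)) (\<sigma> (snd p)))\<^sup>2 * gw n g b \<sigma>)" for p :: "nat \<times> nat" and \<sigma>
  define D where "D p \<sigma> = (ip N (m (fst p)) (\<sigma> (snd p)))\<^sup>2 * gw n g b \<sigma>" for p :: "nat \<times> nat" and \<sigma>
  let ?P = "{..<n} \<times> {..<n}"
  have iA: "integrable (lam n) (A j)" "integral\<^sup>L (lam n) (A j) \<le> ?Zn * \<zeta>" if "j < n" for j
    unfolding A_def using gibbs_negative[OF that b z] by auto
  have iB: "integrable (lam n) (B p)" "integral\<^sup>L (lam n) (B p) \<le> ?Zn * ((real N)\<^sup>2 * r2 ?x)" if "p \<in> ?P" for p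
  proof -
    have "integrable (lam n) (B p) \<and> integral\<^sup>L (lam n) (B p) \<le> ?Zn * ((real N)\<^sup>2 * r2 ?x)"
    proof (cases "fst p = snd p")
      case True
      then have "B p = (\<lambda>_. 0)" by (intro ext) (simp add: B_def)
      then show ?thesis using Zn r2_nonneg[of ?x] by simp
    next
      case False
      then have "B p = (\<lambda>\<sigma>. (ip N (\<sigma> (fst p)) (\<sigma> (snd p)))\<^sup>2 * gw n g b \<sigma>)" by (intro ext) (simp add: B_def)
      then show ?thesis using False that gibbs_overlap[of "fst p" n "snd p" g b] by auto
    qed
    then show "integrable (lam n) (B p)" "integral\<^sup>L (lam n) (B p) \<le> ?Zn * ((real N)\<^sup>2 * r2 ?x)" by auto
  qed
  have iD: "integrable (lam n) (D p)" "integral\<^sup>L (lam n) (D p) \<le> ?Zn * (2 * (real N)\<^sup>2 * sqrt (r2 ?x))" if "p \<in> ?P" for p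
  proof -
    have p: "fst p < n" "snd p < n" using that by auto
    show "integrable (lam n) (D p)" unfolding D_def by (rule gibbs_field[OF p(2)])
    have "integral\<^sup>L (lam n) (D p) \<le> ?Zn * (ip N (m (fst p)) (m (fst p)) * real N * sqrt (r2 ?x))"
      unfolding D_def by (rule gibbs_field[OF p(2)])
    also have "\<dots> \<le> ?Zn * ((2 * real N) * real N * sqrt (r2 ?x))"
      using m[OF p(1)] Zn r2_nonneg[of ?x] by (intro mult_left_mono mult_right_mono) auto
    finally show "integral\<^sup>L (lam n) (D p) \<le> ?Zn * (2 * (real N)\<^sup>2 * sqrt (r2 ?x))"
      by (simp add: power2_eq_square mult_ac)
  qed
  have iS: "integrable (lam n) (\<lambda>\<sigma>. gw n g b \<sigma> - (\<Sum>j<n. A j \<sigma>) - ?c * (\<Sum>p\<in>?P. B p \<sigma>) - ?c * (\<Sum>p\<in>?P. D p \<sigma>))"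
    using iA iB iD gibbs_product_one(1)
    by (intro Bochner_Integration.integrable_diff Bochner_Integration.integrable_sum integrable_mult_right) auto
  have "?Zn / 2 \<le> ?Zn * (1 - (real n * \<zeta> + (real n)\<^sup>2 * r2 ?x / \<eta>\<^sup>2 + 2 * (real n)\<^sup>2 * sqrt (r2 ?x) / \<eta>\<^sup>2))"
    using small Zn mult_left_mono[of "1/2" "1 - (real n * \<zeta> + (real n)\<^sup>2 * r2 ?x / \<eta>\<^sup>2 + 2 * (real n)\<^sup>2 * sqrt (r2 ?x) / \<eta>\<^sup>2)" ?Zn] by simp
  also have "\<dots> = ?Zn - (\<Sum>j<n. ?Zn * \<zeta>) - ?c * (\<Sum>p\<in>?P. ?Zn * ((real N)\<^sup>2 * r2 ?x)) - ?c * (\<Sum>p\<in>?P. ?Zn * (2 * (real N)\<^sup>2 * sqrt (r2 ?x)))"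
    using N_pos \<eta> by (simp add: power2_eq_square field_simps)
  also have "\<dots> \<le> ?Zn - (\<Sum>j<n. integral\<^sup>L (lam n) (A j)) - ?c * (\<Sum>p\<in>?P. integral\<^sup>L (lam n) (B p)) - ?c * (\<Sum>p\<in>?P. integral\<^sup>L (lam n) (D p))"
    using c iA iB iD by (intro diff_mono mult_left_mono sum_mono order_refl) auto
  also have "\<dots> = (LINT \<sigma>|lam n. gw n g b \<sigma> - (\<Sum>j<n. A j \<sigma>) - ?c * (\<Sum>p\<in>?P. B p \<sigma>) - ?c * (\<Sum>p\<in>?P. D p \<sigma>))"
  proof -
    define SA where "SA \<sigma> = (\<Sum>j<n. A j \<sigma>)" for \<sigma>
    define SB where "SB \<sigma> = (\<Sum>p\<in>?P. B p \<sigma>)" for \<sigma>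
    define SD where "SD \<sigma> = (\<Sum>p\<in>?P. D p \<sigma>)" for \<sigma>
    have s: "integrable (lam n) SA" "integrable (lam n) SB" "integrable (lam n) SD"
      unfolding SA_def SB_def SD_def using iA(1) iB(1) iD(1) by (intro Bochner_Integration.integrable_sum; auto)+
    have e: "(\<Sum>j<n. integral\<^sup>L (lam n) (A j)) = integral\<^sup>L (lam n) SA" "(\<Sum>p\<in>?P. integral\<^sup>L (lam n) (B p)) = integral\<^sup>L (lam n) SB"
       "(\<Sum>p\<in>?P. integral\<^sup>L (lam n) (D p)) = integral\<^sup>L (lam n) SD"
      unfolding SA_def SB_def SD_def using iA(1) iB(1) iD(1) by (subst Bochner_Integration.integral_sum; auto)+
    show ?thesis
      unfolding e SA_def[symmetric] SB_def[symmetric] SD_def[symmetric] gibbs_product_one(2)[symmetric]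
      using s gibbs_product_one(1)[of n g b] by simp
  qed
  also have "\<dots> \<le> (LINT \<sigma>|lam n. (if good n g m \<eta> \<sigma> then gw n g b \<sigma> else 0))"
  proof (rule integral_mono_AE[OF iS])
    show "integrable (lam n) (\<lambda>\<sigma>. if good n g m \<eta> \<sigma> then gw n g b \<sigma> else 0)"
      by (rule Bochner_Integration.integrable_bound[OF gibbs_product_one(1)]) (auto simp: gw_def)
    show "AE \<sigma> in lam n. gw n g b \<sigma> - (\<Sum>j<n. A j \<sigma>) - ?c * (\<Sum>p\<in>?P. B p \<sigma>) - ?c * (\<Sum>p\<in>?P. D p \<sigma>) \<le> (if good n g m \<eta> \<sigma> then gw n g b \<sigma> else 0)"
      using AE_lam_sphere
    proof eventually_elim
      case (elim \<sigma>)
      have w: "0 < gw n g b \<sigma>" by (simp add: gw_def)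
      have A0: "0 \<le> A j \<sigma>" for j using w by (simp add: A_def)
      have B0: "0 \<le> B p \<sigma>" for p using w by (simp add: B_def)
      have D0: "0 \<le> D p \<sigma>" for p using w by (simp add: D_def)
      have sA: "0 \<le> (\<Sum>j<n. A j \<sigma>)" and sB: "0 \<le> ?c * (\<Sum>p\<in>?P. B p \<sigma>)" and sD: "0 \<le> ?c * (\<Sum>p\<in>?P. D p \<sigma>)"
      proof -
        show "0 \<le> (\<Sum>j<n. A j \<sigma>)" using A0 by (intro sum_nonneg)
        show "0 \<le> ?c * (\<Sum>p\<in>?P. B p \<sigma>)" using B0 c by (intro mult_nonneg_nonneg sum_nonneg) (simp only: less_imp_le)
        show "0 \<le> ?c * (\<Sum>p\<in>?P. D p \<sigma>)" using D0 c by (intro mult_nonneg_nonneg sum_nonneg) (simp only: less_imp_le)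
      qed
      have big: "gw n g b \<sigma> \<le> ?c * (t\<^sup>2 * gw n g b \<sigma>)" if "\<eta> * real N < \<bar>t\<bar>" for t
      proof -
        have "(\<eta> * real N)\<^sup>2 \<le> t\<^sup>2" using that \<eta> by (simp add: abs_le_square_iff[symmetric])
        then have "1 \<le> ?c * t\<^sup>2" using \<eta> N_pos by (simp add: field_simps)
        then show ?thesis using mult_right_mono[of 1 "?c * t\<^sup>2" "gw n g b \<sigma>"] w by (simp add: mult.assoc)
      qed
      show ?case
      proof (cases "good n g m \<eta> \<sigma>")
        case True
        then show ?thesis using sA sB sD by simp
      next
        case False
        have "(\<exists>j<n. ham N g (\<sigma> j) < 0) \<or> (\<exists>j<n. \<exists>j'<n. j \<noteq> j' \<and> \<eta> * real N < \<bar>ip N (\<sigma> j) (\<sigma> j')\<bar>)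
           \<or> (\<exists>j<n. \<exists>j'<n. \<eta> * real N < \<bar>ip N (m j) (\<sigma> j')\<bar>)"
        proof (rule ccontr)
          assume "\<not> ?thesis"
          then have *: "\<forall>j<n. 0 \<le> ham N g (\<sigma> j)" "\<forall>j<n. \<forall>j'<n. j \<noteq> j' \<longrightarrow> \<bar>ip N (\<sigma> j) (\<sigma> j')\<bar> \<le> \<eta> * real N"
            "\<forall>j<n. \<forall>j'<n. \<bar>ip N (m j) (\<sigma> j')\<bar> \<le> \<eta> * real N"
            by (simp_all only: not_less[symmetric]) blast+
          have "\<forall>j<n. \<sigma> j \<in> spin_sphere N \<and> 0 \<le> ham N g (\<sigma> j)" using elim *(1) by blast
          then have "good n g m \<eta> \<sigma>" unfolding good_def using *(2,3) by (intro conjI)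
          then show False using False by (rule notE[rotated])
        qed
        then consider (a) j where "j < n" "ham N g (\<sigma> j) < 0"
          | (b) j j' where "j < n" "j' < n" "j \<noteq> j'" "\<eta> * real N < \<bar>ip N (\<sigma> j) (\<sigma> j')\<bar>"
          | (d) j j' where "j < n" "j' < n" "\<eta> * real N < \<bar>ip N (m j) (\<sigma> j')\<bar>"
          by (elim disjE exE conjE) (rule that; assumption)+
        then have "gw n g b \<sigma> \<le> (\<Sum>j<n. A j \<sigma>) + ?c * (\<Sum>p\<in>?P. B p \<sigma>) + ?c * (\<Sum>p\<in>?P. D p \<sigma>)"
        proof cases
          case a
          have "gw n g b \<sigma> = A j \<sigma>" using a by (simp add: A_def)
          also have "\<dots> \<le> (\<Sum>j<n. A j \<sigma>)" using a A0 by (intro member_le_sum) auto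
          finally show ?thesis using sB sD by linarith
        next
          case b
          have "gw n g b \<sigma> \<le> ?c * B (j, j') \<sigma>" using big[OF b(4)] b(3) by (simp add: B_def)
          also have "\<dots> \<le> ?c * (\<Sum>p\<in>?P. B p \<sigma>)"
            using b B0 c by (intro mult_left_mono member_le_sum) auto
          finally show ?thesis using sA sD by linarith
        next
          case d
          have "gw n g b \<sigma> \<le> ?c * D (j, j') \<sigma>" using big[OF d(3)] by (simp add: D_def)
          also have "\<dots> \<le> ?c * (\<Sum>p\<in>?P. D p \<sigma>)"
            using d D0 c by (intro mult_left_mono member_le_sum) auto
          finally show ?thesis using sA sB by linarith
        qed
        then show ?thesis using False by simp
      qed
    qed
  qed
  finally show ?thesis .
qed

end

text \<open>Twice W m, the gradient of the Hamiltonian at \<open>m\<close>.\<close>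

definition cross :: "nat \<Rightarrow> (nat \<times> nat \<Rightarrow> real) \<Rightarrow> (nat \<Rightarrow> real) \<Rightarrow> nat \<Rightarrow> real" where
  "cross N g m k = (\<Sum>i<N. (g (i, k) + g (k, i)) * m i) / (sqrt 2 * sqrt (real N))"

lemma ham_add:
  assumes x: "\<And>i. i < N \<Longrightarrow> x i = m i + a * \<sigma> i"
  shows "ham N g x = ham N g m + a * ip N (cross N g m) \<sigma> + a\<^sup>2 * ham N g \<sigma>"
proof -
  let ?c = "1 / (sqrt 2 * sqrt (real N))"
  have "(\<Sum>i<N. \<Sum>k<N. g (i, k) * x i * x k) = (\<Sum>i<N. \<Sum>k<N. g (i, k) * m i * m k) +
     (a * (\<Sum>i<N. \<Sum>k<N. g (i, k) * m i * \<sigma> k) + a * (\<Sum>i<N. \<Sum>k<N. g (i, k) * m k * \<sigma> i)) + a\<^sup>2 * (\<Sum>i<N. \<Sum>k<N. g (i, k) * \<sigma> i * \<sigma> k)"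
    unfolding sum_distrib_left sum.distrib[symmetric]
    by (intro sum.cong refl) (simp add: x power2_eq_square algebra_simps)
  also have "(\<Sum>i<N. \<Sum>k<N. g (i, k) * m i * \<sigma> k) = (\<Sum>k<N. \<Sum>i<N. g (i, k) * m i * \<sigma> k)"
    by (rule sum.swap)
  also have "a * (\<Sum>k<N. \<Sum>i<N. g (i, k) * m i * \<sigma> k) + a * (\<Sum>i<N. \<Sum>k<N. g (i, k) * m k * \<sigma> i) =
     a * (\<Sum>k<N. (\<Sum>i<N. (g (i, k) + g (k, i)) * m i) * \<sigma> k)"
    by (simp add: distrib_left[symmetric] sum.distrib[symmetric] sum_distrib_right distrib_right)
  finally have "ham N g x = ham N g m + a * (?c * (\<Sum>k<N. (\<Sum>i<N. (g (i, k) + g (k, i)) * m i) * \<sigma> k)) + a\<^sup>2 * ham N g \<sigma>"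
    unfolding ham_def hamiltonian_def by (simp only: distrib_left mult_ac)
  moreover have "?c * (\<Sum>k<N. (\<Sum>i<N. (g (i, k) + g (k, i)) * m i) * \<sigma> k) = ip N (cross N g m) \<sigma>"
    by (simp add: ip_def cross_def sum_distrib_left)
  ultimately show ?thesis by (simp only:)
qed

lemma ham_cong: "(\<And>i. i < N \<Longrightarrow> x i = y i) \<Longrightarrow> ham N g x = ham N g y"
  by (simp add: ham_def hamiltonian_def)

lemma ham_scale: "ham N g (\<lambda>i. c * x i) = c\<^sup>2 * ham N g x"
  by (simp add: ham_def hamiltonian_def sum_distrib_left power2_eq_square mult_ac)

lemma radial_projection_eq: "i < N \<Longrightarrow> radial_projection N x i = sqrt (real N / ip N x x) * x i"
  by (simp add: radial_projection_def L2_set_ip real_sqrt_divide)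

lemma ip_radial_projection:
  "ip N (radial_projection N x) (radial_projection N x') = sqrt (real N / ip N x x) * sqrt (real N / ip N x' x') * ip N x x'"
  unfolding ip_scale[symmetric] by (rule ip_cong) (auto simp: radial_projection_eq)

lemma ham_radial_projection: "ham N g (radial_projection N x) = real N / ip N x x * ham N g x"
proof -
  have "ham N g (radial_projection N x) = ham N g (\<lambda>i. sqrt (real N / ip N x x) * x i)"
    by (rule ham_cong) (simp add: radial_projection_eq)
  then show ?thesis by (simp add: ham_scale ip_nonneg)
qed

lemma overlap_ip: "overlap N x y = ip N x y / real N"
  by (simp add: overlap_def ip_def)

text \<open>The sign, the length of y and the factor 1 / sqrt \<beta> are absorbed into one number
  \<open>a\<close>, which leaves a vector on the sphere. The uncertainty of the length is confined
  to the window for a^2.\<close>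

lemma shifted_decomposition:
  assumes N: "0 < N" and y: "y \<in> shell N (real N) (real N * (1 + \<eta>))" and \<beta>: "0 < \<beta>"
  obtains a where "\<And>i. i < N \<Longrightarrow> shifted N (1 / sqrt \<beta>) m w y i = m i + a * radial_projection N y i"
    "1 / \<beta> \<le> a\<^sup>2" "a\<^sup>2 \<le> (1 + \<eta>) / \<beta>" "0 \<le> a * ip N w (radial_projection N y)"
proof
  define t where "t = sqrt (ip N y y / real N)"
  define a where "a = 1 / sqrt \<beta> * flip N w y * t"
  have yy: "real N < ip N y y" "ip N y y \<le> real N * (1 + \<eta>)" using y by (auto simp: shell_def)
  then have pos: "0 < ip N y y" using N by linarith
  have t2: "1 \<le> t\<^sup>2" "t\<^sup>2 \<le> 1 + \<eta>" and t0: "0 < t"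
    using yy pos N by (auto simp: t_def field_simps)
  have tr: "t * radial_projection N y i = y i" if "i < N" for i
  proof -
    have "t * sqrt (real N / ip N y y) = 1"
      unfolding t_def real_sqrt_mult[symmetric] using pos N by simp
    then show ?thesis unfolding radial_projection_eq[OF that] by (simp add: mult.assoc[symmetric])
  qed
  show "shifted N (1 / sqrt \<beta>) m w y i = m i + a * radial_projection N y i" if "i < N" for i
    using that tr[OF that] by (simp add: shifted_def a_def mult.assoc)
  have f2: "(flip N w y)\<^sup>2 = 1" by (simp add: flip_def)
  have a2: "a\<^sup>2 = t\<^sup>2 / \<beta>"
    unfolding a_def power_mult_distrib f2 using \<beta> by (simp add: power_divide)
  show "1 / \<beta> \<le> a\<^sup>2" "a\<^sup>2 \<le> (1 + \<eta>) / \<beta>"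
    unfolding a2 using t2 \<beta> by (auto intro!: divide_right_mono)
  have "t * ip N w (radial_projection N y) = ip N w y"
    unfolding ip_scale_right[symmetric] by (rule ip_cong) (auto simp: tr)
  then have "a * ip N w (radial_projection N y) = 1 / sqrt \<beta> * (flip N w y * ip N w y)"
    by (simp add: a_def mult.assoc)
  moreover have "0 \<le> flip N w y * ip N w y" by (simp add: flip_def)
  ultimately show "0 \<le> a * ip N w (radial_projection N y)" using \<beta> by simp
qed

context spin
begin

text \<open>For X = m + a \<sigma> the Gram matrix has errors \<eta> from m, twice 6/5 \<eta> from
  the mixed products and 3/2 \<eta> from the \<sigma> part, together below 7 \<eta>. Projecting X to
  the sphere divides its energy by at most 1 + 7 \<eta>, and since \<beta> a^2 >= 1 the sample keeps
  at least the inverse temperature 1 / (1 + 7 \<eta>).\<close>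

lemma good_shifted:
  fixes Q :: "real mat" and y :: "nat \<Rightarrow> nat \<Rightarrow> real"
  assumes \<beta>: "1 \<le> \<beta>" and \<eta>: "0 < \<eta>" "\<eta> \<le> 1 / 14" "28 * \<eta> \<le> \<epsilon>"
    and Q: "\<And>j. j < n \<Longrightarrow> Q $$ (j, j) = 1" "\<And>j j'. j < n \<Longrightarrow> j' < n \<Longrightarrow> \<bar>Q $$ (j, j')\<bar> \<le> 1"
    and m: "\<And>j j'. j < n \<Longrightarrow> j' < n \<Longrightarrow> \<bar>ip N (m j) (m j') / real N - (Q $$ (j, j') - (if j = j' then 1 / \<beta> else 0))\<bar> \<le> \<eta>"
    and hm: "\<And>j. j < n \<Longrightarrow> 0 \<le> ham N g (m j)"
    and y: "\<And>j. j < n \<Longrightarrow> y j \<in> shell N (real N) (real N * (1 + \<eta>))"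
    and good: "good n g m \<eta> (\<lambda>j\<in>{..<n}. radial_projection N (y j))"
  defines "X \<equiv> \<lambda>j. shifted N (1 / sqrt \<beta>) (m j) (cross N g (m j)) (y j)"
  shows "\<And>j. j < n \<Longrightarrow> X j \<in> shell N 0 (real N * (1 + 7 * \<eta>))"
    and "(\<lambda>j\<in>{..<n}. radial_projection N (X j)) \<in> overlap_constrained n Q N \<epsilon>"
    and "\<And>j. j < n \<Longrightarrow> 1 / (1 + 7 * \<eta>) * (\<beta> * ham N g (m j)) + 1 / (1 + 7 * \<eta>) * ham N g (radial_projection N (y j))
       \<le> \<beta> * ham N g (radial_projection N (X j))"
proof -
  have N: "0 < real N" using N_pos by simp
  define \<sigma> where "\<sigma> j = radial_projection N (y j)" for j
  have "\<exists>a. (\<forall>i<N. X j i = m j i + a * \<sigma> j i) \<and> 1 / \<beta> \<le> a\<^sup>2 \<and> a\<^sup>2 \<le> (1 + \<eta>) / \<beta> \<and> 0 \<le> a * ip N (cross N g (m j)) (\<sigma> j)"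
    if "j < n" for j
  proof -
    have b0: "0 < \<beta>" using \<beta> by simp
    show ?thesis
      by (rule shifted_decomposition[OF N_pos y[OF that] b0, of "m j" "cross N g (m j)"])
         (unfold X_def \<sigma>_def, blast)
  qed
  then have "\<forall>j\<in>{..<n}. \<exists>a. (\<forall>i<N. X j i = m j i + a * \<sigma> j i) \<and> 1 / \<beta> \<le> a\<^sup>2 \<and> a\<^sup>2 \<le> (1 + \<eta>) / \<beta> \<and> 0 \<le> a * ip N (cross N g (m j)) (\<sigma> j)"
    by blast
  then obtain a where "\<forall>j\<in>{..<n}. (\<forall>i<N. X j i = m j i + a j * \<sigma> j i) \<and> 1 / \<beta> \<le> (a j)\<^sup>2 \<and> (a j)\<^sup>2 \<le> (1 + \<eta>) / \<beta> \<and> 0 \<le> a j * ip N (cross N g (m j)) (\<sigma> j)"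
    by (rule bchoice[THEN exE])
  then have a: "\<And>j i. j < n \<Longrightarrow> i < N \<Longrightarrow> X j i = m j i + a j * \<sigma> j i"
    "\<And>j. j < n \<Longrightarrow> 1 / \<beta> \<le> (a j)\<^sup>2" "\<And>j. j < n \<Longrightarrow> (a j)\<^sup>2 \<le> (1 + \<eta>) / \<beta>" "\<And>j. j < n \<Longrightarrow> 0 \<le> a j * ip N (cross N g (m j)) (\<sigma> j)"
    by blast+
  have hs: "0 \<le> ham N g (\<sigma> j)" if "j < n" for j using good that by (auto simp: good_def \<sigma>_def)
  have os: "\<bar>ip N (\<sigma> j) (\<sigma> j') / real N\<bar> \<le> \<eta>" if "j < n" "j' < n" "j \<noteq> j'" for j j'
    using good that N by (auto simp: good_def \<sigma>_def divide_le_eq)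
  have om: "\<bar>ip N (m j) (\<sigma> j') / real N\<bar> \<le> \<eta>" if "j < n" "j' < n" for j j'
    using good that N by (auto simp: good_def \<sigma>_def divide_le_eq)
  have ypos: "0 < ip N (y j) (y j)" if "j < n" for j using y[OF that] N by (auto simp: shell_def)
  have ss: "ip N (\<sigma> j) (\<sigma> j) / real N = 1" if "j < n" for j
    unfolding \<sigma>_def using radial_projection_in_sphere(2)[OF N_pos ypos[OF that]] N by simp
  \<comment> \<open>a^2 <= 1 + \<eta> <= 15/14 < (6/5)^2.\<close>
  have abs_a: "\<bar>a j\<bar> \<le> 6 / 5" if "j < n" for j
  proof -
    have "(a j)\<^sup>2 \<le> (1 + \<eta>) / 1"
      using a(3)[OF that] \<beta> \<eta> by (elim order_trans) (intro divide_left_mono, auto)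
    also have "\<dots> \<le> (6 / 5)\<^sup>2" using \<eta> by (simp add: power2_eq_square)
    finally have "\<bar>a j\<bar> \<le> \<bar>6 / 5\<bar>" by (rule iffD2[OF abs_le_square_iff])
    then show ?thesis by (simp only: abs_divide abs_numeral)
  qed
  have ipX: "ip N (X j) (X j') / real N = ip N (m j) (m j') / real N + a j' * (ip N (m j) (\<sigma> j') / real N)
      + a j * (ip N (m j') (\<sigma> j) / real N) + a j * a j' * (ip N (\<sigma> j) (\<sigma> j') / real N)" if "j < n" "j' < n" for j j'
  proof -
    have "ip N (X j) (X j') = ip N (\<lambda>i. m j i + a j * \<sigma> j i) (\<lambda>i. m j' i + a j' * \<sigma> j' i)"
      using that by (intro ip_cong a(1))
    then show ?thesis
      by (simp add: ip_add ip_scale_left ip_scale_right ip_commute[of N "\<sigma> j" "m j'"] add_divide_distrib)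
  qed
  have small: "\<bar>u * v\<bar> \<le> 6 / 5 * \<eta>" if "\<bar>u\<bar> \<le> 6 / 5" "\<bar>v\<bar> \<le> \<eta>" for u v :: real
    unfolding abs_mult using that by (intro mult_mono) auto
  have gram: "\<bar>ip N (X j) (X j') / real N - Q $$ (j, j')\<bar> \<le> 7 * \<eta>" if j: "j < n" "j' < n" for j j'
  proof -
    have 1: "\<bar>a j' * (ip N (m j) (\<sigma> j') / real N)\<bar> \<le> 6 / 5 * \<eta>" "\<bar>a j * (ip N (m j') (\<sigma> j) / real N)\<bar> \<le> 6 / 5 * \<eta>"
      using j by (intro small abs_a om; simp)+
    have 2: "\<bar>a j * a j' * (ip N (\<sigma> j) (\<sigma> j') / real N) - (if j = j' then 1 / \<beta> else 0)\<bar> \<le> 3 / 2 * \<eta>"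
    proof (cases "j = j'")
      case True
      have "(1 + \<eta>) / \<beta> \<le> 1 / \<beta> + \<eta>" using \<beta> \<eta> by (simp add: add_divide_distrib divide_le_eq mult_le_cancel_left1)
      then have "\<bar>(a j)\<^sup>2 - 1 / \<beta>\<bar> \<le> \<eta>" using a(2,3)[OF j(1)] by linarith
      then show ?thesis using True ss[OF j(1)] \<eta> by (simp add: power2_eq_square)
    next
      case False
      have "\<bar>a j * a j'\<bar> \<le> 6 / 5 * (6 / 5)" unfolding abs_mult using abs_a j by (intro mult_mono) auto
      then have "\<bar>a j * a j' * (ip N (\<sigma> j) (\<sigma> j') / real N)\<bar> \<le> 6 / 5 * (6 / 5) * \<eta>"
        unfolding abs_mult[of "a j * a j'"] using os[OF j False] by (intro mult_mono) auto
      then show ?thesis using False \<eta> by simp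
    qed
    have "ip N (X j) (X j') / real N - Q $$ (j, j') =
       (ip N (m j) (m j') / real N - (Q $$ (j, j') - (if j = j' then 1 / \<beta> else 0))) + a j' * (ip N (m j) (\<sigma> j') / real N)
       + a j * (ip N (m j') (\<sigma> j) / real N) + (a j * a j' * (ip N (\<sigma> j) (\<sigma> j') / real N) - (if j = j' then 1 / \<beta> else 0))"
      unfolding ipX[OF j] by simp
    then show ?thesis using m[OF j] 1 2 \<eta>(1) by linarith
  qed
  define u where "u j = ip N (X j) (X j) / real N" for j
  have u: "1 - 7 * \<eta> \<le> u j" "u j \<le> 1 + 7 * \<eta>" "1 / 2 \<le> u j" if "j < n" for j
    using gram[OF that that] Q(1)[OF that] \<eta> unfolding u_def by (auto simp: abs_le_iff)
  have ipX0: "0 < ip N (X j) (X j)" if "j < n" for j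
  proof -
    have "0 < u j" using u(3)[OF that] by linarith
    then show ?thesis using N by (simp add: u_def zero_less_divide_iff)
  qed
  show 1: "X j \<in> shell N 0 (real N * (1 + 7 * \<eta>))" if "j < n" for j
    using u(2)[OF that] ipX0[OF that] N by (auto simp: shell_def u_def X_def space_PiM shifted_def divide_le_eq mult.commute)
  show "(\<lambda>j\<in>{..<n}. radial_projection N (X j)) \<in> overlap_constrained n Q N \<epsilon>"
    unfolding overlap_constrained_def
  proof (intro CollectI conjI allI impI)
    show "(\<lambda>j\<in>{..<n}. radial_projection N (X j)) \<in> {..<n} \<rightarrow>\<^sub>E spin_sphere N"
      by (intro restrict_PiE_iff[THEN iffD2] ballI radial_projection_in_sphere N_pos ipX0) simp
    fix j j' assume j: "j < n" "j' < n"
    let ?q = "ip N (X j) (X j') / real N" and ?d = "sqrt (u j * u j')"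
    have ov: "overlap N (radial_projection N (X j)) (radial_projection N (X j')) = ?q / ?d"
    proof -
      have "sqrt (real N / ip N (X i) (X i)) = 1 / sqrt (u i)" for i
        by (simp add: u_def real_sqrt_divide)
      then show ?thesis
        unfolding overlap_ip ip_radial_projection by (simp add: real_sqrt_mult)
    qed
    have d: "1 - 7 * \<eta> \<le> ?d" "?d \<le> 1 + 7 * \<eta>"
    proof -
      have "(1 - 7 * \<eta>)\<^sup>2 \<le> u j * u j'" unfolding power2_eq_square
        using u(1)[OF j(1)] u(1)[OF j(2)] u(3)[OF j(1)] \<eta> by (intro mult_mono) auto
      then show "1 - 7 * \<eta> \<le> ?d" by (rule real_le_rsqrt)
      have "u j * u j' \<le> (1 + 7 * \<eta>)\<^sup>2" unfolding power2_eq_square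
        using u(2)[OF j(1)] u(2)[OF j(2)] u(3)[OF j(2)] \<eta> by (intro mult_mono) auto
      then show "?d \<le> 1 + 7 * \<eta>" using \<eta> by (intro real_le_lsqrt) auto
    qed
    then have d2: "1 / 2 \<le> ?d" "\<bar>1 - ?d\<bar> \<le> 7 * \<eta>" using \<eta> by auto
    have "\<bar>Q $$ (j, j') * (1 - ?d)\<bar> \<le> 1 * (7 * \<eta>)"
      unfolding abs_mult using Q(2)[OF j] d2(2) by (intro mult_mono) auto
    \<comment> \<open>One error 7 \<eta> stems from the Gram matrix and one from the normalisation;
      dividing by a factor that is at least 1/2 doubles their sum, which is the origin of 28
      \<eta>.\<close>
    then have "\<bar>?q - Q $$ (j, j') * ?d\<bar> \<le> 14 * \<eta>"
      using gram[OF j] by (simp add: algebra_simps abs_le_iff)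
    also have "\<dots> \<le> 28 * \<eta> * ?d" using mult_left_mono[OF d2(1), of "28 * \<eta>"] \<eta> by simp
    finally have le: "\<bar>?q - Q $$ (j, j') * ?d\<bar> \<le> 28 * \<eta> * ?d" .
    have "0 < ?d" using d2(1) by linarith
    from iffD2[OF pos_divide_le_eq[OF this] le] have "\<bar>?q - Q $$ (j, j') * ?d\<bar> / ?d \<le> 28 * \<eta>" .
    moreover have "\<bar>?q - Q $$ (j, j') * ?d\<bar> / ?d = \<bar>?q / ?d - Q $$ (j, j')\<bar>"
    proof -
      have dp: "0 < ?d" using d2(1) by linarith
      have "?q / ?d - Q $$ (j, j') = (?q - Q $$ (j, j') * ?d) / ?d"
        unfolding diff_divide_distrib nonzero_mult_div_cancel_right[OF less_imp_neq[OF dp, symmetric]] by (rule refl)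
      then show ?thesis using dp by (simp only: abs_divide abs_of_pos)
    qed
    ultimately have "\<bar>?q / ?d - Q $$ (j, j')\<bar> \<le> \<epsilon>" using \<eta>(3) by linarith
    then have "?q / ?d \<in> {Q $$ (j, j') - \<epsilon>..Q $$ (j, j') + \<epsilon>}" by (auto simp only: abs_le_iff atLeastAtMost_iff)
    then show "overlap N ((\<lambda>j\<in>{..<n}. radial_projection N (X j)) j) ((\<lambda>j\<in>{..<n}. radial_projection N (X j)) j') \<in> {Q $$ (j, j') - \<epsilon>..Q $$ (j, j') + \<epsilon>}"
      using j ov by (simp only: restrict_apply' lessThan_iff)
  qed
  show "1 / (1 + 7 * \<eta>) * (\<beta> * ham N g (m j)) + 1 / (1 + 7 * \<eta>) * ham N g (radial_projection N (y j))
       \<le> \<beta> * ham N g (radial_projection N (X j))" if j: "j < n" for j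
  proof -
    have hX: "ham N g (m j) + 1 / \<beta> * ham N g (\<sigma> j) \<le> ham N g (X j)"
      using ham_add[of N "X j" "m j" "a j" "\<sigma> j" g, OF a(1)[OF j]] a(4)[OF j] mult_right_mono[OF a(2)[OF j] hs[OF j]] by simp
    have u0: "0 < u j" using u(3)[OF j] by linarith
    have "1 / (1 + 7 * \<eta>) * (\<beta> * ham N g (m j)) + 1 / (1 + 7 * \<eta>) * ham N g (\<sigma> j) = 1 / (1 + 7 * \<eta>) * (\<beta> * (ham N g (m j) + 1 / \<beta> * ham N g (\<sigma> j)))"
      using \<beta> by (simp add: algebra_simps)
    also have "\<dots> \<le> 1 / u j * (\<beta> * ham N g (X j))"
    proof (rule mult_mono)
      show "1 / (1 + 7 * \<eta>) \<le> 1 / u j" using u(2)[OF j] u0 by (intro divide_left_mono) auto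
      show "\<beta> * (ham N g (m j) + 1 / \<beta> * ham N g (\<sigma> j)) \<le> \<beta> * ham N g (X j)" using hX \<beta> by (intro mult_left_mono) auto
      show "0 \<le> 1 / u j" using u0 by simp
      show "0 \<le> \<beta> * (ham N g (m j) + 1 / \<beta> * ham N g (\<sigma> j))" using hm[OF j] hs[OF j] \<beta> by (intro mult_nonneg_nonneg add_nonneg_nonneg) auto
    qed
    also have "\<dots> = \<beta> * ham N g (radial_projection N (X j))"
      by (simp add: ham_radial_projection u_def)
    finally show ?thesis by (simp only: \<sigma>_def)
  qed
qed

lemma sets_overlap_constrained [measurable]: "overlap_constrained n Q N \<epsilon> \<in> sets (lam n)"
proof -
  have "overlap_constrained n Q N \<epsilon> = {\<sigma> \<in> space (lam n). (\<forall>j\<in>{..<n}. \<sigma> j \<in> spin_sphere N) \<and>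
     (\<forall>j\<in>{..<n}. \<forall>j'\<in>{..<n}. Q $$ (j, j') - \<epsilon> \<le> ip N (\<sigma> j) (\<sigma> j') / real N \<and> ip N (\<sigma> j) (\<sigma> j') / real N \<le> Q $$ (j, j') + \<epsilon>)}"
    by (auto simp: overlap_constrained_def overlap_ip space_PiM PiE_iff spin_sphere_eq)
  moreover have "Measurable.pred (lam n) (\<lambda>\<sigma>. (\<forall>j\<in>{..<n}. \<sigma> j \<in> spin_sphere N) \<and>
     (\<forall>j\<in>{..<n}. \<forall>j'\<in>{..<n}. Q $$ (j, j') - \<epsilon> \<le> ip N (\<sigma> j) (\<sigma> j') / real N \<and> ip N (\<sigma> j) (\<sigma> j') / real N \<le> Q $$ (j, j') + \<epsilon>))"
  proof -
    have "Measurable.pred (lam n) (\<lambda>\<sigma>. A \<le> ip N (\<sigma> j) (\<sigma> j') / real N \<and> ip N (\<sigma> j) (\<sigma> j') / real N \<le> B)"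
      if "j \<in> {..<n}" "j' \<in> {..<n}" for A B j j'
    proof -
      have [measurable]: "(\<lambda>\<sigma>. ip N (\<sigma> j) (\<sigma> j')) \<in> borel_measurable (lam n)" using that by (intro measurable_ip_lam) simp_all
      show ?thesis by measurable
    qed
    moreover have "Measurable.pred (lam n) (\<lambda>\<sigma>. \<sigma> j \<in> spin_sphere N)" if "j \<in> {..<n}" for j
      using that by (intro measurable_sphere_lam) simp
    ultimately show ?thesis
      by (intro pred_intros_logic pred_intros_finite finite_lessThan) auto
  qed
  ultimately show ?thesis unfolding pred_def by simp
qed

definition ZQ :: "nat \<Rightarrow> real mat \<Rightarrow> real \<Rightarrow> real \<Rightarrow> (nat \<times> nat \<Rightarrow> real) \<Rightarrow> real" where
  "ZQ n Q \<epsilon> \<beta> g = (LINT \<sigma>:overlap_constrained n Q N \<epsilon>|lam n. gw n g \<beta> \<sigma>)"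

lemma ZQ_integrable: "set_integrable (lam n) (overlap_constrained n Q N \<epsilon>) (gw n g \<beta>)"
  unfolding set_integrable_def by (rule integrable_mult_indicator[OF sets_overlap_constrained gibbs_product_one(1)])

text \<open>Only replicas that arise from shifting a good sample are kept. The first factor is the
  entropy price per replica, the exponential is the energy of the shifts, and half the partition
  function at \<open>b\<close> is what the good samples contribute.\<close>

theorem ZQ_lower:
  fixes Q :: "real mat"
  assumes \<beta>: "1 \<le> \<beta>" and \<eta>: "0 < \<eta>" "\<eta> \<le> 1 / 14" "28 * \<eta> \<le> \<epsilon>" and big: "2 \<le> sqrt (1 + \<eta>) ^ N"
    and Q: "\<And>j. j < n \<Longrightarrow> Q $$ (j, j) = 1" "\<And>j j'. j < n \<Longrightarrow> j' < n \<Longrightarrow> \<bar>Q $$ (j, j')\<bar> \<le> 1"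
    and m: "\<And>j j'. j < n \<Longrightarrow> j' < n \<Longrightarrow> \<bar>ip N (m j) (m j') / real N - (Q $$ (j, j') - (if j = j' then 1 / \<beta> else 0))\<bar> \<le> \<eta>"
    and hm: "\<And>j. j < n \<Longrightarrow> 0 \<le> ham N g (m j)"
  defines "b \<equiv> 1 / (1 + 7 * \<eta>)"
  assumes z: "measure (sphere_uniform N) {\<sigma> \<in> space (sphere_uniform N). ham N g \<sigma> < 0} \<le> \<zeta> * Z (disorder b 0 N g)"
    and small: "real n * \<zeta> + (real n)\<^sup>2 * r2 (disorder b 0 N g) / \<eta>\<^sup>2 + 2 * (real n)\<^sup>2 * sqrt (r2 (disorder b 0 N g)) / \<eta>\<^sup>2 \<le> 1 / 2"
  shows "((1 / sqrt (1 + 7 * \<eta>)) ^ N * (1 / sqrt \<beta>) ^ N / 2) ^ n * exp (b * \<beta> * (\<Sum>j<n. ham N g (m j))) * (Z (disorder b 0 N g) ^ n / 2) \<le> ZQ n Q \<epsilon> \<beta> g"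
proof -
  let ?L = "sphere_uniform N" and ?r = "real N" and ?s = "real N * (1 + \<eta>)" and ?R = "real N * (1 + 7 * \<eta>)"
  let ?U = "shell_uniform N ?r ?s"
  have N: "0 < real N" using N_pos by simp
  have rs: "0 \<le> ?r" "?r < ?s" using N \<eta> by (auto simp: field_simps)
  have R: "0 < ?R" using \<eta> by (intro mult_pos_pos N) simp
  define \<kappa> where "\<kappa> = shell_vol N ?r ?s / shell_vol N 0 ?R * (1 / sqrt \<beta>) ^ N / 2"
  define w where "w j = cross N g (m j)" for j
  define T where "T j y = radial_projection N (shifted N (1 / sqrt \<beta>) (m j) (w j) y)" for j y
  define D where "D j = {y \<in> space (bor N). shifted N (1 / sqrt \<beta>) (m j) (w j) y \<in> shell N 0 ?R}" for j
  define OC where "OC = overlap_constrained n Q N \<epsilon>"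
  have OC[measurable]: "OC \<in> sets (lam n)" unfolding OC_def by (rule sets_overlap_constrained)
  define \<Phi> where "\<Phi> \<sigma> = ennreal (indicator OC \<sigma> * gw n g \<beta> \<sigma>)" for \<sigma>
  define \<Psi> where "\<Psi> \<sigma> = ennreal (if good n g m \<eta> \<sigma> then gw n g b \<sigma> else 0)" for \<sigma>
  define E where "E = exp (b * \<beta> * (\<Sum>j<n. ham N g (m j)))"
  have Lp: "prob_space ?L" by (rule prob_space_sphere_uniform[OF N_pos])
  have Up: "prob_space ?U" by (rule prob_space_shell_uniform[OF N_pos rs])
  have ratio: "(1 / sqrt (1 + 7 * \<eta>)) ^ N * (1 / sqrt \<beta>) ^ N / 2 \<le> \<kappa>"
  proof -
    have "shell_vol N ?r ?s / shell_vol N 0 ?R = (sqrt ?s ^ N - sqrt ?r ^ N) / sqrt ?R ^ N"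
      using vol1(1)[OF N_pos] N_pos by (simp add: shell_vol_def)
    also have "\<dots> = (sqrt (1 + \<eta>) ^ N - 1) / sqrt (1 + 7 * \<eta>) ^ N"
      using N by (simp add: real_sqrt_mult power_mult_distrib divide_simps) (simp add: algebra_simps)
    \<comment> \<open>By \<open>big\<close> the numerator is at least 1: the source shell has at
      least the volume of the ball of radius sqrt N.\<close>
    also have "\<dots> \<ge> 1 / sqrt (1 + 7 * \<eta>) ^ N"
      using big \<eta> by (intro divide_right_mono) auto
    finally have "(1 / sqrt (1 + 7 * \<eta>)) ^ N \<le> shell_vol N ?r ?s / shell_vol N 0 ?R" by (simp add: power_one_over)
    then show ?thesis unfolding \<kappa>_def using \<beta> by (intro divide_right_mono mult_right_mono) auto
  qed
  have \<kappa>: "0 \<le> \<kappa>"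
    by (rule order_trans[OF _ ratio]) (use \<eta> \<beta> in auto)
  have Tm[measurable]: "T j \<in> measurable ?U ?L" for j
    unfolding T_def using measurable_compose[OF measurable_shifted measurable_radial_projection]
    by (simp add: measurable_cong_sets[OF sets_shell_uniform sets_sphere_uniform])
  have Dm[measurable]: "D j \<in> sets ?U" for j
  proof -
    have "D j = shifted N (1 / sqrt \<beta>) (m j) (w j) -` shell N 0 ?R \<inter> space (bor N)" by (auto simp: D_def)
    then show ?thesis using measurable_sets[OF measurable_shifted sets_shell] by simp
  qed
  have \<Phi>m: "\<Phi> \<in> borel_measurable (lam n)" unfolding \<Phi>_def by measurable
  have \<Psi>m: "\<Psi> \<in> borel_measurable (lam n)" unfolding \<Psi>_def by measurable
  have low: "ennreal (\<kappa> ^ card {..<n}) * (\<integral>\<^sup>+y. \<Phi> (\<lambda>j\<in>{..<n}. T j (y j)) * (\<Prod>j\<in>{..<n}. indicator (D j) (y j)) \<partial>(\<Pi>\<^sub>M j\<in>{..<n}. ?U)) \<le> (\<integral>\<^sup>+\<sigma>. \<Phi> \<sigma> \<partial>lam n)"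
  proof (rule nn_integral_PiM_le[OF finite_lessThan \<kappa> Lp Up Tm Dm _ \<Phi>m])
    fix j and f :: "(nat \<Rightarrow> real) \<Rightarrow> ennreal" assume f: "f \<in> borel_measurable ?L"
    have "f \<in> borel_measurable (bor N)" using f by (simp add: measurable_cong_sets[OF sets_sphere_uniform refl])
    then show "ennreal \<kappa> * (\<integral>\<^sup>+y. f (T j y) * indicator (D j) y \<partial>?U) \<le> (\<integral>\<^sup>+\<sigma>. f \<sigma> \<partial>?L)"
      unfolding \<kappa>_def T_def D_def using \<beta> R rs by (intro sphere_shift_le N_pos) auto
  qed
  have "AE y in (\<Pi>\<^sub>M j\<in>{..<n}. ?U). \<forall>j\<in>{..<n}. y j \<in> shell N ?r ?s"
    by (subst AE_finite_all) (auto intro!: AE_PiM_component Up AE_shell_uniform[OF N_pos rs])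
  then have pw: "AE y in (\<Pi>\<^sub>M j\<in>{..<n}. ?U). ennreal E * \<Psi> (\<lambda>j\<in>{..<n}. radial_projection N (y j)) \<le>
     \<Phi> (\<lambda>j\<in>{..<n}. T j (y j)) * (\<Prod>j\<in>{..<n}. indicator (D j) (y j))"
  proof eventually_elim
    case (elim y)
    let ?\<sigma> = "\<lambda>j\<in>{..<n}. radial_projection N (y j)"
    show ?case
    proof (cases "good n g m \<eta> ?\<sigma>")
      case False
      then show ?thesis by (simp only: \<Psi>_def if_False ennreal_0 mult_zero_right zero_le)
    next
      case True
      have yj: "y j \<in> shell N ?r ?s" if "j < n" for j using elim that by blast
      note gs = good_shifted[OF \<beta> \<eta> Q m hm yj True, folded w_def]
      have D1: "indicator (D j) (y j) = (1::ennreal)" if "j \<in> {..<n}" for j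
      proof -
        have "y j \<in> D j" using gs(1)[of j] yj[of j] that by (auto simp only: D_def shell_def mem_Collect_eq lessThan_iff)
        then show ?thesis by (rule indicator_simps(1))
      qed
      have D: "(\<Prod>j\<in>{..<n}. indicator (D j) (y j)) = (1::ennreal)"
        by (rule prod.neutral) (use D1 in blast)
      have O: "(\<lambda>j\<in>{..<n}. T j (y j)) \<in> OC"
        unfolding OC_def T_def by (rule gs(2)) auto
      have "b * \<beta> * (\<Sum>j<n. ham N g (m j)) + b * (\<Sum>j<n. ham N g (?\<sigma> j)) = (\<Sum>j<n. b * (\<beta> * ham N g (m j)) + b * ham N g (radial_projection N (y j)))"
        by (simp add: sum.distrib sum_distrib_left mult.assoc)
      also have "\<dots> \<le> (\<Sum>j<n. \<beta> * ham N g (T j (y j)))"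
        unfolding b_def T_def by (intro sum_mono gs(3)) auto
      also have "\<dots> = \<beta> * (\<Sum>j<n. ham N g ((\<lambda>j\<in>{..<n}. T j (y j)) j))"
        by (simp add: sum_distrib_left)
      finally have "E * gw n g b ?\<sigma> \<le> gw n g \<beta> (\<lambda>j\<in>{..<n}. T j (y j))"
        unfolding E_def gw_def exp_add[symmetric] by (simp only: exp_le_cancel_iff)
      moreover have "ennreal E * \<Psi> ?\<sigma> = ennreal (E * gw n g b ?\<sigma>)"
        using True unfolding \<Psi>_def E_def gw_def by (simp only: if_True ennreal_mult[OF exp_ge_zero exp_ge_zero])
      moreover have "\<Phi> (\<lambda>j\<in>{..<n}. T j (y j)) = ennreal (gw n g \<beta> (\<lambda>j\<in>{..<n}. T j (y j)))"
        using O unfolding \<Phi>_def by (simp only: indicator_simps(1) mult_1)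
      ultimately show ?thesis unfolding D mult_1_right by (simp only: ennreal_leI)
    qed
  qed
  have rm: "(\<lambda>y. \<lambda>j\<in>{..<n}. radial_projection N (y j)) \<in> measurable (\<Pi>\<^sub>M j\<in>{..<n}. ?U) (lam n)"
    by (intro measurable_restrict measurable_compose[OF measurable_component_singleton])
       (simp_all add: measurable_cong_sets[OF sets_shell_uniform sets_sphere_uniform])
  have "ennreal E * (\<integral>\<^sup>+\<sigma>. \<Psi> \<sigma> \<partial>lam n) = ennreal E * (\<integral>\<^sup>+y. \<Psi> (\<lambda>j\<in>{..<n}. radial_projection N (y j)) \<partial>(\<Pi>\<^sub>M j\<in>{..<n}. ?U))"
    by (subst PiM_sphere_uniform_distr[OF N_pos rs finite_lessThan], subst nn_integral_distr[OF rm]) (use \<Psi>m in simp_all)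
  also have "\<dots> = (\<integral>\<^sup>+y. ennreal E * \<Psi> (\<lambda>j\<in>{..<n}. radial_projection N (y j)) \<partial>(\<Pi>\<^sub>M j\<in>{..<n}. ?U))"
    by (rule nn_integral_cmult[symmetric]) (rule measurable_compose[OF rm \<Psi>m])
  also have "\<dots> \<le> (\<integral>\<^sup>+y. \<Phi> (\<lambda>j\<in>{..<n}. T j (y j)) * (\<Prod>j\<in>{..<n}. indicator (D j) (y j)) \<partial>(\<Pi>\<^sub>M j\<in>{..<n}. ?U))"
    by (rule nn_integral_mono_AE[OF pw])
  finally have mid: "ennreal E * (\<integral>\<^sup>+\<sigma>. \<Psi> \<sigma> \<partial>lam n) \<le> (\<integral>\<^sup>+y. \<Phi> (\<lambda>j\<in>{..<n}. T j (y j)) * (\<Prod>j\<in>{..<n}. indicator (D j) (y j)) \<partial>(\<Pi>\<^sub>M j\<in>{..<n}. ?U))" .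
  have gm: "Z (disorder b 0 N g) ^ n / 2 \<le> (LINT \<sigma>|lam n. (if good n g m \<eta> \<sigma> then gw n g b \<sigma> else 0))"
  proof (rule good_mass[OF _ \<eta>(1) _ z small])
    show "0 \<le> b" using \<eta> by (simp add: b_def)
    fix j assume j: "j < n"
    have "0 \<le> 1 / \<beta>" using \<beta> by simp
    moreover have "\<bar>ip N (m j) (m j) / real N - (1 - 1 / \<beta>)\<bar> \<le> \<eta>" using m[OF j j] Q(1)[OF j] by simp
    ultimately have "ip N (m j) (m j) / real N \<le> 2" using \<eta> by linarith
    then show "ip N (m j) (m j) \<le> 2 * real N" using N by (simp add: divide_le_eq)
  qed
  have ig: "integrable (lam n) (\<lambda>\<sigma>. if good n g m \<eta> \<sigma> then gw n g b \<sigma> else 0)"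
    by (rule Bochner_Integration.integrable_bound[OF gibbs_product_one(1)[of n g b]]) (auto simp: gw_def)
  have P1: "ennreal (Z (disorder b 0 N g) ^ n / 2) \<le> (\<integral>\<^sup>+\<sigma>. \<Psi> \<sigma> \<partial>lam n)"
    unfolding \<Psi>_def using order_trans[OF ennreal_leI[OF gm] ennreal_integral_le_nn_integral[OF ig]] .
  have P2: "(\<integral>\<^sup>+\<sigma>. \<Phi> \<sigma> \<partial>lam n) = ennreal (ZQ n Q \<epsilon> \<beta> g)"
    unfolding \<Phi>_def ZQ_def set_lebesgue_integral_def OC_def real_scaleR_def
    using ZQ_integrable[of n Q \<epsilon> g \<beta>] unfolding set_integrable_def real_scaleR_def
    by (intro nn_integral_eq_integral) (auto simp: gw_def)
  have Z0: "0 \<le> Z (disorder b 0 N g) ^ n / 2" using Z_pos[of "disorder b 0 N g"] by simp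
  have "ennreal (\<kappa> ^ n * E * (Z (disorder b 0 N g) ^ n / 2)) = ennreal (\<kappa> ^ n) * (ennreal E * ennreal (Z (disorder b 0 N g) ^ n / 2))"
    using \<kappa> Z0 by (simp only: ennreal_mult[OF zero_le_power mult_nonneg_nonneg] ennreal_mult E_def exp_ge_zero mult.assoc)
  also have "\<dots> \<le> ennreal (\<kappa> ^ n) * (ennreal E * (\<integral>\<^sup>+\<sigma>. \<Psi> \<sigma> \<partial>lam n))"
    by (intro mult_left_mono P1) auto
  also have "\<dots> \<le> ennreal (\<kappa> ^ n) * (\<integral>\<^sup>+y. \<Phi> (\<lambda>j\<in>{..<n}. T j (y j)) * (\<Prod>j\<in>{..<n}. indicator (D j) (y j)) \<partial>(\<Pi>\<^sub>M j\<in>{..<n}. ?U))"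
    by (rule mult_left_mono[OF mid]) simp
  also have "\<dots> \<le> ennreal (ZQ n Q \<epsilon> \<beta> g)"
    using low unfolding P2 card_lessThan .
  finally have "\<kappa> ^ n * E * (Z (disorder b 0 N g) ^ n / 2) \<le> ZQ n Q \<epsilon> \<beta> g"
    by (rule iffD1[OF ennreal_le_iff, rotated])
       (simp add: ZQ_def set_lebesgue_integral_def gw_def Bochner_Integration.integral_nonneg)
  moreover have "((1 / sqrt (1 + 7 * \<eta>)) ^ N * (1 / sqrt \<beta>) ^ N / 2) ^ n * E * (Z (disorder b 0 N g) ^ n / 2) \<le> \<kappa> ^ n * E * (Z (disorder b 0 N g) ^ n / 2)"
    using ratio Z0 \<eta> \<beta> by (intro mult_right_mono power_mono) (auto simp: E_def)
  ultimately show ?thesis unfolding E_def by (rule order_trans[rotated])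
qed

end

section \<open>Nonnegative definite matrices\<close>

definition qform :: "nat \<Rightarrow> (nat \<Rightarrow> nat \<Rightarrow> real) \<Rightarrow> (nat \<Rightarrow> real) \<Rightarrow> real" where
  "qform n A v = (\<Sum>i<n. \<Sum>j<n. A i j * v i * v j)"

lemma qform_Suc:
  assumes "\<And>i. i < n \<Longrightarrow> A n i = A i n"
  shows "qform (Suc n) A v = qform n A v + 2 * v n * (\<Sum>i<n. A i n * v i) + A n n * (v n)\<^sup>2"
proof -
  have "(\<Sum>j<n. A n j * v n * v j) = v n * (\<Sum>i<n. A i n * v i)"
    unfolding sum_distrib_left by (intro sum.cong) (simp_all add: assms)
  moreover have "(\<Sum>i<n. A i n * v i * v n) = v n * (\<Sum>i<n. A i n * v i)"
    unfolding sum_distrib_left by (intro sum.cong) simp_all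
  ultimately show ?thesis
    by (simp add: qform_def sum.distrib power2_eq_square)
qed

text \<open>Induction through the Schur complement of the last variable. The semidefinite case
  matters: \<open>Q - 1/\<beta>\<close> is singular when the least eigenvalue of \<beta>Q equals
  1.\<close>

theorem cholesky:
  assumes "\<And>i j. i < n \<Longrightarrow> j < n \<Longrightarrow> A i j = A j i" and "\<And>v. 0 \<le> qform n A v"
  shows "\<exists>L. \<forall>i<n. \<forall>j<n. A i j = (\<Sum>l<n. L i l * L j l)"
  using assms
proof (induction n arbitrary: A)
  case 0
  then show ?case by simp
next
  case (Suc n)
  have sym: "A n i = A i n" if "i < n" for i using Suc.prems(1)[of n i] that by simp
  note qS = qform_Suc[of n A, OF sym]
  define d where "d = A n n"
  have d: "0 \<le> d"
    using Suc.prems(2)[of "\<lambda>i. if i = n then 1 else 0"] unfolding qS by (simp add: qform_def d_def)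
  \<comment> \<open>A vanishing pivot forces its column to vanish, since otherwise the form would be
    affine and nonconstant in \<open>s\<close>; the value of \<open>s\<close> inserted at the end
    would make it equal to -1.\<close>
  have d0: "A i n = 0" if "d = 0" "i < n" for i
  proof -
    have "0 \<le> A i i + 2 * s * A i n" for s
    proof -
      let ?v = "\<lambda>k. if k = n then s else if k = i then 1 else (0::real)"
      have "(\<Sum>k<n. A k n * ?v k) = (\<Sum>k<n. if k = i then A i n else 0)" by (intro sum.cong) auto
      then have 1: "(\<Sum>k<n. A k n * ?v k) = A i n" using that by simp
      have "qform n A ?v = (\<Sum>k<n. \<Sum>l<n. if k = i \<and> l = i then A i i else 0)"
        unfolding qform_def by (intro sum.cong) auto
      also have "\<dots> = (\<Sum>k<n. if k = i then (\<Sum>l<n. if l = i then A i i else 0) else 0)"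
        by (intro sum.cong) auto
      finally have 2: "qform n A ?v = A i i" using that by simp
      have "qform (Suc n) A ?v = A i i + 2 * s * A i n"
        using qS[of ?v] 1 2 that by (simp add: d_def)
      then show ?thesis using Suc.prems(2)[of ?v] by (simp only:)
    qed
    from this[of "- (A i i + 1) / (2 * A i n)"] show ?thesis by (cases "A i n = 0") (auto simp: field_simps)
  qed
  \<comment> \<open>For d = 0 division by zero yields 0, and \<open>d0\<close> says that the column
    is then zero, so one formula covers both cases.\<close>
  let ?A = "\<lambda>i j. A i j - A i n * A j n / d"
  have "\<exists>L. \<forall>i<n. \<forall>j<n. ?A i j = (\<Sum>l<n. L i l * L j l)"
  proof (rule Suc.IH)
    show "?A i j = ?A j i" if "i < n" "j < n" for i j using Suc.prems(1)[of i j] that by simp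
    fix v :: "nat \<Rightarrow> real"
    let ?S = "\<Sum>i<n. A i n * v i"
    \<comment> \<open>For d > 0 this last coordinate minimises the larger form for given
      \<open>v\<close>, and the minimum is the Schur complement.\<close>
    let ?v = "v(n := - ?S / d)"
    have 1: "(\<Sum>i<n. A i n * ?v i) = ?S" by (intro sum.cong) auto
    have 2: "qform n A ?v = qform n A v" unfolding qform_def by (intro sum.cong) auto
    have "qform n ?A v = qform n A v - (\<Sum>i<n. \<Sum>j<n. (A i n * v i) * (A j n * v j) / d)"
      unfolding qform_def sum_subtractf[symmetric] by (intro sum.cong refl) (simp add: algebra_simps)
    also have "(\<Sum>i<n. \<Sum>j<n. (A i n * v i) * (A j n * v j) / d) = ?S * ?S / d"
      by (simp only: sum_product sum_divide_distrib)
    also have "qform n A v - ?S * ?S / d = qform (Suc n) A ?v"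
    proof -
      have "qform (Suc n) A ?v = qform n A v + 2 * (- ?S / d) * ?S + d * (- ?S / d)\<^sup>2"
        using qS[of ?v] unfolding 1 2 by (simp only: fun_upd_same d_def)
      moreover have "?S = 0" if "d = 0" using d0[OF that] by simp
      moreover have "u - S * S / d = u + 2 * (- S / d) * S + d * (- S / d)\<^sup>2" if "d = 0 \<Longrightarrow> S = 0" for u S :: real
        using that by (cases "d = 0") (auto simp: power2_eq_square field_simps)
      ultimately show ?thesis by (simp only:)
    qed
    finally show "0 \<le> qform n ?A v" using Suc.prems(2)[of ?v] by (simp only:)
  qed
  then obtain L where L: "\<And>i j. i < n \<Longrightarrow> j < n \<Longrightarrow> ?A i j = (\<Sum>l<n. L i l * L j l)" by blast
  define M where "M i l = (if l = n then A i n / sqrt d else if i = n then 0 else L i l)" for i l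
  have split: "(\<Sum>l<Suc n. M i l * M j l) = (\<Sum>l<n. M i l * M j l) + A i n * A j n / d" for i j
    using d by (simp add: M_def)
  have "A i j = (\<Sum>l<Suc n. M i l * M j l)" if ij: "i < Suc n" "j < Suc n" for i j
  proof -
    consider "i < n" "j < n" | "i < n" "j = n" | "i = n" "j < n" | "i = n" "j = n" using ij by linarith
    then show ?thesis
    proof cases
      case 1
      then have "(\<Sum>l<n. M i l * M j l) = ?A i j" unfolding L[OF 1] by (intro sum.cong) (auto simp: M_def)
      then show ?thesis unfolding split by simp
    qed (use d d0 sym in \<open>auto simp: split M_def d_def[symmetric]\<close>)
  qed
  then show ?case by blast
qed

lemma mult_mat_vec_sum:
  assumes "A \<in> carrier_mat n n" "i < n"
  shows "(A *\<^sub>v vec n v) $ i = (\<Sum>j<n. A $$ (i, j) * v j)"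
  using assms by (simp add: scalar_prod_def lessThan_atLeast0)

lemma qform_scalar_prod:
  assumes "A \<in> carrier_mat n n"
  shows "vec n v \<bullet> (A *\<^sub>v vec n v) = qform n (\<lambda>i j. A $$ (i, j)) v"
proof -
  have "vec n v \<bullet> (A *\<^sub>v vec n v) = (\<Sum>i<n. v i * (A *\<^sub>v vec n v) $ i)"
    using assms by (simp add: scalar_prod_def lessThan_atLeast0 del: index_mult_mat_vec)
  also have "\<dots> = (\<Sum>i<n. v i * (\<Sum>j<n. A $$ (i, j) * v j))"
    using assms by (intro sum.cong refl) (simp only: mult_mat_vec_sum lessThan_iff)
  finally show ?thesis by (simp add: qform_def sum_distrib_left mult_ac)
qed

lemma qform_shift: "qform n (\<lambda>i j. A i j - (if i = j then s else 0)) v = qform n A v - s * (\<Sum>i<n. (v i)\<^sup>2)"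
proof -
  have "(\<Sum>j<n. (A i j - (if i = j then s else 0)) * v i * v j) = (\<Sum>j<n. A i j * v i * v j) - s * (v i)\<^sup>2" if "i < n" for i
  proof -
    have "(\<Sum>j<n. (A i j - (if i = j then s else 0)) * v i * v j) = (\<Sum>j<n. A i j * v i * v j) - (\<Sum>j<n. if i = j then s * (v i)\<^sup>2 else 0)"
      unfolding sum_subtractf[symmetric] by (intro sum.cong refl) (auto simp: algebra_simps power2_eq_square)
    then show ?thesis using that by simp
  qed
  then show ?thesis by (simp add: qform_def sum_subtractf sum_distrib_left)
qed

text \<open>At the optimal constant \<open>\<mu>\<close> the form \<open>A - \<mu>\<close> is nonnegative; were it invertible, its Cholesky
  factor would be bounded below, and \<open>\<mu>\<close> could be increased.\<close>

theorem qform_ge_least_root: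
  fixes A :: "real mat"
  assumes A: "A \<in> carrier_mat n n" and sym: "transpose_mat A = A" and n: "0 < n"
    and roots: "\<And>t. poly (char_poly A) t = 0 \<Longrightarrow> c \<le> t"
    and psd: "\<And>v. s0 * (\<Sum>i<n. (v i)\<^sup>2) \<le> qform n (\<lambda>i j. A $$ (i, j)) v"
  shows "c * (\<Sum>i<n. (v i)\<^sup>2) \<le> qform n (\<lambda>i j. A $$ (i, j)) v"
proof -
  let ?q = "qform n (\<lambda>i j. A $$ (i, j))" and ?s = "\<lambda>v. \<Sum>i<n. (v i)\<^sup>2"
  define S where "S = {s. \<forall>v. s * ?s v \<le> ?q v}"
  have symA: "A $$ (i, j) = A $$ (j, i)" if "i < n" "j < n" for i j
    using sym A that by (metis carrier_matD index_transpose_mat(1))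
  have ub: "s \<le> ?q (\<lambda>i. if i = 0 then 1 else 0)" if "s \<in> S" for s
  proof -
    have "?s (\<lambda>i. if i = 0 then 1 else 0) = (\<Sum>i<n. if i = 0 then 1 else (0::real))" by (intro sum.cong) auto
    then have "?s (\<lambda>i. if i = 0 then 1 else (0::real)) = 1" using n by simp
    moreover have "s * ?s (\<lambda>i. if i = 0 then 1 else 0) \<le> ?q (\<lambda>i. if i = 0 then 1 else 0)"
      using that[unfolded S_def, THEN CollectD, THEN spec] .
    ultimately show ?thesis by (simp only: mult_1_right)
  qed
  have ne: "s0 \<in> S" using psd by (simp add: S_def)
  have bdd: "bdd_above S" by (rule bdd_aboveI) (rule ub)
  define \<mu> where "\<mu> = Sup S"
  have s0: "0 \<le> ?s v" for v :: "nat \<Rightarrow> real" by (intro sum_nonneg) simp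
  have \<mu>: "\<mu> * ?s v \<le> ?q v" for v
  proof (cases "?s v = 0")
    case True
    then show ?thesis using psd[of v] by simp
  next
    case False
    then have "0 < ?s v" using s0[of v] by linarith
    moreover from this have "s \<le> ?q v / ?s v" if "s \<in> S" for s
      using that by (simp add: S_def pos_le_divide_eq)
    then have "\<mu> \<le> ?q v / ?s v" unfolding \<mu>_def using ne by (intro cSup_least) auto
    ultimately show ?thesis by (simp add: pos_le_divide_eq)
  qed
  have "c \<le> \<mu>"
  proof (rule ccontr)
    assume "\<not> c \<le> \<mu>"
    then have "poly (char_poly A) \<mu> \<noteq> 0" using roots[of \<mu>] by auto
    then have "det (char_matrix A \<mu>) \<noteq> 0"
      using eigenvalue_root_char_poly[OF A] eigenvalue_det[OF A] by blast
    then obtain B where B: "B \<in> carrier_mat n n" "B * char_matrix A \<mu> = 1\<^sub>m n"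
      using det_non_zero_imp_unit[of "char_matrix A \<mu>" n] A
      by (auto simp: Units_def ring_mat_def)
    let ?M = "\<lambda>i j. A $$ (i, j) - (if i = j then \<mu> else 0)"
    have M: "char_matrix A \<mu> $$ (i, j) = ?M i j" if "i < n" "j < n" for i j
      using that A by (simp add: char_matrix_def)
    have "\<exists>L. \<forall>i<n. \<forall>j<n. ?M i j = (\<Sum>l<n. L i l * L j l)"
    proof (rule cholesky)
      show "?M i j = ?M j i" if "i < n" "j < n" for i j using symA that by simp
      show "0 \<le> qform n ?M v" for v unfolding qform_shift using \<mu>[of v] by simp
    qed
    then obtain L where L: "\<And>i j. i < n \<Longrightarrow> j < n \<Longrightarrow> ?M i j = (\<Sum>l<n. L i l * L j l)" by blast
    \<comment> \<open>T = B L satisfies T L^T = 1, so v is recovered from w = L^T v, and the squared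
      norm of w is the value of the shifted form at v. Cauchy-Schwarz then bounds |v|^2 by a
      multiple of that value.\<close>
    define T where "T i l = (\<Sum>k<n. B $$ (i, k) * L k l)" for i l
    have id: "(\<Sum>l<n. T i l * L j l) = (if i = j then 1 else 0)" if "i < n" "j < n" for i j
    proof -
      have "(\<Sum>l<n. T i l * L j l) = (\<Sum>k<n. B $$ (i, k) * (\<Sum>l<n. L k l * L j l))"
        unfolding T_def sum_distrib_left sum_distrib_right by (subst sum.swap) (simp add: mult.assoc)
      also have "\<dots> = (\<Sum>k<n. B $$ (i, k) * char_matrix A \<mu> $$ (k, j))"
        using L M that by (intro sum.cong) auto
      also have "\<dots> = (B * char_matrix A \<mu>) $$ (i, j)"
        using that B(1) carrier_matD[OF char_matrix_closed[OF A, of \<mu>]] by (simp add: scalar_prod_def lessThan_atLeast0)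
      finally show ?thesis using that B(2) by simp
    qed
    define C where "C = (\<Sum>i<n. \<Sum>l<n. (T i l)\<^sup>2)"
    have key: "?s v \<le> C * (?q v - \<mu> * ?s v)" for v
    proof -
      define w where "w l = (\<Sum>j<n. L j l * v j)" for l
      have wq: "(\<Sum>l<n. (w l)\<^sup>2) = ?q v - \<mu> * ?s v"
      proof -
        have "(\<Sum>l<n. (w l)\<^sup>2) = (\<Sum>l<n. \<Sum>i<n. \<Sum>j<n. (L i l * v i) * (L j l * v j))"
          by (simp only: w_def power2_eq_square sum_product)
        also have "\<dots> = (\<Sum>i<n. \<Sum>l<n. \<Sum>j<n. (L i l * v i) * (L j l * v j))"
          by (rule sum.swap)
        also have "\<dots> = (\<Sum>i<n. \<Sum>j<n. \<Sum>l<n. (L i l * v i) * (L j l * v j))"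
          by (rule sum.cong[OF refl sum.swap])
        also have "\<dots> = qform n ?M v"
          unfolding qform_def
        proof (intro sum.cong refl)
          fix i j assume "i \<in> {..<n}" "j \<in> {..<n}"
          then have "?M i j = (\<Sum>l<n. L i l * L j l)" by (intro L) simp_all
          then have "?M i j * v i * v j = (\<Sum>l<n. L i l * L j l * v i * v j)"
            by (simp only: sum_distrib_right)
          then show "(\<Sum>l<n. (L i l * v i) * (L j l * v j)) = ?M i j * v i * v j"
            by (simp only: mult_ac)
        qed
        finally show ?thesis by (simp only: qform_shift)
      qed
      have v: "v i = (\<Sum>l<n. T i l * w l)" if "i < n" for i
      proof -
        have "(\<Sum>l<n. T i l * w l) = (\<Sum>j<n. (\<Sum>l<n. T i l * L j l) * v j)"
          unfolding w_def sum_distrib_left sum_distrib_right by (subst sum.swap) (simp add: mult.assoc)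
        also have "\<dots> = (\<Sum>j<n. if i = j then v j else 0)" using that by (intro sum.cong) (auto simp: id)
        finally show ?thesis using that by simp
      qed
      have "?s v \<le> (\<Sum>i<n. (\<Sum>l<n. (T i l)\<^sup>2) * (\<Sum>l<n. (w l)\<^sup>2))"
        by (intro sum_mono) (simp only: v lessThan_iff Cauchy_Schwarz_ineq_sum)
      then show ?thesis by (simp add: C_def wq sum_distrib_right)
    qed
    have C: "0 < C"
    proof -
      have "?s (\<lambda>i. if i = 0 then 1 else 0) = (\<Sum>i<n. if i = 0 then 1 else (0::real))" by (intro sum.cong) auto
      then have "?s (\<lambda>i. if i = 0 then 1 else (0::real)) = 1" using n by simp
      then have "C \<noteq> 0" using key[of "\<lambda>i. if i = 0 then 1 else 0"] by auto
      moreover have "0 \<le> C" unfolding C_def by (intro sum_nonneg) simp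
      ultimately show ?thesis by simp
    qed
    have "(\<mu> + 1 / C) * ?s v \<le> ?q v" for v
      using key[of v] C by (simp add: field_simps)
    then have "\<mu> + 1 / C \<in> S" by (simp add: S_def)
    then have "\<mu> + 1 / C \<le> \<mu>" unfolding \<mu>_def by (intro cSup_upper bdd)
    then show False using C by simp
  qed
  then have "c * ?s v \<le> \<mu> * ?s v" using s0 by (intro mult_right_mono) auto
  then show ?thesis using \<mu>[of v] by linarith
qed

text \<open>Here the eigenvalues enter: that all of them are at least 1 means that
  \<open>Q - 1/\<beta>\<close> is nonnegative. Row j of \<open>L\<close> will hold the coefficients
  of the shift of replica j in a nearly orthonormal system.\<close>

corollary edge_factorization:
  fixes Q :: "real mat"
  assumes n: "0 < n" and \<beta>: "0 < \<beta>" and Q: "Q \<in> carrier_mat n n" "transpose_mat Q = Q" "nonneg_definite n Q"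
    and r: "char_poly (\<beta> \<cdot>\<^sub>m Q) = (\<Prod>j<n. [:- r j, 1:])" "Min (r ` {..<n}) \<ge> 1"
  obtains L where "\<And>i j. i < n \<Longrightarrow> j < n \<Longrightarrow> Q $$ (i, j) - (if i = j then 1 / \<beta> else 0) = (\<Sum>l<n. L i l * L j l)"
proof -
  have q: "qform n (\<lambda>i j. (\<beta> \<cdot>\<^sub>m Q) $$ (i, j)) v = \<beta> * qform n (\<lambda>i j. Q $$ (i, j)) v" for v
    using Q unfolding qform_def sum_distrib_left by (intro sum.cong) (auto simp: mult.assoc)
  have "1 * (\<Sum>i<n. (v i)\<^sup>2) \<le> qform n (\<lambda>i j. (\<beta> \<cdot>\<^sub>m Q) $$ (i, j)) v" for v
  proof (rule qform_ge_least_root[where ?s0.0 = 0])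
    show "\<beta> \<cdot>\<^sub>m Q \<in> carrier_mat n n" using Q by simp
    show "transpose_mat (\<beta> \<cdot>\<^sub>m Q) = \<beta> \<cdot>\<^sub>m Q" using Q by (intro eq_matI) (auto, metis carrier_matD index_transpose_mat(1))
    show "1 \<le> t" if t: "poly (char_poly (\<beta> \<cdot>\<^sub>m Q)) t = 0" for t
    proof -
      have "\<exists>j<n. t = r j" using t unfolding r by (auto simp: poly_prod)
      then obtain j where "j < n" "t = r j" by blast
      moreover from this have "Min (r ` {..<n}) \<le> r j" by (intro Min_le) auto
      ultimately show ?thesis using r(2) by linarith
    qed
    show "0 * (\<Sum>i<n. (v i)\<^sup>2) \<le> qform n (\<lambda>i j. (\<beta> \<cdot>\<^sub>m Q) $$ (i, j)) v" for v
    proof -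
      have "0 \<le> vec n v \<bullet> (Q *\<^sub>v vec n v)"
        using Q(3) unfolding nonneg_definite_def by (rule bspec) (rule vec_carrier)
      then show ?thesis unfolding q qform_scalar_prod[OF Q(1)] using \<beta> by simp
    qed
  qed (rule n)
  then have "0 \<le> qform n (\<lambda>i j. Q $$ (i, j) - (if i = j then 1 / \<beta> else 0)) v" for v
    unfolding qform_shift q using \<beta> by (simp add: field_simps)
  moreover have "Q $$ (i, j) = Q $$ (j, i)" if "i < n" "j < n" for i j
    using Q that by (metis carrier_matD index_transpose_mat(1))
  ultimately have "\<exists>L. \<forall>i<n. \<forall>j<n. Q $$ (i, j) - (if i = j then 1 / \<beta> else 0) = (\<Sum>l<n. L i l * L j l)"
    by (intro cholesky) auto
  then show thesis using that by blast
qed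

section \<open>Lower bound for the constrained partition function\<close>

lemma measurable_gauss_component: "p \<in> K \<Longrightarrow> (\<lambda>g. g p) \<in> borel_measurable (gauss K)"
  using measurable_component_singleton[of p K "\<lambda>_. borel"] by (simp add: measurable_cong_sets[OF sets_gauss refl])

context spin
begin

lemma gw_nonneg: "0 \<le> gw n g b \<sigma>" by (simp add: gw_def)

lemma ZQ_nonneg: "0 \<le> ZQ n Q \<epsilon> \<beta> g"
  unfolding ZQ_def set_lebesgue_integral_def by (intro Bochner_Integration.integral_nonneg) (simp add: gw_nonneg)

lemma ZQ_le: "ZQ n Q \<epsilon> \<beta> g \<le> Z (disorder \<beta> 0 N g) ^ n"
proof -
  have "ZQ n Q \<epsilon> \<beta> g \<le> (LINT \<sigma>|lam n. gw n g \<beta> \<sigma>)"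
    unfolding ZQ_def set_lebesgue_integral_def
    by (intro integral_mono ZQ_integrable[unfolded set_integrable_def] gibbs_product_one(1))
       (auto simp: indicator_def gw_nonneg)
  then show ?thesis by (simp only: gibbs_product_one(2))
qed

lemma ZQ_zero: "ZQ n Q \<epsilon> 0 g = ZQ n Q \<epsilon> 0 g'"
  by (simp add: ZQ_def gw_def)

lemma measurable_ZQ:
  shows "(\<lambda>g. ZQ n Q \<epsilon> \<beta> g) \<in> borel_measurable (gauss (sites N))"
proof -
  let ?G = "gauss (sites N)"
  interpret P: prob_space "lam n" by (rule prob_space_lam)
  note c = measurable_gauss_component[of _ "sites N"]
  have h: "(\<lambda>w. ham N (fst w) (snd w j)) \<in> borel_measurable (?G \<Otimes>\<^sub>M lam n)" if "j \<in> {..<n}" for j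
    using that by (intro measurable_ham measurable_compose[OF measurable_fst c] measurable_compose[OF measurable_snd measurable_component2]) auto
  have [measurable]: "(\<lambda>w. gw n (fst w) \<beta> (snd w)) \<in> borel_measurable (?G \<Otimes>\<^sub>M lam n)"
    unfolding gw_def by (intro measurable_compose[OF _ borel_measurable_exp] borel_measurable_times borel_measurable_const borel_measurable_sum h)
  have [measurable]: "(\<lambda>w. indicator (overlap_constrained n Q N \<epsilon>) (snd w) :: real) \<in> borel_measurable (?G \<Otimes>\<^sub>M lam n)"
    by (rule measurable_compose[OF measurable_snd borel_measurable_indicator[OF sets_overlap_constrained]])
  have "(\<lambda>(g, \<sigma>). indicator (overlap_constrained n Q N \<epsilon>) \<sigma> *\<^sub>R gw n g \<beta> \<sigma>) \<in> borel_measurable (?G \<Otimes>\<^sub>M lam n)"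
    unfolding case_prod_beta by measurable
  then show ?thesis
    unfolding ZQ_def set_lebesgue_integral_def by (rule P.borel_measurable_lebesgue_integral)
qed

text \<open>Cauchy-Schwarz for exp (\<beta> H / 2) and exp (- \<beta> H / 2), derived from a
  nonnegative quadratic in t. For every disorder it bounds \<open>ZQ\<close> from below by the
  squared volume divided by a partition function at - \<beta>, and the latter can be bounded from
  above.\<close>

lemma ZQ_symmetrization: "(ZQ n Q \<epsilon> 0 g)\<^sup>2 \<le> ZQ n Q \<epsilon> \<beta> g * ZQ n Q \<epsilon> (- \<beta>) g"
proof -
  let ?A = "ZQ n Q \<epsilon> \<beta> g" and ?B = "ZQ n Q \<epsilon> (- \<beta>) g" and ?V = "ZQ n Q \<epsilon> 0 g"
  let ?I = "\<lambda>b \<sigma>. indicator (overlap_constrained n Q N \<epsilon>) \<sigma> * gw n g b \<sigma>"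
  have i: "integrable (lam n) (?I b)" for b
    using ZQ_integrable[of n Q \<epsilon> g b] unfolding set_integrable_def by simp
  have Z: "ZQ n Q \<epsilon> b g = (LINT \<sigma>|lam n. ?I b \<sigma>)" for b
    by (simp add: ZQ_def set_lebesgue_integral_def)
  have quad: "0 \<le> t\<^sup>2 * ?A - 2 * t * ?V + ?B" for t
  proof -
    have "0 \<le> (LINT \<sigma>|lam n. t\<^sup>2 * ?I \<beta> \<sigma> - 2 * t * ?I 0 \<sigma> + ?I (- \<beta>) \<sigma>)"
    proof (intro Bochner_Integration.integral_nonneg)
      fix \<sigma>
      let ?x = "exp (\<beta> * (\<Sum>j<n. ham N g (\<sigma> j)) / 2)" and ?y = "exp (- (\<beta> * (\<Sum>j<n. ham N g (\<sigma> j))) / 2)"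
      have "gw n g \<beta> \<sigma> = ?x\<^sup>2" "gw n g (- \<beta>) \<sigma> = ?y\<^sup>2" "gw n g 0 \<sigma> = ?x * ?y"
        by (simp_all add: gw_def power2_eq_square exp_add[symmetric])
      then have "t\<^sup>2 * ?I \<beta> \<sigma> - 2 * t * ?I 0 \<sigma> + ?I (- \<beta>) \<sigma> = indicator (overlap_constrained n Q N \<epsilon>) \<sigma> * (t * ?x - ?y)\<^sup>2"
        by (simp add: power2_diff power_mult_distrib algebra_simps)
      then show "0 \<le> t\<^sup>2 * ?I \<beta> \<sigma> - 2 * t * ?I 0 \<sigma> + ?I (- \<beta>) \<sigma>" by simp
    qed
    then show ?thesis unfolding Z using i by simp
  qed
  show ?thesis
  proof (cases "?A = 0")
    case True
    have "?V = 0"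
    proof (rule ccontr)
      assume V: "?V \<noteq> 0"
      have "2 * ((?B + 1) / (2 * ?V)) * ?V = ?B + 1" using V by (simp add: field_simps)
      then show False using quad[of "(?B + 1) / (2 * ?V)"] True by simp
    qed
    then show ?thesis using True by simp
  next
    case False
    then have A: "0 < ?A" using ZQ_nonneg[of n Q \<epsilon> \<beta> g] by simp
    have "(?V / ?A)\<^sup>2 * ?A - 2 * (?V / ?A) * ?V = - (?V\<^sup>2 / ?A)" using A by (simp add: field_simps power2_eq_square)
    then have "?V\<^sup>2 / ?A \<le> ?B" using quad[of "?V / ?A"] by linarith
    then show ?thesis using A by (simp add: pos_divide_le_eq mult.commute)
  qed
qed

lemma ZQ_pos: "0 < ZQ n Q \<epsilon> 0 g \<Longrightarrow> 0 < ZQ n Q \<epsilon> \<beta> g"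
  using ZQ_symmetrization[of n Q \<epsilon> g \<beta>] ZQ_nonneg[of n Q \<epsilon> \<beta> g]
  by (cases "ZQ n Q \<epsilon> \<beta> g = 0") auto

lemma ln_ZQ_le: "0 < ZQ n Q \<epsilon> 0 g \<Longrightarrow> ln (ZQ n Q \<epsilon> \<beta> g) \<le> real n * ln (Z (disorder \<beta> 0 N g))"
  using ZQ_le[of n Q \<epsilon> \<beta> g] ZQ_pos[of n Q \<epsilon> g \<beta>] Z_pos[of "disorder \<beta> 0 N g"]
  by (simp add: ln_realpow[symmetric])

lemma ln_ZQ_ge:
  assumes "0 < ZQ n Q \<epsilon> 0 g"
  shows "2 * ln (ZQ n Q \<epsilon> 0 g) - real n * ln (Z (disorder (- \<beta>) 0 N g)) \<le> ln (ZQ n Q \<epsilon> \<beta> g)"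
proof -
  have "2 * ln (ZQ n Q \<epsilon> 0 g) = ln ((ZQ n Q \<epsilon> 0 g)\<^sup>2)" using assms by (simp add: ln_realpow)
  also have "\<dots> \<le> ln (ZQ n Q \<epsilon> \<beta> g * ZQ n Q \<epsilon> (- \<beta>) g)"
    by (rule iffD2[OF ln_le_cancel_iff[OF zero_less_power[OF assms] mult_pos_pos[OF ZQ_pos[OF assms] ZQ_pos[OF assms]]] ZQ_symmetrization])
  also have "\<dots> = ln (ZQ n Q \<epsilon> \<beta> g) + ln (ZQ n Q \<epsilon> (- \<beta>) g)"
    using ZQ_pos[OF assms] by (simp add: ln_mult less_imp_neq[symmetric])
  finally show ?thesis using ln_ZQ_le[OF assms, of "- \<beta>"] by simp
qed

lemma integrable_ln_ZQ:
  assumes "\<And>g. 0 < ZQ n Q \<epsilon> 0 g"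
  shows "integrable (gauss (sites N)) (\<lambda>g. ln (ZQ n Q \<epsilon> \<beta> g))"
proof (rule Bochner_Integration.integrable_bound)
  interpret G: prob_space "gauss (sites N)" by (rule prob_space_gauss)
  let ?V = "ZQ n Q \<epsilon> 0 (\<lambda>_. 0)"
  show "integrable (gauss (sites N)) (\<lambda>g. real n * \<bar>ln (Z (disorder \<beta> 0 N g))\<bar> + real n * \<bar>ln (Z (disorder (- \<beta>) 0 N g))\<bar> + 2 * \<bar>ln ?V\<bar>)"
    using integrable_abs[OF integrable_ln_Z_disorder] by (intro Bochner_Integration.integrable_add integrable_mult_right) auto
  show "(\<lambda>g. ln (ZQ n Q \<epsilon> \<beta> g)) \<in> borel_measurable (gauss (sites N))"
    by (rule measurable_compose[OF measurable_ZQ borel_measurable_ln]) simp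
  show "AE g in gauss (sites N). norm (ln (ZQ n Q \<epsilon> \<beta> g)) \<le>
     norm (real n * \<bar>ln (Z (disorder \<beta> 0 N g))\<bar> + real n * \<bar>ln (Z (disorder (- \<beta>) 0 N g))\<bar> + 2 * \<bar>ln ?V\<bar>)"
  proof (rule AE_I2)
    fix g
    let ?a = "real n * \<bar>ln (Z (disorder \<beta> 0 N g))\<bar>" and ?b = "real n * \<bar>ln (Z (disorder (- \<beta>) 0 N g))\<bar>"
    have "ln (ZQ n Q \<epsilon> \<beta> g) \<le> ?a"
    proof -
      have "real n * ln (Z (disorder \<beta> 0 N g)) \<le> ?a" by (intro mult_left_mono abs_ge_self) simp
      then show ?thesis using ln_ZQ_le[OF assms, of \<beta> g] by linarith
    qed
    moreover have "- ?b - 2 * \<bar>ln ?V\<bar> \<le> ln (ZQ n Q \<epsilon> \<beta> g)"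
    proof -
      have "real n * ln (Z (disorder (- \<beta>) 0 N g)) \<le> ?b" by (intro mult_left_mono abs_ge_self) simp
      then show ?thesis using ln_ZQ_ge[OF assms, of g \<beta>] unfolding ZQ_zero[of n Q \<epsilon> g "\<lambda>_. 0"] by linarith
    qed
    moreover have "0 \<le> ?a" "0 \<le> ?b" by simp_all
    moreover have "\<bar>x\<bar> \<le> \<bar>a + b + 2 * \<bar>v\<bar>\<bar>" if "x \<le> a" "- b - 2 * \<bar>v\<bar> \<le> x" "0 \<le> a" "0 \<le> b" for x a b v :: real
      using that by (simp only: abs_le_iff abs_of_nonneg) linarith
    ultimately show "norm (ln (ZQ n Q \<epsilon> \<beta> g)) \<le> norm (?a + ?b + 2 * \<bar>ln ?V\<bar>)" unfolding real_norm_def by blast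
  qed
qed

lemma expected_ln_ZQ_le:
  assumes "\<And>g. 0 < ZQ n Q \<epsilon> 0 g"
  shows "(LINT g|gauss (sites N). ln (ZQ n Q \<epsilon> \<beta> g)) \<le> real n * phi \<beta> 0"
proof -
  have "(LINT g|gauss (sites N). ln (ZQ n Q \<epsilon> \<beta> g)) \<le> (LINT g|gauss (sites N). real n * ln (Z (disorder \<beta> 0 N g)))"
    using assms by (intro integral_mono integrable_ln_ZQ ln_ZQ_le integrable_mult_right integrable_ln_Z_disorder) auto
  then show ?thesis by (simp add: phi_def)
qed

lemma expected_Z:
  "integrable (gauss (sites N)) (\<lambda>g. Z (disorder b 0 N g))"
  "(LINT g|gauss (sites N). Z (disorder b 0 N g)) \<le> exp (real N * b\<^sup>2 / 4)"
proof -
  let ?L = "sphere_uniform N" and ?G = "gauss (sites N)"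
  interpret G: prob_space ?G by (rule prob_space_gauss)
  interpret GL: pair_sigma_finite ?G ?L ..
  note c = measurable_gauss_component[of _ "sites N"]
  have [measurable]: "(\<lambda>w. ham N (fst w) (snd w)) \<in> borel_measurable (?G \<Otimes>\<^sub>M ?L)"
    by (intro measurable_ham measurable_compose[OF measurable_fst c] measurable_compose[OF measurable_snd measurable_spin])
  have m: "(\<lambda>(g, \<sigma>). ennreal (exp (b * ham N g \<sigma>))) \<in> borel_measurable (?G \<Otimes>\<^sub>M ?L)"
    unfolding case_prod_beta by measurable
  have "(\<integral>\<^sup>+g. ennreal (Z (disorder b 0 N g)) \<partial>?G) = (\<integral>\<^sup>+g. (\<integral>\<^sup>+\<sigma>. ennreal (exp (b * ham N g \<sigma>)) \<partial>?L) \<partial>?G)"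
    unfolding Z_def using integrable_exp_energy1[of "disorder b 0 N g" for g]
    by (intro nn_integral_cong, subst nn_integral_eq_integral[symmetric]) (auto simp: energy_field)
  also have "\<dots> = (\<integral>\<^sup>+\<sigma>. (\<integral>\<^sup>+g. ennreal (exp (b * ham N g \<sigma>)) \<partial>?G) \<partial>?L)"
    by (rule GL.Fubini'[symmetric]) (rule m)
  also have "\<dots> = (\<integral>\<^sup>+\<sigma>. ennreal (exp (real N * b\<^sup>2 / 4)) \<partial>?L)"
  proof (rule nn_integral_cong_AE)
    show "AE \<sigma> in ?L. (\<integral>\<^sup>+g. ennreal (exp (b * ham N g \<sigma>)) \<partial>?G) = ennreal (exp (real N * b\<^sup>2 / 4))"
      using AE_spin_sphere[OF N_pos]
    proof eventually_elim
      case (elim \<sigma>)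
      have "ip N \<sigma> \<sigma> = real N" using elim by (simp add: spin_sphere_eq)
      \<comment> \<open>One replica at b is the two-replica formula at \<sigma> = \<tau> and b /
        2.\<close>
      then show ?case using nn_integral_gauss_ham[OF elim elim, of "b / 2"] N_pos
        by (simp add: power_divide power2_eq_square field_simps)
    qed
  qed
  also have "\<dots> = ennreal (exp (real N * b\<^sup>2 / 4))" using emeasure_space_1 by simp
  finally have eq: "(\<integral>\<^sup>+g. ennreal (Z (disorder b 0 N g)) \<partial>?G) = ennreal (exp (real N * b\<^sup>2 / 4))" .
  have Zn: "norm (Z (disorder b 0 N g)) = Z (disorder b 0 N g)" for g using Z_pos[of "disorder b 0 N g"] by simp
  show i: "integrable ?G (\<lambda>g. Z (disorder b 0 N g))"
    by (rule integrableI_bounded[OF measurable_Z_disorder]) (simp only: Zn eq ennreal_less_top infinity_ennreal_def)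
  have "ennreal (LINT g|?G. Z (disorder b 0 N g)) \<le> ennreal (exp (real N * b\<^sup>2 / 4))"
    using ennreal_integral_le_nn_integral[OF i] by (simp only: eq)
  then show "(LINT g|?G. Z (disorder b 0 N g)) \<le> exp (real N * b\<^sup>2 / 4)" by (simp only: ennreal_le_iff exp_ge_zero)
qed

text \<open>
  This bound holds for every disorder and controls the event where the sharp bound fails; with \<open>K = N \<beta>\<^sup>2 / 4\<close> the
  second term has bounded expectation.
\<close>

lemma ln_ZQ_crude:
  assumes "0 < ZQ n Q \<epsilon> 0 g"
  shows "2 * ln (ZQ n Q \<epsilon> 0 g) - real n * (K + exp (- K) * Z (disorder (- \<beta>) 0 N g)) \<le> ln (ZQ n Q \<epsilon> \<beta> g)"
proof -
  let ?z = "Z (disorder (- \<beta>) 0 N g)"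
  have z: "0 < ?z" by (rule Z_pos)
  have "ln (exp (- K) * ?z) \<le> exp (- K) * ?z - 1" using z by (intro ln_le_minus_one) simp
  then have "ln ?z \<le> K + exp (- K) * ?z" using z by (simp add: ln_mult)
  then have "real n * ln ?z \<le> real n * (K + exp (- K) * ?z)" by (rule mult_left_mono) simp
  then show ?thesis using ln_ZQ_ge[OF assms, of \<beta>] by linarith
qed

end

section \<open>Vectors at the upper spectral edge\<close>

lemma ham_goe: "ham N g v = ip N v (\<lambda>i. \<Sum>k<N. goe N g i k * v k)"
proof -
  let ?s = "2 * sqrt (2 * real N)"
  have "ip N v (\<lambda>i. \<Sum>k<N. goe N g i k * v k) = (\<Sum>i<N. \<Sum>k<N. g (i, k) * v i * v k / ?s) + (\<Sum>i<N. \<Sum>k<N. g (k, i) * v i * v k / ?s)"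
    unfolding ip_def sum.distrib[symmetric] sum_distrib_left
    by (intro sum.cong refl) (simp add: goe_def add_divide_distrib algebra_simps)
  also have "(\<Sum>i<N. \<Sum>k<N. g (k, i) * v i * v k / ?s) = (\<Sum>k<N. \<Sum>i<N. g (k, i) * v i * v k / ?s)"
    by (rule sum.swap)
  also have "\<dots> = (\<Sum>i<N. \<Sum>k<N. g (i, k) * v i * v k / ?s)"
    by (intro sum.cong refl) (simp add: mult_ac)
  finally show ?thesis
    by (simp add: ham_def hamiltonian_def real_sqrt_mult sum_divide_distrib[symmetric])
qed

text \<open>
  The vector \<open>(1 + W) W\<^sup>k e\<^sub>l\<close>: for large \<open>k\<close> it lies close to the upper edge \<open>1\<close> of the spectrum of \<open>W = goe N g\<close>, because
  the factor \<open>1 + W\<close> removes the lower edge \<open>- 1\<close>.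
\<close>

definition krylov :: "nat \<Rightarrow> (nat \<times> nat \<Rightarrow> real) \<Rightarrow> nat \<Rightarrow> nat \<Rightarrow> nat \<Rightarrow> real" where
  "krylov N g k l i = goe_pow N g k i l + goe_pow N g (Suc k) i l"

lemma goe_krylov: "(\<Sum>a<N. goe N g i a * krylov N g k l a) = krylov N g (Suc k) l i"
  by (simp add: krylov_def distrib_left sum.distrib)

lemma ip_krylov:
  assumes "l < N" "l' < N"
  shows "ip N (krylov N g k l) (krylov N g k' l') =
    goe_pow N g (k + k') l l' + 2 * goe_pow N g (k + k' + 1) l l' + goe_pow N g (k + k' + 2) l l'"
proof -
  have "(\<Sum>i<N. goe_pow N g a i l * goe_pow N g b i l') = goe_pow N g (a + b) l l'" for a b
    using goe_pow_add[OF assms(2,1), of g a b] assms goe_pow_commute[of l N _ g a]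
    by (metis (no_types, lifting) lessThan_iff sum.cong)
  then show ?thesis
    by (simp add: ip_def krylov_def distrib_left distrib_right sum.distrib del: goe_pow.simps)
qed

lemma ip_combination:
  "ip N (\<lambda>i. c * (\<Sum>l<n. a l * x l i)) (\<lambda>i. d * (\<Sum>l<n. b l * y l i)) = c * d * (\<Sum>l<n. \<Sum>l'<n. a l * b l' * ip N (x l) (y l'))"
proof -
  have "ip N (\<lambda>i. c * (\<Sum>l<n. a l * x l i)) (\<lambda>i. d * (\<Sum>l<n. b l * y l i)) = c * d * ip N (\<lambda>i. \<Sum>l<n. a l * x l i) (\<lambda>i. \<Sum>l<n. b l * y l i)"
    by (rule ip_scale)
  also have "ip N (\<lambda>i. \<Sum>l<n. a l * x l i) (\<lambda>i. \<Sum>l<n. b l * y l i) = (\<Sum>i<N. \<Sum>l<n. \<Sum>l'<n. (a l * x l i) * (b l' * y l' i))"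
    by (simp only: ip_def sum_product)
  also have "\<dots> = (\<Sum>l<n. \<Sum>i<N. \<Sum>l'<n. (a l * x l i) * (b l' * y l' i))"
    by (rule sum.swap)
  also have "\<dots> = (\<Sum>l<n. \<Sum>l'<n. \<Sum>i<N. (a l * x l i) * (b l' * y l' i))"
    by (rule sum.cong[OF refl sum.swap])
  also have "\<dots> = (\<Sum>l<n. \<Sum>l'<n. a l * b l' * ip N (x l) (y l'))"
    unfolding ip_def sum_distrib_left by (intro sum.cong refl) (simp only: mult_ac)
  finally show ?thesis .
qed

lemma near_diagonal_form:
  fixes X :: "nat \<Rightarrow> nat \<Rightarrow> real"
  assumes X: "\<And>l l'. l < n \<Longrightarrow> l' < n \<Longrightarrow> \<bar>X l l' - (if l = l' then s else 0)\<bar> \<le> e"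
    and a: "\<And>l. l < n \<Longrightarrow> \<bar>a l\<bar> \<le> 1" and b: "\<And>l. l < n \<Longrightarrow> \<bar>b l\<bar> \<le> 1"
  shows "\<bar>(\<Sum>l<n. \<Sum>l'<n. a l * b l' * X l l') - s * (\<Sum>l<n. a l * b l)\<bar> \<le> (real n)\<^sup>2 * e"
proof -
  have "s * (\<Sum>l<n. a l * b l) = (\<Sum>l<n. \<Sum>l'<n. a l * b l' * (if l = l' then s else 0))"
    unfolding sum_distrib_left by (intro sum.cong refl) (simp add: if_distrib[of "(*) _"] sum.delta cong: if_cong)
  then have "(\<Sum>l<n. \<Sum>l'<n. a l * b l' * X l l') - s * (\<Sum>l<n. a l * b l) = (\<Sum>l<n. \<Sum>l'<n. a l * b l' * (X l l' - (if l = l' then s else 0)))"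
    by (simp only: sum_subtractf[symmetric] right_diff_distrib)
  also have "\<bar>\<dots>\<bar> \<le> (\<Sum>l<n. \<Sum>l'<n. e)"
  proof (rule order_trans[OF sum_abs], rule sum_mono, rule order_trans[OF sum_abs], rule sum_mono)
    fix l l' assume l: "l \<in> {..<n}" "l' \<in> {..<n}"
    have "\<bar>a l * b l'\<bar> * \<bar>X l l' - (if l = l' then s else 0)\<bar> \<le> 1 * e"
      using l a[of l] b[of l'] by (intro mult_mono X) (auto simp: abs_mult mult_le_one)
    then show "\<bar>a l * b l' * (X l l' - (if l = l' then s else 0))\<bar> \<le> e" by (simp only: abs_mult mult_1)
  qed
  finally show ?thesis by (simp add: power2_eq_square)
qed

text \<open>With all entries at their limits, the Krylov vectors are orthogonal with squared norm
  semi (2k) + 2 semi (2k+1) + semi (2k+2) = S and energy 2 cat (k+1); by \<open>k\<close> the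
  quotient is at least 1 - d. In the tolerance for the entries, the 4 collects the coefficients 1,
  2, 1, the n^2 counts pairs of vectors, and the S undoes the normalisation.\<close>

theorem edge_vectors:
  assumes N: "0 < N" and n: "0 < n" "n \<le> N" and d: "0 < d" "d < 1" and k: "(1 - d) * cat k \<le> cat (Suc k)"
  defines "S \<equiv> cat k + cat (Suc k)"
  assumes P: "\<And>p i j. p \<in> {2 * k..2 * k + 3} \<Longrightarrow> i < n \<Longrightarrow> j < n \<Longrightarrow>
      \<bar>goe_pow N g p i j - (if i = j then semi p else 0)\<bar> \<le> S * \<nu> / (4 * (real n)\<^sup>2)"
    and L: "\<And>i j. i < n \<Longrightarrow> j < n \<Longrightarrow> q i j = (\<Sum>l<n. L i l * L j l)"
    and q: "\<And>j. j < n \<Longrightarrow> q j j = s" and s: "0 \<le> s" "s \<le> 1"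
  shows "\<exists>m. (\<forall>i<n. \<forall>j<n. \<bar>ip N (m i) (m j) / real N - q i j\<bar> \<le> \<nu>) \<and> (\<forall>j<n. real N * ((1 - d) * s - \<nu>) \<le> ham N g (m j))"
proof (intro exI conjI allI impI)
  have S: "0 < S" using cat_pos[of k] cat_pos[of "Suc k"] by (simp add: S_def)
  define c where "c = sqrt (real N / S)"
  have c: "c * c = real N / S" using S by (simp add: c_def)
  define m where "m j i = c * (\<Sum>l<n. L j l * krylov N g k l i)" for j i
  have L1: "\<bar>L j l\<bar> \<le> 1" if "j < n" "l < n" for j l
  proof -
    have "(L j l)\<^sup>2 \<le> (\<Sum>l<n. (L j l)\<^sup>2)" using that by (intro member_le_sum) auto
    also have "\<dots> = s" using L[OF that(1,1)] q[OF that(1)] by (simp add: power2_eq_square)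
    finally have "(L j l)\<^sup>2 \<le> 1" using s by linarith
    then show ?thesis by (rule iffD1[OF abs_square_le_1])
  qed
  have semi: "semi (2 * k) = cat k" "semi (2 * k + 1) = 0" "semi (2 * k + 2) = cat (Suc k)" "semi (2 * k + 3) = 0"
    by (simp_all add: semi_def)
  let ?e = "S * \<nu> / (4 * (real n)\<^sup>2)"
  have four: "(real n)\<^sup>2 * (4 * ?e) = S * \<nu>" using n by simp
  have near: "\<bar>x + 2 * y + z - w\<bar> \<le> 4 * e"
    if "\<bar>x - x'\<bar> \<le> e" "\<bar>y - y'\<bar> \<le> e" "\<bar>z - z'\<bar> \<le> e" "w = x' + 2 * y' + z'" for x y z x' y' z' w e :: real
    using that by linarith
  have gram: "\<bar>ip N (krylov N g k l) (krylov N g k l') - (if l = l' then S else 0)\<bar> \<le> 4 * ?e" if l: "l < n" "l' < n" for l l'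
    unfolding ip_krylov[OF less_le_trans[OF l(1) n(2)] less_le_trans[OF l(2) n(2)]]
    by (rule near[OF P[OF _ l] P[OF _ l] P[OF _ l]])
       (simp_all add: semi[simplified] S_def mult_2[symmetric] del: goe_pow.simps)
  have field: "\<bar>ip N (krylov N g k l) (krylov N g (Suc k) l') - (if l = l' then 2 * cat (Suc k) else 0)\<bar> \<le> 4 * ?e" if l: "l < n" "l' < n" for l l'
    unfolding ip_krylov[OF less_le_trans[OF l(1) n(2)] less_le_trans[OF l(2) n(2)]]
  proof (rule near[OF P[OF _ l] P[OF _ l] P[OF _ l]])
    have "k + Suc k = 2 * k + 1" "k + Suc k + 1 = 2 * k + 2" "k + Suc k + 2 = 2 * k + 3" by simp_all
    then show "(if l = l' then 2 * cat (Suc k) else 0) = (if l = l' then semi (k + Suc k) else 0) + 2 * (if l = l' then semi (k + Suc k + 1) else 0) + (if l = l' then semi (k + Suc k + 2) else 0)"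
      by (simp only: semi) simp
  qed simp_all
  show "\<bar>ip N (m i) (m j) / real N - q i j\<bar> \<le> \<nu>" if ij: "i < n" "j < n" for i j
  proof -
    let ?X = "\<Sum>l<n. \<Sum>l'<n. L i l * L j l' * ip N (krylov N g k l) (krylov N g k l')"
    have "\<bar>?X - S * (\<Sum>l<n. L i l * L j l)\<bar> \<le> (real n)\<^sup>2 * (4 * ?e)"
      by (rule near_diagonal_form[OF gram L1[OF ij(1)] L1[OF ij(2)]])
    then have "\<bar>?X - S * q i j\<bar> \<le> S * \<nu>" unfolding four L[OF ij] .
    moreover have "ip N (m i) (m j) = real N / S * ?X"
      unfolding m_def ip_combination c ..
    then have "ip N (m i) (m j) / real N - q i j = (?X - S * q i j) / S" using N S by (simp add: field_simps)
    ultimately show ?thesis using S by (simp add: pos_divide_le_eq mult.commute)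
  qed
  show "real N * ((1 - d) * s - \<nu>) \<le> ham N g (m j)" if j: "j < n" for j
  proof -
    let ?X = "\<Sum>l<n. \<Sum>l'<n. L j l * L j l' * ip N (krylov N g k l) (krylov N g (Suc k) l')"
    have X: "\<bar>?X - 2 * cat (Suc k) * s\<bar> \<le> S * \<nu>"
    proof -
      have "\<bar>?X - 2 * cat (Suc k) * (\<Sum>l<n. L j l * L j l)\<bar> \<le> (real n)\<^sup>2 * (4 * ?e)"
        by (rule near_diagonal_form[OF field L1[OF j] L1[OF j]])
      then show ?thesis unfolding four L[OF j j, symmetric] q[OF j] .
    qed
    have "(\<Sum>a<N. goe N g i a * m j a) = c * (\<Sum>l<n. L j l * krylov N g (Suc k) l i)" for i
    proof -
      have "(\<Sum>a<N. goe N g i a * m j a) = (\<Sum>a<N. \<Sum>l<n. c * (L j l * (goe N g i a * krylov N g k l a)))"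
        unfolding m_def sum_distrib_left by (intro sum.cong refl) (simp only: mult_ac)
      also have "\<dots> = (\<Sum>l<n. \<Sum>a<N. c * (L j l * (goe N g i a * krylov N g k l a)))" by (rule sum.swap)
      finally show ?thesis by (simp only: goe_krylov[symmetric] sum_distrib_left)
    qed
    then have "ham N g (m j) = ip N (m j) (\<lambda>i. c * (\<Sum>l<n. L j l * krylov N g (Suc k) l i))"
      unfolding ham_goe by (simp only:)
    also have "\<dots> = real N / S * ?X"
      unfolding m_def ip_combination c ..
    finally have "ham N g (m j) = real N / S * ?X" .
    moreover have "S * ((1 - d) * s - \<nu>) \<le> ?X"
    proof -
      have "(1 - d) * S \<le> 2 * cat (Suc k)"
      proof -
        have "(1 - d) * cat (Suc k) \<le> 1 * cat (Suc k)" using d cat_nonneg by (intro mult_right_mono) auto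
        then show ?thesis using k by (simp add: S_def distrib_left)
      qed
      then have "(1 - d) * S * s \<le> 2 * cat (Suc k) * s" using s by (intro mult_right_mono)
      then show ?thesis using X by (simp add: abs_le_iff algebra_simps)
    qed
    then have "real N / S * (S * ((1 - d) * s - \<nu>)) \<le> real N / S * ?X" using S by (intro mult_left_mono) auto
    moreover have "real N / S * (S * ((1 - d) * s - \<nu>)) = real N * ((1 - d) * s - \<nu>)" using S by simp
    ultimately show ?thesis by (simp only:)
  qed
qed

text \<open>Divides the budget 1/2 of \<open>good_mass\<close>: 1/4 for negative energies, 1/256 and
  1/8 for the overlap terms. The bound on r is a square because its root enters the last
  term.\<close>

lemma overlap_budget:
  fixes r \<eta> \<zeta> :: real
  assumes n: "0 < n" and \<eta>: "0 < \<eta>" "\<eta> \<le> 1" and r: "0 \<le> r" "r \<le> (\<eta>\<^sup>2 / (16 * (real n)\<^sup>2))\<^sup>2" and z: "real n * \<zeta> \<le> 1 / 4"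
  shows "real n * \<zeta> + (real n)\<^sup>2 * r / \<eta>\<^sup>2 + 2 * (real n)\<^sup>2 * sqrt r / \<eta>\<^sup>2 \<le> 1 / 2"
proof -
  let ?t = "\<eta>\<^sup>2 / (16 * (real n)\<^sup>2)"
  have sr: "sqrt r \<le> ?t" using r by (intro real_le_lsqrt) auto
  have e2: "\<eta>\<^sup>2 \<le> 1" using \<eta> by (simp add: power_le_one)
  have n2: "1 \<le> (real n)\<^sup>2" using n by simp
  have "2 * (real n)\<^sup>2 * sqrt r / \<eta>\<^sup>2 \<le> 2 * (real n)\<^sup>2 * ?t / \<eta>\<^sup>2"
    using sr by (intro divide_right_mono mult_left_mono) auto
  also have "\<dots> = 1 / 8" using n \<eta> by (simp add: field_simps)
  finally have 1: "2 * (real n)\<^sup>2 * sqrt r / \<eta>\<^sup>2 \<le> 1 / 8" .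
  have t1: "?t \<le> 1 / 16" using e2 n2 by (simp add: divide_le_eq)
  have "r \<le> ?t * (1 / 16)" using r(2) mult_left_mono[OF t1, of ?t] by (simp add: power2_eq_square)
  then have "(real n)\<^sup>2 * r / \<eta>\<^sup>2 \<le> (real n)\<^sup>2 * (?t * (1 / 16)) / \<eta>\<^sup>2"
    by (intro divide_right_mono mult_left_mono) auto
  also have "\<dots> = 1 / 256" using n \<eta> by (simp add: field_simps)
  finally show ?thesis using 1 z by linarith
qed

section \<open>Lower bound for the expected logarithm\<close>

context spin
begin

lemma Z_0: "Z (\<lambda>_. 0) = 1"
  unfolding Z_def energy_def using prob_space by simp

lemma ln_ZQ_lower:
  fixes Q :: "real mat"
  assumes \<beta>: "1 \<le> \<beta>" and \<eta>: "0 < \<eta>" "\<eta> \<le> 1 / 14" "28 * \<eta> \<le> \<epsilon>" and big: "2 \<le> sqrt (1 + \<eta>) ^ N" and n: "0 < n"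
    and Q: "\<And>j. j < n \<Longrightarrow> Q $$ (j, j) = 1" "\<And>j j'. j < n \<Longrightarrow> j' < n \<Longrightarrow> \<bar>Q $$ (j, j')\<bar> \<le> 1"
    and m: "\<And>j j'. j < n \<Longrightarrow> j' < n \<Longrightarrow> \<bar>ip N (m j) (m j') / real N - (Q $$ (j, j') - (if j = j' then 1 / \<beta> else 0))\<bar> \<le> \<eta>"
    and h: "0 \<le> h" "\<And>j. j < n \<Longrightarrow> h \<le> ham N g (m j)"
  defines "b \<equiv> 1 / (1 + 7 * \<eta>)"
  assumes z: "measure (sphere_uniform N) {\<sigma> \<in> space (sphere_uniform N). ham N g \<sigma> < 0} \<le> \<zeta> * Z (disorder b 0 N g)"
    and \<zeta>: "real n * \<zeta> \<le> 1 / 4" and r: "r2 (disorder b 0 N g) \<le> (\<eta>\<^sup>2 / (16 * (real n)\<^sup>2))\<^sup>2"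
  shows "0 < ZQ n Q \<epsilon> \<beta> g"
    and "real n * (- (real N * (ln (1 + 7 * \<eta>) + ln \<beta>) / 2) + b * \<beta> * h + ln (Z (disorder b 0 N g))) - (real n + 1) * ln 2 \<le> ln (ZQ n Q \<epsilon> \<beta> g)"
proof -
  let ?\<kappa> = "(1 / sqrt (1 + 7 * \<eta>)) ^ N * (1 / sqrt \<beta>) ^ N / 2" and ?Z = "Z (disorder b 0 N g)"
  have \<kappa>: "0 < ?\<kappa>" using \<eta> \<beta> by simp
  have Z: "0 < ?Z" by (rule Z_pos)
  have b: "0 \<le> b" using \<eta> by (simp add: b_def)
  have hm: "0 \<le> ham N g (m j)" if "j < n" for j using h(1) h(2)[OF that] by linarith
  have lo: "?\<kappa> ^ n * exp (b * \<beta> * (\<Sum>j<n. ham N g (m j))) * (?Z ^ n / 2) \<le> ZQ n Q \<epsilon> \<beta> g"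
    unfolding b_def
    by (rule ZQ_lower[OF \<beta> \<eta> big Q m hm z[unfolded b_def] overlap_budget[OF n \<eta>(1) _ r2_nonneg r[unfolded b_def] \<zeta>]]) (use \<eta> in auto)
  have p: "0 < ?\<kappa> ^ n * exp (b * \<beta> * (\<Sum>j<n. ham N g (m j))) * (?Z ^ n / 2)"
    by (intro mult_pos_pos zero_less_power \<kappa> exp_gt_zero divide_pos_pos Z) simp
  show pos: "0 < ZQ n Q \<epsilon> \<beta> g" by (rule less_le_trans[OF p lo])
  have "b * \<beta> * (real n * h) \<le> b * \<beta> * (\<Sum>j<n. ham N g (m j))"
  proof (rule mult_left_mono)
    have "(\<Sum>j<n. h) \<le> (\<Sum>j<n. ham N g (m j))" using h(2) by (intro sum_mono) auto
    then show "real n * h \<le> (\<Sum>j<n. ham N g (m j))" by simp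
  qed (use b \<beta> in auto)
  moreover have "real n * (- C + b * \<beta> * h + z) - (real n + 1) * l \<le> w"
    if "b * \<beta> * (real n * h) \<le> X" "k = - C - l" "t = real n * k + X + (real n * z - l)" "t \<le> w" for C X k l t z w
  proof -
    have "t = real n * (- C - l) + X + (real n * z - l)" using that(2,3) by (simp only:)
    then show ?thesis using that(1,4) by (simp add: algebra_simps)
  qed
  moreover have "ln ?\<kappa> = - (real N * (ln (1 + 7 * \<eta>) + ln \<beta>) / 2) - ln 2"
    using \<eta> \<beta> by (simp add: ln_mult ln_div ln_realpow ln_sqrt algebra_simps add_divide_distrib)
  moreover have "ln (?\<kappa> ^ n * exp (b * \<beta> * (\<Sum>j<n. ham N g (m j))) * (?Z ^ n / 2)) = real n * ln ?\<kappa> + b * \<beta> * (\<Sum>j<n. ham N g (m j)) + (real n * ln ?Z - ln 2)"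
  proof -
    have "ln (u ^ n * exp x * (v ^ n / 2)) = real n * ln u + x + (real n * ln v - ln 2)" if "0 < u" "0 < v" for u v x :: real
      using that by (simp add: ln_mult ln_div ln_realpow)
    from this[OF \<kappa> Z] show ?thesis .
  qed
  moreover have "ln (?\<kappa> ^ n * exp (b * \<beta> * (\<Sum>j<n. ham N g (m j))) * (?Z ^ n / 2)) \<le> ln (ZQ n Q \<epsilon> \<beta> g)"
    by (rule iffD2[OF ln_le_cancel_iff[OF p pos] lo])
  ultimately show "real n * (- (real N * (ln (1 + 7 * \<eta>) + ln \<beta>) / 2) + b * \<beta> * h + ln ?Z) - (real n + 1) * ln 2 \<le> ln (ZQ n Q \<epsilon> \<beta> g)"
    by blast
qed

text \<open>The volume of the constraint set is the value of \<open>ZQ\<close> at zero disorder, so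
  the same lower bound applies. All energies vanish there, hence multiples of coordinate vectors can
  replace edge vectors, with \<zeta> = 0 and Z = 1.\<close>

lemma ln_volume_lower:
  fixes Q :: "real mat"
  assumes \<beta>: "1 \<le> \<beta>" and \<eta>: "0 < \<eta>" "\<eta> \<le> 1 / 14" "28 * \<eta> \<le> \<epsilon>" and big: "2 \<le> sqrt (1 + \<eta>) ^ N" and n: "0 < n" "n \<le> N"
    and Q: "\<And>j. j < n \<Longrightarrow> Q $$ (j, j) = 1" "\<And>j j'. j < n \<Longrightarrow> j' < n \<Longrightarrow> \<bar>Q $$ (j, j')\<bar> \<le> 1"
    and L: "\<And>i j. i < n \<Longrightarrow> j < n \<Longrightarrow> Q $$ (i, j) - (if i = j then 1 / \<beta> else 0) = (\<Sum>l<n. L i l * L j l)"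
    and r: "R2 0 0 \<le> (\<eta>\<^sup>2 / (16 * (real n)\<^sup>2))\<^sup>2"
  shows "0 < ZQ n Q \<epsilon> 0 g"
    and "real n * (- (real N * (ln (1 + 7 * \<eta>) + ln \<beta>) / 2)) - (real n + 1) * ln 2 \<le> ln (ZQ n Q \<epsilon> 0 g)"
proof -
  interpret G: prob_space "gauss (sites N)" by (rule prob_space_gauss)
  let ?b = "1 / (1 + 7 * \<eta>)"
  define m where "m j i = (if i < n then sqrt (real N) * L j i else 0)" for j i
  have ipm: "ip N (m i) (m j) / real N = (\<Sum>l<n. L i l * L j l)" for i j
  proof -
    have "ip N (m i) (m j) = (\<Sum>l<n. real N * (L i l * L j l))"
      unfolding ip_def using n by (intro sum.mono_neutral_cong_right) (auto simp: m_def)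
    then show ?thesis using N_pos by (simp add: sum_distrib_left[symmetric])
  qed
  have d: "disorder b h N (\<lambda>_. 0) = (\<lambda>_. 0)" for b h by (simp add: disorder_def)
  have h0: "ham N (\<lambda>_. 0) x = 0" for x by (simp add: ham_def hamiltonian_def)
  have r0: "r2 (\<lambda>_. 0) = R2 0 0"
  proof -
    have "disorder 0 0 N g = (\<lambda>_. 0)" for g by (simp add: disorder_def weight_def)
    then show ?thesis by (simp add: R2_def G.prob_space)
  qed
  have eq: "ZQ n Q \<epsilon> \<beta> (\<lambda>_. 0) = ZQ n Q \<epsilon> 0 g" by (simp add: ZQ_def gw_def h0)
  have "\<bar>ip N (m j) (m j') / real N - (Q $$ (j, j') - (if j = j' then 1 / \<beta> else 0))\<bar> \<le> \<eta>" if "j < n" "j' < n" for j j'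
    using L[OF that] \<eta> by (simp add: ipm)
  note lower = ln_ZQ_lower[of \<beta> \<eta> \<epsilon> n Q m 0 "\<lambda>_. 0" 0, OF \<beta> \<eta> big n(1) Q this]
  show "0 < ZQ n Q \<epsilon> 0 g"
    and "real n * (- (real N * (ln (1 + 7 * \<eta>) + ln \<beta>) / 2)) - (real n + 1) * ln 2 \<le> ln (ZQ n Q \<epsilon> 0 g)"
    using lower r by (simp_all add: h0 d r0 Z_0 eq)
qed

text \<open>A lower tail of ln Z without a concentration inequality. With exp c as the bound on the
  second moment, \<open>F\<close> is x - ln x at x = exp (- c) Z^2. It is at least 1, it is large
  where Z is small, and its mean is at most 1 + c - 2 phi, where c and 2 phi nearly agree by
  \<open>high_temperature\<close>.\<close>

lemma high_temperature_fluctuation: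
  assumes e: "0 < e" and N: "shell_threshold e \<le> real N" and b: "0 \<le> b" "b < 1"
  defines "lam' \<equiv> (1 - b\<^sup>2) / 2"
  defines "D \<equiv> ln 2 + real N * e - ln lam' / 2"
  defines "A \<equiv> ln (2 / sqrt (1 - b\<^sup>2))"
  shows "\<exists>F. integrable (gauss (sites N)) F \<and> (\<forall>g. 0 \<le> F g) \<and>
    (LINT g|gauss (sites N). F g) \<le> 1 + real N * e + A + D * exp (2 * b / lam') \<and>
    (\<forall>g t. ln (Z (disorder b 0 N g)) < real N * (b\<^sup>2 / 4 - t) \<longrightarrow> 2 * real N * t \<le> F g)"
proof -
  let ?G = "gauss (sites N)" and ?Z = "\<lambda>g. Z (disorder b 0 N g)"
  interpret G: prob_space ?G by (rule prob_space_gauss)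
  have b2: "b\<^sup>2 < 1" using b by (simp add: power_less_one_iff)
  define q where "q = 1 - b\<^sup>2"
  have q: "0 < q" "q \<le> 1" using b2 by (auto simp: q_def)
  have A: "0 \<le> A"
  proof -
    have "sqrt q \<le> 1" using q by simp
    then have "1 \<le> 2 / sqrt q" using q by (simp only: le_divide_eq real_sqrt_gt_zero if_True)
    then show ?thesis unfolding A_def q_def[symmetric] by (rule ln_ge_zero)
  qed
  have eA: "exp A = 2 / sqrt q" using q by (simp add: A_def q_def[symmetric])
  define c where "c = real N * b\<^sup>2 / 2 + real N * e + A"
  have ec: "exp c = exp (real N * b\<^sup>2 / 2) * (2 * exp (real N * e) / sqrt (1 - b\<^sup>2))"
    by (simp add: c_def exp_add eA q_def)
  have zp: "0 < ?Z g" for g by (rule Z_pos)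
  have nn: "(\<integral>\<^sup>+g. ennreal ((?Z g)\<^sup>2) \<partial>?G) \<le> ennreal (exp c)"
    using annealed_bound[OF e N, of 0 b] b2 by (simp add: ec)
  have i2: "integrable ?G (\<lambda>g. (?Z g)\<^sup>2)"
  proof (rule integrableI_bounded)
    show "(\<lambda>g. (?Z g)\<^sup>2) \<in> borel_measurable ?G" by measurable
    have "norm ((?Z g)\<^sup>2) = (?Z g)\<^sup>2" for g by simp
    then show "(\<integral>\<^sup>+g. ennreal (norm ((?Z g)\<^sup>2)) \<partial>?G) < \<infinity>"
      using le_less_trans[OF nn ennreal_less_top] by (simp only: infinity_ennreal_def)
  qed
  have E2: "(LINT g|?G. (?Z g)\<^sup>2) \<le> exp c"
    using order_trans[OF ennreal_integral_le_nn_integral[OF i2] nn] by (simp only: ennreal_le_iff exp_ge_zero)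
  define F where "F g = exp (- c) * (?Z g)\<^sup>2 - (2 * ln (?Z g) - c)" for g
  have F: "1 \<le> F g" for g
  proof -
    have "ln (exp (- c) * (?Z g)\<^sup>2) \<le> exp (- c) * (?Z g)\<^sup>2 - 1"
      using zp[of g] by (intro ln_le_minus_one) simp
    moreover have "ln (exp (- c) * (?Z g)\<^sup>2) = 2 * ln (?Z g) - c"
      using zp[of g] by (simp add: ln_mult ln_realpow)
    ultimately show ?thesis by (simp add: F_def)
  qed
  have iF: "integrable ?G F"
    unfolding F_def[abs_def]
    by (intro Bochner_Integration.integrable_diff integrable_mult_right i2 integrable_ln_Z_disorder) simp
  have "(LINT g|?G. F g) = exp (- c) * (LINT g|?G. (?Z g)\<^sup>2) - (2 * phi b 0 - c)"
    unfolding F_def[abs_def] phi_def using i2 integrable_ln_Z_disorder[of b 0] G.prob_space by simp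
  also have "exp (- c) * (LINT g|?G. (?Z g)\<^sup>2) \<le> exp (- c) * exp c"
    using E2 by (rule mult_left_mono) simp
  also have "exp (- c) * exp c = 1" by (simp add: exp_add[symmetric])
  finally have "(LINT g|?G. F g) \<le> 1 - (2 * phi b 0 - c)" by simp
  moreover have "real N * b\<^sup>2 / 4 - phi b 0 \<le> D / 2 * exp (2 * b / lam')"
    unfolding D_def lam'_def by (rule high_temperature[OF e N b])
  ultimately have "(LINT g|?G. F g) \<le> 1 + real N * e + A + D * exp (2 * b / lam')"
    by (simp add: c_def)
  moreover have "2 * real N * t \<le> F g" if "ln (?Z g) < real N * (b\<^sup>2 / 4 - t)" for g t
  proof -
    have "0 \<le> exp (- c) * (?Z g)\<^sup>2" "0 \<le> real N * e" using e by simp_all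
    then have "real N * b\<^sup>2 / 2 - 2 * ln (?Z g) \<le> F g" using A unfolding F_def by (simp add: c_def)
    then show ?thesis using that by (simp add: algebra_simps)
  qed
  moreover have "0 \<le> F g" for g using F[of g] by simp
  ultimately show ?thesis using iF by blast
qed

text \<open>
  In place of bad events, \<open>T\<close> sums the Markov test functions of everything that may go wrong: the sharp bound holds where
  \<open>T < 1\<close>, and elsewhere the crude bound is paid for by \<open>B T\<close>.
\<close>

theorem expected_ln_ZQ_ge:
  fixes Q :: "real mat" and B :: real
  assumes \<beta>: "1 < \<beta>" and \<eta>: "0 < \<eta>" "\<eta> \<le> 1 / 14" "28 * \<eta> \<le> \<epsilon>" and big: "2 \<le> sqrt (1 + \<eta>) ^ N" and n: "0 < n" "n \<le> N"
    and Q: "\<And>j. j < n \<Longrightarrow> Q $$ (j, j) = 1" "\<And>j j'. j < n \<Longrightarrow> j' < n \<Longrightarrow> \<bar>Q $$ (j, j')\<bar> \<le> 1"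
    and L: "\<And>i j. i < n \<Longrightarrow> j < n \<Longrightarrow> Q $$ (i, j) - (if i = j then 1 / \<beta> else 0) = (\<Sum>l<n. L i l * L j l)"
    and e: "0 < e" "shell_threshold e \<le> real N"
  defines "\<rho> \<equiv> (\<eta>\<^sup>2 / (16 * (real n)\<^sup>2))\<^sup>2"
  assumes r0: "R2 0 0 \<le> \<rho>"
    and d: "0 < d" "d < 1" and k: "(1 - d) * cat k \<le> cat (Suc k)" and \<nu>: "0 < \<nu>" "\<nu> \<le> \<eta>" "\<nu> \<le> (1 - d) * (1 - 1 / \<beta>)"
  defines "\<theta> \<equiv> (cat k + cat (Suc k)) * \<nu> / (4 * (real n)\<^sup>2)"
  assumes mom: "\<And>p i j. p \<in> {2 * k..2 * k + 3} \<Longrightarrow> i < n \<Longrightarrow> j < n \<Longrightarrow>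
      integrable (gauss (sites N)) (\<lambda>g. (goe_pow N g p i j - (if i = j then semi p else 0))\<^sup>2) \<and>
      (LINT g|gauss (sites N). (goe_pow N g p i j - (if i = j then semi p else 0))\<^sup>2) \<le> C / real N"
  defines "b \<equiv> 1 / (1 + 7 * \<eta>)"
  assumes Nb: "4 * real n \<le> exp (real N * (b\<^sup>2 / 4 - \<eta>))"
  defines "c0 \<equiv> (ln (1 + 7 * \<eta>) + ln \<beta>) / 2"
  defines "a \<equiv> real n * (real N * (- c0 + b * \<beta> * ((1 - d) * (1 - 1 / \<beta>) - \<nu>) + b\<^sup>2 / 4 - \<eta>)) - (real n + 1) * ln 2"
  assumes B: "0 \<le> B" "a - (2 * (real n * (- (real N * c0)) - (real n + 1) * ln 2) - real n * (real N * \<beta>\<^sup>2 / 4)) \<le> B"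
  defines "lam' \<equiv> (1 - b\<^sup>2) / 2"
  defines "D \<equiv> ln 2 + real N * e - ln lam' / 2"
  shows "a - B * (4 * (real n)\<^sup>2 * (C / real N / \<theta>\<^sup>2) + R2 b 0 / \<rho>
      + (1 + real N * e + ln (2 / sqrt (1 - b\<^sup>2)) + D * exp (2 * b / lam')) / (2 * real N * \<eta>)) - real n
    \<le> (LINT g|gauss (sites N). ln (ZQ n Q \<epsilon> \<beta> g))"
proof -
  let ?G = "gauss (sites N)" and ?Z = "\<lambda>g. Z (disorder b 0 N g)" and ?I = "{2 * k..2 * k + 3}"
  interpret G: prob_space ?G by (rule prob_space_gauss)
  have N: "0 < real N" using N_pos by simp
  have b: "0 \<le> b" "b < 1" using \<eta> by (auto simp: b_def)
  have \<beta>1: "1 \<le> \<beta>" using \<beta> by simp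
  have \<rho>: "0 < \<rho>" using \<eta> n by (simp add: \<rho>_def)
  have \<theta>: "0 < \<theta>" unfolding \<theta>_def using cat_pos[of k] cat_pos[of "Suc k"] \<nu> n by (intro divide_pos_pos mult_pos_pos) auto
  obtain F where F: "integrable ?G F" "\<And>g. 0 \<le> F g"
    "(LINT g|?G. F g) \<le> 1 + real N * e + ln (2 / sqrt (1 - b\<^sup>2)) + D * exp (2 * b / lam')"
    "\<And>g t. ln (?Z g) < real N * (b\<^sup>2 / 4 - t) \<Longrightarrow> 2 * real N * t \<le> F g"
    using high_temperature_fluctuation[OF e b] unfolding D_def lam'_def by blast
  note vol = ln_volume_lower[OF \<beta>1 \<eta> big n Q L r0[unfolded \<rho>_def]]
  define W where "W p i j g = (goe_pow N g p i j - (if i = j then semi p else 0))\<^sup>2" for p i j g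
  define T1 where "T1 g = (\<Sum>p\<in>?I. \<Sum>i<n. \<Sum>j<n. W p i j g)" for g
  define T where "T g = T1 g / \<theta>\<^sup>2 + r2 (disorder b 0 N g) / \<rho> + F g / (2 * real N * \<eta>)" for g
  define K where "K = real N * \<beta>\<^sup>2 / 4"
  define Y where "Y g = real n * (exp (- K) * Z (disorder (- \<beta>) 0 N g))" for g
  have Y0: "0 \<le> Y g" for g using Z_pos[of "disorder (- \<beta>) 0 N g"] by (simp add: Y_def)
  have W0: "0 \<le> W p i j g" for p i j g by (simp add: W_def)
  have T1_0: "0 \<le> T1 g" for g unfolding T1_def by (intro sum_nonneg W0)
  have parts: "0 \<le> T1 g / \<theta>\<^sup>2" "0 \<le> r2 (disorder b 0 N g) / \<rho>" "0 \<le> F g / (2 * real N * \<eta>)" for g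
    using T1_0[of g] F(2)[of g] r2_nonneg \<rho> \<eta> by (auto intro!: divide_nonneg_nonneg mult_nonneg_nonneg)
  have good: "a \<le> ln (ZQ n Q \<epsilon> \<beta> g)" if T: "T g < 1" for g
  proof -
    have P: "\<bar>goe_pow N g p i j - (if i = j then semi p else 0)\<bar> \<le> \<theta>" if "p \<in> ?I" "i < n" "j < n" for p i j
    proof -
      have "W p i j g \<le> (\<Sum>j<n. W p i j g)" using that W0 by (intro member_le_sum) auto
      also have "\<dots> \<le> (\<Sum>i<n. \<Sum>j<n. W p i j g)" using that W0 by (intro member_le_sum sum_nonneg) auto
      also have "\<dots> \<le> T1 g" unfolding T1_def using that W0 by (intro member_le_sum sum_nonneg) auto
      also have "\<dots> \<le> \<theta>\<^sup>2"
      proof -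
        have "T1 g / \<theta>\<^sup>2 < 1" using T parts[of g] unfolding T_def by linarith
        then show ?thesis using \<theta> by (simp add: divide_less_eq)
      qed
      finally have "\<bar>goe_pow N g p i j - (if i = j then semi p else 0)\<bar> \<le> \<bar>\<theta>\<bar>"
        unfolding W_def by (rule iffD2[OF abs_le_square_iff])
      then show ?thesis using \<theta> by simp
    qed
    have r: "r2 (disorder b 0 N g) \<le> \<rho>"
    proof -
      have "r2 (disorder b 0 N g) / \<rho> < 1" using T parts[of g] unfolding T_def by linarith
      then show ?thesis using \<rho> by (simp add: divide_less_eq)
    qed
    have Zl: "real N * (b\<^sup>2 / 4 - \<eta>) \<le> ln (?Z g)"
    proof (rule ccontr)
      assume "\<not> ?thesis"
      then have "2 * real N * \<eta> \<le> F g" by (intro F(4)) simp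
      then have "1 \<le> F g / (2 * real N * \<eta>)" using N \<eta> by (simp add: le_divide_eq)
      then show False using T parts[of g] unfolding T_def by linarith
    qed
    have Z4: "4 * real n \<le> ?Z g"
    proof -
      have "exp (real N * (b\<^sup>2 / 4 - \<eta>)) \<le> exp (ln (?Z g))" using Zl by (simp only: exp_le_cancel_iff)
      then show ?thesis using Nb Z_pos[of "disorder b 0 N g"] by simp
    qed
    let ?q = "\<lambda>i j. Q $$ (i, j) - (if i = j then 1 / \<beta> else 0)" and ?h = "real N * ((1 - d) * (1 - 1 / \<beta>) - \<nu>)"
    have "\<exists>m. (\<forall>i<n. \<forall>j<n. \<bar>ip N (m i) (m j) / real N - ?q i j\<bar> \<le> \<nu>) \<and> (\<forall>j<n. ?h \<le> ham N g (m j))"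
    proof (rule edge_vectors[OF N_pos n d k P[unfolded \<theta>_def] L])
      show "?q j j = 1 - 1 / \<beta>" if "j < n" for j using Q(1)[OF that] by simp
    qed (use \<beta> in auto)
    then obtain m where m: "\<And>i j. i < n \<Longrightarrow> j < n \<Longrightarrow> \<bar>ip N (m i) (m j) / real N - ?q i j\<bar> \<le> \<nu>" "\<And>j. j < n \<Longrightarrow> ?h \<le> ham N g (m j)"
      by blast
    have gram: "\<bar>ip N (m i) (m j) / real N - ?q i j\<bar> \<le> \<eta>" if "i < n" "j < n" for i j
      using m(1)[OF that] \<nu>(2) by linarith
    have h: "0 \<le> ?h" using N \<nu> by simp
    \<comment> \<open>The volume is at most 1 and Z is at least 4 n, so \<zeta> = 1 / (4 n)
      serves.\<close>
    have z: "measure (sphere_uniform N) {\<sigma> \<in> space (sphere_uniform N). ham N g \<sigma> < 0} \<le> 1 / (4 * real n) * ?Z g"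
    proof -
      have "1 \<le> 1 / (4 * real n) * ?Z g" using Z4 n by (simp add: le_divide_eq)
      then show ?thesis using prob_le_1 order_trans by blast
    qed
    have "real n * (- (real N * (ln (1 + 7 * \<eta>) + ln \<beta>) / 2) + b * \<beta> * ?h + ln (?Z g)) - (real n + 1) * ln 2 \<le> ln (ZQ n Q \<epsilon> \<beta> g)"
      unfolding b_def
      by (rule ln_ZQ_lower(2)[OF \<beta>1 \<eta> big n(1) Q gram h m(2) z[unfolded b_def] _ r[unfolded \<rho>_def b_def]]) (use n in auto)
    moreover have "real n * (- (real N * (ln (1 + 7 * \<eta>) + ln \<beta>) / 2) + b * \<beta> * ?h + real N * (b\<^sup>2 / 4 - \<eta>)) \<le>
      real n * (- (real N * (ln (1 + 7 * \<eta>) + ln \<beta>) / 2) + b * \<beta> * ?h + ln (?Z g))"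
      using Zl by (intro mult_left_mono) auto
    moreover have "a = real n * (- (real N * (ln (1 + 7 * \<eta>) + ln \<beta>) / 2) + b * \<beta> * ?h + real N * (b\<^sup>2 / 4 - \<eta>)) - (real n + 1) * ln 2"
      by (simp add: a_def c0_def algebra_simps)
    ultimately show ?thesis by linarith
  qed
  have pw: "a - B * T g - Y g \<le> ln (ZQ n Q \<epsilon> \<beta> g)" for g
  proof (cases "T g < 1")
    case True
    have "0 \<le> B * T g" using B parts[of g] by (simp add: T_def)
    then show ?thesis using good[OF True] Y0[of g] by linarith
  next
    case False
    \<comment> \<open>By assumption \<open>B\<close> covers the gap between the sharp bound and the
      crude one, and T >= 1 pays for it in full.\<close>
    then have "B \<le> B * T g" using B mult_left_mono[of 1 "T g" B] by simp
    moreover have "2 * ln (ZQ n Q \<epsilon> 0 g) - real n * K - Y g \<le> ln (ZQ n Q \<epsilon> \<beta> g)"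
      using ln_ZQ_crude[OF vol(1), of g K \<beta>] by (simp add: Y_def distrib_left)
    moreover have "real n * (- (real N * c0)) - (real n + 1) * ln 2 \<le> ln (ZQ n Q \<epsilon> 0 g)"
      using vol(2) by (simp add: c0_def)
    moreover have "a - t - y \<le> z" if "B \<le> t" "2 * w - x - y \<le> z" "v \<le> w" "a - (2 * v - x) \<le> B" for t w x y z v :: real
      using that by linarith
    ultimately show ?thesis using B(2)[folded K_def] by blast
  qed
  have iW: "integrable ?G (W p i j)" "(LINT g|?G. W p i j g) \<le> C / real N" if "p \<in> ?I" "i < n" "j < n" for p i j
    unfolding W_def[abs_def] using mom[OF that] by auto
  have iT1: "integrable ?G T1"
    unfolding T1_def[abs_def] by (intro Bochner_Integration.integrable_sum iW) auto
  have E1: "(LINT g|?G. T1 g) \<le> 4 * (real n)\<^sup>2 * (C / real N)"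
  proof -
    have "(LINT g|?G. T1 g) = (\<Sum>p\<in>?I. \<Sum>i<n. \<Sum>j<n. (LINT g|?G. W p i j g))"
    proof -
      have 1: "integrable ?G (\<lambda>g. \<Sum>j<n. W p i j g)" if "p \<in> ?I" "i < n" for p i
        using that by (intro Bochner_Integration.integrable_sum iW) auto
      have 2: "integrable ?G (\<lambda>g. \<Sum>i<n. \<Sum>j<n. W p i j g)" if "p \<in> ?I" for p
        using that by (intro Bochner_Integration.integrable_sum 1) auto
      have "(LINT g|?G. T1 g) = (\<Sum>p\<in>?I. (LINT g|?G. (\<Sum>i<n. \<Sum>j<n. W p i j g)))"
        unfolding T1_def[abs_def] by (rule Bochner_Integration.integral_sum[OF 2])
      also have "\<dots> = (\<Sum>p\<in>?I. \<Sum>i<n. (LINT g|?G. (\<Sum>j<n. W p i j g)))"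
        by (intro sum.cong refl Bochner_Integration.integral_sum 1) auto
      also have "\<dots> = (\<Sum>p\<in>?I. \<Sum>i<n. \<Sum>j<n. (LINT g|?G. W p i j g))"
        by (intro sum.cong refl Bochner_Integration.integral_sum iW) auto
      finally show ?thesis .
    qed
    also have "\<dots> \<le> (\<Sum>p\<in>?I. \<Sum>i<n. \<Sum>j<n. C / real N)"
      by (intro sum_mono iW(2)) auto
    also have "\<dots> = 4 * (real n)\<^sup>2 * (C / real N)" by (simp add: power2_eq_square)
    finally show ?thesis .
  qed
  have iT: "integrable ?G T"
    unfolding T_def[abs_def] using iT1 F(1) integrable_r2[of b 0] by (intro Bochner_Integration.integrable_add integrable_divide) auto
  have ET: "(LINT g|?G. T g) \<le> 4 * (real n)\<^sup>2 * (C / real N / \<theta>\<^sup>2) + R2 b 0 / \<rho>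
      + (1 + real N * e + ln (2 / sqrt (1 - b\<^sup>2)) + D * exp (2 * b / lam')) / (2 * real N * \<eta>)"
  proof -
    have "(LINT g|?G. T g) = (LINT g|?G. T1 g) / \<theta>\<^sup>2 + R2 b 0 / \<rho> + (LINT g|?G. F g) / (2 * real N * \<eta>)"
      unfolding T_def[abs_def] R2_def using iT1 F(1) integrable_r2[of b 0] by simp
    moreover have "(LINT g|?G. T1 g) / \<theta>\<^sup>2 \<le> 4 * (real n)\<^sup>2 * (C / real N) / \<theta>\<^sup>2"
      by (intro divide_right_mono E1) simp
    moreover have "(LINT g|?G. F g) / (2 * real N * \<eta>) \<le> (1 + real N * e + ln (2 / sqrt (1 - b\<^sup>2)) + D * exp (2 * b / lam')) / (2 * real N * \<eta>)"
      using N \<eta> by (intro divide_right_mono F(3)) auto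
    ultimately show ?thesis by simp
  qed
  have iY: "integrable ?G Y" unfolding Y_def[abs_def] by (intro integrable_mult_right expected_Z(1))
  have EY: "(LINT g|?G. Y g) \<le> real n"
  proof -
    have "(LINT g|?G. Y g) = real n * (exp (- K) * (LINT g|?G. Z (disorder (- \<beta>) 0 N g)))"
      by (simp add: Y_def[abs_def])
    also have "\<dots> \<le> real n * (exp (- K) * exp K)"
      using expected_Z(2)[of "- \<beta>"] by (intro mult_left_mono) (auto simp: K_def)
    also have "\<dots> = real n" by (simp add: exp_add[symmetric])
    finally show ?thesis .
  qed
  have "a - B * (LINT g|?G. T g) - (LINT g|?G. Y g) = (LINT g|?G. a - B * T g - Y g)"
    using iT iY G.prob_space by simp
  also have "\<dots> \<le> (LINT g|?G. ln (ZQ n Q \<epsilon> \<beta> g))"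
    using iT iY vol(1) by (intro integral_mono pw integrable_ln_ZQ) auto
  finally have "a - B * (LINT g|?G. T g) - (LINT g|?G. Y g) \<le> (LINT g|?G. ln (ZQ n Q \<epsilon> \<beta> g))" .
  then show ?thesis using mult_left_mono[OF ET B(1)] EY by linarith
qed

end

section \<open>The limit\<close>

text \<open>Independence gives the couplings indexed by \<open>sites N\<close> the product law, and
  the free energy depends on the probability space only through that law. The auxiliary column N is
  filled with the couplings g i N of the infinite array.\<close>

lemma free_energy_gauss:
  fixes M :: "'w measure" and g :: "nat \<Rightarrow> nat \<Rightarrow> 'w \<Rightarrow> real"
  assumes M: "prob_space M" and ind: "prob_space.indep_vars M (\<lambda>_. borel) (\<lambda>(i, k). g i k) UNIV"
    and dist: "\<And>i k. distributed M lborel (g i k) std_normal_density" and N: "0 < N"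
  shows "free_energy M g \<beta> n N (overlap_constrained n Q N \<epsilon>) =
    1 / real N * (LINT G|gauss (sites N). ln (spin.ZQ N n Q \<epsilon> \<beta> G))"
proof -
  interpret S: spin N by unfold_locales (rule N)
  interpret M: prob_space M by (rule M)
  define X where "X p = g (fst p) (snd p)" for p
  define Y where "Y \<omega> = (\<lambda>p\<in>sites N. X p \<omega>)" for \<omega>
  have Xm: "X p \<in> borel_measurable M" for p
    using dist[of "fst p" "snd p"] by (simp add: X_def distributed_def)
  have law: "distr M borel (X p) = std_normal" for p
  proof -
    have "distr M borel (X p) = distr M lborel (X p)" by (rule distr_cong) simp_all
    then show ?thesis using dist[of "fst p" "snd p"] by (simp add: X_def distributed_def std_normal_def)
  qed
  have "(\<lambda>(i, k). g i k) = X" by (rule ext) (simp add: X_def case_prod_beta)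
  then have "M.indep_vars (\<lambda>_. borel) X (sites N)"
    using M.indep_vars_subset[OF ind, of "sites N"] by simp
  moreover have ne: "sites N \<noteq> {}" using N by auto
  ultimately have "distr M (\<Pi>\<^sub>M p\<in>sites N. borel) Y = (\<Pi>\<^sub>M p\<in>sites N. distr M borel (X p))"
    unfolding Y_def[abs_def] by (subst (asm) M.indep_vars_iff_distr_eq_PiM'[OF ne Xm])
  then have Y: "distr M (\<Pi>\<^sub>M p\<in>sites N. borel) Y = gauss (sites N)"
    unfolding law gauss_def .
  have Ym: "Y \<in> measurable M (\<Pi>\<^sub>M p\<in>sites N. borel)"
    unfolding Y_def[abs_def] by (rule measurable_restrict) (rule Xm)
  have "hamiltonian N (\<lambda>i k. g i k \<omega>) x = ham N (Y \<omega>) x" for \<omega> x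
    unfolding ham_def hamiltonian_def by (intro arg_cong2[where f="(*)"] refl sum.cong) (auto simp: Y_def X_def)
  then have "(LINT \<sigma>:overlap_constrained n Q N \<epsilon>|(\<Pi>\<^sub>M j\<in>{..<n}. sphere_uniform N). exp (\<beta> * (\<Sum>j<n. hamiltonian N (\<lambda>i k. g i k \<omega>) (\<sigma> j)))) = S.ZQ n Q \<epsilon> \<beta> (Y \<omega>)" for \<omega>
    unfolding S.ZQ_def S.gw_def by (simp only:)
  then have "free_energy M g \<beta> n N (overlap_constrained n Q N \<epsilon>) = 1 / real N * (LINT \<omega>|M. ln (S.ZQ n Q \<epsilon> \<beta> (Y \<omega>)))"
    unfolding free_energy_def by (simp only:)
  also have "(LINT \<omega>|M. ln (S.ZQ n Q \<epsilon> \<beta> (Y \<omega>))) = (LINT G|gauss (sites N). ln (S.ZQ n Q \<epsilon> \<beta> G))"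
  proof -
    have "(\<lambda>G. ln (S.ZQ n Q \<epsilon> \<beta> G)) \<in> borel_measurable (gauss (sites N))"
      by (rule measurable_compose[OF S.measurable_ZQ borel_measurable_ln]) simp
    then have "(\<lambda>G. ln (S.ZQ n Q \<epsilon> \<beta> G)) \<in> borel_measurable (\<Pi>\<^sub>M p\<in>sites N. borel)"
      by (simp only: measurable_cong_sets[OF sets_gauss refl])
    from integral_distr[OF Ym this] show ?thesis unfolding Y by (rule sym)
  qed
  finally show ?thesis .
qed

section \<open>Thresholds for large N\<close>

lemma eventually_real_ge: "\<forall>\<^sub>F N in sequentially. (c::real) \<le> real N"
  using filterlim_real_sequentially unfolding filterlim_at_top by blast

lemma (in spin) R2_le:
  assumes e: "0 < e" "shell_threshold e \<le> real N" and b: "0 \<le> b" "b < 1"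
  defines "lam' \<equiv> (1 - b\<^sup>2) / 2"
  shows "R2 b 0 \<le> 2 * (exp (2 * b / lam') + 1) / lam' * ((ln 2 - ln lam' / 2) / real N + e)"
proof -
  have "b\<^sup>2 < 1" using b by (simp add: power_less_one_iff)
  then have l: "0 < lam'" by (simp add: lam'_def)
  have N: "0 < real N" using N_pos by simp
  have "lam' * real N / 2 * R2 b 0 \<le> (ln 2 + real N * e - ln lam' / 2) * (exp (2 * b / lam') + 1)"
    unfolding lam'_def by (rule high_temperature(2)[OF e b])
  then have "R2 b 0 \<le> (ln 2 + real N * e - ln lam' / 2) * (exp (2 * b / lam') + 1) / (lam' * real N / 2)"
    using l N by (simp add: pos_le_divide_eq mult.commute)
  also have "\<dots> = 2 * (exp (2 * b / lam') + 1) / lam' * ((ln 2 - ln lam' / 2) / real N + e)"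
    using l N by (simp add: field_simps)
  finally show ?thesis .
qed

lemma eventually_R2_0_le:
  assumes \<rho>: "0 < \<rho>"
  shows "\<forall>\<^sub>F N in sequentially. 0 < N \<longrightarrow> spin.R2 N 0 0 \<le> \<rho>"
proof -
  define c where "c = ln 2 - ln (1 / 2 :: real) / 2"
  have "\<forall>\<^sub>F N in sequentially. 16 * c / \<rho> \<le> real N"
    "\<forall>\<^sub>F N in sequentially. shell_threshold (\<rho> / 16) \<le> real N"
    by (rule eventually_real_ge)+
  then show ?thesis
  proof eventually_elim
    case (elim N)
    show ?case
    proof
      assume N: "0 < N"
      interpret spin N by unfold_locales (rule N)
      \<comment> \<open>At b = 0 the constant \<open>lam'\<close> is 1/2 and the prefactor 2 * 2 /
        (1/2) = 8. The choice e = \<rho> / 16 and the condition 16 c / \<rho> <= N use up half of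
        \<rho> each.\<close>
      have "R2 0 0 \<le> 8 * (c / real N + \<rho> / 16)"
        using R2_le[of "\<rho> / 16" 0] elim \<rho> by (simp add: c_def)
      moreover have "16 * (c / real N) \<le> \<rho>"
        using elim(1) \<rho> N by (simp add: field_simps)
      ultimately show "R2 0 0 \<le> \<rho>" by simp
    qed
  qed
qed

lemma eventually_sqrt_power_ge:
  assumes \<eta>: "0 < (\<eta>::real)"
  shows "\<forall>\<^sub>F N in sequentially. 2 \<le> sqrt (1 + \<eta>) ^ N"
  using eventually_real_ge[of "1 / (sqrt (1 + \<eta>) - 1)"]
proof eventually_elim
  case (elim N)
  have s: "0 < sqrt (1 + \<eta>) - 1" using \<eta> by simp
  have "1 \<le> real N * (sqrt (1 + \<eta>) - 1)" using elim s by (simp add: pos_divide_le_eq)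
  moreover have "1 + real N * (sqrt (1 + \<eta>) - 1) \<le> (1 + (sqrt (1 + \<eta>) - 1)) ^ N"
    using s by (intro Bernoulli_inequality) simp
  ultimately show ?case by simp
qed

section \<open>Two-sided bounds at fixed width of the constraint\<close>

locale replicas =
  fixes n :: nat and \<beta> :: real and Q :: "real mat" and L :: "nat \<Rightarrow> nat \<Rightarrow> real"
  assumes n: "0 < n" and \<beta>: "1 < \<beta>"
    and Q: "\<And>j. j < n \<Longrightarrow> Q $$ (j, j) = 1" "\<And>j j'. j < n \<Longrightarrow> j' < n \<Longrightarrow> \<bar>Q $$ (j, j')\<bar> \<le> 1"
    and L: "\<And>i j. i < n \<Longrightarrow> j < n \<Longrightarrow> Q $$ (i, j) - (if i = j then 1 / \<beta> else 0) = (\<Sum>l<n. L i l * L j l)"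
begin

definition F :: "real \<Rightarrow> nat \<Rightarrow> real" where
  "F \<epsilon> N = 1 / real N * (LINT g|gauss (sites N). ln (spin.ZQ N n Q \<epsilon> \<beta> g))"

lemma F_upper:
  assumes \<epsilon>: "0 < \<epsilon>" and \<delta>: "0 < \<delta>"
  shows "\<forall>\<^sub>F N in sequentially. F \<epsilon> N \<le> real n * limit_free_energy \<beta> + \<delta>"
proof -
  define \<eta> where "\<eta> = min (1 / 14) (\<epsilon> / 28)"
  have \<eta>: "0 < \<eta>" "\<eta> \<le> 1 / 14" "28 * \<eta> \<le> \<epsilon>" using \<epsilon> by (auto simp: \<eta>_def)
  define \<rho> where "\<rho> = (\<eta>\<^sup>2 / (16 * (real n)\<^sup>2))\<^sup>2"
  have \<rho>: "0 < \<rho>" using \<eta> n by (simp add: \<rho>_def)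
  \<comment> \<open>The n replicas together lose e (1 + \<beta>) / 2 each per site, which this
    choice makes \<delta> / 2; the other half absorbs the constants ln 4.\<close>
  define e where "e = \<delta> / (real n * (1 + \<beta>))"
  have e: "0 < e" "real n * (e * (1 + \<beta>) / 2) = \<delta> / 2"
  proof -
    have "0 < real n * (1 + \<beta>)" using n \<beta> by simp
    then show "0 < e" using \<delta> by (simp only: e_def divide_pos_pos)
    show "real n * (e * (1 + \<beta>) / 2) = \<delta> / 2" using n \<beta> by (simp add: e_def)
  qed
  have \<beta>1: "1 \<le> \<beta>" using \<beta> by simp
  have "\<forall>\<^sub>F N in sequentially. shell_threshold e \<le> real N" "\<forall>\<^sub>F N in sequentially. 2 * (real n * ln 4) / \<delta> \<le> real N"
    "\<forall>\<^sub>F N in sequentially. real n \<le> real N" by (rule eventually_real_ge)+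
  moreover note eventually_R2_0_le[OF \<rho>] eventually_sqrt_power_ge[OF \<eta>(1)] eventually_gt_at_top[of "0::nat"]
  ultimately show ?thesis
  proof eventually_elim
    case (elim N)
    interpret spin N by unfold_locales (use elim in simp)
    have N: "0 < real N" using elim by simp
    have "R2 0 0 \<le> \<rho>" using elim by simp
    \<comment> \<open>Positivity matters even for the upper bound: under the convention ln 0 = 0 a
      vanishing \<open>ZQ\<close> could have a logarithm above n ln Z.\<close>
    then have pos: "0 < ZQ n Q \<epsilon> 0 g" for g
      using ln_volume_lower(1)[OF \<beta>1 \<eta> _ n _ Q L, of g] elim unfolding \<rho>_def by simp
    have "(LINT g|gauss (sites N). ln (ZQ n Q \<epsilon> \<beta> g)) \<le> real n * phi \<beta> 0"
      by (rule expected_ln_ZQ_le[OF pos])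
    also have "\<dots> \<le> real n * (ln 4 + real N * (limit_free_energy \<beta> + e * (1 + \<beta>) / 2))"
      using phi_upper[OF e(1) _ \<beta>] elim by (intro mult_left_mono) auto
    also have "\<dots> = real n * ln 4 + real N * (real n * limit_free_energy \<beta>) + real N * (real n * (e * (1 + \<beta>) / 2))"
      by (simp add: algebra_simps)
    also have "\<dots> \<le> real N * (real n * limit_free_energy \<beta> + \<delta>)"
      unfolding e(2) using elim(2) \<delta> by (simp add: pos_divide_le_eq algebra_simps)
    finally show ?case unfolding F_def using N by (simp add: pos_divide_le_eq mult.commute)
  qed
qed

text \<open>The order of choices: \<eta> determines k, \<nu> and \<theta>, and with them B, K1 and
  K2, none of which involves \<open>e\<close>. The expected test function is at most K1 / N + K2 e
  and each unit of it costs N B, so first \<open>e\<close> is made small against B K2, and then N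
  large against R.\<close>

lemma F_lower:
  assumes \<eta>: "0 < \<eta>" "\<eta> \<le> 1 / 14" "28 * \<eta> \<le> \<epsilon>" and \<delta>: "0 < \<delta>"
  defines "b \<equiv> 1 / (1 + 7 * \<eta>)"
  shows "\<forall>\<^sub>F N in sequentially.
    real n * (- ((ln (1 + 7 * \<eta>) + ln \<beta>) / 2) + b * \<beta> * ((1 - \<eta>) * (1 - 1 / \<beta>) - \<eta>) + b\<^sup>2 / 4 - \<eta>) - \<delta> \<le> F \<epsilon> N"
proof -
  define \<rho> where "\<rho> = (\<eta>\<^sup>2 / (16 * (real n)\<^sup>2))\<^sup>2"
  have \<rho>: "0 < \<rho>" using \<eta> n by (simp add: \<rho>_def)
  have b: "0 < b" "b < 1" using \<eta> by (auto simp: b_def)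
  \<comment> \<open>1 + 7 \<eta> <= 3/2 gives b >= 2/3 and b^2 / 4 >= 1/9 > 1/14, so the partition
    function at \<open>b\<close> is exponentially large where its lower tail is controlled.\<close>
  have b4: "0 < b\<^sup>2 / 4 - \<eta>"
  proof -
    have "2 / 3 \<le> b" using \<eta> by (simp add: b_def le_divide_eq)
    then have "2 / 3 * (2 / 3) \<le> b * b" by (intro mult_mono) auto
    then show ?thesis using \<eta>(2) by (simp add: power2_eq_square)
  qed
  have b2: "b\<^sup>2 < 1" using b by (simp add: power_less_one_iff)
  define l where "l = (1 - b\<^sup>2) / 2"
  have l: "0 < l" using b2 by (simp add: l_def)
  have d: "0 < \<eta>" "\<eta> < 1" using \<eta> by auto
  obtain k where k: "(1 - \<eta>) * cat k \<le> cat (Suc k)" using cat_ratio[OF d] by blast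
  \<comment> \<open>The second entry keeps the guaranteed edge energy (1 - \<eta>) (1 - 1/\<beta>) -
    \<nu> nonnegative.\<close>
  define \<nu> where "\<nu> = min \<eta> ((1 - \<eta>) * (1 - 1 / \<beta>))"
  have \<nu>: "0 < \<nu>" "\<nu> \<le> \<eta>" "\<nu> \<le> (1 - \<eta>) * (1 - 1 / \<beta>)" using d \<beta> by (auto simp: \<nu>_def)
  define \<theta> where "\<theta> = (cat k + cat (Suc k)) * \<nu> / (4 * (real n)\<^sup>2)"
  have \<theta>: "0 < \<theta>" unfolding \<theta>_def using cat_pos[of k] cat_pos[of "Suc k"] \<nu> n by (intro divide_pos_pos mult_pos_pos) auto
  have "\<exists>C. \<forall>p. 0 \<le> C p \<and> (\<forall>N>0. \<forall>i<N. \<forall>j<N.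
     integrable (gauss (sites N)) (\<lambda>g. (goe_pow N g p i j - (if i = j then semi p else 0))\<^sup>2) \<and>
     (LINT g|gauss (sites N). (goe_pow N g p i j - (if i = j then semi p else 0))\<^sup>2) \<le> C p / real N)"
    by (rule choice) (use goe_pow_second_moment in blast)
  then obtain C' where "\<forall>p. 0 \<le> C' p \<and> (\<forall>N>0. \<forall>i<N. \<forall>j<N.
     integrable (gauss (sites N)) (\<lambda>g. (goe_pow N g p i j - (if i = j then semi p else 0))\<^sup>2) \<and>
     (LINT g|gauss (sites N). (goe_pow N g p i j - (if i = j then semi p else 0))\<^sup>2) \<le> C' p / real N)" ..
  note C' = this[THEN spec, THEN conjunct1] this[THEN spec, THEN conjunct2, rule_format]
  define C where "C = (\<Sum>p\<in>{2 * k..2 * k + 3}. C' p)"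
  have C: "C' p \<le> C" if "p \<in> {2 * k..2 * k + 3}" for p
    unfolding C_def using that C'(1) by (intro member_le_sum) auto
  define c0 where "c0 = (ln (1 + 7 * \<eta>) + ln \<beta>) / 2"
  define m where "m = real n * (- c0 + b * \<beta> * ((1 - \<eta>) * (1 - 1 / \<beta>) - \<nu>) + b\<^sup>2 / 4 - \<eta>)"
  define B where "B = \<bar>m + 2 * (real n * c0) + real n * (\<beta>\<^sup>2 / 4)\<bar> + (real n + 1) * ln 2"
  have B: "0 \<le> B" by (simp add: B_def)
  define E where "E = exp (2 * b / l)"
  define A where "A = ln (2 / sqrt (1 - b\<^sup>2))"
  define D where "D = ln 2 - ln l / 2"
  define K1 where "K1 = 4 * (real n)\<^sup>2 * C / \<theta>\<^sup>2 + 2 * (E + 1) / l * D / \<rho> + (1 + A + D * E) / (2 * \<eta>)"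
  define K2 where "K2 = 2 * (E + 1) / l / \<rho> + (1 + E) / (2 * \<eta>)"
  have K2: "0 \<le> K2" using l \<rho> \<eta> by (simp add: K2_def E_def)
  define e where "e = \<delta> / (2 * (B * K2 + 1))"
  have BK: "0 \<le> B * K2" using B K2 by (rule mult_nonneg_nonneg)
  have e: "0 < e" "B * (K2 * e) \<le> \<delta> / 2"
  proof -
    show e0: "0 < e" using \<delta> BK by (simp add: e_def)
    have "x * (\<delta> / (2 * x)) = \<delta> / 2" if "x \<noteq> 0" for x using that by simp
    from this[of "B * K2 + 1"] have "(B * K2 + 1) * e = \<delta> / 2" using BK by (simp only: e_def)
    then show "B * (K2 * e) \<le> \<delta> / 2" using e0 by (simp add: distrib_right mult.assoc)
  qed
  define R where "R = (real n + 1) * ln 2 + real n + B * K1"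
  have "\<forall>\<^sub>F N in sequentially. shell_threshold e \<le> real N" "\<forall>\<^sub>F N in sequentially. 2 * R / \<delta> \<le> real N"
    "\<forall>\<^sub>F N in sequentially. 4 * real n / (b\<^sup>2 / 4 - \<eta>) \<le> real N"
    "\<forall>\<^sub>F N in sequentially. real n \<le> real N" by (rule eventually_real_ge)+
  moreover note eventually_R2_0_le[OF \<rho>] eventually_sqrt_power_ge[OF \<eta>(1)] eventually_gt_at_top[of "0::nat"]
  ultimately show ?thesis
  proof eventually_elim
    case (elim N)
    interpret spin N by unfold_locales (use elim in simp)
    have N: "0 < real N" "1 \<le> real N" using elim by simp_all
    have r0: "R2 0 0 \<le> \<rho>" using elim by simp
    have Nb: "4 * real n \<le> exp (real N * (b\<^sup>2 / 4 - \<eta>))"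
      using elim(3) b4 exp_ge_add_one_self[of "real N * (b\<^sup>2 / 4 - \<eta>)"] by (simp only: pos_divide_le_eq)
    have mom: "integrable (gauss (sites N)) (\<lambda>g. (goe_pow N g p i j - (if i = j then semi p else 0))\<^sup>2) \<and>
      (LINT g|gauss (sites N). (goe_pow N g p i j - (if i = j then semi p else 0))\<^sup>2) \<le> C / real N"
      if "p \<in> {2 * k..2 * k + 3}" "i < n" "j < n" for p i j
    proof -
      have "C' p / real N \<le> C / real N" using C[OF that(1)] by (rule divide_right_mono) simp
      then show ?thesis using C'(2)[of N i j p] that elim by (meson less_le_trans of_nat_le_iff order_trans)
    qed
    let ?a = "real n * (real N * (- c0 + b * \<beta> * ((1 - \<eta>) * (1 - 1 / \<beta>) - \<nu>) + b\<^sup>2 / 4 - \<eta>)) - (real n + 1) * ln 2"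
    let ?T = "4 * (real n)\<^sup>2 * (C / real N / \<theta>\<^sup>2) + R2 b 0 / \<rho> + (1 + real N * e + A + (ln 2 + real N * e - ln l / 2) * E) / (2 * real N * \<eta>)"
    have a: "?a = real N * m - (real n + 1) * ln 2" by (simp add: m_def mult_ac)
    have B2: "?a - (2 * (real n * (- (real N * c0)) - (real n + 1) * ln 2) - real n * (real N * \<beta>\<^sup>2 / 4)) \<le> real N * B"
    proof -
      have "real N * (m + 2 * (real n * c0) + real n * (\<beta>\<^sup>2 / 4)) \<le> real N * \<bar>m + 2 * (real n * c0) + real n * (\<beta>\<^sup>2 / 4)\<bar>"
        by (intro mult_left_mono abs_ge_self) simp
      moreover have "1 * ((real n + 1) * ln 2) \<le> real N * ((real n + 1) * ln 2)"
        using N by (intro mult_right_mono) auto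
      ultimately show ?thesis unfolding a B_def by (simp add: algebra_simps)
    qed
    have "?a - real N * B * ?T - real n \<le> (LINT g|gauss (sites N). ln (ZQ n Q \<epsilon> \<beta> g))"
      unfolding A_def E_def l_def \<rho>_def \<theta>_def c0_def b_def
      by (rule expected_ln_ZQ_ge[OF \<beta> \<eta> _ n _ Q L e(1) _ _ d k \<nu> mom Nb[unfolded b_def]])
         (use elim r0 B B2 in \<open>simp_all only: \<rho>_def c0_def b_def of_nat_le_iff mult_nonneg_nonneg of_nat_0_le_iff\<close>)
    moreover have "?T \<le> K1 / real N + K2 * e"
    proof -
      have "R2 b 0 \<le> 2 * (E + 1) / l * (D / real N + e)"
        unfolding E_def l_def D_def by (rule R2_le[OF e(1)]) (use elim b in auto)
      then have "R2 b 0 / \<rho> \<le> 2 * (E + 1) / l * (D / real N + e) / \<rho>" using \<rho> by (intro divide_right_mono) auto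
      moreover have "4 * (real n)\<^sup>2 * (C / real N / \<theta>\<^sup>2) + 2 * (E + 1) / l * (D / real N + e) / \<rho> + (1 + real N * e + A + (ln 2 + real N * e - ln l / 2) * E) / (2 * real N * \<eta>)
        = K1 / real N + K2 * e"
        unfolding K1_def K2_def D_def using N \<eta> l \<rho> \<theta> by (simp add: field_simps)
      ultimately show ?thesis by linarith
    qed
    then have "real N * B * ?T \<le> real N * B * (K1 / real N + K2 * e)" using B by (intro mult_left_mono) auto
    moreover have "real N * B * (K1 / real N + K2 * e) = B * K1 + real N * (B * (K2 * e))"
      using N by (simp add: field_simps)
    moreover have "real N * (B * (K2 * e)) \<le> real N * (\<delta> / 2)" using e(2) by (rule mult_left_mono) simp
    moreover have "R \<le> real N * (\<delta> / 2)" using elim(2) \<delta> by (simp add: pos_divide_le_eq)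
    ultimately have "real N * m - real N * \<delta> \<le> (LINT g|gauss (sites N). ln (ZQ n Q \<epsilon> \<beta> g))"
      unfolding a R_def by simp
    then have "(m - \<delta>) * real N \<le> (LINT g|gauss (sites N). ln (ZQ n Q \<epsilon> \<beta> g))"
      by (simp add: algebra_simps)
    then have "m - \<delta> \<le> F \<epsilon> N"
      unfolding F_def using iffD2[OF pos_le_divide_eq[OF N(1)]] by simp
    moreover have "real n * (- c0 + b * \<beta> * ((1 - \<eta>) * (1 - 1 / \<beta>) - \<eta>) + b\<^sup>2 / 4 - \<eta>) \<le> m"
      unfolding m_def using \<nu>(2) b \<beta> by (intro mult_left_mono add_mono diff_mono order_refl) auto
    ultimately show ?case unfolding c0_def by linarith
  qed
qed

text \<open>\<open>F \<epsilon>\<close> does not involve \<eta>, so the lower bounds for all small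
  \<eta> are available at once. As \<eta> tends to 0 they approach n times \<beta> - 1 + 1/4 - ln
  \<beta> / 2, the value of the upper bound.\<close>

theorem F_limit:
  assumes \<epsilon>: "0 < \<epsilon>"
  shows "F \<epsilon> \<longlonglongrightarrow> real n * limit_free_energy \<beta>"
proof (rule tendstoI)
  fix \<delta> :: real assume \<delta>: "0 < \<delta>"
  define M where "M \<eta> = - ((ln (1 + 7 * \<eta>) + ln \<beta>) / 2) + 1 / (1 + 7 * \<eta>) * \<beta> * ((1 - \<eta>) * (1 - 1 / \<beta>) - \<eta>) + (1 / (1 + 7 * \<eta>))\<^sup>2 / 4 - \<eta>" for \<eta>
  have "(M \<longlongrightarrow> - (ln \<beta> / 2) + \<beta> * (1 - 1 / \<beta>) + 1 / 4) (at_right 0)"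
    unfolding M_def by (rule tendsto_eq_intros refl | simp)+
  also have "- (ln \<beta> / 2) + \<beta> * (1 - 1 / \<beta>) + 1 / 4 = limit_free_energy \<beta>"
    using \<beta> by (simp add: limit_free_energy_def field_simps)
  finally have "((\<lambda>\<eta>. real n * M \<eta>) \<longlongrightarrow> real n * limit_free_energy \<beta>) (at_right 0)"
    by (intro tendsto_intros)
  then have "\<forall>\<^sub>F \<eta> in at_right 0. real n * limit_free_energy \<beta> - \<delta> / 3 < real n * M \<eta>"
    by (rule order_tendstoD) (use \<delta> in simp)
  moreover have "\<forall>\<^sub>F \<eta> in at_right 0. \<eta> < min (1 / 14) (\<epsilon> / 28)"
    using \<epsilon> by (intro order_tendstoD[OF tendsto_ident_at]) simp
  moreover have "\<forall>\<^sub>F \<eta> in at_right (0::real). 0 < \<eta>" by (rule eventually_at_right_less)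
  ultimately have "\<forall>\<^sub>F \<eta> in at_right (0::real). real n * limit_free_energy \<beta> - \<delta> / 3 < real n * M \<eta> \<and> \<eta> < min (1 / 14) (\<epsilon> / 28) \<and> 0 < \<eta>"
    by eventually_elim simp
  then obtain \<eta> where h: "real n * limit_free_energy \<beta> - \<delta> / 3 < real n * M \<eta>" "\<eta> < min (1 / 14) (\<epsilon> / 28)" "0 < \<eta>"
    using eventually_happens'[OF trivial_limit_at_right_real] by blast
  have \<eta>: "0 < \<eta>" "\<eta> \<le> 1 / 14" "28 * \<eta> \<le> \<epsilon>" using h by auto
  have "\<forall>\<^sub>F N in sequentially. real n * M \<eta> - \<delta> / 3 \<le> F \<epsilon> N"
    unfolding M_def by (rule F_lower[OF \<eta>]) (use \<delta> in simp)
  moreover have "\<forall>\<^sub>F N in sequentially. F \<epsilon> N \<le> real n * limit_free_energy \<beta> + \<delta> / 3"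
    by (rule F_upper[OF \<epsilon>]) (use \<delta> in simp)
  ultimately show "\<forall>\<^sub>F N in sequentially. dist (F \<epsilon> N) (real n * limit_free_energy \<beta>) < \<delta>"
    by eventually_elim (use h \<delta> in \<open>simp add: dist_real_def abs_less_iff\<close>)
qed

end

theorem theorem2:
  fixes M :: "'w measure"
    and g :: "nat \<Rightarrow> nat \<Rightarrow> 'w \<Rightarrow> real"
    and n :: nat
    and \<beta> :: real
    and Q :: "real mat"
    and r :: "nat \<Rightarrow> real"
  assumes "prob_space M"
    and "prob_space.indep_vars M (\<lambda>_. borel) (\<lambda>(i, k). g i k) UNIV"
    and "\<And>i k. distributed M lborel (g i k) std_normal_density"
    and "n \<ge> 1"
    and "\<beta> > 1"
    and "Q \<in> carrier_mat n n"
    and "transpose_mat Q = Q"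
    and "nonneg_definite n Q"
    and "\<And>j j'. j < n \<Longrightarrow> j' < n \<Longrightarrow> Q $$ (j, j') \<in> {-1..1}"
    and "\<And>j. j < n \<Longrightarrow> Q $$ (j, j) = 1"
    and "char_poly (\<beta> \<cdot>\<^sub>m Q) = (\<Prod>j<n. [:- r j, 1:])"
    and "Min (r ` {..<n}) \<ge> 1"
  shows "\<exists>L. (\<forall>\<epsilon>>0. (\<lambda>N. free_energy M g \<beta> n N (overlap_constrained n Q N \<epsilon>)) \<longlonglongrightarrow> L \<epsilon>)
           \<and> (L \<longlongrightarrow> real n * limit_free_energy \<beta>) (at_right 0)"
proof (intro exI conjI allI impI)
  have n: "0 < n" and \<beta>: "0 < \<beta>" using assms(4,5) by simp_all
  obtain L where L: "\<And>i j. i < n \<Longrightarrow> j < n \<Longrightarrow> Q $$ (i, j) - (if i = j then 1 / \<beta> else 0) = (\<Sum>l<n. L i l * L j l)"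
    using edge_factorization[OF n \<beta> assms(6,7,8,11,12)] by blast
  interpret replicas n \<beta> Q L
  proof
    show "\<bar>Q $$ (j, j')\<bar> \<le> 1" if "j < n" "j' < n" for j j' using assms(9)[OF that] by (auto simp: abs_le_iff)
  qed (use n assms(5,10) L in auto)
  fix \<epsilon> :: real assume "0 < \<epsilon>"
  then have "F \<epsilon> \<longlonglongrightarrow> real n * limit_free_energy \<beta>" by (rule F_limit)
  moreover have "\<forall>\<^sub>F N in sequentially. F \<epsilon> N = free_energy M g \<beta> n N (overlap_constrained n Q N \<epsilon>)"
    using eventually_gt_at_top[of "0::nat"]
    by eventually_elim (simp only: F_def free_energy_gauss[OF assms(1-3)])
  \<comment> \<open>The limit in N is the same for every \<epsilon>, so the existential witness
    becomes a constant function and the outer limit is that of a constant.\<close>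
  ultimately show "(\<lambda>N. free_energy M g \<beta> n N (overlap_constrained n Q N \<epsilon>)) \<longlonglongrightarrow> real n * limit_free_energy \<beta>"
    by (rule Lim_transform_eventually)
qed (rule tendsto_const)

end
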